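(* Let $n\ge1$, $0<s<t<1$, let $\Omega\subset\mathbb{R}^n$ be a bounded Lipschitz domain, $\Omega_e=\mathbb{R}^n\setminus\overline\Omega$, and let $b,q\in L^\infty(\Omega)$. Assume the eigenvalue condition: the only $\varphi\in H^t(\mathbb{R}^n)$ with $\mathscr{L}_{b,q}\varphi=0$ in $\Omega$ and $\varphi=0$ in $\Omega_e$ is $\varphi=0$, where $\mathscr{L}_{b,q}=(-\Delta)^t+(-\Delta)^{s/2}_\Omega\,b\,(-\Delta)^{s/2}_\Omega+q$. Then for any $F\in H^{-t}(\Omega)$ and $f\in\widetilde H^t(\Omega_e)$ there exists a unique weak solution $u\in H^t(\mathbb{R}^n)$ of the Dirichlet problem $$\mathscr{L}_{b,q}u=F\ \text{ in }\Omega,\qquad u=f\ \text{ in }\Omega_e,$$ and it satisfies the stability estimate $$\|u\|_{H^t(\mathbb{R}^n)}\le C\left(\|F\|_{H^{-t}(\Omega)}+\|f\|_{H^t(\Omega_e)}\right)$$ with a constant $C$ independent of $F$ and $f$.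
   Context: All functions are real valued. $H^r(\mathbb{R}^n)$ is the $L^2$-based Sobolev space with norm $\|\langle\xi\rangle^r\widehat u\|_{L^2}$. For an open set $U$ with Lipschitz boundary, $H^r(U)$ is the space of restrictions to $U$ of elements of $H^r(\mathbb{R}^n)$ with the quotient norm, $\widetilde H^r(U)$ is the closure of $C_c^\infty(U)$ in $H^r(\mathbb{R}^n)$, and $H^{-r}(U)$ is identified with the dual of $\widetilde H^r(U)$. $(-\Delta)^t$ is the Fourier multiplier $|\xi|^{2t}$ on $\mathbb{R}^n$. For $0<a<1$, $C_{n,a}>0$ is the constant with $(-\Delta)^a u(x)=C_{n,a}\,\mathrm{p.v.}\int_{\mathbb{R}^n}\frac{u(x)-u(y)}{|x-y|^{n+2a}}dy$ for Schwartz $u$. The regional fractional Laplacian is $(-\Delta)^a_\Omega u(x)=C_{n,a}\,\mathrm{p.v.}\int_\Omega\frac{u(x)-u(y)}{|x-y|^{n+2a}}dy$, extended to $u\in H^a(\Omega)$ weakly by $\langle(-\Delta)^a_\Omega u,v\rangle=\frac{C_{n,a}}{2}\int_\Omega\int_\Omega\frac{(u(x)-u(y))(v(x)-v(y))}{|x-y|^{n+2a}}dy\,dx$; applied to functions on $\mathbb{R}^n$ it acts on their restriction to $\Omega$. The bilinear form of $\mathscr{L}_{b,q}$ is $$\mathcal{B}_{b,q}(\varphi,\psi)=\int_{\mathbb{R}^n}(-\Delta)^{t/2}\varphi\,(-\Delta)^{t/2}\psi\,dx+\int_\Omega b\,(-\Delta)^{s/2}_\Omega\varphi\,(-\Delta)^{s/2}_\Omega\psi\,dx+\int_\Omega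 q\,\varphi\,\psi\,dx.$$ $u\in H^t(\mathbb{R}^n)$ is a weak solution if $u=f$ in $\Omega_e$ and $\mathcal{B}_{b,q}(u,\varphi)=\langle F,\varphi\rangle$ for every $\varphi\in C_c^\infty(\Omega)$. (For such $u$, $u|_\Omega=(u-f)|_\Omega$ with $u-f\in\widetilde H^t(\Omega)$, and $(-\Delta)^{s/2}_\Omega u\in L^2(\Omega)$, so the form makes sense.) *)

theory Defs
  imports "HOL-Analysis.Analysis"
begin

text \<open>
  Conventions. The space \<open>\<real>\<^sup>n\<close> is an arbitrary \<^class>\<open>euclidean_space\<close>, so \<open>n = DIM('a) \<ge> 1\<close>.
  Elements of function spaces are Borel functions defined on the whole space (every Lebesgue class
  has such a representative); two of them denote the same element iff they agree almost everywhere.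
  A function on a set \<open>U\<close> is a function on the whole space of which only the values on \<open>U\<close> matter.
\<close>

section \<open>Test functions and Schwartz functions\<close>

fun iterated_deriv :: "'a list \<Rightarrow> ('a::euclidean_space \<Rightarrow> real) \<Rightarrow> 'a \<Rightarrow> real" where
  "iterated_deriv [] f = f"
| "iterated_deriv (v # vs) f = (\<lambda>x. frechet_derivative (iterated_deriv vs f) (at x) v)"

definition smooth :: "('a::euclidean_space \<Rightarrow> real) \<Rightarrow> bool" where
  "smooth f \<longleftrightarrow> (\<forall>vs \<in> lists Basis. \<forall>x. iterated_deriv vs f differentiable (at x))"

definition test_functions :: "'a::euclidean_space set \<Rightarrow> ('a \<Rightarrow> real) set" where
  "test_functions U =
     {f. smooth f \<and> compact (closure {x. f x \<noteq> 0}) \<and> closure {x. f x \<noteq> 0} \<subseteq> U}"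

definition schwartz :: "('a::euclidean_space \<Rightarrow> real) \<Rightarrow> bool" where
  "schwartz f \<longleftrightarrow> smooth f \<and>
     (\<forall>vs \<in> lists Basis. \<forall>k::nat. bounded (range (\<lambda>x. (1 + norm x) ^ k * iterated_deriv vs f x)))"

section \<open>Lebesgue spaces and the Fourier transform\<close>

definition L2_on :: "'a::euclidean_space set \<Rightarrow> ('a \<Rightarrow> real) set" where
  "L2_on U = {u. set_borel_measurable lborel U u \<and> set_integrable lborel U (\<lambda>x. (u x)\<^sup>2)}"

definition Linf_on :: "'a::euclidean_space set \<Rightarrow> ('a \<Rightarrow> real) set" where
  "Linf_on U = {b. set_borel_measurable lborel U b \<and> (\<exists>M. AE x\<in>U in lborel. \<bar>b x\<bar> \<le> M)}"

definition fourier_integral :: "('a::euclidean_space \<Rightarrow> real) \<Rightarrow> 'a \<Rightarrow> complex" where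
  "fourier_integral u \<xi> = (LINT x|lborel. cis (- (x \<bullet> \<xi>)) * complex_of_real (u x))"

text \<open>
  The Fourier transform on \<open>L\<^sup>2\<close> is the \<open>L\<^sup>2\<close>-limit of the Fourier integrals over the balls of radius
  \<open>R \<rightarrow> \<infinity>\<close>; it is determined almost everywhere.
\<close>

definition has_L2_fourier :: "('a::euclidean_space \<Rightarrow> real) \<Rightarrow> ('a \<Rightarrow> complex) \<Rightarrow> bool" where
  "has_L2_fourier u U \<longleftrightarrow>
     u \<in> L2_on UNIV \<and> U \<in> borel_measurable lborel \<and> integrable lborel (\<lambda>\<xi>. (cmod (U \<xi>))\<^sup>2) \<and>
     ((\<lambda>R::real. \<integral>\<^sup>+ \<xi>. ennreal
         ((cmod (fourier_integral (\<lambda>x. indicator (cball 0 R) x * u x) \<xi> - U \<xi>))\<^sup>2) \<partial>lborel)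
       \<longlongrightarrow> 0) at_top"

definition L2_fourier :: "('a::euclidean_space \<Rightarrow> real) \<Rightarrow> 'a \<Rightarrow> complex" where
  "L2_fourier u = (SOME U. has_L2_fourier u U)"

section \<open>Sobolev spaces\<close>

text \<open>
  For \<open>r \<ge> 0\<close>, where \<open>H\<^sup>r \<subseteq> L\<^sup>2\<close>. Spaces of negative order occur only as dual spaces, see below.
\<close>

definition sobolev :: "real \<Rightarrow> ('a::euclidean_space \<Rightarrow> real) set" where
  "sobolev r = {u \<in> L2_on UNIV.
     integrable lborel (\<lambda>\<xi>. (1 + (norm \<xi>)\<^sup>2) powr r * (cmod (L2_fourier u \<xi>))\<^sup>2)}"

definition sobolev_norm :: "real \<Rightarrow> ('a::euclidean_space \<Rightarrow> real) \<Rightarrow> real" where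
  "sobolev_norm r u =
     sqrt (LINT \<xi>|lborel. (1 + (norm \<xi>)\<^sup>2) powr r * (cmod (L2_fourier u \<xi>))\<^sup>2)"

definition sobolev_on :: "real \<Rightarrow> 'a::euclidean_space set \<Rightarrow> ('a \<Rightarrow> real) set" where
  "sobolev_on r U = {v. set_borel_measurable lborel U v \<and>
     (\<exists>w \<in> sobolev r. AE x\<in>U in lborel. v x = w x)}"

definition sobolev_norm_on :: "real \<Rightarrow> 'a::euclidean_space set \<Rightarrow> ('a \<Rightarrow> real) \<Rightarrow> real" where
  "sobolev_norm_on r U v =
     Inf {sobolev_norm r w | w. w \<in> sobolev r \<and> (AE x\<in>U in lborel. v x = w x)}"

definition sobolev_tilde :: "real \<Rightarrow> 'a::euclidean_space set \<Rightarrow> ('a \<Rightarrow> real) set" where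
  "sobolev_tilde r U = {u \<in> sobolev r.
     \<forall>\<epsilon>>0. \<exists>\<phi> \<in> test_functions U. sobolev_norm r (\<lambda>x. u x - \<phi> x) < \<epsilon>}"

text \<open>
  \<open>sobolev_dual r U\<close> is \<open>H\<^sup>-\<^sup>r(U)\<close>, identified with the dual of \<open>sobolev_tilde r U\<close>: the pairing of \<open>F\<close>
  with \<open>\<phi>\<close> is \<open>F \<phi>\<close>, and the values of \<open>F\<close> outside \<open>sobolev_tilde r U\<close> are irrelevant. Boundedness
  makes \<open>F\<close> respect equality almost everywhere.
\<close>

definition sobolev_dual :: "real \<Rightarrow> 'a::euclidean_space set \<Rightarrow> (('a \<Rightarrow> real) \<Rightarrow> real) set" where
  "sobolev_dual r U = {F.
     (\<forall>u \<in> sobolev_tilde r U. \<forall>v \<in> sobolev_tilde r U. F (\<lambda>x. u x + v x) = F u + F v) \<and>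
     (\<forall>c. \<forall>u \<in> sobolev_tilde r U. F (\<lambda>x. c * u x) = c * F u) \<and>
     (\<exists>K. \<forall>u \<in> sobolev_tilde r U. \<bar>F u\<bar> \<le> K * sobolev_norm r u)}"

definition sobolev_dual_norm :: "real \<Rightarrow> 'a::euclidean_space set \<Rightarrow> (('a \<Rightarrow> real) \<Rightarrow> real) \<Rightarrow> real" where
  "sobolev_dual_norm r U F =
     (SUP u \<in> {u \<in> sobolev_tilde r U. sobolev_norm r u \<le> 1}. \<bar>F u\<bar>)"

section \<open>Fractional Laplacians\<close>

text \<open>
  The Fourier multiplier \<open>|\<xi>|\<^sup>2\<^sup>a\<close>, for functions on which its value lies in \<open>L\<^sup>2\<close> (such as
  \<open>u \<in> H\<^sup>2\<^sup>a\<close>). The value is real because the symbol is even, and determined almost everywhere.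
\<close>

definition frac_laplacian :: "real \<Rightarrow> ('a::euclidean_space \<Rightarrow> real) \<Rightarrow> 'a \<Rightarrow> real" where
  "frac_laplacian a u = (SOME g. g \<in> L2_on UNIV \<and>
     (AE \<xi> in lborel. L2_fourier g \<xi> = complex_of_real (norm \<xi> powr (2 * a)) * L2_fourier u \<xi>))"

text \<open>The constant \<open>C\<^sub>n\<^sub>,\<^sub>a\<close>; the dimension enters through the type argument.\<close>

definition frac_const :: "'a::euclidean_space itself \<Rightarrow> real \<Rightarrow> real" where
  "frac_const (_ :: 'a itself) a = (THE c. c > 0 \<and>
     (\<forall>u :: 'a \<Rightarrow> real. schwartz u \<longrightarrow> (AE x in lborel.
        ((\<lambda>\<epsilon>. c * (LINT y:{y. dist x y > \<epsilon>}|lborel.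
                     (u x - u y) / norm (x - y) powr (real DIM('a) + 2 * a)))
          \<longlongrightarrow> frac_laplacian a u x) (at_right 0))))"

definition regional_form ::
    "real \<Rightarrow> 'a::euclidean_space set \<Rightarrow> ('a \<Rightarrow> real) \<Rightarrow> ('a \<Rightarrow> real) \<Rightarrow> real" where
  "regional_form a \<Omega> u v = frac_const TYPE('a) a / 2 *
     (LINT x:\<Omega>|lborel. (LINT y:\<Omega>|lborel.
        (u x - u y) * (v x - v y) / norm (x - y) powr (real DIM('a) + 2 * a)))"

text \<open>
  The weak regional fractional Laplacian of \<open>u \<in> H\<^sup>a(\<Omega>)\<close>, in the case that the functional
  \<open>v \<mapsto> regional_form a \<Omega> u v\<close> on \<open>H\<^sup>a(\<Omega>)\<close> is represented by a function in \<open>L\<^sup>2(\<Omega>)\<close>; this function is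
  determined almost everywhere on \<open>\<Omega>\<close>. For bounded \<open>\<Omega>\<close> this covers \<open>a = s / 2\<close> and \<open>u \<in> H\<^sup>t(\<real>\<^sup>n)\<close>
  with \<open>0 < s < t < 1\<close>.
\<close>

definition regional_frac_laplacian ::
    "real \<Rightarrow> 'a::euclidean_space set \<Rightarrow> ('a \<Rightarrow> real) \<Rightarrow> 'a \<Rightarrow> real" where
  "regional_frac_laplacian a \<Omega> u = (SOME g. g \<in> L2_on \<Omega> \<and>
     (\<forall>v \<in> sobolev_on a \<Omega>. (LINT x:\<Omega>|lborel. g x * v x) = regional_form a \<Omega> u v))"

section \<open>The Dirichlet problem\<close>

text \<open>
  Near each boundary point, \<open>\<Omega>\<close> is the part of a ball lying above the graph of a Lipschitz function
  \<open>\<gamma>\<close> on the hyperplane orthogonal to a unit vector \<open>e\<close>.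
\<close>

definition lipschitz_boundary :: "'a::euclidean_space set \<Rightarrow> bool" where
  "lipschitz_boundary \<Omega> \<longleftrightarrow> (\<forall>p \<in> frontier \<Omega>. \<exists>r>0. \<exists>e. \<exists>\<gamma> :: 'a \<Rightarrow> real. \<exists>L.
     norm e = 1 \<and> L-lipschitz_on {y. y \<bullet> e = 0} \<gamma> \<and>
     \<Omega> \<inter> ball p r = {x \<in> ball p r. x \<bullet> e > \<gamma> (x - (x \<bullet> e) *\<^sub>R e)})"

definition bounded_lipschitz_domain :: "'a::euclidean_space set \<Rightarrow> bool" where
  "bounded_lipschitz_domain \<Omega> \<longleftrightarrow>
     open \<Omega> \<and> connected \<Omega> \<and> \<Omega> \<noteq> {} \<and> bounded \<Omega> \<and> lipschitz_boundary \<Omega>"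

definition exterior_of :: "'a::euclidean_space set \<Rightarrow> 'a set" where
  "exterior_of \<Omega> = - closure \<Omega>"

definition bilinear_form ::
    "real \<Rightarrow> real \<Rightarrow> 'a::euclidean_space set \<Rightarrow> ('a \<Rightarrow> real) \<Rightarrow> ('a \<Rightarrow> real) \<Rightarrow>
     ('a \<Rightarrow> real) \<Rightarrow> ('a \<Rightarrow> real) \<Rightarrow> real" where
  "bilinear_form s t \<Omega> b q \<phi> \<psi> =
     (LINT x|lborel. frac_laplacian (t / 2) \<phi> x * frac_laplacian (t / 2) \<psi> x) +
     (LINT x:\<Omega>|lborel. b x * regional_frac_laplacian (s / 2) \<Omega> \<phi> x
                            * regional_frac_laplacian (s / 2) \<Omega> \<psi> x) +
     (LINT x:\<Omega>|lborel. q x * \<phi> x * \<psi> x)"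

definition weak_solution ::
    "real \<Rightarrow> real \<Rightarrow> 'a::euclidean_space set \<Rightarrow> ('a \<Rightarrow> real) \<Rightarrow> ('a \<Rightarrow> real) \<Rightarrow>
     (('a \<Rightarrow> real) \<Rightarrow> real) \<Rightarrow> ('a \<Rightarrow> real) \<Rightarrow> ('a \<Rightarrow> real) \<Rightarrow> bool" where
  "weak_solution s t \<Omega> b q F f u \<longleftrightarrow>
     u \<in> sobolev t \<and> (AE x\<in>exterior_of \<Omega> in lborel. u x = f x) \<and>
     (\<forall>\<phi> \<in> test_functions \<Omega>. bilinear_form s t \<Omega> b q u \<phi> = F \<phi>)"

text \<open>
  In the eigenvalue condition, as in the Dirichlet problem, \<open>\<L>\<^sub>b\<^sub>,\<^sub>q \<phi> = 0\<close> is meant in the weak sense.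
\<close>

definition eigenvalue_condition ::
    "real \<Rightarrow> real \<Rightarrow> 'a::euclidean_space set \<Rightarrow> ('a \<Rightarrow> real) \<Rightarrow> ('a \<Rightarrow> real) \<Rightarrow> bool" where
  "eigenvalue_condition s t \<Omega> b q \<longleftrightarrow>
     (\<forall>\<phi>. weak_solution s t \<Omega> b q (\<lambda>_. 0) (\<lambda>_. 0) \<phi> \<longrightarrow> (AE x in lborel. \<phi> x = 0))"

end

theory Submission
  imports Defs "HOL-Library.Function_Algebras" "HOL-Probability.Characteristic_Functions"
    "HOL-Complex_Analysis.Great_Picard"
begin

text \<open>
  A Fredholm alternative proves the theorem. On the Hilbert space \<open>V = sobolev_tilde t \<Omega>\<close> the bilinear
  form is symmetric and bounded, and up to terms that are compact on \<open>V\<close> it controls the square of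
  the \<open>H\<^sup>t\<close> norm. The eigenvalue condition says that its kernel is trivial, so every bounded functional
  on \<open>V\<close> is represented by the form, with a bound (\<open>inf_sup\<close>, \<open>solvable\<close>).

  That the term with \<open>b\<close> is compact is where \<open>s < t\<close> enters. For \<open>u \<in> H\<^sup>t\<close> the regional Laplacian is
  the absolutely convergent integral of \<open>(u x - u y) / \<bar>x - y\<bar>\<^bsup>n + s\<^esup>\<close> over \<open>y \<in> \<Omega>\<close>, up to a constant
  factor. Indeed \<open>\<parallel>u(\<cdot> + h) - u\<parallel> \<le> C \<bar>h\<bar>\<^sup>t \<parallel>u\<parallel>\<close>, and so by the Cauchy-Schwarz inequality the part of the
  integral with \<open>\<bar>x - y\<bar> < \<delta>\<close> has an \<open>L\<^sup>2\<close> norm of order \<open>\<delta>\<^bsup>t - s\<^esup> \<parallel>u\<parallel>\<close> (\<open>oscillation_estimate\<close>), while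
  the part with \<open>\<bar>x - y\<bar> \<ge> \<delta>\<close> is bounded by the \<open>L\<^sup>2\<close> norm of \<open>u\<close> (\<open>regional_op_bound\<close>). Rellich's
  theorem (\<open>rellich\<close>) makes the \<open>L\<^sup>2\<close> norm compact on \<open>V\<close>.

  To solve the problem with exterior datum \<open>f\<close>, take any \<open>w \<in> H\<^sup>t\<close> that equals \<open>f\<close> in the exterior, and
  solve for the difference \<open>u - w \<in> V\<close>; this is possible because the form is defined and bounded on all
  of \<open>H\<^sup>t\<close>. The solution satisfies an estimate by the norm of \<open>w\<close> (\<open>solution_with_datum\<close>). By
  uniqueness (\<open>weak_solution_unique\<close>) it does not depend on \<open>w\<close>, and the infimum over \<open>w\<close> gives the
  quotient norm of \<open>f\<close>.

  All spaces and operators are defined through the Fourier transform on \<open>L\<^sup>2\<close>, written \<open>\<F> u\<close> in the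
  comments. The proof therefore rests on Plancherel's theorem (\<open>plancherel\<close>), obtained by testing with
  Gaussians, and on the description of the range of \<open>\<F>\<close> as the Hermitian functions
  (\<open>L2_fourier_range\<close>), which gives the existence of \<open>frac_laplacian\<close>.
\<close>

section \<open>Semi-inner product spaces and the Fredholm alternative\<close>

text \<open>
  The elements of the function spaces are functions with pointwise operations. Functions that agree
  almost everywhere are not identified; instead, the inner products below may be degenerate.
\<close>

instantiation "fun" :: (type, real_vector) real_vector
begin
definition scaleR_fun :: "real \<Rightarrow> ('a \<Rightarrow> 'b) \<Rightarrow> 'a \<Rightarrow> 'b" where
  "scaleR_fun c f = (\<lambda>x. c *\<^sub>R f x)"
instance
  by standard (auto simp: scaleR_fun_def plus_fun_def scaleR_add_right scaleR_add_left)
end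

text \<open>
  The first order condition at a minimum: if \<open>c a + c\<^sup>2 b\<close> is minimal at \<open>c = 0\<close>, then \<open>a = 0\<close>.
\<close>

lemma linear_dominated_by_quadratic:
  fixes a b :: real
  assumes "\<And>c. 0 \<le> c * a + c\<^sup>2 * b"
  shows "a = 0"
proof (rule ccontr)
  assume "a \<noteq> 0"
  define e where "e = 1 / (\<bar>b\<bar> + 1)"
  have e: "e > 0" "e * b < 1"
    by (auto simp: e_def divide_simps)
  have "0 \<le> (- a * e) * a + (- a * e)\<^sup>2 * b"
    by (rule assms)
  also have "\<dots> = (a\<^sup>2 * e) * (e * b - 1)"
    by (simp add: power2_eq_square algebra_simps)
  also have "\<dots> < 0"
    using e \<open>a \<noteq> 0\<close> by (intro mult_pos_neg) auto
  finally show False by simp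
qed

locale semi_inner_space =
  fixes V :: "'v::real_vector set" and ip :: "'v \<Rightarrow> 'v \<Rightarrow> real"
  assumes zero_mem: "0 \<in> V"
    and add_mem: "\<And>x y. x \<in> V \<Longrightarrow> y \<in> V \<Longrightarrow> x + y \<in> V"
    and scale_mem: "\<And>c x. x \<in> V \<Longrightarrow> c *\<^sub>R x \<in> V"
    and ip_add: "\<And>x y z. x \<in> V \<Longrightarrow> y \<in> V \<Longrightarrow> z \<in> V \<Longrightarrow> ip (x + y) z = ip x z + ip y z"
    and ip_scale: "\<And>c x z. x \<in> V \<Longrightarrow> z \<in> V \<Longrightarrow> ip (c *\<^sub>R x) z = c * ip x z"
    and ip_sym: "\<And>x y. x \<in> V \<Longrightarrow> y \<in> V \<Longrightarrow> ip x y = ip y x"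
    and ip_nonneg: "\<And>x. x \<in> V \<Longrightarrow> 0 \<le> ip x x"
begin

definition nrm :: "'v \<Rightarrow> real" where "nrm x = sqrt (ip x x)"

definition cauchy_seq :: "(nat \<Rightarrow> 'v) \<Rightarrow> bool" where
  "cauchy_seq X \<longleftrightarrow> (\<forall>e>0. \<exists>N. \<forall>m\<ge>N. \<forall>n\<ge>N. nrm (X m - X n) < e)"

lemma uminus_mem: "x \<in> V \<Longrightarrow> - x \<in> V"
  using scale_mem[of x "-1"] by simp

lemma diff_mem: "x \<in> V \<Longrightarrow> y \<in> V \<Longrightarrow> x - y \<in> V"
  using add_mem[of x "-y"] uminus_mem[of y] by simp

lemmas mem = zero_mem add_mem scale_mem uminus_mem diff_mem

lemma ip_minus: "x \<in> V \<Longrightarrow> z \<in> V \<Longrightarrow> ip (- x) z = - ip x z"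
  using ip_scale[of x z "-1"] by simp

lemma ip_diff: "x \<in> V \<Longrightarrow> y \<in> V \<Longrightarrow> z \<in> V \<Longrightarrow> ip (x - y) z = ip x z - ip y z"
  using ip_add[of x "-y" z] by (simp add: ip_minus mem)

lemma ip_add_right: "x \<in> V \<Longrightarrow> y \<in> V \<Longrightarrow> z \<in> V \<Longrightarrow> ip z (x + y) = ip z x + ip z y"
  by (metis ip_add ip_sym add_mem)

lemma ip_diff_right: "x \<in> V \<Longrightarrow> y \<in> V \<Longrightarrow> z \<in> V \<Longrightarrow> ip z (x - y) = ip z x - ip z y"
  by (metis ip_diff ip_sym diff_mem)

lemma ip_scale_right: "x \<in> V \<Longrightarrow> z \<in> V \<Longrightarrow> ip z (c *\<^sub>R x) = c * ip z x"
  by (metis ip_scale ip_sym scale_mem)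

lemma ip_zero: "z \<in> V \<Longrightarrow> ip 0 z = 0"
  using ip_scale[of 0 z 0] zero_mem by simp

lemmas ips = ip_add ip_diff ip_scale ip_add_right ip_diff_right ip_scale_right

lemma nrm_nonneg [simp]: "x \<in> V \<Longrightarrow> 0 \<le> nrm x"
  by (simp add: nrm_def ip_nonneg)

lemma nrm_sq: "x \<in> V \<Longrightarrow> (nrm x)\<^sup>2 = ip x x"
  by (simp add: nrm_def ip_nonneg)

lemma nrm_zero: "nrm 0 = 0"
  by (simp add: nrm_def ip_zero zero_mem)

lemma nrm_scale: "x \<in> V \<Longrightarrow> nrm (c *\<^sub>R x) = \<bar>c\<bar> * nrm x"
proof -
  assume x: "x \<in> V"
  have "ip (c *\<^sub>R x) (c *\<^sub>R x) = c\<^sup>2 * ip x x"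
    using x by (simp add: ips mem power2_eq_square)
  then show ?thesis by (simp add: nrm_def real_sqrt_mult)
qed

lemma nrm_minus_commute: "x \<in> V \<Longrightarrow> y \<in> V \<Longrightarrow> nrm (x - y) = nrm (y - x)"
  using nrm_scale[of "x - y" "-1"] by (simp add: mem)

lemma ip_eq_0_if_nrm_0:
  assumes "x \<in> V" "y \<in> V" "nrm x = 0"
  shows "ip x y = 0"
proof -
  have x0: "ip x x = 0" using assms by (simp add: nrm_def ip_nonneg)
  have "0 \<le> c * (2 * ip x y) + c\<^sup>2 * 0 + ip y y" for c
  proof -
    have "0 \<le> ip (c *\<^sub>R x + y) (c *\<^sub>R x + y)"
      using assms by (intro ip_nonneg mem)
    also have "\<dots> = c * (2 * ip x y) + ip y y"
      using assms x0 by (simp add: ips mem ip_sym[of y x] algebra_simps)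
    finally show ?thesis by simp
  qed
  note * = this
  show ?thesis
  proof (rule ccontr)
    assume n: "ip x y \<noteq> 0"
    have "0 \<le> (- (ip y y + 1) / (2 * ip x y)) * (2 * ip x y) + ip y y"
      using *[of "- (ip y y + 1) / (2 * ip x y)"] by simp
    with n show False by simp
  qed
qed

lemma cauchy_schwarz:
  assumes x: "x \<in> V" and y: "y \<in> V"
  shows "\<bar>ip x y\<bar> \<le> nrm x * nrm y"
proof (cases "nrm y = 0")
  case True
  then show ?thesis using ip_eq_0_if_nrm_0[OF y x] ip_sym[OF x y] by simp
next
  case False
  then have p: "ip y y > 0" using y ip_nonneg[OF y] by (simp add: nrm_def less_le)
  define c where "c = ip x y / ip y y"
  have "0 \<le> ip (x - c *\<^sub>R y) (x - c *\<^sub>R y)"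
    using assms by (intro ip_nonneg mem)
  also have "\<dots> = ip x x - 2 * c * ip x y + c * c * ip y y"
    using assms by (simp add: ips mem ip_sym[of y x] algebra_simps)
  also have "\<dots> = ip x x - (ip x y)\<^sup>2 / ip y y"
    using p by (simp add: c_def power2_eq_square field_simps)
  finally have "(ip x y)\<^sup>2 \<le> ip x x * ip y y"
    using p by (simp add: field_simps)
  then have "sqrt ((ip x y)\<^sup>2) \<le> sqrt (ip x x * ip y y)"
    by (rule real_sqrt_le_mono)
  then show ?thesis by (simp add: nrm_def real_sqrt_mult)
qed

lemma nrm_triangle:
  assumes x: "x \<in> V" and y: "y \<in> V"
  shows "nrm (x + y) \<le> nrm x + nrm y"
proof -
  have "(nrm (x + y))\<^sup>2 = (nrm x)\<^sup>2 + 2 * ip x y + (nrm y)\<^sup>2"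
    using assms by (simp add: nrm_sq ips mem ip_sym[of y x])
  also have "\<dots> \<le> (nrm x + nrm y)\<^sup>2"
    using cauchy_schwarz[OF assms] by (simp add: power2_sum)
  finally show ?thesis
    by (rule power2_le_imp_le) (use assms in simp)
qed

lemma nrm_triangle_diff:
  assumes "x \<in> V" "y \<in> V" "z \<in> V"
  shows "nrm (x - z) \<le> nrm (x - y) + nrm (y - z)"
  using nrm_triangle[of "x - y" "y - z"] assms by (simp add: mem)

lemma nrm_diff_ge:
  assumes "x \<in> V" "y \<in> V"
  shows "\<bar>nrm x - nrm y\<bar> \<le> nrm (x - y)"
  using nrm_triangle[of "x - y" y] nrm_triangle[of "y - x" x] nrm_minus_commute[of x y] assms
  by (simp add: mem)

lemma limit_imp_cauchy:
  assumes "\<And>n. X n \<in> V" "x \<in> V" "(\<lambda>n. nrm (X n - x)) \<longlonglongrightarrow> 0"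
  shows "cauchy_seq X"
  unfolding cauchy_seq_def
proof (intro allI impI)
  fix e :: real assume "e > 0"
  then obtain N where N: "\<And>n. n \<ge> N \<Longrightarrow> nrm (X n - x) < e / 2"
    using LIMSEQ_D[OF assms(3), of "e/2"] by (auto simp: assms mem)
  have "nrm (X m - X n) < e" if "m \<ge> N" "n \<ge> N" for m n
    using nrm_triangle_diff[of "X m" x "X n"] N[OF that(1)] N[OF that(2)]
      nrm_minus_commute[of x "X n"] assms by simp
  then show "\<exists>N. \<forall>m\<ge>N. \<forall>n\<ge>N. nrm (X m - X n) < e" by blast
qed

lemma nrm_tendsto:
  assumes "\<And>n. X n \<in> V" "x \<in> V" "(\<lambda>n. nrm (X n - x)) \<longlonglongrightarrow> 0"
  shows "(\<lambda>n. nrm (X n)) \<longlonglongrightarrow> nrm x"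
proof -
  have "(\<lambda>n. nrm (X n) - nrm x) \<longlonglongrightarrow> 0"
    by (rule Lim_null_comparison[OF _ assms(3)]) (use nrm_diff_ge assms in auto)
  then show ?thesis by (simp add: LIM_zero_iff)
qed

lemma ip_tendsto:
  assumes "\<And>n. X n \<in> V" "x \<in> V" "z \<in> V" "(\<lambda>n. nrm (X n - x)) \<longlonglongrightarrow> 0"
  shows "(\<lambda>n. ip (X n) z) \<longlonglongrightarrow> ip x z"
proof -
  have "(\<lambda>n. nrm (X n - x) * nrm z) \<longlonglongrightarrow> 0"
    using tendsto_mult_left_zero[OF assms(4)] by blast
  then have "(\<lambda>n. ip (X n) z - ip x z) \<longlonglongrightarrow> 0"
  proof (rule Lim_null_comparison[rotated])
    show "\<forall>\<^sub>F n in sequentially. norm (ip (X n) z - ip x z) \<le> nrm (X n - x) * nrm z"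
      using cauchy_schwarz[of "X _ - x" z] assms by (auto simp: mem ip_diff)
  qed
  then show ?thesis by (simp add: LIM_zero_iff)
qed

end

locale semi_hilbert_space = semi_inner_space +
  assumes complete: "\<And>X. (\<And>n. X n \<in> V) \<Longrightarrow> cauchy_seq X \<Longrightarrow> \<exists>x\<in>V. (\<lambda>n. nrm (X n - x)) \<longlonglongrightarrow> 0"
begin

text \<open>
  The representing vector minimises \<open>u \<mapsto> \<parallel>u\<parallel>\<^sup>2/2 - F u\<close>. By the parallelogram identity a minimising
  sequence is Cauchy, so the minimum is attained, and the derivative vanishes there.
\<close>

lemma riesz:
  assumes add: "\<And>u v. u \<in> V \<Longrightarrow> v \<in> V \<Longrightarrow> F (u + v) = F u + F v"
    and scale: "\<And>c u. u \<in> V \<Longrightarrow> F (c *\<^sub>R u) = c * F u"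
    and bound: "\<And>u. u \<in> V \<Longrightarrow> \<bar>F u\<bar> \<le> K * nrm u"
  shows "\<exists>u\<in>V. \<forall>v\<in>V. ip u v = F v"
proof -
  have Fdiff: "F (u - v) = F u - F v" if "u \<in> V" "v \<in> V" for u v
    using add[of u "- v"] scale[of v "-1"] that by (simp add: mem)
  define J where "J u = ip u u / 2 - F u" for u
  have lower: "- K\<^sup>2 / 2 \<le> J u" if "u \<in> V" for u
  proof -
    have "0 \<le> (nrm u - K)\<^sup>2 / 2" by simp
    also have "\<dots> = (nrm u)\<^sup>2 / 2 - K * nrm u + K\<^sup>2 / 2"
      by (simp add: power2_diff field_simps)
    also have "\<dots> \<le> J u + K\<^sup>2 / 2"
      using bound[OF that] by (simp add: J_def nrm_sq that)
    finally show ?thesis by simp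
  qed
  define d where "d = Inf (J ` V)"
  have bdd: "bdd_below (J ` V)"
    by (rule bdd_belowI2[where m="- K\<^sup>2 / 2"]) (use lower in simp)
  have d_le: "d \<le> J u" if "u \<in> V" for u
    unfolding d_def by (rule cINF_lower[OF bdd that])
  have "\<exists>u\<in>V. J u < d + 1 / real (Suc n)" for n
  proof -
    have "\<exists>y\<in>J ` V. y < d + 1 / real (Suc n)"
      using cInf_lessD[of "J ` V" "d + 1 / real (Suc n)"] zero_mem by (auto simp: d_def)
    then show ?thesis by auto
  qed
  then obtain U where U: "\<And>n. U n \<in> V" "\<And>n. J (U n) < d + 1 / real (Suc n)" by metis
  have par: "(nrm (a - b))\<^sup>2 \<le> 4 * (J a - d) + 4 * (J b - d)" if ab: "a \<in> V" "b \<in> V" for a b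
  proof -
    have "d \<le> J ((1/2) *\<^sub>R (a + b))" by (intro d_le mem ab)
    also have "\<dots> = (J a + J b) / 2 - (nrm (a - b))\<^sup>2 / 8"
      using ab by (simp add: J_def scale add nrm_sq ips mem ip_sym[of b a] field_simps)
    finally show ?thesis by (simp add: field_simps)
  qed
  have "cauchy_seq U"
    unfolding cauchy_seq_def
  proof (intro allI impI)
    fix e :: real assume e: "e > 0"
    then obtain N where N: "N > 0" "1 / real N < e\<^sup>2 / 8"
      using real_arch_inverse[of "e\<^sup>2/8"] e by (auto simp: inverse_eq_divide)
    have "nrm (U m - U n) < e" if "m \<ge> N" "n \<ge> N" for m n
    proof -
      have "1 / real (Suc m) \<le> 1 / real N" "1 / real (Suc n) \<le> 1 / real N"
        using that N by (auto simp: divide_simps)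
      then have "J (U m) - d < e\<^sup>2 / 8" "J (U n) - d < e\<^sup>2 / 8"
        using U(2)[of m] U(2)[of n] N by linarith+
      then have "(nrm (U m - U n))\<^sup>2 < e\<^sup>2"
        using par[OF U(1) U(1), of m n] by (simp add: field_simps)
      then show ?thesis by (rule power2_less_imp_less) (use e in simp)
    qed
    then show "\<exists>N. \<forall>m\<ge>N. \<forall>n\<ge>N. nrm (U m - U n) < e" by blast
  qed
  from complete[OF U(1) this] obtain u where u: "u \<in> V" "(\<lambda>n. nrm (U n - u)) \<longlonglongrightarrow> 0" by blast
  have "(\<lambda>n. F (U n) - F u) \<longlonglongrightarrow> 0"
  proof (rule Lim_null_comparison)
    show "\<forall>\<^sub>F n in sequentially. norm (F (U n) - F u) \<le> K * nrm (U n - u)"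
      using bound[of "U _ - u"] U(1) u(1) by (auto simp: Fdiff mem)
    show "(\<lambda>n. K * nrm (U n - u)) \<longlonglongrightarrow> 0"
      using tendsto_mult_right_zero[OF u(2)] by blast
  qed
  then have "(\<lambda>n. F (U n)) \<longlonglongrightarrow> F u" by (simp add: LIM_zero_iff)
  moreover have "(\<lambda>n. (nrm (U n))\<^sup>2) \<longlonglongrightarrow> (nrm u)\<^sup>2"
    by (intro tendsto_power nrm_tendsto U u)
  ultimately have "(\<lambda>n. (nrm (U n))\<^sup>2 / 2 - F (U n)) \<longlonglongrightarrow> (nrm u)\<^sup>2 / 2 - F u"
    by (intro tendsto_diff tendsto_divide tendsto_const) auto
  then have "(\<lambda>n. J (U n)) \<longlonglongrightarrow> J u"
    using U(1) u(1) by (simp add: J_def nrm_sq)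
  moreover have "(\<lambda>n. d + 1 / real (Suc n)) \<longlonglongrightarrow> d + 0"
    by (intro tendsto_intros LIMSEQ_Suc[OF lim_1_over_n])
  ultimately have "J u \<le> d + 0"
    by (rule LIMSEQ_le) (use U(2) in \<open>auto intro: less_imp_le\<close>)
  then have min: "J u \<le> J v" if "v \<in> V" for v using d_le[OF that] by simp
  have "ip u v - F v = 0" if v: "v \<in> V" for v
  proof (rule linear_dominated_by_quadratic)
    fix c :: real
    have "J u \<le> J (u + c *\<^sub>R v)" by (intro min mem u v)
    also have "\<dots> = J u + (c * (ip u v - F v) + c\<^sup>2 * (ip v v / 2))"
      using u(1) v by (simp add: J_def add scale ips mem ip_sym[of v u] power2_eq_square field_simps)
    finally show "0 \<le> c * (ip u v - F v) + c\<^sup>2 * (ip v v / 2)" by simp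
  qed
  with u(1) show ?thesis by auto
qed

end

text \<open>
  The hypothesis \<open>compact_perturbation\<close> is the form in which a Garding inequality with compact error
  terms is used: on the differences of a suitable subsequence the error is arbitrarily small.
\<close>

locale fredholm_form = semi_hilbert_space +
  fixes B :: "'a \<Rightarrow> 'a \<Rightarrow> real" and M c :: real
  assumes B_add: "\<And>u v w. u \<in> V \<Longrightarrow> v \<in> V \<Longrightarrow> w \<in> V \<Longrightarrow> B (u + v) w = B u w + B v w"
    and B_scale: "\<And>a u w. u \<in> V \<Longrightarrow> w \<in> V \<Longrightarrow> B (a *\<^sub>R u) w = a * B u w"
    and B_sym: "\<And>u v. u \<in> V \<Longrightarrow> v \<in> V \<Longrightarrow> B u v = B v u"
    and B_bound: "\<And>u v. u \<in> V \<Longrightarrow> v \<in> V \<Longrightarrow> \<bar>B u v\<bar> \<le> M * nrm u * nrm v"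
    and c_pos: "c > 0"
    and compact_perturbation: "\<And>X. (\<And>n. X n \<in> V) \<Longrightarrow> (\<And>n. nrm (X n) \<le> 1) \<Longrightarrow>
      \<exists>r. strict_mono (r :: nat \<Rightarrow> nat) \<and> (\<forall>e>0. \<exists>N. \<forall>m\<ge>N. \<forall>n\<ge>N.
        c * (nrm (X (r m) - X (r n)))\<^sup>2 \<le> B (X (r m) - X (r n)) (X (r m) - X (r n)) + e)"
    and trivial_kernel: "\<And>u. u \<in> V \<Longrightarrow> (\<And>v. v \<in> V \<Longrightarrow> B u v = 0) \<Longrightarrow> nrm u = 0"
begin

lemma B_diff: "u \<in> V \<Longrightarrow> v \<in> V \<Longrightarrow> w \<in> V \<Longrightarrow> B (u - v) w = B u w - B v w"
  using B_add[of u "- v" w] B_scale[of v w "-1"] by (simp add: mem)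

lemma B_tendsto:
  assumes "\<And>n. X n \<in> V" "x \<in> V" "v \<in> V" "(\<lambda>n. nrm (X n - x)) \<longlonglongrightarrow> 0"
  shows "(\<lambda>n. B (X n) v) \<longlonglongrightarrow> B x v"
proof -
  have "(\<lambda>n. M * nrm (X n - x) * nrm v) \<longlonglongrightarrow> 0"
    using tendsto_mult_left_zero[OF tendsto_mult_right_zero[OF assms(4)]] by blast
  then have "(\<lambda>n. B (X n) v - B x v) \<longlonglongrightarrow> 0"
  proof (rule Lim_null_comparison[rotated])
    show "\<forall>\<^sub>F n in sequentially. norm (B (X n) v - B x v) \<le> M * nrm (X n - x) * nrm v"
      using B_bound[of "X _ - x" v] assms by (auto simp: mem B_diff)
  qed
  then show ?thesis by (simp add: LIM_zero_iff)
qed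

text \<open>
  Otherwise there are unit vectors \<open>w\<^sub>k\<close> with \<open>B w\<^sub>k \<rightarrow> 0\<close> as functionals. Then \<open>B d d\<close> is small for the
  differences \<open>d\<close> of these vectors, so a subsequence is Cauchy, and its limit is a unit vector in the
  kernel.
\<close>

lemma inf_sup:
  "\<exists>C\<ge>0. \<forall>u\<in>V. \<forall>K\<ge>0. (\<forall>v\<in>V. \<bar>B u v\<bar> \<le> K * nrm v) \<longrightarrow> nrm u \<le> C * K"
proof (rule ccontr)
  assume neg: "\<not> ?thesis"
  have "\<exists>u K. u \<in> V \<and> K \<ge> 0 \<and> (\<forall>v\<in>V. \<bar>B u v\<bar> \<le> K * nrm v) \<and> nrm u > real (Suc k) * K" for k
    using neg[simplified, rule_format, of "real (Suc k)"] by (auto simp: not_le)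
  then obtain u K where u: "\<And>k. u k \<in> V" "\<And>k. K k \<ge> 0"
    "\<And>k v. v \<in> V \<Longrightarrow> \<bar>B (u k) v\<bar> \<le> K k * nrm v" "\<And>k. nrm (u k) > real (Suc k) * K k"
    by metis
  have pos: "nrm (u k) > 0" for k
    using u(4)[of k] u(2)[of k] by (smt (verit) mult_nonneg_nonneg of_nat_0_le_iff)
  define w where "w k = (1 / nrm (u k)) *\<^sub>R u k" for k
  have w: "w k \<in> V" and w1: "nrm (w k) = 1" for k
    using pos[of k] by (auto simp: w_def u mem nrm_scale)
  have Bw: "\<bar>B (w k) v\<bar> \<le> 1 / real (Suc k) * nrm v" if v: "v \<in> V" for k v
  proof -
    have "\<bar>B (w k) v\<bar> = \<bar>B (u k) v\<bar> / nrm (u k)"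
      using pos[of k] v by (simp add: w_def B_scale u abs_mult)
    also have "\<dots> \<le> K k * nrm v / nrm (u k)"
      using u(3)[OF v, of k] pos[of k] by (intro divide_right_mono) auto
    also have "\<dots> = K k / nrm (u k) * nrm v" by simp
    also have "\<dots> \<le> 1 / real (Suc k) * nrm v"
      using u(4)[of k] pos[of k] v
      by (intro mult_right_mono) (simp_all add: field_simps)
    finally show ?thesis .
  qed
  obtain r where r: "strict_mono (r :: nat \<Rightarrow> nat)" and cpt: "\<And>e. e > 0 \<Longrightarrow> \<exists>N. \<forall>m\<ge>N. \<forall>n\<ge>N.
      c * (nrm (w (r m) - w (r n)))\<^sup>2 \<le> B (w (r m) - w (r n)) (w (r m) - w (r n)) + e"
    using compact_perturbation[of w] w w1 by auto
  have small: "B (w (r m) - w (r n)) (w (r m) - w (r n)) \<le> 2 / real (Suc m) + 2 / real (Suc n)" for m n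
  proof -
    let ?d = "w (r m) - w (r n)"
    have d: "?d \<in> V" by (intro mem w)
    have d2: "nrm ?d \<le> 2"
      using nrm_triangle_diff[of "w (r m)" 0 "w (r n)"] w w1 nrm_minus_commute[of 0 "w (r n)"]
      by (simp add: mem)
    have le: "1 / real (Suc (r k)) \<le> 1 / real (Suc k)" for k
      using seq_suble[OF r, of k] by (simp add: divide_simps)
    have *: "\<bar>B (w (r k)) ?d\<bar> \<le> 1 / real (Suc k) * 2" for k
      by (rule order_trans[OF Bw[OF d]]) (intro mult_mono le d2, use d in auto)
    show ?thesis using *[of m] *[of n] by (simp add: B_diff w d)
  qed
  have "cauchy_seq (\<lambda>k. w (r k))"
    unfolding cauchy_seq_def
  proof (intro allI impI)
    fix e :: real assume e: "e > 0"
    then have e2: "c * e\<^sup>2 / 4 > 0" using c_pos by simp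
    obtain N1 where N1: "\<And>m n. m \<ge> N1 \<Longrightarrow> n \<ge> N1 \<Longrightarrow>
        c * (nrm (w (r m) - w (r n)))\<^sup>2 \<le> B (w (r m) - w (r n)) (w (r m) - w (r n)) + c * e\<^sup>2 / 4"
      using cpt[OF e2] by blast
    obtain N2 where N2: "N2 > 0" "1 / real N2 < c * e\<^sup>2 / 8"
      using real_arch_inverse[of "c * e\<^sup>2/8"] e2 by (auto simp: inverse_eq_divide)
    have "nrm (w (r m) - w (r n)) < e" if mn: "m \<ge> max N1 N2" "n \<ge> max N1 N2" for m n
    proof -
      have "1 / real (Suc m) \<le> 1 / real N2" "1 / real (Suc n) \<le> 1 / real N2"
        using mn N2 by (auto simp: divide_simps)
      then have "c * (nrm (w (r m) - w (r n)))\<^sup>2 < c * e\<^sup>2"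
        using N1[of m n] small[of m n] N2 mn e2 by simp
      then have "(nrm (w (r m) - w (r n)))\<^sup>2 < e\<^sup>2" using c_pos by simp
      then show ?thesis by (rule power2_less_imp_less) (use e in simp)
    qed
    then show "\<exists>N. \<forall>m\<ge>N. \<forall>n\<ge>N. nrm (w (r m) - w (r n)) < e" by blast
  qed
  from complete[OF _ this] w obtain z where z: "z \<in> V" "(\<lambda>n. nrm (w (r n) - z)) \<longlonglongrightarrow> 0" by blast
  have "(\<lambda>n. nrm (w (r n))) \<longlonglongrightarrow> nrm z"
    by (rule nrm_tendsto[OF _ z]) (rule w)
  then have "nrm z = 1"
    by (simp add: w1 LIMSEQ_const_iff)
  moreover have "B z v = 0" if v: "v \<in> V" for v
  proof -
    have "(\<lambda>n. 1 / real (Suc n) * nrm v) \<longlonglongrightarrow> 0"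
      by (intro tendsto_mult_left_zero LIMSEQ_Suc[OF lim_1_over_n])
    then have "(\<lambda>n. B (w n) v) \<longlonglongrightarrow> 0"
      by (rule Lim_null_comparison[rotated]) (use Bw[OF v] in auto)
    then have "(\<lambda>n. B (w (r n)) v) \<longlonglongrightarrow> 0"
      using LIMSEQ_subseq_LIMSEQ[OF _ r] by (auto simp: o_def)
    moreover have "(\<lambda>n. B (w (r n)) v) \<longlonglongrightarrow> B z v"
      by (rule B_tendsto[OF _ z(1) v z(2)]) (rule w)
    ultimately show ?thesis using LIMSEQ_unique by blast
  qed
  ultimately show False using trivial_kernel[OF z(1)] by simp
qed

text \<open>
  The range of the operator \<open>A\<close> with \<open>\<langle>A u, v\<rangle> = B u v\<close> is closed by the inf-sup estimate. A vector
  orthogonal to it lies in the kernel of \<open>A\<close>, because \<open>A\<close> is symmetric; so \<open>A\<close> is onto.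
\<close>

theorem solvable:
  "\<exists>C\<ge>0. \<forall>F. \<forall>K\<ge>0. (\<forall>u\<in>V. \<forall>v\<in>V. F (u + v) = F u + F v) \<and> (\<forall>a. \<forall>u\<in>V. F (a *\<^sub>R u) = a * F u) \<and>
      (\<forall>v\<in>V. \<bar>F v\<bar> \<le> K * nrm v) \<longrightarrow> (\<exists>u\<in>V. (\<forall>v\<in>V. B u v = F v) \<and> nrm u \<le> C * K)"
proof -
  obtain C where C: "C \<ge> 0" "\<And>u K. u \<in> V \<Longrightarrow> K \<ge> 0 \<Longrightarrow> (\<And>v. v \<in> V \<Longrightarrow> \<bar>B u v\<bar> \<le> K * nrm v) \<Longrightarrow> nrm u \<le> C * K"
    using inf_sup by blast
  define R where "R = {w \<in> V. \<exists>u\<in>V. \<forall>v\<in>V. ip w v = B u v}"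
  have RV: "R \<subseteq> V" by (auto simp: R_def)
  have B0: "B 0 v = 0" if "v \<in> V" for v using B_scale[of 0 v 0] that zero_mem by simp
  interpret R: semi_inner_space R ip
  proof
    show "0 \<in> R" using B0 by (auto simp: R_def mem ip_zero intro!: bexI[of _ 0])
    show "x + y \<in> R" if xy: "x \<in> R" "y \<in> R" for x y
    proof -
      obtain u v where "u \<in> V" "\<forall>z\<in>V. ip x z = B u z" "v \<in> V" "\<forall>z\<in>V. ip y z = B v z"
        using xy by (auto simp: R_def)
      then show ?thesis using xy by (auto simp: R_def mem ips B_add intro!: bexI[of _ "u + v"])
    qed
    show "a *\<^sub>R x \<in> R" if x: "x \<in> R" for a x
    proof -
      obtain u where "u \<in> V" "\<forall>z\<in>V. ip x z = B u z" using x by (auto simp: R_def)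
      then show ?thesis using x by (auto simp: R_def mem ips B_scale intro!: bexI[of _ "a *\<^sub>R u"])
    qed
  qed (use RV in \<open>auto simp: ips ip_nonneg ip_sym subset_iff\<close>)
  interpret R: semi_hilbert_space R ip
  proof
    fix W assume W: "\<And>n. W n \<in> R" and cW: "R.cauchy_seq W"
    have WV: "W n \<in> V" for n using W RV by auto
    have "cauchy_seq W" by (rule cW)
    from complete[OF WV this] obtain w where w: "w \<in> V" "(\<lambda>n. nrm (W n - w)) \<longlonglongrightarrow> 0" by blast
    have "\<forall>n. \<exists>u\<in>V. \<forall>v\<in>V. ip (W n) v = B u v" using W by (auto simp: R_def)
    then obtain U where U: "\<And>n. U n \<in> V" "\<And>n v. v \<in> V \<Longrightarrow> ip (W n) v = B (U n) v" by metis
    have UW: "nrm (U m - U n) \<le> C * nrm (W m - W n)" for m n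
    proof (rule C(2))
      fix v assume v: "v \<in> V"
      have "B (U m - U n) v = ip (W m - W n) v" using v U WV by (simp add: B_diff ips)
      then show "\<bar>B (U m - U n) v\<bar> \<le> nrm (W m - W n) * nrm v"
        using cauchy_schwarz[of "W m - W n" v] WV v by (simp add: mem)
    qed (auto simp: mem U WV)
    have "cauchy_seq U"
      unfolding cauchy_seq_def
    proof (intro allI impI)
      fix e :: real assume e: "e > 0"
      then obtain N where N: "\<And>m n. m \<ge> N \<Longrightarrow> n \<ge> N \<Longrightarrow> nrm (W m - W n) < e / (C + 1)"
        using \<open>cauchy_seq W\<close> C(1) unfolding cauchy_seq_def by (meson add_nonneg_pos divide_pos_pos zero_less_one)
      have "nrm (U m - U n) < e" if "m \<ge> N" "n \<ge> N" for m n
      proof -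
        have "nrm (U m - U n) \<le> (C + 1) * nrm (W m - W n) - nrm (W m - W n)"
          using UW[of m n] by (simp add: algebra_simps)
        moreover have "(C + 1) * nrm (W m - W n) < e"
          using N[OF that] C(1) by (simp add: field_simps)
        moreover have "0 \<le> nrm (W m - W n)" by (simp add: mem WV)
        ultimately show ?thesis by linarith
      qed
      then show "\<exists>N. \<forall>m\<ge>N. \<forall>n\<ge>N. nrm (U m - U n) < e" by blast
    qed
    from complete[OF U(1) this] obtain u where u: "u \<in> V" "(\<lambda>n. nrm (U n - u)) \<longlonglongrightarrow> 0" by blast
    have "ip w v = B u v" if v: "v \<in> V" for v
    proof -
      have "(\<lambda>n. B (U n) v) \<longlonglongrightarrow> ip w v"
        using ip_tendsto[OF WV w(1) v w(2)] U(2)[OF v] by simp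
      then show ?thesis using B_tendsto[OF U(1) u(1) v u(2)] LIMSEQ_unique by blast
    qed
    then have "w \<in> R" using w u by (auto simp: R_def)
    with w show "\<exists>x\<in>R. (\<lambda>n. R.nrm (W n - x)) \<longlonglongrightarrow> 0" by auto
  qed
  have "\<exists>u\<in>V. (\<forall>v\<in>V. B u v = F v) \<and> nrm u \<le> C * K"
    if K: "K \<ge> 0" and F: "\<And>u v. u \<in> V \<Longrightarrow> v \<in> V \<Longrightarrow> F (u + v) = F u + F v"
      "\<And>a u. u \<in> V \<Longrightarrow> F (a *\<^sub>R u) = a * F u" "\<And>v. v \<in> V \<Longrightarrow> \<bar>F v\<bar> \<le> K * nrm v" for F K
  proof -
    obtain f where f: "f \<in> V" "\<And>v. v \<in> V \<Longrightarrow> ip f v = F v"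
      using riesz[OF F(1) F(2) F(3)] by auto
    obtain w where w: "w \<in> R" "\<And>v. v \<in> R \<Longrightarrow> ip w v = ip f v"
    proof -
      have "\<exists>w\<in>R. \<forall>v\<in>R. ip w v = ip f v"
        by (rule R.riesz[of "ip f" "nrm f"]) (use RV f(1) cauchy_schwarz in \<open>auto simp: ips subset_iff\<close>)
      then show ?thesis using that by blast
    qed
    have wV: "w \<in> V" using w RV by auto
    obtain u where u: "u \<in> V" "\<And>v. v \<in> V \<Longrightarrow> ip w v = B u v" using w(1) by (auto simp: R_def)
    have z: "f - w \<in> V" using f wV by (simp add: mem)
    have "nrm (f - w) = 0"
    proof (rule trivial_kernel[OF z])
      fix v assume v: "v \<in> V"
      obtain Av where Av: "Av \<in> V" "\<And>x. x \<in> V \<Longrightarrow> ip Av x = B v x"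
        using riesz[of "B v" "M * nrm v"] v B_bound[OF v] B_add B_scale B_sym
        by (metis add_mem scale_mem)
      then have "Av \<in> R" using v by (auto simp: R_def)
      then have "ip (f - w) Av = 0" using w(2) f wV Av by (simp add: ips)
      then show "B (f - w) v = 0"
        using Av z v by (metis B_sym ip_sym)
    qed
    then have "B u v = F v" if "v \<in> V" for v
      using ip_eq_0_if_nrm_0[OF z that] f wV u that by (simp add: ips)
    then show ?thesis using u C(2)[OF u(1) K] F(3) by auto
  qed
  then show ?thesis using C(1) by (intro exI[of _ C]) blast
qed

end

section \<open>The space of square integrable functions\<close>

definition L2_space :: "'x measure \<Rightarrow> ('x \<Rightarrow> 'b::euclidean_space) set" where
  "L2_space M = {f \<in> borel_measurable M. integrable M (\<lambda>x. (norm (f x))\<^sup>2)}"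

definition L2_inner :: "'x measure \<Rightarrow> ('x \<Rightarrow> 'b::euclidean_space) \<Rightarrow> ('x \<Rightarrow> 'b) \<Rightarrow> real" where
  "L2_inner M f g = (LINT x|M. f x \<bullet> g x)"

definition L2_norm :: "'x measure \<Rightarrow> ('x \<Rightarrow> 'b::euclidean_space) \<Rightarrow> real" where
  "L2_norm M f = sqrt (LINT x|M. (norm (f x))\<^sup>2)"

lemma L2_measurable: "f \<in> L2_space M \<Longrightarrow> f \<in> borel_measurable M"
  by (simp add: L2_space_def)

lemma L2_integrable_square: "f \<in> L2_space M \<Longrightarrow> integrable M (\<lambda>x. (norm (f x))\<^sup>2)"
  by (simp add: L2_space_def)

lemma L2_dominated:
  assumes "g \<in> L2_space M" "f \<in> borel_measurable M" "AE x in M. norm (f x) \<le> norm (g x)"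
  shows "f \<in> L2_space M"
proof -
  have [measurable]: "f \<in> borel_measurable M" by fact
  have "integrable M (\<lambda>x. (norm (f x))\<^sup>2)"
    by (rule Bochner_Integration.integrable_bound[OF L2_integrable_square[OF assms(1)]])
      (use assms(3) in \<open>auto intro: power_mono\<close>)
  then show ?thesis by (simp add: L2_space_def assms)
qed

lemma integrable_L2_inner:
  assumes "f \<in> L2_space M" "g \<in> L2_space M"
  shows "integrable M (\<lambda>x. f x \<bullet> g x)"
proof -
  have [measurable]: "f \<in> borel_measurable M" "g \<in> borel_measurable M"
    using assms by (auto simp: L2_measurable)
  have "integrable M (\<lambda>x. (norm (f x))\<^sup>2 + (norm (g x))\<^sup>2)"
    by (intro Bochner_Integration.integrable_add L2_integrable_square assms)
  then show ?thesis
  proof (rule Bochner_Integration.integrable_bound)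
    have "norm (f x \<bullet> g x) \<le> norm ((norm (f x))\<^sup>2 + (norm (g x))\<^sup>2)" for x
    proof -
      have "2 * \<bar>f x \<bullet> g x\<bar> \<le> 2 * (norm (f x) * norm (g x))"
        using Cauchy_Schwarz_ineq2[of "f x" "g x"] by simp
      also have "\<dots> \<le> (norm (f x))\<^sup>2 + (norm (g x))\<^sup>2"
        using sum_squares_bound[of "norm (f x)" "norm (g x)"] by simp
      finally show ?thesis using zero_le_power2[of "norm (f x)"] zero_le_power2[of "norm (g x)"] by simp
    qed
    then show "AE x in M. norm (f x \<bullet> g x) \<le> norm ((norm (f x))\<^sup>2 + (norm (g x))\<^sup>2)" by blast
  qed simp
qed

lemma integrable_L2_mult:
  fixes f g :: "'x \<Rightarrow> real"
  shows "f \<in> L2_space M \<Longrightarrow> g \<in> L2_space M \<Longrightarrow> integrable M (\<lambda>x. f x * g x)"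
  using integrable_L2_inner[of f M g] by simp

lemma L2_add: 
  assumes "f \<in> L2_space M" "g \<in> L2_space M"
  shows "f + g \<in> L2_space M"
proof -
  have [measurable]: "f \<in> borel_measurable M" "g \<in> borel_measurable M"
    using assms by (auto simp: L2_measurable)
  have "integrable M (\<lambda>x. (norm (f x))\<^sup>2 + 2 * (f x \<bullet> g x) + (norm (g x))\<^sup>2)"
    by (intro Bochner_Integration.integrable_add integrable_mult_right integrable_L2_inner L2_integrable_square assms)
  moreover have "(norm (f x + g x))\<^sup>2 = (norm (f x))\<^sup>2 + 2 * (f x \<bullet> g x) + (norm (g x))\<^sup>2" for x
    by (simp add: power2_norm_eq_inner inner_add_left inner_add_right inner_commute)
  ultimately show ?thesis by (simp add: L2_space_def plus_fun_def)
qed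

lemma L2_scale: "f \<in> L2_space M \<Longrightarrow> c *\<^sub>R f \<in> L2_space M"
  by (auto simp: L2_space_def scaleR_fun_def power_mult_distrib)

lemma L2_zero: "0 \<in> L2_space M"
  by (simp add: L2_space_def zero_fun_def)

lemma semi_inner_space_L2:
  "semi_inner_space (L2_space M :: ('x \<Rightarrow> 'b::euclidean_space) set) (L2_inner M)"
proof (unfold_locales)
  fix x y z :: "'x \<Rightarrow> 'b" and c :: real
  assume xyz: "x \<in> L2_space M" "y \<in> L2_space M" "z \<in> L2_space M"
  show "L2_inner M (x + y) z = L2_inner M x z + L2_inner M y z"
    using xyz integrable_L2_inner[of x M z] integrable_L2_inner[of y M z]
    by (simp add: L2_inner_def plus_fun_def inner_add_left)
qed (auto simp: L2_zero L2_add L2_scale, auto simp: L2_inner_def scaleR_fun_def inner_commute)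

lemma L2_nrm_eq: "semi_inner_space.nrm (L2_inner M) = L2_norm M"
  by (auto simp: semi_inner_space.nrm_def[OF semi_inner_space_L2] L2_norm_def L2_inner_def
      fun_eq_iff power2_norm_eq_inner)

interpretation L2: semi_inner_space "L2_space M" "L2_inner M"
    rewrites "semi_inner_space.nrm (L2_inner M) = L2_norm M" for M :: "'x measure"
  by (rule semi_inner_space_L2 L2_nrm_eq)+

lemma L2_norm_nn:
  assumes "f \<in> L2_space M"
  shows "ennreal ((L2_norm M f)\<^sup>2) = (\<integral>\<^sup>+x. ennreal ((norm (f x))\<^sup>2) \<partial>M)"
  using assms by (simp add: L2_norm_def L2_integrable_square nn_integral_eq_integral)

lemma L2_norm_square: "(L2_norm M f)\<^sup>2 = (LINT x|M. (norm (f x))\<^sup>2)"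
  by (simp add: L2_norm_def)

lemma L2_norm_nonneg [simp]: "0 \<le> L2_norm M f"
  by (simp add: L2_norm_def)

lemma L2_I_nn:
  assumes [measurable]: "f \<in> borel_measurable M" and "(\<integral>\<^sup>+x. ennreal ((norm (f x))\<^sup>2) \<partial>M) \<le> ennreal C"
  shows "f \<in> L2_space M" "0 \<le> C \<Longrightarrow> (L2_norm M f)\<^sup>2 \<le> C"
proof -
  show *: "f \<in> L2_space M"
    unfolding L2_space_def by (auto intro!: integrableI_bounded le_less_trans[OF assms(2)])
  show "(L2_norm M f)\<^sup>2 \<le> C" if "0 \<le> C"
    using assms(2) that by (simp add: L2_norm_nn[OF *, symmetric])
qed

lemma L2_norm_cong_AE:
  assumes "AE x in M. f x = g x" "f \<in> L2_space M" "g \<in> L2_space M"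
  shows "L2_norm M f = L2_norm M g"
proof -
  have [measurable]: "f \<in> borel_measurable M" "g \<in> borel_measurable M"
    using assms by (auto simp: L2_measurable)
  show ?thesis unfolding L2_norm_def
    by (intro arg_cong[where f=sqrt] integral_cong_AE) (use assms(1) in auto)
qed

lemma L2_cong_AE:
  assumes "AE x in M. f x = g x" "f \<in> L2_space M" "g \<in> borel_measurable M"
  shows "g \<in> L2_space M"
  by (rule L2_dominated[OF assms(2,3)]) (use assms(1) in auto)

lemma L2_inner_cong_AE:
  assumes "AE x in M. f x = g x" "f \<in> L2_space M" "g \<in> L2_space M" "h \<in> L2_space M"
  shows "L2_inner M f h = L2_inner M g h"
proof -
  have [measurable]: "f \<in> borel_measurable M" "g \<in> borel_measurable M" "h \<in> borel_measurable M"
    using assms by (auto simp: L2_measurable)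
  show ?thesis unfolding L2_inner_def
    by (intro integral_cong_AE) (use assms(1) in auto)
qed

lemma L2_norm_eq_0_iff:
  assumes "f \<in> L2_space M"
  shows "L2_norm M f = 0 \<longleftrightarrow> (AE x in M. f x = 0)"
  using integral_nonneg_eq_0_iff_AE[OF L2_integrable_square[OF assms]]
  by (simp add: L2_norm_def)

lemma L2_norm_diff_eq_0_iff:
  assumes "f \<in> L2_space M" "g \<in> L2_space M"
  shows "L2_norm M (f - g) = 0 \<longleftrightarrow> (AE x in M. f x = g x)"
  using L2_norm_eq_0_iff[OF L2.diff_mem[OF assms]] by (simp add: fun_diff_def)

lemma L2_limit_unique:
  assumes X: "\<And>n. X n \<in> L2_space M" and f: "f \<in> L2_space M" and g: "g \<in> L2_space M"
    and "(\<lambda>n. L2_norm M (X n - f)) \<longlonglongrightarrow> 0" "(\<lambda>n. L2_norm M (X n - g)) \<longlonglongrightarrow> 0"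
  shows "AE x in M. f x = g x"
proof -
  have "(\<lambda>n. L2_norm M (X n - f) + L2_norm M (X n - g)) \<longlonglongrightarrow> 0 + 0"
    by (intro tendsto_intros assms)
  moreover have "L2_norm M (f - g) \<le> L2_norm M (X n - f) + L2_norm M (X n - g)" for n
    using L2.nrm_triangle_diff[OF f X g, of n] L2.nrm_minus_commute[OF f X] by simp
  ultimately have "L2_norm M (f - g) \<le> 0"
    by (intro LIMSEQ_le_const) auto
  then show ?thesis
    using L2_norm_diff_eq_0_iff[OF f g] by (simp add: antisym)
qed

text \<open>
  Along a subsequence the increments \<open>d\<^sub>k\<close> have norm below \<open>2\<^sup>-\<^sup>k\<close>. Then
  \<open>\<Sum>\<^sub>k 2\<^sup>k \<bar>d\<^sub>k\<bar>\<^sup>2\<close> has a finite integral, so almost everywhere \<open>\<bar>d\<^sub>k\<bar>\<close> is dominated by a geometric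
  series and the subsequence converges pointwise; Fatou's lemma identifies the limit.
\<close>

lemma L2_complete:
  fixes X :: "nat \<Rightarrow> 'x \<Rightarrow> 'b::euclidean_space"
  assumes X: "\<And>n. X n \<in> L2_space M"
    and cauchy: "\<And>e. e > 0 \<Longrightarrow> \<exists>N. \<forall>m\<ge>N. \<forall>n\<ge>N. L2_norm M (X m - X n) < e"
  shows "\<exists>f\<in>L2_space M. (\<lambda>n. L2_norm M (X n - f)) \<longlonglongrightarrow> 0"
proof -
  note [measurable] = L2_measurable[OF X]
  have "\<exists>N. \<forall>m\<ge>N. \<forall>n\<ge>N. L2_norm M (X m - X n) < (1/2)^k" for k :: nat
    by (rule cauchy) simp
  then obtain N where N: "\<And>k m n. m \<ge> N k \<Longrightarrow> n \<ge> N k \<Longrightarrow> L2_norm M (X m - X n) < (1/2)^k"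
    by metis
  \<comment> \<open>an increasing index sequence with \<open>r k \<ge> N k\<close>\<close>
  define r where "r k = (\<Sum>i\<le>k. N i) + k" for k
  have rN: "r k \<ge> N k" "r (Suc k) \<ge> N k" "r k \<ge> k" for k
  proof -
    have "N k \<le> sum N {..k}" by (rule member_le_sum) auto
    then show "r k \<ge> N k" "r (Suc k) \<ge> N k" "r k \<ge> k" by (auto simp: r_def)
  qed
  define d where "d k x = X (r (Suc k)) x - X (r k) x" for k x
  have [measurable]: "d k \<in> borel_measurable M" for k by (simp add: d_def[abs_def])
  have d: "(\<integral>\<^sup>+x. ennreal ((norm (d k x))\<^sup>2) \<partial>M) \<le> ennreal ((1/4)^k)" for k
  proof -
    have "L2_norm M (X (r (Suc k)) - X (r k)) \<le> (1/2)^k"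
      using N[of k "r (Suc k)" "r k"] rN[of k] by simp
    then have "(L2_norm M (X (r (Suc k)) - X (r k)))\<^sup>2 \<le> ((1/2)^k)\<^sup>2" by (rule power_mono) simp
    also have "((1/2)^k)\<^sup>2 = (1/4::real)^k"
      by (simp add: power_mult_distrib[symmetric] power2_eq_square)
    finally have "ennreal ((L2_norm M (X (r (Suc k)) - X (r k)))\<^sup>2) \<le> ennreal ((1/4)^k)"
      by (rule ennreal_leI)
    then show ?thesis
      unfolding L2_norm_nn[OF L2.diff_mem[OF X X]] by (simp only: d_def minus_apply)
  qed
  have "(\<integral>\<^sup>+x. (\<Sum>k. ennreal (2^k * (norm (d k x))\<^sup>2)) \<partial>M) = (\<Sum>k. \<integral>\<^sup>+x. ennreal (2^k * (norm (d k x))\<^sup>2) \<partial>M)"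
    by (rule nn_integral_suminf) simp
  also have "\<dots> = (\<Sum>k. ennreal (2^k) * (\<integral>\<^sup>+x. ennreal ((norm (d k x))\<^sup>2) \<partial>M))"
    by (simp add: ennreal_mult nn_integral_cmult)
  also have "\<dots> \<le> (\<Sum>k. ennreal ((1/2)^k))"
  proof (rule suminf_le)
    fix k
    have "ennreal (2^k) * (\<integral>\<^sup>+x. ennreal ((norm (d k x))\<^sup>2) \<partial>M) \<le> ennreal (2^k) * ennreal ((1/4)^k)"
      by (intro mult_left_mono d) simp
    also have "\<dots> = ennreal ((1/2)^k)"
      by (simp add: ennreal_mult[symmetric] power_mult_distrib[symmetric] del: ennreal_power)
    finally show "ennreal (2^k) * (\<integral>\<^sup>+x. ennreal ((norm (d k x))\<^sup>2) \<partial>M) \<le> ennreal ((1/2)^k)" .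
  qed auto
  also have "\<dots> < \<infinity>"
    by (subst suminf_ennreal2) (auto simp: summable_geometric)
  finally have "AE x in M. (\<Sum>k. ennreal (2^k * (norm (d k x))\<^sup>2)) \<noteq> \<infinity>"
    by (intro nn_integral_PInf_AE) auto
  then have conv: "AE x in M. convergent (\<lambda>k. X (r k) x)"
  proof eventually_elim
    fix x assume fin: "(\<Sum>k. ennreal (2^k * (norm (d k x))\<^sup>2)) \<noteq> \<infinity>"
    define S where "S = enn2real (\<Sum>k. ennreal (2^k * (norm (d k x))\<^sup>2))"
    have le: "norm (d k x) \<le> sqrt S * (1 / sqrt 2)^k" for k
    proof -
      have "ennreal (2^k * (norm (d k x))\<^sup>2) = (\<Sum>i\<in>{k}. ennreal (2^i * (norm (d i x))\<^sup>2))" by simp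
      also have "\<dots> \<le> (\<Sum>i. ennreal (2^i * (norm (d i x))\<^sup>2))" by (rule sum_le_suminf) auto
      finally have "enn2real (ennreal (2^k * (norm (d k x))\<^sup>2)) \<le> S"
        unfolding S_def using fin by (intro enn2real_mono) (auto simp: top.not_eq_extremum)
      then have "2^k * (norm (d k x))\<^sup>2 \<le> S" by simp
      then have "sqrt (2^k * (norm (d k x))\<^sup>2) \<le> sqrt S" by (rule real_sqrt_le_mono)
      then have "sqrt 2^k * norm (d k x) \<le> sqrt S" by (simp add: real_sqrt_mult real_sqrt_power)
      then show ?thesis by (simp add: field_simps)
    qed
    have "summable (\<lambda>k. sqrt S * (1 / sqrt 2)^k)"
      by (intro summable_mult summable_geometric) simp
    then have "summable (\<lambda>k. d k x)"
      by (rule summable_comparison_test') (use le in auto)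
    then have "(\<lambda>n. X (r 0) x + (\<Sum>k<n. d k x)) \<longlonglongrightarrow> X (r 0) x + (\<Sum>k. d k x)"
      by (intro tendsto_intros summable_LIMSEQ)
    moreover have "X (r 0) x + (\<Sum>k<n. d k x) = X (r n) x" for n
      unfolding d_def by (subst sum_lessThan_telescope) simp
    ultimately show "convergent (\<lambda>k. X (r k) x)" by (auto simp: convergent_def)
  qed
  define f where "f x = lim (\<lambda>k. X (r k) x)" for x
  have [measurable]: "f \<in> borel_measurable M"
    unfolding f_def[abs_def] by (rule borel_measurable_lim_metric) simp
  have lim: "AE x in M. (\<lambda>k. X (r k) x) \<longlonglongrightarrow> f x"
    using conv by eventually_elim (simp add: f_def convergent_LIMSEQ_iff)
  have fatou: "(\<integral>\<^sup>+x. ennreal ((norm (X n x - f x))\<^sup>2) \<partial>M) \<le> ennreal (e\<^sup>2)"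
    if n: "\<And>m. m \<ge> n0 \<Longrightarrow> L2_norm M (X n - X m) \<le> e" for n n0 e
  proof -
    have "(\<integral>\<^sup>+x. ennreal ((norm (X n x - f x))\<^sup>2) \<partial>M)
        = (\<integral>\<^sup>+x. liminf (\<lambda>k. ennreal ((norm (X n x - X (r k) x))\<^sup>2)) \<partial>M)"
    proof (rule nn_integral_cong_AE)
      show "AE x in M. ennreal ((norm (X n x - f x))\<^sup>2) = liminf (\<lambda>k. ennreal ((norm (X n x - X (r k) x))\<^sup>2))"
        using lim
      proof eventually_elim
        fix x assume "(\<lambda>k. X (r k) x) \<longlonglongrightarrow> f x"
        then have "(\<lambda>k. ennreal ((norm (X n x - X (r k) x))\<^sup>2)) \<longlonglongrightarrow> ennreal ((norm (X n x - f x))\<^sup>2)"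
          by (intro tendsto_intros)
        then show "ennreal ((norm (X n x - f x))\<^sup>2) = liminf (\<lambda>k. ennreal ((norm (X n x - X (r k) x))\<^sup>2))"
          by (intro lim_imp_Liminf[symmetric]) auto
      qed
    qed
    also have "\<dots> \<le> liminf (\<lambda>k. \<integral>\<^sup>+x. ennreal ((norm (X n x - X (r k) x))\<^sup>2) \<partial>M)"
      by (rule nn_integral_liminf) simp
    also have "\<dots> \<le> ennreal (e\<^sup>2)"
    proof (rule Liminf_le)
      show "\<forall>\<^sub>F k in sequentially. (\<integral>\<^sup>+x. ennreal ((norm (X n x - X (r k) x))\<^sup>2) \<partial>M) \<le> ennreal (e\<^sup>2)"
      proof (rule eventually_sequentiallyI)
        fix k assume "k \<ge> n0"
        then have "L2_norm M (X n - X (r k)) \<le> e" using n rN(3)[of k] by simp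
        then have "ennreal ((L2_norm M (X n - X (r k)))\<^sup>2) \<le> ennreal (e\<^sup>2)"
          by (intro ennreal_leI power_mono) auto
        then show "(\<integral>\<^sup>+x. ennreal ((norm (X n x - X (r k) x))\<^sup>2) \<partial>M) \<le> ennreal (e\<^sup>2)"
          unfolding L2_norm_nn[OF L2.diff_mem[OF X X]] by (simp only: minus_apply)
      qed
    qed simp
    finally show ?thesis .
  qed
  have close: "X n - f \<in> L2_space M" "L2_norm M (X n - f) \<le> e"
    if n: "\<And>m. m \<ge> n0 \<Longrightarrow> L2_norm M (X n - X m) \<le> e" and e: "e \<ge> 0" for n n0 e
  proof -
    have [measurable]: "X n - f \<in> borel_measurable M" by (simp add: fun_diff_def)
    have "(\<integral>\<^sup>+x. ennreal ((norm ((X n - f) x))\<^sup>2) \<partial>M) \<le> ennreal (e\<^sup>2)"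
      using fatou[OF n] by (simp only: minus_apply)
    from L2_I_nn[of "X n - f", OF _ this] show "X n - f \<in> L2_space M" "L2_norm M (X n - f) \<le> e"
      using power2_le_imp_le[OF _ e] by auto
  qed
  obtain N1 where "\<And>m n. m \<ge> N1 \<Longrightarrow> n \<ge> N1 \<Longrightarrow> L2_norm M (X m - X n) < 1"
    using cauchy[of 1] by auto
  then have "X N1 - f \<in> L2_space M" by (intro close(1)[of N1 N1 1]) (auto intro: less_imp_le)
  then have "X N1 - (X N1 - f) \<in> L2_space M" by (rule L2.diff_mem[OF X])
  moreover have "X N1 - (X N1 - f) = f" by (simp add: fun_eq_iff)
  ultimately have "f \<in> L2_space M" by (simp only:)
  moreover have "(\<lambda>n. L2_norm M (X n - f)) \<longlonglongrightarrow> 0"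
  proof (rule LIMSEQ_I)
    fix e :: real assume e: "e > 0"
    then obtain N0 where N0: "\<And>m n. m \<ge> N0 \<Longrightarrow> n \<ge> N0 \<Longrightarrow> L2_norm M (X m - X n) < e / 2"
      using cauchy[of "e/2"] by auto
    have "L2_norm M (X n - f) < e" if "n \<ge> N0" for n
      using close(2)[of N0 n "e/2"] N0[OF that] e by (force intro: less_imp_le)
    then show "\<exists>no. \<forall>n\<ge>no. norm (L2_norm M (X n - f) - 0) < e" by auto
  qed
  ultimately show ?thesis by blast
qed

lemma semi_hilbert_space_L2: "semi_hilbert_space (L2_space M) (L2_inner M)"
  by unfold_locales (auto simp: L2.cauchy_seq_def L2_nrm_eq intro!: L2_complete)

interpretation L2: semi_hilbert_space "L2_space M" "L2_inner M"
    rewrites "semi_inner_space.nrm (L2_inner M) = L2_norm M" for M :: "'x measure"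
  by (rule semi_hilbert_space_L2 L2_nrm_eq)+

section \<open>Translations in \<open>L\<^sup>2\<close>\<close>

definition measure_preserving :: "('a::euclidean_space \<Rightarrow> 'a) \<Rightarrow> bool" where
  "measure_preserving T \<longleftrightarrow> T \<in> borel \<rightarrow>\<^sub>M borel \<and> distr lborel borel T = lborel"

lemma measure_preserving_translate: "measure_preserving (\<lambda>x. x + h)"
  using lborel_distr_plus[of h] by (simp add: measure_preserving_def add.commute[of _ h])

lemma measure_preserving_reflect: "measure_preserving (\<lambda>x. - x)"
proof -
  have "lborel = density (distr lborel borel (\<lambda>x::'a. 0 + (-1) *\<^sub>R x)) (\<lambda>_. ennreal (\<bar>-1\<bar>^DIM('a)))"
    by (rule lborel_affine) simp
  then show ?thesis by (simp add: measure_preserving_def density_1)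
qed

lemma measure_preserving_measurable: "measure_preserving T \<Longrightarrow> T \<in> borel \<rightarrow>\<^sub>M borel"
  by (simp add: measure_preserving_def)

lemma nn_integral_measure_preserving:
  assumes "measure_preserving T" and [measurable]: "f \<in> borel_measurable borel"
  shows "(\<integral>\<^sup>+x. f (T x) \<partial>lborel) = (\<integral>\<^sup>+x. f x \<partial>lborel)"
proof -
  have [measurable]: "T \<in> borel \<rightarrow>\<^sub>M borel" by (rule measure_preserving_measurable[OF assms(1)])
  have "(\<integral>\<^sup>+x. f x \<partial>lborel) = (\<integral>\<^sup>+x. f x \<partial>distr lborel borel T)"
    using assms(1) unfolding measure_preserving_def by metis
  also have "\<dots> = (\<integral>\<^sup>+x. f (T x) \<partial>lborel)" by (rule nn_integral_distr) auto
  finally show ?thesis ..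
qed

lemma integral_measure_preserving:
  fixes f :: "'a::euclidean_space \<Rightarrow> 'b::{banach, second_countable_topology}"
  assumes "measure_preserving T" and [measurable]: "f \<in> borel_measurable borel"
  shows "(LINT x|lborel. f (T x)) = (LINT x|lborel. f x)"
proof -
  have [measurable]: "T \<in> borel \<rightarrow>\<^sub>M borel" by (rule measure_preserving_measurable[OF assms(1)])
  have "(LINT x|lborel. f x) = (LINT x|distr lborel borel T. f x)"
    using assms(1) unfolding measure_preserving_def by metis
  also have "\<dots> = (LINT x|lborel. f (T x))" by (rule integral_distr) auto
  finally show ?thesis ..
qed

lemma integrable_measure_preserving:
  fixes f :: "'a::euclidean_space \<Rightarrow> 'b::{banach, second_countable_topology}"
  assumes "measure_preserving T" and f: "integrable lborel f"
  shows "integrable lborel (\<lambda>x. f (T x))"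
proof -
  have [measurable]: "T \<in> borel \<rightarrow>\<^sub>M borel" by (rule measure_preserving_measurable[OF assms(1)])
  have "integrable (distr lborel borel T) f"
    using assms by (simp add: measure_preserving_def)
  then show ?thesis using borel_measurable_integrable[OF f] by (simp add: integrable_distr_eq)
qed

lemma AE_measure_preserving:
  assumes "measure_preserving T" and "AE x in lborel. P x"
  shows "AE x in lborel. P (T x)"
proof -
  have [measurable]: "T \<in> borel \<rightarrow>\<^sub>M borel" by (rule measure_preserving_measurable[OF assms(1)])
  obtain N where N: "\<And>x. x \<in> space lborel - N \<Longrightarrow> P x" "N \<in> null_sets lborel"
    using AE_E3[OF assms(2)] by blast
  then have [measurable]: "N \<in> sets borel" by (auto simp: null_sets_def)
  have "AE x in distr lborel borel T. x \<notin> N"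
    unfolding conjunct2[OF assms(1)[unfolded measure_preserving_def]] by (rule AE_not_in[OF N(2)])
  then have "AE x in lborel. T x \<notin> N" by (simp add: AE_distr_iff)
  then show ?thesis by eventually_elim (use N in auto)
qed

lemma L2_measure_preserving:
  fixes f :: "'a::euclidean_space \<Rightarrow> 'b::euclidean_space"
  assumes T: "measure_preserving T" and f: "f \<in> L2_space lborel"
  shows "(\<lambda>x. f (T x)) \<in> L2_space lborel" "L2_norm lborel (\<lambda>x. f (T x)) = L2_norm lborel f"
proof -
  have [measurable]: "T \<in> borel \<rightarrow>\<^sub>M borel" by (rule measure_preserving_measurable[OF assms(1)])
  have [measurable]: "f \<in> borel_measurable borel" using L2_measurable[OF f] by simp
  show "(\<lambda>x. f (T x)) \<in> L2_space lborel"
    using integrable_measure_preserving[OF T L2_integrable_square[OF f]] by (simp add: L2_space_def)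
  show "L2_norm lborel (\<lambda>x. f (T x)) = L2_norm lborel f"
    using integral_measure_preserving[OF T, of "\<lambda>x. (norm (f x))\<^sup>2"] by (simp add: L2_norm_def)
qed

lemma L2_dominated_convergence:
  fixes f :: "'x \<Rightarrow> 'b::euclidean_space"
  assumes X: "\<And>n. X n \<in> L2_space M" and f: "f \<in> L2_space M" and g: "g \<in> L2_space M"
    and dom: "\<And>n. AE x in M. norm (X n x) \<le> norm (g x)"
    and lim: "AE x in M. (\<lambda>n. X n x) \<longlonglongrightarrow> f x"
  shows "(\<lambda>n. L2_norm M (X n - f)) \<longlonglongrightarrow> 0"
proof -
  note [measurable] = L2_measurable[OF X] L2_measurable[OF f] L2_measurable[OF g]
  have le: "AE x in M. norm (f x) \<le> norm (g x)"
  proof -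
    have "AE x in M. \<forall>n. norm (X n x) \<le> norm (g x)" using dom by (simp add: AE_all_countable)
    with lim show ?thesis
    proof eventually_elim
      case (elim x)
      show ?case by (rule LIMSEQ_le_const2[OF tendsto_norm[OF elim(1)]]) (use elim(2) in auto)
    qed
  qed
  have "(\<lambda>n. LINT x|M. (norm (X n x - f x))\<^sup>2) \<longlonglongrightarrow> (LINT x|M. 0)"
  proof (rule integral_dominated_convergence[where w="\<lambda>x. 4 * (norm (g x))\<^sup>2"])
    show "integrable M (\<lambda>x. 4 * (norm (g x))\<^sup>2)"
      by (intro integrable_mult_right L2_integrable_square g)
    show "AE x in M. (\<lambda>n. (norm (X n x - f x))\<^sup>2) \<longlonglongrightarrow> 0"
      using lim
    proof eventually_elim
      case (elim x)
      have "(\<lambda>n. (norm (X n x - f x))\<^sup>2) \<longlonglongrightarrow> (norm (f x - f x))\<^sup>2"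
        by (intro tendsto_intros elim)
      then show ?case by simp
    qed
    show "AE x in M. norm ((norm (X n x - f x))\<^sup>2) \<le> 4 * (norm (g x))\<^sup>2" for n
      using dom[of n] le
    proof eventually_elim
      case (elim x)
      have "norm (X n x - f x) \<le> 2 * norm (g x)"
        using norm_triangle_ineq4[of "X n x" "f x"] elim by simp
      then have "(norm (X n x - f x))\<^sup>2 \<le> (2 * norm (g x))\<^sup>2" by (rule power_mono) simp
      then show ?case by (simp add: power_mult_distrib)
    qed
  qed auto
  then have "(\<lambda>n. sqrt (LINT x|M. (norm (X n x - f x))\<^sup>2)) \<longlonglongrightarrow> sqrt 0"
    by (intro tendsto_real_sqrt) simp
  then show ?thesis by (simp add: L2_norm_def)
qed

definition translate :: "'a::euclidean_space \<Rightarrow> ('a \<Rightarrow> 'b) \<Rightarrow> 'a \<Rightarrow> 'b" where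
  "translate h u = (\<lambda>x. u (x + h))"

lemma translate_L2:
  "u \<in> L2_space lborel \<Longrightarrow> translate h u \<in> L2_space lborel"
  "u \<in> L2_space lborel \<Longrightarrow> L2_norm lborel (translate h u) = L2_norm lborel u"
  for u :: "'a::euclidean_space \<Rightarrow> 'b::euclidean_space"
  using L2_measure_preserving[OF measure_preserving_translate, of u h] by (auto simp: translate_def)

definition translation_continuous :: "('a::euclidean_space \<Rightarrow> real) \<Rightarrow> bool" where
  "translation_continuous u \<longleftrightarrow> u \<in> L2_space lborel \<and>
     (\<forall>e>0. \<exists>d>0. \<forall>h. norm h < d \<longrightarrow> L2_norm lborel (translate h u - u) < e)"

text \<open>
  Enclose \<open>A\<close> between a compact set \<open>K\<close> and an open set \<open>U\<close>. For small \<open>h\<close> the translates of \<open>K\<close> stay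
  inside \<open>U\<close>, so the symmetric difference of \<open>A\<close> and its translate is covered by translates of
  \<open>A - K\<close> and of \<open>U - A\<close>.
\<close>

lemma translation_continuous_indicator:
  fixes A :: "'a::euclidean_space set"
  assumes A[measurable]: "A \<in> sets borel" and bA: "bounded A"
  shows "translation_continuous (indicator A)"
  unfolding translation_continuous_def
proof (intro conjI allI impI)
  have fin: "emeasure lborel A < \<infinity>" by (rule emeasure_bounded_finite[OF bA])
  have "integrable lborel (\<lambda>x. indicator A x :: real)" using fin by simp
  moreover have "(norm (indicator A x :: real))\<^sup>2 = indicator A x" for x by (auto simp: indicator_def)
  ultimately show L2: "(indicator A :: 'a \<Rightarrow> real) \<in> L2_space lborel"
    by (simp add: L2_space_def)
  fix e :: real assume e: "e > 0"
  define \<epsilon> where "\<epsilon> = e\<^sup>2 / 5"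
  have \<epsilon>: "\<epsilon> > 0" using e by (simp add: \<epsilon>_def)
  obtain U where U: "open U" "A \<subseteq> U" "emeasure lborel (U - A) < \<epsilon>"
    using outer_regular_lborel[OF A \<epsilon>] by blast
  obtain W where W: "open W" "- A \<subseteq> W" "emeasure lborel (W - (- A)) < \<epsilon>"
    using outer_regular_lborel[OF _ \<epsilon>, of "- A"] by (metis A borel_comp)
  define K where "K = - W"
  have "closed K" "K \<subseteq> A" using W by (auto simp: K_def)
  then have "compact K" using bA by (meson bounded_subset compact_eq_bounded_closed)
  have AK: "emeasure lborel (A - K) < \<epsilon>"
    using W(3) by (simp add: K_def Diff_eq Int_commute)
  obtain d where d: "d > 0" "(\<Union>x\<in>K. ball x d) \<subseteq> U"
    using compact_subset_open_imp_ball_epsilon_subset[OF \<open>compact K\<close> U(1)] \<open>K \<subseteq> A\<close> U(2) by blast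
  have [measurable]: "U \<in> sets borel" "K \<in> sets borel" using U(1) \<open>closed K\<close> by auto
  have "L2_norm lborel (translate h (indicator A) - indicator A :: 'a \<Rightarrow> real) < e" if h: "norm h < d" for h
  proof -
    let ?f = "translate h (indicator A) - indicator A :: 'a \<Rightarrow> real"
    have f: "?f \<in> L2_space lborel" by (intro L2.diff_mem translate_L2 L2)
    have step: "x + h \<in> U" "x - h \<in> U" if "x \<in> K" for x
    proof -
      have "x + h \<in> ball x d" "x - h \<in> ball x d" using h by (auto simp: dist_norm)
      then show "x + h \<in> U" "x - h \<in> U" using d(2) that by blast+
    qed
    have pt: "ennreal ((norm (?f x))\<^sup>2) \<le> indicator (A - K) (x + h) + indicator (U - A) x
          + indicator (A - K) x + indicator (U - A) (x + h)" for x
      using step(1)[of x] step(2)[of "x + h"]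
      by (auto simp: indicator_def translate_def)
    have *: "(\<integral>\<^sup>+x. indicator B (x + h) \<partial>lborel) = emeasure lborel B" if [measurable]: "B \<in> sets borel" for B :: "'a set"
      using nn_integral_measure_preserving[OF measure_preserving_translate, of "indicator B" h] by simp
    have "ennreal ((L2_norm lborel ?f)\<^sup>2) \<le> (\<integral>\<^sup>+x. indicator (A - K) (x + h) + indicator (U - A) x
          + indicator (A - K) x + indicator (U - A) (x + h) \<partial>lborel)"
      unfolding L2_norm_nn[OF f] by (intro nn_integral_mono pt)
    also have "\<dots> = emeasure lborel (A - K) + emeasure lborel (U - A) + emeasure lborel (A - K) + emeasure lborel (U - A)"
      by (simp add: nn_integral_add *)
    also have "\<dots> \<le> ennreal \<epsilon> + ennreal \<epsilon> + ennreal \<epsilon> + ennreal \<epsilon>"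
      using AK U(3) by (intro add_mono) auto
    also have "\<dots> = ennreal (4 * \<epsilon>)" using \<epsilon> by (simp flip: ennreal_plus)
    finally have "(L2_norm lborel ?f)\<^sup>2 \<le> 4 * \<epsilon>" using \<epsilon> by simp
    also have "\<dots> < e\<^sup>2" using e by (simp add: \<epsilon>_def)
    finally show ?thesis by (rule power2_less_imp_less) (use e in simp)
  qed
  then show "\<exists>d>0. \<forall>h. norm h < d \<longrightarrow> L2_norm lborel (translate h (indicator A) - indicator A :: 'a \<Rightarrow> real) < e"
    using d by blast
qed

lemma translation_continuous_add:
  fixes u v :: "'a::euclidean_space \<Rightarrow> real"
  assumes "translation_continuous u" "translation_continuous v"
  shows "translation_continuous (u + v)"
  unfolding translation_continuous_def
proof (intro conjI allI impI)
  have L: "u \<in> L2_space lborel" "v \<in> L2_space lborel" using assms by (auto simp: translation_continuous_def)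
  then show "u + v \<in> L2_space lborel" by (rule L2.add_mem)
  fix e :: real assume e: "e > 0"
  obtain d1 where d1: "d1 > 0" "\<And>h. norm h < d1 \<Longrightarrow> L2_norm lborel (translate h u - u) < e / 2"
    using assms(1) e unfolding translation_continuous_def by (meson half_gt_zero)
  obtain d2 where d2: "d2 > 0" "\<And>h. norm h < d2 \<Longrightarrow> L2_norm lborel (translate h v - v) < e / 2"
    using assms(2) e unfolding translation_continuous_def by (meson half_gt_zero)
  have "L2_norm lborel (translate h (u + v) - (u + v)) < e" if h: "norm h < min d1 d2" for h
  proof -
    have eq: "translate h (u + v) - (u + v) = (translate h u - u) + (translate h v - v)"
      by (simp add: translate_def fun_eq_iff)
    have "L2_norm lborel (translate h (u + v) - (u + v))
        \<le> L2_norm lborel (translate h u - u) + L2_norm lborel (translate h v - v)"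
      unfolding eq by (intro L2.nrm_triangle L2.diff_mem translate_L2 L)
    then show ?thesis using d1(2)[of h] d2(2)[of h] h by simp
  qed
  then show "\<exists>d>0. \<forall>h. norm h < d \<longrightarrow> L2_norm lborel (translate h (u + v) - (u + v)) < e"
    using d1 d2 by (intro exI[of _ "min d1 d2"]) auto
qed

lemma translation_continuous_scale:
  fixes u :: "'a::euclidean_space \<Rightarrow> real"
  assumes "translation_continuous u"
  shows "translation_continuous (c *\<^sub>R u)"
  unfolding translation_continuous_def
proof (intro conjI allI impI)
  have L: "u \<in> L2_space lborel" using assms by (auto simp: translation_continuous_def)
  then show "c *\<^sub>R u \<in> L2_space lborel" by (rule L2.scale_mem)
  fix e :: real assume e: "e > 0"
  obtain d where d: "d > 0" "\<And>h. norm h < d \<Longrightarrow> L2_norm lborel (translate h u - u) < e / (\<bar>c\<bar> + 1)"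
  proof -
    have "e / (\<bar>c\<bar> + 1) > 0" using e by simp
    then show ?thesis using assms that unfolding translation_continuous_def by blast
  qed
  have "L2_norm lborel (translate h (c *\<^sub>R u) - c *\<^sub>R u) < e" if h: "norm h < d" for h
  proof -
    have eq: "translate h (c *\<^sub>R u) - c *\<^sub>R u = c *\<^sub>R (translate h u - u)"
      by (simp add: translate_def fun_eq_iff scaleR_fun_def algebra_simps)
    have "L2_norm lborel (translate h (c *\<^sub>R u) - c *\<^sub>R u) = \<bar>c\<bar> * L2_norm lborel (translate h u - u)"
      unfolding eq by (rule L2.nrm_scale) (intro L2.mem translate_L2 L)
    also have "\<dots> \<le> (\<bar>c\<bar> + 1) * L2_norm lborel (translate h u - u)"
      by (intro mult_right_mono) auto
    also have "\<dots> < e" using d(2)[OF h] by (simp add: field_simps)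
    finally show ?thesis .
  qed
  then show "\<exists>d>0. \<forall>h. norm h < d \<longrightarrow> L2_norm lborel (translate h (c *\<^sub>R u) - c *\<^sub>R u) < e"
    using d by blast
qed

lemma translation_continuous_sum:
  fixes f :: "'i \<Rightarrow> 'a::euclidean_space \<Rightarrow> real"
  assumes "finite I" "\<And>i. i \<in> I \<Longrightarrow> translation_continuous (f i)"
  shows "translation_continuous (\<lambda>x. \<Sum>i\<in>I. f i x)"
  using assms
proof (induction I rule: finite_induct)
  case empty
  have "translation_continuous (0 *\<^sub>R indicator {} :: 'a \<Rightarrow> real)"
    by (intro translation_continuous_scale translation_continuous_indicator) auto
  then show ?case by (simp add: scaleR_fun_def)
next
  case (insert i I)
  have "translation_continuous (f i + (\<lambda>x. \<Sum>i\<in>I. f i x))"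
    by (intro translation_continuous_add insert) (use insert in auto)
  then show ?case using insert by (simp add: plus_fun_def)
qed

lemma translation_continuous_limit:
  fixes u :: "'a::euclidean_space \<Rightarrow> real"
  assumes X: "\<And>n. translation_continuous (X n)" and u: "u \<in> L2_space lborel"
    and lim: "(\<lambda>n. L2_norm lborel (X n - u)) \<longlonglongrightarrow> 0"
  shows "translation_continuous u"
  unfolding translation_continuous_def
proof (intro conjI allI impI u)
  fix e :: real assume e: "e > 0"
  have XL: "X n \<in> L2_space lborel" for n using X by (auto simp: translation_continuous_def)
  obtain n where n: "L2_norm lborel (X n - u) < e / 3"
    using LIMSEQ_D[OF lim, of "e/3"] e by auto
  obtain d where d: "d > 0" "\<And>h. norm h < d \<Longrightarrow> L2_norm lborel (translate h (X n) - X n) < e / 3"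
    using X[of n] e unfolding translation_continuous_def by (meson divide_pos_pos zero_less_numeral)
  have "L2_norm lborel (translate h u - u) < e" if h: "norm h < d" for h
  proof -
    have "L2_norm lborel (translate h u - translate h (X n)) = L2_norm lborel (translate h (u - X n))"
      by (rule arg_cong[where f="L2_norm lborel"]) (simp add: translate_def fun_eq_iff)
    also have "\<dots> = L2_norm lborel (X n - u)"
      by (simp add: translate_L2 L2.mem u XL L2.nrm_minus_commute)
    finally have "L2_norm lborel (translate h u - translate h (X n)) = L2_norm lborel (X n - u)" .
    moreover have "L2_norm lborel (translate h u - u) \<le> L2_norm lborel (translate h u - translate h (X n))
         + L2_norm lborel (translate h (X n) - u)"
      by (intro L2.nrm_triangle_diff translate_L2 u XL)
    moreover have "L2_norm lborel (translate h (X n) - u) \<le> L2_norm lborel (translate h (X n) - X n)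
         + L2_norm lborel (X n - u)"
      by (intro L2.nrm_triangle_diff translate_L2 u XL)
    ultimately show ?thesis using n d(2)[OF h] by linarith
  qed
  then show "\<exists>d>0. \<forall>h. norm h < d \<longrightarrow> L2_norm lborel (translate h u - u) < e" using d by blast
qed

text \<open>
  Simple functions with bounded support are combinations of the indicators treated above, and they
  are dense.
\<close>

theorem L2_translation_continuous:
  fixes u :: "'a::euclidean_space \<Rightarrow> real"
  assumes u: "u \<in> L2_space lborel"
  shows "translation_continuous u"
proof -
  have [measurable]: "u \<in> borel_measurable lborel" by (rule L2_measurable[OF u])
  obtain F where F: "\<And>i. simple_function lborel (F i)" "\<And>x. (\<lambda>i. F i x) \<longlonglongrightarrow> u x"
    "\<And>i x. dist (F i x) 0 \<le> 2 * dist (u x) 0"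
    using borel_measurable_implies_sequence_metric[of u lborel 0] by auto
  define G where "G i x = indicator (cball 0 (real i)) x * F i x" for i x
  have [measurable]: "F i \<in> borel_measurable lborel" for i
    using F(1) by (rule borel_measurable_simple_function)
  have GT: "translation_continuous (G i)" for i
  proof -
    have fin: "finite (range (F i))" using F(1)[of i] by (auto simp: simple_function_def)
    have G: "G i = (\<lambda>x. \<Sum>y\<in>range (F i). (y *\<^sub>R indicator (F i -` {y} \<inter> cball 0 (real i))) x)"
    proof
      fix x
      have "(\<Sum>y\<in>range (F i). (y *\<^sub>R indicator (F i -` {y} \<inter> cball 0 (real i))) x)
         = (\<Sum>y\<in>range (F i). if y = F i x then indicator (cball 0 (real i)) x * F i x else 0)"
        by (intro sum.cong) (auto simp: scaleR_fun_def indicator_def)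
      also have "\<dots> = G i x" using fin by (simp add: sum.delta G_def)
      finally show "G i x = (\<Sum>y\<in>range (F i). (y *\<^sub>R indicator (F i -` {y} \<inter> cball 0 (real i))) x)" by simp
    qed
    show ?thesis
      unfolding G
    proof (intro translation_continuous_sum fin translation_continuous_scale translation_continuous_indicator)
      show "F i -` {y} \<inter> cball 0 (real i) \<in> sets borel" for y
        using measurable_sets_borel[of "F i" borel "{y}"] by (intro sets.Int) auto
    qed auto
  qed
  have "(\<lambda>n. L2_norm lborel (G n - u)) \<longlonglongrightarrow> 0"
  proof (rule L2_dominated_convergence[where g="2 *\<^sub>R u"])
    show "G n \<in> L2_space lborel" for n using GT[of n] by (simp add: translation_continuous_def)
    show "AE x in lborel. norm (G n x) \<le> norm ((2 *\<^sub>R u) x)" for n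
      using F(3)[of n] by (intro AE_I2) (auto simp: G_def scaleR_fun_def indicator_def abs_mult)
    have "(\<lambda>n. G n x) \<longlonglongrightarrow> u x" for x
    proof (rule Lim_transform_eventually[OF F(2)])
      obtain n0 where "norm x \<le> real n0" using real_arch_simple by blast
      then show "\<forall>\<^sub>F n in sequentially. F n x = G n x"
        by (intro eventually_sequentiallyI[of n0]) (auto simp: G_def indicator_def)
    qed
    then show "AE x in lborel. (\<lambda>n. G n x) \<longlonglongrightarrow> u x" by simp
  qed (auto simp: u L2.mem)
  then show ?thesis by (rule translation_continuous_limit[OF GT u])
qed

lemma translation_tendsto:
  fixes u :: "'a::euclidean_space \<Rightarrow> real"
  assumes u: "u \<in> L2_space lborel" and h: "(h \<longlongrightarrow> 0) F"
  shows "((\<lambda>n. L2_norm lborel (translate (h n) u - u)) \<longlongrightarrow> 0) F"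
proof (rule tendstoI)
  fix e :: real assume "e > 0"
  then obtain d where d: "d > 0" "\<And>h. norm h < d \<Longrightarrow> L2_norm lborel (translate h u - u) < e"
    using L2_translation_continuous[OF u] unfolding translation_continuous_def by blast
  have "\<forall>\<^sub>F n in F. dist (h n) 0 < d" by (rule tendstoD[OF h d(1)])
  then show "\<forall>\<^sub>F n in F. dist (L2_norm lborel (translate (h n) u - u)) 0 < e"
    by eventually_elim (use d in simp)
qed

section \<open>Plancherel's theorem\<close>

lemma borel_measurable_cis [measurable (raw)]:
  assumes "f \<in> borel_measurable M"
  shows "(\<lambda>x. cis (f x)) \<in> borel_measurable M"
proof -
  have "cis \<in> borel_measurable borel"
    by (intro borel_measurable_continuous_onI continuous_on_cis continuous_on_id)
  then show ?thesis using assms by (rule measurable_compose[rotated])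
qed

lemma borel_measurable_cnj [measurable (raw)]:
  assumes "f \<in> borel_measurable M"
  shows "(\<lambda>x. cnj (f x)) \<in> borel_measurable M"
proof -
  have "cnj \<in> borel_measurable borel"
    by (intro borel_measurable_continuous_onI continuous_on_cnj continuous_on_id)
  then show ?thesis using assms by (rule measurable_compose[rotated])
qed

definition gauss :: "real \<Rightarrow> 'a::euclidean_space \<Rightarrow> real" where
  "gauss d x = exp (- (d * norm x)\<^sup>2 / 2)"

text \<open>
  The integral of the standard Gaussian, which is also the factor by which the Fourier transform
  multiplies the \<open>L\<^sup>2\<close> norm.
\<close>

abbreviation gauss_const :: "'a::euclidean_space itself \<Rightarrow> real" where
  "gauss_const (_ :: 'a itself) \<equiv> sqrt (2 * pi) ^ DIM('a)"

lemma gauss_pos: "0 < gauss d x"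
  by (simp add: gauss_def)

lemma gauss_nonneg [simp]: "0 \<le> gauss d x" "\<bar>gauss d x\<bar> = gauss d x"
  by (auto simp: gauss_def)

lemma borel_measurable_gauss [measurable]: "gauss d \<in> borel_measurable borel"
  unfolding gauss_def[abs_def] by measurable

text \<open>
  A rescaling of the characteristic function of the standard normal distribution.
\<close>

lemma gauss_fourier_1d:
  fixes d y :: real
  assumes d: "d > 0"
  shows "integrable lborel (\<lambda>x::real. cis (- (x * y)) * complex_of_real (exp (- (d * x)\<^sup>2 / 2)))"
    and "(LINT x|lborel. cis (- (x * y)) * complex_of_real (exp (- (d * x)\<^sup>2 / 2)))
       = complex_of_real (sqrt (2 * pi) / d * exp (- (y / d)\<^sup>2 / 2))"
proof -
  define f where "f x = complex_of_real (std_normal_density x) * iexp (- (y / d) * x)" for x :: real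
  have [measurable]: "f \<in> borel_measurable borel" unfolding f_def[abs_def] by measurable
  have fi: "integrable lborel f"
    by (rule Bochner_Integration.integrable_bound[of _ "std_normal_density"])
      (auto simp: f_def norm_mult)
  have "char std_normal_distribution (- (y / d)) = (LINT x|lborel. f x)"
    unfolding char_def by (subst integral_density) (auto simp: f_def[abs_def] scaleR_conv_of_real)
  then have fval: "(LINT x|lborel. f x) = complex_of_real (exp (- (y / d)\<^sup>2 / 2))"
    by (simp add: char_std_normal_distribution)
  have fd: "f (0 + d * x) = complex_of_real (1 / sqrt (2 * pi)) *
      (cis (- (x * y)) * complex_of_real (exp (- (d * x)\<^sup>2 / 2)))" for x
    using d by (simp add: f_def std_normal_density_def cis_conv_exp mult_ac)
  have "integrable lborel (\<lambda>x. f (0 + d * x))"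
    using fi d by (intro lborel_integrable_real_affine) auto
  then have "integrable lborel (\<lambda>x. complex_of_real (sqrt (2 * pi)) * f (0 + d * x))"
    by (rule integrable_mult_right)
  then show "integrable lborel (\<lambda>x::real. cis (- (x * y)) * complex_of_real (exp (- (d * x)\<^sup>2 / 2)))"
    unfolding fd by (simp add: mult.assoc[symmetric] flip: of_real_mult)
  have "(LINT x|lborel. f x) = \<bar>d\<bar> *\<^sub>R (LINT x|lborel. f (0 + d * x))"
    by (rule lborel_integral_real_affine) (use d in simp)
  also have "(LINT x|lborel. f (0 + d * x)) = complex_of_real (1 / sqrt (2 * pi)) *
      (LINT x|lborel. cis (- (x * y)) * complex_of_real (exp (- (d * x)\<^sup>2 / 2)))"
    unfolding fd by simp
  finally show "(LINT x|lborel. cis (- (x * y)) * complex_of_real (exp (- (d * x)\<^sup>2 / 2)))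
       = complex_of_real (sqrt (2 * pi) / d * exp (- (y / d)\<^sup>2 / 2))"
    unfolding fval using d by (simp add: scaleR_conv_of_real field_simps)
qed

lemma lborel_prod_Basis:
  fixes f :: "'a::euclidean_space \<Rightarrow> real \<Rightarrow> complex"
  assumes f: "\<And>b. b \<in> Basis \<Longrightarrow> integrable lborel (f b)"
  shows "integrable lborel (\<lambda>x::'a. \<Prod>b\<in>Basis. f b (x \<bullet> b))"
    and "(LINT x|lborel. (\<Prod>b\<in>Basis. f b (x \<bullet> b))) = (\<Prod>b\<in>Basis. LINT r|lborel. f b r)"
proof -
  interpret product_sigma_finite "\<lambda>_::'a. lborel :: real measure" ..
  have f_meas [measurable]: "f b \<in> borel_measurable borel" if "b \<in> Basis" for b
    using borel_measurable_integrable[OF f[OF that]] by simp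
  have m [measurable]: "(\<lambda>g. \<Sum>b\<in>Basis. g b *\<^sub>R b) \<in> (\<Pi>\<^sub>M b\<in>Basis. lborel :: real measure) \<rightarrow>\<^sub>M (borel :: 'a measure)"
    by measurable
  have p [measurable]: "(\<lambda>x::'a. \<Prod>b\<in>Basis. f b (x \<bullet> b)) \<in> borel_measurable borel"
    by measurable
  have eq: "(\<Prod>b\<in>Basis. f b ((\<Sum>b\<in>Basis. g b *\<^sub>R b) \<bullet> b)) = (\<Prod>b\<in>Basis. f b (g b))" for g :: "'a \<Rightarrow> real"
    by (intro prod.cong refl) (simp add: inner_sum_left_Basis)
  have L: "(lborel :: 'a measure) = distr (\<Pi>\<^sub>M b\<in>Basis. lborel) borel (\<lambda>g. \<Sum>b\<in>Basis. g b *\<^sub>R b)"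
    by (rule lborel_eq)
  show "integrable lborel (\<lambda>x::'a. \<Prod>b\<in>Basis. f b (x \<bullet> b))"
    unfolding L integrable_distr_eq[OF m p] eq
    by (rule product_integrable_prod) (use f in auto)
  have "(LINT x|lborel. (\<Prod>b\<in>Basis. f b (x \<bullet> b))) = (LINT g|(\<Pi>\<^sub>M b\<in>Basis. lborel). (\<Prod>b\<in>Basis. f b (g b)))"
    unfolding L integral_distr[OF m p] eq ..
  also have "\<dots> = (\<Prod>b\<in>Basis. LINT r|lborel. f b r)"
    by (rule product_integral_prod) (use f in auto)
  finally show "(LINT x|lborel. (\<Prod>b\<in>Basis. f b (x \<bullet> b))) = (\<Prod>b\<in>Basis. LINT r|lborel. f b r)" .
qed

lemma gauss_prod: "gauss d x = (\<Prod>b\<in>Basis. exp (- (d * (x \<bullet> b))\<^sup>2 / 2))"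
proof -
  have "(d * norm x)\<^sup>2 = d\<^sup>2 * (\<Sum>b\<in>Basis. (x \<bullet> b) * (x \<bullet> b))"
    by (simp add: power_mult_distrib power2_norm_eq_inner euclidean_inner[of x x])
  also have "\<dots> = (\<Sum>b\<in>Basis. (d * (x \<bullet> b))\<^sup>2)"
    by (simp add: sum_distrib_left power2_eq_square mult_ac)
  finally have "- (d * norm x)\<^sup>2 / 2 = (\<Sum>b\<in>Basis. - (d * (x \<bullet> b))\<^sup>2 / 2)"
    by (simp add: sum_divide_distrib sum_negf)
  then show ?thesis by (simp add: gauss_def exp_sum)
qed

lemma cis_inner_prod: "cis (- (x \<bullet> y)) = (\<Prod>b\<in>Basis. cis (- ((x \<bullet> b) * (y \<bullet> b))))"
  by (subst euclidean_inner[of x y]) (simp add: cis_conv_exp sum_distrib_left flip: exp_sum sum_negf)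

text \<open>
  Both the Gaussian and the character are products of functions of one coordinate.
\<close>

lemma gauss_fourier:
  fixes y :: "'a::euclidean_space"
  assumes d: "d > 0"
  shows "integrable lborel (\<lambda>x::'a. cis (- (x \<bullet> y)) * complex_of_real (gauss d x))"
    and "(LINT x|lborel. cis (- (x \<bullet> y)) * complex_of_real (gauss d x))
       = complex_of_real (gauss_const TYPE('a) / d ^ DIM('a) * gauss (1 / d) y)"
proof -
  define f where "f b r = cis (- (r * (y \<bullet> b))) * complex_of_real (exp (- (d * r)\<^sup>2 / 2))" for b :: 'a and r
  have eq: "cis (- (x \<bullet> y)) * complex_of_real (gauss d x) = (\<Prod>b\<in>Basis. f b (x \<bullet> b))" for x
    by (simp add: f_def prod.distrib cis_inner_prod gauss_prod)
  have int: "integrable lborel (f b)" for b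
    unfolding f_def[abs_def] by (rule gauss_fourier_1d[OF d])
  show "integrable lborel (\<lambda>x::'a. cis (- (x \<bullet> y)) * complex_of_real (gauss d x))"
    unfolding eq by (rule lborel_prod_Basis) (rule int)
  have "(LINT x|lborel. (\<Prod>b\<in>Basis. f b (x \<bullet> b))) = (\<Prod>b\<in>Basis. LINT r|lborel. f b r)"
    by (rule lborel_prod_Basis) (rule int)
  also have "\<dots> = (\<Prod>b\<in>Basis. complex_of_real (sqrt (2 * pi) / d * exp (- ((y \<bullet> b) / d)\<^sup>2 / 2)))"
    unfolding f_def gauss_fourier_1d[OF d] ..
  also have "\<dots> = complex_of_real ((\<Prod>b\<in>(Basis :: 'a set). sqrt (2 * pi) / d) * gauss (1 / d) y)"
    unfolding of_real_prod[symmetric] prod.distrib gauss_prod by simp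
  finally show "(LINT x|lborel. cis (- (x \<bullet> y)) * complex_of_real (gauss d x))
       = complex_of_real (gauss_const TYPE('a) / d ^ DIM('a) * gauss (1 / d) y)"
    unfolding eq by (simp add: power_divide)
qed

lemma gauss_integral:
  assumes d: "d > 0"
  shows "integrable lborel (gauss d :: 'a::euclidean_space \<Rightarrow> real)"
    and "(LINT x|lborel. gauss d (x::'a)) = gauss_const TYPE('a) / d ^ DIM('a)"
proof -
  show "integrable lborel (gauss d :: 'a \<Rightarrow> real)"
    using integrable_norm[OF gauss_fourier(1)[OF d, of 0]] by (simp add: norm_mult)
  have "complex_of_real (LINT x|lborel. gauss d (x::'a)) = complex_of_real (gauss_const TYPE('a) / d ^ DIM('a))"
    using gauss_fourier(2)[OF d, of "0::'a"] by (simp add: gauss_def)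
  then show "(LINT x|lborel. gauss d (x::'a)) = gauss_const TYPE('a) / d ^ DIM('a)"
    by (simp only: of_real_eq_iff)
qed

lemma integral_affine:
  fixes f :: "'a::euclidean_space \<Rightarrow> real"
  assumes [measurable]: "f \<in> borel_measurable borel" and d: "d > 0"
  shows "(LINT y|lborel. f y) = d ^ DIM('a) * (LINT z|lborel. f (t + d *\<^sub>R z))"
proof -
  have "(LINT y|lborel. f y) = (LINT y|density (distr lborel borel (\<lambda>x. t + d *\<^sub>R x)) (\<lambda>_. ennreal (\<bar>d\<bar> ^ DIM('a))). f y)"
    using lborel_affine[of d t] d by simp
  also have "\<dots> = d ^ DIM('a) * (LINT z|lborel. f (t + d *\<^sub>R z))"
    using d by (simp add: integral_density integral_distr)
  finally show ?thesis .
qed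

definition ft :: "('a::euclidean_space \<Rightarrow> complex) \<Rightarrow> 'a \<Rightarrow> complex" where
  "ft f \<xi> = (LINT x|lborel. cis (- (x \<bullet> \<xi>)) * f x)"

lemma fourier_integral_ft: "fourier_integral u = ft (\<lambda>x. complex_of_real (u x))"
  by (simp add: fourier_integral_def ft_def fun_eq_iff)

lemma ft_integrable:
  assumes "integrable lborel f"
  shows "integrable lborel (\<lambda>x. cis (- (x \<bullet> \<xi>)) * f x)"
proof -
  have [measurable]: "f \<in> borel_measurable borel" using borel_measurable_integrable[OF assms] by simp
  show ?thesis
    by (rule Bochner_Integration.integrable_bound[OF assms]) (auto simp: norm_mult)
qed

lemma ft_bound:
  shows "cmod (ft f \<xi>) \<le> (LINT x|lborel. cmod (f x))"
proof -
  have "cmod (ft f \<xi>) \<le> (LINT x|lborel. cmod (cis (- (x \<bullet> \<xi>)) * f x))"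
    unfolding ft_def by (rule integral_norm_bound)
  then show ?thesis by (simp add: norm_mult)
qed

lemma ft_measurable [measurable]:
  assumes [measurable]: "f \<in> borel_measurable borel"
  shows "ft f \<in> borel_measurable borel"
  unfolding ft_def[abs_def] by measurable

text \<open>
  Both sides are the double integral of \<open>e\<^bsup>- i x \<bullet> \<xi>\<^esup> f x g \<xi>\<close>.
\<close>

lemma ft_multiplication_formula:
  assumes f: "integrable lborel f" and g: "integrable lborel g"
  shows "(LINT \<xi>|lborel. ft f \<xi> * g \<xi>) = (LINT x|lborel. f x * ft g x)"
proof -
  have [measurable]: "f \<in> borel_measurable borel" "g \<in> borel_measurable borel"
    using borel_measurable_integrable[OF f] borel_measurable_integrable[OF g] by auto
  define h where "h x \<xi> = cis (- (x \<bullet> \<xi>)) * f x * g \<xi>" for x \<xi>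
  have "integrable (lborel \<Otimes>\<^sub>M lborel) (case_prod h)"
  proof (rule lborel_pair.Fubini_integrable)
    show "case_prod h \<in> borel_measurable (lborel \<Otimes>\<^sub>M lborel)"
      unfolding h_def[abs_def] by measurable
    show "integrable lborel (\<lambda>x. LINT y|lborel. norm (case (x, y) of (x, xa) \<Rightarrow> h x xa))"
      using f by (simp add: h_def norm_mult)
    have "integrable lborel (\<lambda>\<xi>. f x * (cis (- (\<xi> \<bullet> x)) * g \<xi>))" for x
      by (intro integrable_mult_right ft_integrable g)
    then show "AE x in lborel. integrable lborel (\<lambda>y. case (x, y) of (x, xa) \<Rightarrow> h x xa)"
      by (simp add: h_def inner_commute mult_ac)
  qed
  then have "(LINT \<xi>|lborel. LINT x|lborel. h x \<xi>) = (LINT x|lborel. LINT \<xi>|lborel. h x \<xi>)"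
    by (rule lborel_pair.Fubini_integral)
  moreover have "(LINT x|lborel. h x \<xi>) = ft f \<xi> * g \<xi>" for \<xi>
    by (simp add: h_def ft_def)
  moreover have "(LINT \<xi>|lborel. h x \<xi>) = f x * ft g x" for x
  proof -
    have "(LINT \<xi>|lborel. h x \<xi>) = (LINT \<xi>|lborel. f x * (cis (- (\<xi> \<bullet> x)) * g \<xi>))"
      by (simp add: h_def inner_commute mult_ac)
    then show ?thesis by (simp add: ft_def)
  qed
  ultimately show ?thesis by simp
qed

text \<open>
  Against a Gaussian weight the integral of \<open>\<bar>\<F> u\<bar>\<^sup>2\<close> is, by Fubini and the Fourier transform of the
  Gaussian, an average of the autocorrelations \<open>\<langle>u, u(\<cdot> + d z)\<rangle>\<close> over a Gaussian in \<open>z\<close>.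
\<close>

lemma gauss_weighted_fourier:
  fixes u :: "'a::euclidean_space \<Rightarrow> real"
  assumes u1: "integrable lborel u" and u2: "u \<in> L2_space lborel" and d: "d > 0"
  shows "integrable lborel (\<lambda>\<xi>. (cmod (fourier_integral u \<xi>))\<^sup>2 * gauss d \<xi>)"
    and "(LINT \<xi>|lborel. (cmod (fourier_integral u \<xi>))\<^sup>2 * gauss d \<xi>)
      = gauss_const TYPE('a) * (LINT z|lborel. gauss 1 z * L2_inner lborel u (translate (d *\<^sub>R z) u))"
proof -
  define \<kappa> where "\<kappa> = gauss_const TYPE('a)"
  define U where "U = fourier_integral u"
  have [measurable]: "u \<in> borel_measurable borel" using L2_measurable[OF u2] by simp
  have uc: "integrable lborel (\<lambda>x. complex_of_real (u x))" using u1 by simp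
  have [measurable]: "U \<in> borel_measurable borel" unfolding U_def fourier_integral_ft by measurable
  define B where "B = (LINT x|lborel. \<bar>u x\<bar>)"
  have UB: "cmod (U \<xi>) \<le> B" for \<xi>
    using ft_bound[of "\<lambda>x. complex_of_real (u x)" \<xi>] by (simp add: U_def fourier_integral_ft B_def)
  have B0: "B \<ge> 0" by (simp add: B_def)
  have gi: "integrable lborel (gauss d :: 'a \<Rightarrow> real)" by (rule gauss_integral[OF d])
  define g where "g \<xi> = cnj (U \<xi>) * complex_of_real (gauss d \<xi>)" for \<xi>
  have g_int: "integrable lborel g"
  proof (rule Bochner_Integration.integrable_bound)
    show "integrable lborel (\<lambda>\<xi>. B * gauss d (\<xi>::'a))" by (intro integrable_mult_right gi)
    show "g \<in> borel_measurable lborel" unfolding g_def[abs_def] by measurable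
    show "AE x in lborel. norm (g x) \<le> norm (B * gauss d x)"
      using UB gauss_pos[of d] by (intro AE_I2) (auto simp: g_def norm_mult less_imp_le abs_mult B0 intro!: mult_right_mono)
  qed
  show "integrable lborel (\<lambda>\<xi>. (cmod (fourier_integral u \<xi>))\<^sup>2 * gauss d \<xi>)"
  proof (rule Bochner_Integration.integrable_bound)
    show "integrable lborel (\<lambda>\<xi>. B\<^sup>2 * gauss d (\<xi>::'a))" by (intro integrable_mult_right gi)
    show "(\<lambda>\<xi>. (cmod (fourier_integral u \<xi>))\<^sup>2 * gauss d \<xi>) \<in> borel_measurable lborel"
      unfolding U_def[symmetric] by measurable
    show "AE x in lborel. norm ((cmod (fourier_integral u x))\<^sup>2 * gauss d x) \<le> norm (B\<^sup>2 * gauss d x)"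
      using UB gauss_pos[of d]
      by (intro AE_I2) (auto simp: U_def less_imp_le abs_mult intro!: mult_right_mono power_mono)
  qed
  have ft_g: "ft g x = complex_of_real (\<kappa> * (LINT z|lborel. u (x + d *\<^sub>R z) * gauss 1 z))" for x
  proof -
    \<comment> \<open>a modulated Gaussian; its transform is a Gaussian centred at \<open>x\<close>\<close>
    define G where "G \<xi> = cis (x \<bullet> \<xi>) * complex_of_real (gauss d \<xi>)" for \<xi>
    have G_int: "integrable lborel G"
      using ft_integrable[of "\<lambda>\<xi>. complex_of_real (gauss d \<xi>)" "- x"] gi
      by (simp add: G_def[abs_def] inner_commute)
    have ftG: "ft G y = complex_of_real (\<kappa> / d ^ DIM('a) * gauss (1 / d) (y - x))" for y
    proof -
      have "ft G y = (LINT \<xi>|lborel. cis (- (\<xi> \<bullet> (y - x))) * complex_of_real (gauss d \<xi>))"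
        unfolding ft_def G_def mult.assoc[symmetric] cis_mult
        by (simp add: inner_diff_right inner_commute)
      then show ?thesis using gauss_fourier(2)[OF d, of "y - x"] by (simp add: \<kappa>_def)
    qed
    have "ft g x = (LINT \<xi>|lborel. cnj (U \<xi> * G \<xi>))"
      unfolding ft_def g_def G_def by (intro Bochner_Integration.integral_cong) (auto simp: cis_cnj inner_commute mult_ac)
    also have "\<dots> = cnj (LINT \<xi>|lborel. U \<xi> * G \<xi>)" by (simp del: complex_cnj_mult)
    also have "(LINT \<xi>|lborel. U \<xi> * G \<xi>) = (LINT y|lborel. complex_of_real (u y) * ft G y)"
      unfolding U_def fourier_integral_ft by (rule ft_multiplication_formula[OF uc G_int])
    also have "\<dots> = complex_of_real (LINT y|lborel. u y * (\<kappa> / d ^ DIM('a) * gauss (1 / d) (y - x)))"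
      unfolding ftG of_real_mult[symmetric] integral_complex_of_real ..
    also have "(LINT y|lborel. u y * (\<kappa> / d ^ DIM('a) * gauss (1 / d) (y - x)))
        = d ^ DIM('a) * (LINT z|lborel. u (x + d *\<^sub>R z) * (\<kappa> / d ^ DIM('a) * gauss (1 / d) ((x + d *\<^sub>R z) - x)))"
      by (rule integral_affine[OF _ d]) measurable
    also have "(LINT z|lborel. u (x + d *\<^sub>R z) * (\<kappa> / d ^ DIM('a) * gauss (1 / d) ((x + d *\<^sub>R z) - x)))
       = (LINT z|lborel. \<kappa> / d ^ DIM('a) * (u (x + d *\<^sub>R z) * gauss 1 z))"
      using d by (intro Bochner_Integration.integral_cong) (auto simp: gauss_def)
    finally show ?thesis using d by simp
  qed
  define h where "h z x = gauss 1 z * (u x * u (x + d *\<^sub>R z))" for z x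
  have L2t: "integrable lborel (\<lambda>x. u x * translate (d *\<^sub>R z) u x)" for z
    by (intro integrable_L2_mult translate_L2 u2)
  have "integrable (lborel \<Otimes>\<^sub>M lborel) (case_prod h)"
  proof (rule lborel_pair.Fubini_integrable)
    show hm: "case_prod h \<in> borel_measurable (lborel \<Otimes>\<^sub>M lborel)"
      unfolding h_def[abs_def] by measurable
    show "AE z in lborel. integrable lborel (\<lambda>x. case (z, x) of (z, x) \<Rightarrow> h z x)"
      using L2t by (simp add: h_def translate_def)
    show "integrable lborel (\<lambda>z. LINT x|lborel. norm (case (z, x) of (z, x) \<Rightarrow> h z x))"
    proof (rule Bochner_Integration.integrable_bound)
      show "integrable lborel (\<lambda>z::'a. (L2_norm lborel u)\<^sup>2 * gauss 1 z)"
        by (intro integrable_mult_right gauss_integral) simp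
      show "(\<lambda>z. LINT x|lborel. norm (case (z, x) of (z, x) \<Rightarrow> h z x)) \<in> borel_measurable lborel"
        unfolding h_def[abs_def] by measurable
      have "(LINT x|lborel. \<bar>u x\<bar> * \<bar>u (x + d *\<^sub>R z)\<bar>) \<le> (L2_norm lborel u)\<^sup>2" for z
      proof -
        have a: "(\<lambda>x. \<bar>u x\<bar>) \<in> L2_space lborel" by (rule L2_dominated[OF u2]) auto
        have n: "L2_norm lborel (\<lambda>x. \<bar>u x\<bar>) = L2_norm lborel u" by (simp add: L2_norm_def)
        have "\<bar>L2_inner lborel (\<lambda>x. \<bar>u x\<bar>) (translate (d *\<^sub>R z) (\<lambda>x. \<bar>u x\<bar>))\<bar>
          \<le> L2_norm lborel (\<lambda>x. \<bar>u x\<bar>) * L2_norm lborel (translate (d *\<^sub>R z) (\<lambda>x. \<bar>u x\<bar>))"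
          by (intro L2.cauchy_schwarz translate_L2 a)
        then show ?thesis
          unfolding translate_L2(2)[OF a] n
          by (simp add: L2_inner_def translate_def power2_eq_square)
      qed
      then have "norm (LINT x|lborel. norm (case (z, x) of (z, x) \<Rightarrow> h z x)) \<le> norm ((L2_norm lborel u)\<^sup>2 * gauss 1 z)" for z
        using gauss_pos[of 1 z] by (simp add: h_def abs_mult mult.commute[of _ "gauss 1 z"])
      then show "AE z in lborel. norm (LINT x|lborel. norm (case (z, x) of (z, x) \<Rightarrow> h z x)) \<le> norm ((L2_norm lborel u)\<^sup>2 * gauss 1 z)"
        by blast
    qed
  qed
  then have fub: "(LINT x|lborel. LINT z|lborel. h z x) = (LINT z|lborel. LINT x|lborel. h z x)"
    by (rule lborel_pair.Fubini_integral)
  have "complex_of_real (LINT \<xi>|lborel. (cmod (U \<xi>))\<^sup>2 * gauss d \<xi>) = (LINT \<xi>|lborel. U \<xi> * g \<xi>)"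
    unfolding integral_complex_of_real[symmetric]
    by (intro Bochner_Integration.integral_cong)
      (auto simp: g_def mult.assoc[symmetric] complex_norm_square simp del: of_real_power)
  also have "\<dots> = (LINT x|lborel. complex_of_real (u x) * ft g x)"
    unfolding U_def fourier_integral_ft by (rule ft_multiplication_formula[OF uc g_int])
  also have "\<dots> = complex_of_real (LINT x|lborel. u x * (\<kappa> * (LINT z|lborel. u (x + d *\<^sub>R z) * gauss 1 z)))"
    unfolding ft_g of_real_mult[symmetric] integral_complex_of_real ..
  also have "(LINT x|lborel. u x * (\<kappa> * (LINT z|lborel. u (x + d *\<^sub>R z) * gauss 1 z))) = (LINT x|lborel. \<kappa> * (LINT z|lborel. h z x))"
  proof (intro Bochner_Integration.integral_cong refl)
    fix x
    have "(LINT z|lborel. h z x) = (LINT z|lborel. u x * (u (x + d *\<^sub>R z) * gauss 1 z))"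
      by (simp add: h_def mult_ac)
    also have "\<dots> = u x * (LINT z|lborel. u (x + d *\<^sub>R z) * gauss 1 z)" by simp
    finally show "u x * (\<kappa> * (LINT z|lborel. u (x + d *\<^sub>R z) * gauss 1 z)) = \<kappa> * (LINT z|lborel. h z x)" by simp
  qed
  also have "\<dots> = \<kappa> * (LINT z|lborel. LINT x|lborel. h z x)" by (simp add: fub)
  finally have "(LINT \<xi>|lborel. (cmod (U \<xi>))\<^sup>2 * gauss d \<xi>) = \<kappa> * (LINT z|lborel. LINT x|lborel. h z x)"
    by (simp only: of_real_eq_iff)
  then show "(LINT \<xi>|lborel. (cmod (fourier_integral u \<xi>))\<^sup>2 * gauss d \<xi>)
      = gauss_const TYPE('a) * (LINT z|lborel. gauss 1 z * L2_inner lborel u (translate (d *\<^sub>R z) u))"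
    by (simp add: U_def \<kappa>_def h_def L2_inner_def translate_def)
qed

text \<open>
  Let \<open>d \<rightarrow> 0\<close> in the weighted identity. The left-hand sides increase to the integral of \<open>\<bar>\<F> u\<bar>\<^sup>2\<close>, and
  the autocorrelations converge to \<open>\<parallel>u\<parallel>\<^sup>2\<close> because translations are continuous in \<open>L\<^sup>2\<close>.
\<close>

theorem plancherel_L1_L2:
  fixes u :: "'a::euclidean_space \<Rightarrow> real"
  assumes u1: "integrable lborel u" and u2: "u \<in> L2_space lborel"
  shows "fourier_integral u \<in> L2_space lborel"
    and "L2_norm lborel (fourier_integral u) = gauss_const TYPE('a) * L2_norm lborel u"
proof -
  define \<kappa> where "\<kappa> = gauss_const TYPE('a)"
  have [measurable]: "u \<in> borel_measurable borel" using L2_measurable[OF u2] by simp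
  have Um [measurable]: "fourier_integral u \<in> borel_measurable borel" unfolding fourier_integral_ft by measurable
  define \<delta> where "\<delta> n = 1 / real (Suc n)" for n
  have \<delta>: "\<delta> n > 0" for n by (simp add: \<delta>_def)
  have \<delta>0: "\<delta> \<longlonglongrightarrow> 0" unfolding \<delta>_def[abs_def] by (rule LIMSEQ_Suc[OF lim_1_over_n])
  have "(\<lambda>n. LINT z|lborel. gauss 1 z * L2_inner lborel u (translate (\<delta> n *\<^sub>R z) u))
      \<longlonglongrightarrow> (LINT z|lborel. gauss 1 (z::'a) * (L2_norm lborel u)\<^sup>2)"
  proof (rule integral_dominated_convergence[where w="\<lambda>z. gauss 1 z * (L2_norm lborel u)\<^sup>2"])
    show "integrable lborel (\<lambda>z::'a. gauss 1 z * (L2_norm lborel u)\<^sup>2)"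
      by (intro integrable_mult_left gauss_integral) simp
    show "(\<lambda>z. gauss 1 z * L2_inner lborel u (translate (\<delta> n *\<^sub>R z) u)) \<in> borel_measurable lborel" for n
      unfolding L2_inner_def translate_def by measurable
    show "AE z in lborel. (\<lambda>n. gauss 1 z * L2_inner lborel u (translate (\<delta> n *\<^sub>R z) u)) \<longlonglongrightarrow> gauss 1 z * (L2_norm lborel u)\<^sup>2"
    proof (intro AE_I2 tendsto_mult tendsto_const)
      fix z :: 'a
      have "(\<lambda>n. \<delta> n *\<^sub>R z) \<longlonglongrightarrow> 0 *\<^sub>R z" by (intro tendsto_intros \<delta>0)
      then have "(\<lambda>n. L2_norm lborel (translate (\<delta> n *\<^sub>R z) u - u)) \<longlonglongrightarrow> 0"
        by (intro translation_tendsto[OF u2]) simp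
      from L2.ip_tendsto[OF _ u2 u2 this]
      have "(\<lambda>n. L2_inner lborel (translate (\<delta> n *\<^sub>R z) u) u) \<longlonglongrightarrow> L2_inner lborel u u"
        by (simp add: translate_L2 u2)
      then show "(\<lambda>n. L2_inner lborel u (translate (\<delta> n *\<^sub>R z) u)) \<longlonglongrightarrow> (L2_norm lborel u)\<^sup>2"
        by (simp add: L2.nrm_sq u2 L2.ip_sym[OF u2 translate_L2(1)[OF u2]])
    qed
    show "AE z in lborel. norm (gauss 1 z * L2_inner lborel u (translate (\<delta> n *\<^sub>R z) u)) \<le> gauss 1 z * (L2_norm lborel u)\<^sup>2" for n
    proof (intro AE_I2)
      fix z :: 'a
      have "\<bar>L2_inner lborel u (translate (\<delta> n *\<^sub>R z) u)\<bar> \<le> L2_norm lborel u * L2_norm lborel (translate (\<delta> n *\<^sub>R z) u)"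
        by (intro L2.cauchy_schwarz translate_L2 u2)
      then show "norm (gauss 1 z * L2_inner lborel u (translate (\<delta> n *\<^sub>R z) u)) \<le> gauss 1 z * (L2_norm lborel u)\<^sup>2"
        using gauss_pos[of 1 z] by (simp add: abs_mult translate_L2 u2 power2_eq_square)
    qed
  qed simp
  then have lim: "(\<lambda>n. LINT \<xi>|lborel. (cmod (fourier_integral u \<xi>))\<^sup>2 * gauss (\<delta> n) \<xi>) \<longlonglongrightarrow> \<kappa> * (\<kappa> * (L2_norm lborel u)\<^sup>2)"
    unfolding gauss_weighted_fourier(2)[OF u1 u2 \<delta>]
    by (intro tendsto_mult tendsto_const) (simp_all add: \<kappa>_def gauss_integral)
  have mono: "mono (\<lambda>n. (cmod (fourier_integral u \<xi>))\<^sup>2 * gauss (\<delta> n) \<xi>)" for \<xi>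
  proof (rule monoI)
    fix m n :: nat assume "m \<le> n"
    then have "\<delta> n \<le> \<delta> m" by (simp add: \<delta>_def divide_simps)
    then have "(\<delta> n * norm \<xi>)\<^sup>2 \<le> (\<delta> m * norm \<xi>)\<^sup>2"
      using \<delta>[of n] by (intro power_mono mult_right_mono) auto
    then show "(cmod (fourier_integral u \<xi>))\<^sup>2 * gauss (\<delta> m) \<xi> \<le> (cmod (fourier_integral u \<xi>))\<^sup>2 * gauss (\<delta> n) \<xi>"
      by (intro mult_left_mono) (auto simp: gauss_def)
  qed
  have ptlim: "(\<lambda>n. (cmod (fourier_integral u \<xi>))\<^sup>2 * gauss (\<delta> n) \<xi>) \<longlonglongrightarrow> (cmod (fourier_integral u \<xi>))\<^sup>2" for \<xi>
  proof -
    have "(\<lambda>n. (cmod (fourier_integral u \<xi>))\<^sup>2 * exp (- (\<delta> n * norm \<xi>)\<^sup>2 / 2))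
       \<longlonglongrightarrow> (cmod (fourier_integral u \<xi>))\<^sup>2 * exp (- (0 * norm \<xi>)\<^sup>2 / 2)"
      by (intro tendsto_intros \<delta>0) simp
    then show ?thesis by (simp add: gauss_def)
  qed
  have main: "integrable lborel (\<lambda>\<xi>. (cmod (fourier_integral u \<xi>))\<^sup>2)"
    "(LINT \<xi>|lborel. (cmod (fourier_integral u \<xi>))\<^sup>2) = \<kappa> * (\<kappa> * (L2_norm lborel u)\<^sup>2)"
    using integral_monotone_convergence_nonneg[OF gauss_weighted_fourier(1)[OF u1 u2 \<delta>] AE_I2[OF mono]
        _ AE_I2[OF ptlim] lim] by auto
  then show "fourier_integral u \<in> L2_space lborel" by (simp add: L2_space_def)
  have "\<kappa> \<ge> 0" by (simp add: \<kappa>_def)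
  have "L2_norm lborel (fourier_integral u) = sqrt ((\<kappa> * L2_norm lborel u)\<^sup>2)"
    unfolding L2_norm_def[of _ "fourier_integral u"] main(2) by (simp add: power2_eq_square mult_ac)
  then show "L2_norm lborel (fourier_integral u) = gauss_const TYPE('a) * L2_norm lborel u"
    using \<open>\<kappa> \<ge> 0\<close> by (simp add: \<kappa>_def)
qed

section \<open>The Fourier transform on \<open>L\<^sup>2\<close>\<close>

lemma L2_on_UNIV: "L2_on UNIV = (L2_space lborel :: ('a::euclidean_space \<Rightarrow> real) set)"
  by (simp add: L2_on_def L2_space_def set_borel_measurable_def set_integrable_def)

lemma L2_norm_mono:
  assumes "f \<in> borel_measurable M" "g \<in> L2_space M" "AE x in M. norm (f x) \<le> norm (g x)"
  shows "L2_norm M f \<le> L2_norm M g"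
  unfolding L2_norm_def
proof (intro real_sqrt_le_mono integral_mono_AE)
  show "integrable M (\<lambda>x. (norm (f x))\<^sup>2)" "integrable M (\<lambda>x. (norm (g x))\<^sup>2)"
    using L2_dominated[OF assms(2,1,3)] assms(2) by (auto simp: L2_integrable_square)
  show "AE x in M. (norm (f x))\<^sup>2 \<le> (norm (g x))\<^sup>2"
    using assms(3) by eventually_elim (simp add: power_mono)
qed

lemma L2_inner_tendsto:
  assumes a: "\<And>n. a n \<in> L2_space M" "a0 \<in> L2_space M" "(\<lambda>n. L2_norm M (a n - a0)) \<longlonglongrightarrow> 0"
    and b: "\<And>n. b n \<in> L2_space M" "b0 \<in> L2_space M" "(\<lambda>n. L2_norm M (b n - b0)) \<longlonglongrightarrow> 0"
  shows "(\<lambda>n. L2_inner M (a n) (b n)) \<longlonglongrightarrow> L2_inner M a0 b0"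
proof -
  have "(\<lambda>n. L2_norm M (a n - a0) * L2_norm M (b n) + L2_norm M a0 * L2_norm M (b n - b0))
     \<longlonglongrightarrow> 0 * L2_norm M b0 + L2_norm M a0 * 0"
    by (intro tendsto_intros a b L2.nrm_tendsto)
  then have lim: "(\<lambda>n. L2_norm M (a n - a0) * L2_norm M (b n) + L2_norm M a0 * L2_norm M (b n - b0)) \<longlonglongrightarrow> 0"
    by simp
  have "(\<lambda>n. L2_inner M (a n) (b n) - L2_inner M a0 b0) \<longlonglongrightarrow> 0"
  proof (rule Lim_null_comparison[OF _ lim], intro always_eventually allI)
    fix n
    have "L2_inner M (a n) (b n) - L2_inner M a0 b0 = L2_inner M (a n - a0) (b n) + L2_inner M a0 (b n - b0)"
      using a b by (simp add: L2.ips L2.mem)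
    then show "norm (L2_inner M (a n) (b n) - L2_inner M a0 b0)
        \<le> L2_norm M (a n - a0) * L2_norm M (b n) + L2_norm M a0 * L2_norm M (b n - b0)"
      using L2.cauchy_schwarz[of "a n - a0" M "b n"] L2.cauchy_schwarz[of a0 M "b n - b0"] a b
      by (simp add: L2.mem)
  qed
  then show ?thesis by (simp add: LIM_zero_iff)
qed

definition trunc :: "real \<Rightarrow> ('a::euclidean_space \<Rightarrow> real) \<Rightarrow> 'a \<Rightarrow> real" where
  "trunc R u = (\<lambda>x. indicator (cball 0 R) x * u x)"

lemma trunc_L2:
  assumes u: "u \<in> L2_space lborel"
  shows "trunc R u \<in> L2_space lborel"
proof -
  have [measurable]: "u \<in> borel_measurable borel" using L2_measurable[OF u] by simp
  show ?thesis
    by (rule L2_dominated[OF u]) (auto simp: trunc_def indicator_def)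
qed

lemma indicator_L2:
  fixes A :: "'a::euclidean_space set"
  assumes "A \<in> sets borel" "bounded A"
  shows "(indicator A :: 'a \<Rightarrow> real) \<in> L2_space lborel"
  using translation_continuous_indicator[OF assms] by (simp add: translation_continuous_def)

lemma trunc_integrable:
  assumes u: "u \<in> L2_space lborel"
  shows "integrable lborel (trunc R u)"
  unfolding trunc_def
  by (rule integrable_L2_mult[OF indicator_L2 u]) auto

lemma trunc_tendsto:
  assumes u: "u \<in> L2_space lborel"
  shows "((\<lambda>R. L2_norm lborel (trunc R u - u)) \<longlongrightarrow> 0) at_top"
proof (rule tendsto_at_topI_sequentially)
  fix R :: "nat \<Rightarrow> real" assume R: "filterlim R at_top sequentially"
  show "(\<lambda>n. L2_norm lborel (trunc (R n) u - u)) \<longlonglongrightarrow> 0"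
  proof (rule L2_dominated_convergence[OF trunc_L2[OF u] u u])
    show "AE x in lborel. norm (trunc (R n) u x) \<le> norm (u x)" for n
      by (auto simp: trunc_def indicator_def)
    have "(\<lambda>n. trunc (R n) u x) \<longlonglongrightarrow> u x" for x
    proof (rule tendsto_eventually)
      have "\<forall>\<^sub>F n in sequentially. R n \<ge> norm x" using R by (simp add: filterlim_at_top)
      then show "\<forall>\<^sub>F n in sequentially. trunc (R n) u x = u x"
        by eventually_elim (auto simp: trunc_def)
    qed
    then show "AE x in lborel. (\<lambda>n. trunc (R n) u x) \<longlonglongrightarrow> u x" by simp
  qed
qed

lemma trunc_tendsto_seq:
  "u \<in> L2_space lborel \<Longrightarrow> (\<lambda>n. L2_norm lborel (trunc (real n) u - u)) \<longlonglongrightarrow> 0"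
  using filterlim_compose[OF trunc_tendsto filterlim_real_sequentially] .

lemma fourier_integral_add:
  "integrable lborel u \<Longrightarrow> integrable lborel v \<Longrightarrow> fourier_integral (u + v) = fourier_integral u + fourier_integral v"
  using ft_integrable[of "\<lambda>x. complex_of_real (u x)"] ft_integrable[of "\<lambda>x. complex_of_real (v x)"]
  by (simp add: fourier_integral_def fun_eq_iff ring_distribs)

lemma fourier_integral_scale:
  "fourier_integral (c *\<^sub>R u) = c *\<^sub>R fourier_integral u"
proof
  fix \<xi>
  have "fourier_integral (c *\<^sub>R u) \<xi> = (LINT x|lborel. complex_of_real c * (cis (- (x \<bullet> \<xi>)) * complex_of_real (u x)))"
    by (simp add: fourier_integral_def scaleR_fun_def mult_ac)
  also have "\<dots> = (c *\<^sub>R fourier_integral u) \<xi>"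
    by (simp add: fourier_integral_def scaleR_fun_def scaleR_conv_of_real)
  finally show "fourier_integral (c *\<^sub>R u) \<xi> = (c *\<^sub>R fourier_integral u) \<xi>" .
qed

lemma fourier_integral_diff:
  assumes "integrable lborel u" "integrable lborel v"
  shows "fourier_integral (u - v) = fourier_integral u - fourier_integral v"
proof -
  have "integrable lborel ((-1) *\<^sub>R v)" using assms(2) by (simp add: scaleR_fun_def)
  then have "fourier_integral (u + (-1) *\<^sub>R v) = fourier_integral u + (-1) *\<^sub>R fourier_integral v"
    by (simp only: fourier_integral_add[OF assms(1)] fourier_integral_scale)
  then show ?thesis by simp
qed

lemma plancherel_diff:
  fixes u v :: "'a::euclidean_space \<Rightarrow> real"
  assumes "integrable lborel u" "u \<in> L2_space lborel" "integrable lborel v" "v \<in> L2_space lborel"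
  shows "L2_norm lborel (fourier_integral u - fourier_integral v) = gauss_const TYPE('a) * L2_norm lborel (u - v)"
proof -
  have "integrable lborel (u - v)" using assms by (simp add: fun_diff_def)
  from plancherel_L1_L2(2)[OF this L2.diff_mem[OF assms(2,4)]] show ?thesis
    by (simp add: fourier_integral_diff assms)
qed

lemma has_L2_fourier_iff:
  "has_L2_fourier u U \<longleftrightarrow> u \<in> L2_space lborel \<and> U \<in> L2_space lborel \<and>
     ((\<lambda>R. L2_norm lborel (fourier_integral (trunc R u) - U)) \<longlongrightarrow> 0) at_top"
proof (cases "u \<in> L2_space lborel \<and> U \<in> L2_space lborel")
  case True
  then have d: "fourier_integral (trunc R u) - U \<in> L2_space lborel" for R
    by (intro L2.diff_mem plancherel_L1_L2 trunc_integrable trunc_L2) auto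
  have eq: "(\<integral>\<^sup>+ \<xi>. ennreal ((cmod (fourier_integral (trunc R u) \<xi> - U \<xi>))\<^sup>2) \<partial>lborel)
     = ennreal ((L2_norm lborel (fourier_integral (trunc R u) - U))\<^sup>2)" for R
    unfolding L2_norm_nn[OF d] by simp
  have sq: "((\<lambda>R. (f R)\<^sup>2) \<longlongrightarrow> 0) at_top \<longleftrightarrow> (f \<longlongrightarrow> 0) at_top" if "\<And>R. f R \<ge> 0" for f :: "real \<Rightarrow> real"
  proof
    assume "((\<lambda>R. (f R)\<^sup>2) \<longlongrightarrow> 0) at_top"
    then have "((\<lambda>R. sqrt ((f R)\<^sup>2)) \<longlongrightarrow> sqrt 0) at_top" by (rule tendsto_real_sqrt)
    then show "(f \<longlongrightarrow> 0) at_top" using that by simp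
  next
    assume "(f \<longlongrightarrow> 0) at_top"
    then have "((\<lambda>R. (f R)\<^sup>2) \<longlongrightarrow> 0\<^sup>2) at_top" by (rule tendsto_power)
    then show "((\<lambda>R. (f R)\<^sup>2) \<longlongrightarrow> 0) at_top" by simp
  qed
  have "((\<lambda>R. ennreal ((L2_norm lborel (fourier_integral (trunc R u) - U))\<^sup>2)) \<longlongrightarrow> ennreal 0) at_top
     \<longleftrightarrow> ((\<lambda>R. (L2_norm lborel (fourier_integral (trunc R u) - U))\<^sup>2) \<longlongrightarrow> 0) at_top"
    by (rule tendsto_ennreal_iff) auto
  then show ?thesis
    using True unfolding has_L2_fourier_def trunc_def[symmetric] eq L2_on_UNIV
    by (simp add: sq) (simp add: L2_space_def)
next
  case False
  then show ?thesis unfolding has_L2_fourier_def L2_on_UNIV by (auto simp: L2_space_def)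
qed

text \<open>
  By Plancherel's theorem the Fourier integrals of the truncations form a Cauchy sequence, and the
  distance to its limit is controlled by the tail of \<open>u\<close>.
\<close>

lemma has_L2_fourier_exists:
  fixes u :: "'a::euclidean_space \<Rightarrow> real"
  assumes u: "u \<in> L2_space lborel"
  shows "\<exists>U. has_L2_fourier u U"
proof -
  define \<kappa> where "\<kappa> = gauss_const TYPE('a)"
  have \<kappa>: "\<kappa> > 0" by (simp add: \<kappa>_def)
  define X where "X n = fourier_integral (trunc (real n) u)" for n
  have X: "X n \<in> L2_space lborel" for n
    unfolding X_def by (intro plancherel_L1_L2 trunc_integrable trunc_L2 u)
  have d: "L2_norm lborel (fourier_integral (trunc R u) - fourier_integral (trunc R' u)) = \<kappa> * L2_norm lborel (trunc R u - trunc R' u)" for R R'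
    unfolding \<kappa>_def by (intro plancherel_diff trunc_integrable trunc_L2 u)
  have "L2.cauchy_seq lborel (\<lambda>n. trunc (real n) u)"
    by (rule L2.limit_imp_cauchy[OF trunc_L2[OF u] u trunc_tendsto_seq[OF u]])
  have "\<exists>N. \<forall>m\<ge>N. \<forall>n\<ge>N. L2_norm lborel (X m - X n) < e" if e: "e > 0" for e
  proof -
    have "e / \<kappa> > 0" using e \<kappa> by simp
    then obtain N where "\<And>m n. m \<ge> N \<Longrightarrow> n \<ge> N \<Longrightarrow> L2_norm lborel (trunc (real m) u - trunc (real n) u) < e / \<kappa>"
      using \<open>L2.cauchy_seq lborel (\<lambda>n. trunc (real n) u)\<close> unfolding L2.cauchy_seq_def by blast
    then show ?thesis unfolding X_def d using \<kappa> by (intro exI[of _ N]) (auto simp: field_simps)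
  qed
  from L2_complete[of X lborel, OF X this] obtain U where U: "U \<in> L2_space lborel" "(\<lambda>n. L2_norm lborel (X n - U)) \<longlonglongrightarrow> 0"
    by blast
  have bound: "L2_norm lborel (fourier_integral (trunc R u) - U) \<le> \<kappa> * L2_norm lborel (trunc R u - u)" for R
  proof -
    have f: "fourier_integral (trunc R u) \<in> L2_space lborel"
      by (intro plancherel_L1_L2 trunc_integrable trunc_L2 u)
    have "L2_norm lborel (fourier_integral (trunc R u) - U)
       \<le> \<kappa> * (L2_norm lborel (trunc R u - u) + L2_norm lborel (trunc (real n) u - u)) + L2_norm lborel (X n - U)" for n
    proof -
      have "L2_norm lborel (fourier_integral (trunc R u) - U) \<le> \<kappa> * L2_norm lborel (trunc R u - trunc (real n) u) + L2_norm lborel (X n - U)"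
        using L2.nrm_triangle_diff[OF f X U(1), of n] by (simp add: X_def d)
      moreover have "L2_norm lborel (trunc R u - trunc (real n) u) \<le> L2_norm lborel (trunc R u - u) + L2_norm lborel (trunc (real n) u - u)"
        using L2.nrm_triangle_diff[OF trunc_L2[OF u] u trunc_L2[OF u], of R "real n"]
          L2.nrm_minus_commute[OF u trunc_L2[OF u], of "real n"] by simp
      ultimately show ?thesis using \<kappa> by (smt (verit) mult_left_mono)
    qed
    moreover have "(\<lambda>n. \<kappa> * (L2_norm lborel (trunc R u - u) + L2_norm lborel (trunc (real n) u - u)) + L2_norm lborel (X n - U))
       \<longlonglongrightarrow> \<kappa> * (L2_norm lborel (trunc R u - u) + 0) + 0"
      by (intro tendsto_intros trunc_tendsto_seq u U)
    ultimately show ?thesis by (intro LIMSEQ_le_const[of _ "\<kappa> * L2_norm lborel (trunc R u - u)"]) auto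
  qed
  have "((\<lambda>R. \<kappa> * L2_norm lborel (trunc R u - u)) \<longlongrightarrow> 0) at_top"
    by (intro tendsto_mult_right_zero trunc_tendsto u)
  then have "((\<lambda>R. L2_norm lborel (fourier_integral (trunc R u) - U)) \<longlongrightarrow> 0) at_top"
    by (rule Lim_null_comparison[OF always_eventually, rotated]) (use bound in auto)
  then show ?thesis using u U has_L2_fourier_iff by blast
qed

lemma has_L2_fourier_L2_fourier: "u \<in> L2_space lborel \<Longrightarrow> has_L2_fourier u (L2_fourier u)"
  unfolding L2_fourier_def by (rule someI_ex[OF has_L2_fourier_exists])

lemma L2_fourier_L2: "u \<in> L2_space lborel \<Longrightarrow> L2_fourier u \<in> L2_space lborel"
  using has_L2_fourier_L2_fourier has_L2_fourier_iff by blast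

text \<open>
  The balls in the definition are not special: every approximation of \<open>u\<close> by integrable functions
  computes the same transform.
\<close>

lemma L2_fourier_approx:
  fixes u :: "'a::euclidean_space \<Rightarrow> real"
  assumes u: "u \<in> L2_space lborel" and X: "\<And>n. X n \<in> L2_space lborel" "\<And>n. integrable lborel (X n)"
    and lim: "(\<lambda>n. L2_norm lborel (X n - u)) \<longlonglongrightarrow> 0"
  shows "(\<lambda>n. L2_norm lborel (fourier_integral (X n) - L2_fourier u)) \<longlonglongrightarrow> 0"
proof -
  define \<kappa> where "\<kappa> = gauss_const TYPE('a)"
  have \<kappa>: "\<kappa> > 0" by (simp add: \<kappa>_def)
  let ?T = "\<lambda>n. trunc (real n) u"
  have "((\<lambda>R. L2_norm lborel (fourier_integral (trunc R u) - L2_fourier u)) \<longlongrightarrow> 0) at_top"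
    using has_L2_fourier_L2_fourier[OF u] by (simp add: has_L2_fourier_iff)
  then have l1: "(\<lambda>n. L2_norm lborel (fourier_integral (?T n) - L2_fourier u)) \<longlonglongrightarrow> 0"
    using filterlim_compose[OF _ filterlim_real_sequentially] by blast
  have "(\<lambda>n. \<kappa> * (L2_norm lborel (X n - u) + L2_norm lborel (?T n - u)) + L2_norm lborel (fourier_integral (?T n) - L2_fourier u)) \<longlonglongrightarrow> \<kappa> * (0 + 0) + 0"
    by (intro tendsto_intros lim l1 trunc_tendsto_seq u)
  then have l2: "(\<lambda>n. \<kappa> * (L2_norm lborel (X n - u) + L2_norm lborel (?T n - u)) + L2_norm lborel (fourier_integral (?T n) - L2_fourier u)) \<longlonglongrightarrow> 0"
    by simp
  show ?thesis
  proof (rule Lim_null_comparison[OF _ l2], intro always_eventually allI)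
    fix n
    have "L2_norm lborel (fourier_integral (X n) - L2_fourier u)
      \<le> L2_norm lborel (fourier_integral (X n) - fourier_integral (?T n)) + L2_norm lborel (fourier_integral (?T n) - L2_fourier u)"
      by (intro L2.nrm_triangle_diff plancherel_L1_L2 X trunc_L2 trunc_integrable u L2_fourier_L2)
    moreover have "L2_norm lborel (fourier_integral (X n) - fourier_integral (?T n)) = \<kappa> * L2_norm lborel (X n - ?T n)"
      unfolding \<kappa>_def by (intro plancherel_diff X trunc_L2 trunc_integrable u)
    moreover have "L2_norm lborel (X n - ?T n) \<le> L2_norm lborel (X n - u) + L2_norm lborel (?T n - u)"
      using L2.nrm_triangle_diff[OF X(1) u trunc_L2[OF u], of n "real n"]
          L2.nrm_minus_commute[OF u trunc_L2[OF u], of "real n"] by simp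
    ultimately show "norm (L2_norm lborel (fourier_integral (X n) - L2_fourier u))
       \<le> \<kappa> * (L2_norm lborel (X n - u) + L2_norm lborel (?T n - u)) + L2_norm lborel (fourier_integral (?T n) - L2_fourier u)"
      using \<kappa> by (simp, smt (verit) mult_left_mono)
  qed
qed

lemma L2_fourier_trunc_approx:
  "u \<in> L2_space lborel \<Longrightarrow>
    (\<lambda>n. L2_norm lborel (fourier_integral (trunc (real n) u) - L2_fourier u)) \<longlonglongrightarrow> 0"
  by (intro L2_fourier_approx trunc_L2 trunc_integrable trunc_tendsto_seq)

lemma L2_fourier_unique:
  fixes u :: "'a::euclidean_space \<Rightarrow> real"
  assumes u: "u \<in> L2_space lborel" and X: "\<And>n. X n \<in> L2_space lborel" "\<And>n. integrable lborel (X n)"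
    and lim: "(\<lambda>n. L2_norm lborel (X n - u)) \<longlonglongrightarrow> 0"
    and W: "W \<in> L2_space lborel" "(\<lambda>n. L2_norm lborel (fourier_integral (X n) - W)) \<longlonglongrightarrow> 0"
  shows "AE \<xi> in lborel. L2_fourier u \<xi> = W \<xi>"
  by (rule L2_limit_unique[where X="\<lambda>n. fourier_integral (X n)"])
    (intro plancherel_L1_L2 X L2_fourier_L2 L2_fourier_approx u lim W)+

lemma L2_fourier_eq_fourier_integral:
  assumes "u \<in> L2_space lborel" "integrable lborel u"
  shows "AE \<xi> in lborel. L2_fourier u \<xi> = fourier_integral u \<xi>"
  by (rule L2_fourier_unique[where X="\<lambda>_. u"])
    (auto simp: assms L2.nrm_zero intro: plancherel_L1_L2)

lemma L2_fourier_add: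
  assumes u: "u \<in> L2_space lborel" and v: "v \<in> L2_space lborel"
  shows "AE \<xi> in lborel. L2_fourier (u + v) \<xi> = (L2_fourier u + L2_fourier v) \<xi>"
proof (rule L2_fourier_unique[where X="\<lambda>n. trunc (real n) u + trunc (real n) v"])
  show "u + v \<in> L2_space lborel" "\<And>n. trunc (real n) u + trunc (real n) v \<in> L2_space lborel"
    "L2_fourier u + L2_fourier v \<in> L2_space lborel"
    by (intro L2.add_mem trunc_L2 L2_fourier_L2 u v)+
  show "integrable lborel (trunc (real n) u + trunc (real n) v)" for n
    using trunc_integrable[OF u] trunc_integrable[OF v] by (simp add: plus_fun_def)
  have "trunc (real n) u + trunc (real n) v = trunc (real n) (u + v)" for n
    by (simp add: trunc_def fun_eq_iff algebra_simps)
  then show "(\<lambda>n. L2_norm lborel (trunc (real n) u + trunc (real n) v - (u + v))) \<longlonglongrightarrow> 0"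
    using trunc_tendsto_seq[OF L2.add_mem[OF u v]] by simp
  have l: "(\<lambda>n. L2_norm lborel (fourier_integral (trunc (real n) u) - L2_fourier u)
         + L2_norm lborel (fourier_integral (trunc (real n) v) - L2_fourier v)) \<longlonglongrightarrow> 0"
    using tendsto_add[OF L2_fourier_trunc_approx[OF u] L2_fourier_trunc_approx[OF v]] by simp
  show "(\<lambda>n. L2_norm lborel (fourier_integral (trunc (real n) u + trunc (real n) v) - (L2_fourier u + L2_fourier v))) \<longlonglongrightarrow> 0"
  proof (rule Lim_null_comparison[OF _ l], intro always_eventually allI)
    fix n
    have eq: "fourier_integral (trunc (real n) u + trunc (real n) v) - (L2_fourier u + L2_fourier v)
      = (fourier_integral (trunc (real n) u) - L2_fourier u) + (fourier_integral (trunc (real n) v) - L2_fourier v)"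
      by (simp add: fourier_integral_add trunc_integrable u v)
    have "L2_norm lborel (fourier_integral (trunc (real n) u + trunc (real n) v) - (L2_fourier u + L2_fourier v))
      \<le> L2_norm lborel (fourier_integral (trunc (real n) u) - L2_fourier u)
         + L2_norm lborel (fourier_integral (trunc (real n) v) - L2_fourier v)"
      unfolding eq by (intro L2.nrm_triangle L2.diff_mem plancherel_L1_L2 trunc_L2 trunc_integrable u v L2_fourier_L2)
    then show "norm (L2_norm lborel (fourier_integral (trunc (real n) u + trunc (real n) v) - (L2_fourier u + L2_fourier v)))
      \<le> L2_norm lborel (fourier_integral (trunc (real n) u) - L2_fourier u)
         + L2_norm lborel (fourier_integral (trunc (real n) v) - L2_fourier v)"
      by simp
  qed
qed

lemma L2_fourier_scale:
  assumes u: "u \<in> L2_space lborel"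
  shows "AE \<xi> in lborel. L2_fourier (c *\<^sub>R u) \<xi> = (c *\<^sub>R L2_fourier u) \<xi>"
proof (rule L2_fourier_unique[where X="\<lambda>n. c *\<^sub>R trunc (real n) u"])
  show "c *\<^sub>R u \<in> L2_space lborel" "\<And>n. c *\<^sub>R trunc (real n) u \<in> L2_space lborel"
    "c *\<^sub>R L2_fourier u \<in> L2_space lborel"
    by (intro L2.scale_mem trunc_L2 L2_fourier_L2 u)+
  show "integrable lborel (c *\<^sub>R trunc (real n) u)" for n
    using trunc_integrable[OF u] by (simp add: scaleR_fun_def)
  have "c *\<^sub>R trunc (real n) u = trunc (real n) (c *\<^sub>R u)" for n
    by (simp add: trunc_def scaleR_fun_def fun_eq_iff algebra_simps)
  then show "(\<lambda>n. L2_norm lborel (c *\<^sub>R trunc (real n) u - c *\<^sub>R u)) \<longlonglongrightarrow> 0"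
    using trunc_tendsto_seq[OF L2.scale_mem[OF u]] by simp
  have "fourier_integral (c *\<^sub>R trunc (real n) u) - c *\<^sub>R L2_fourier u
      = c *\<^sub>R (fourier_integral (trunc (real n) u) - L2_fourier u)" for n
    by (simp add: fourier_integral_scale scaleR_diff_right)
  then have "L2_norm lborel (fourier_integral (c *\<^sub>R trunc (real n) u) - c *\<^sub>R L2_fourier u)
      = \<bar>c\<bar> * L2_norm lborel (fourier_integral (trunc (real n) u) - L2_fourier u)" for n
    by (simp add: L2.nrm_scale L2.mem plancherel_L1_L2 trunc_L2 trunc_integrable u L2_fourier_L2)
  then show "(\<lambda>n. L2_norm lborel (fourier_integral (c *\<^sub>R trunc (real n) u) - c *\<^sub>R L2_fourier u)) \<longlonglongrightarrow> 0"
    using tendsto_mult[OF tendsto_const[of "\<bar>c\<bar>"] L2_fourier_trunc_approx[OF u]] by simp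
qed

theorem plancherel:
  fixes u :: "'a::euclidean_space \<Rightarrow> real"
  assumes u: "u \<in> L2_space lborel"
  shows "L2_norm lborel (L2_fourier u) = gauss_const TYPE('a) * L2_norm lborel u"
proof (rule LIMSEQ_unique)
  show "(\<lambda>n. L2_norm lborel (fourier_integral (trunc (real n) u))) \<longlonglongrightarrow> L2_norm lborel (L2_fourier u)"
    by (intro L2.nrm_tendsto plancherel_L1_L2 trunc_L2 trunc_integrable L2_fourier_L2 L2_fourier_trunc_approx u)
  have "(\<lambda>n. L2_norm lborel (trunc (real n) u)) \<longlonglongrightarrow> L2_norm lborel u"
    by (intro L2.nrm_tendsto trunc_L2 trunc_tendsto_seq u)
  then show "(\<lambda>n. L2_norm lborel (fourier_integral (trunc (real n) u))) \<longlonglongrightarrow> gauss_const TYPE('a) * L2_norm lborel u"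
    by (simp add: plancherel_L1_L2 trunc_L2 trunc_integrable u tendsto_mult_left)
qed

lemma L2_fourier_diff:
  assumes u: "u \<in> L2_space lborel" and v: "v \<in> L2_space lborel"
  shows "AE \<xi> in lborel. L2_fourier (u - v) \<xi> = (L2_fourier u - L2_fourier v) \<xi>"
proof -
  have "u + (-1) *\<^sub>R v = u - v" by simp
  then have "AE \<xi> in lborel. L2_fourier (u - v) \<xi> = (L2_fourier u + L2_fourier ((-1) *\<^sub>R v)) \<xi>"
    using L2_fourier_add[OF u L2.scale_mem[OF v, of "-1"]] by (simp only:)
  moreover have "AE \<xi> in lborel. L2_fourier ((-1) *\<^sub>R v) \<xi> = ((-1) *\<^sub>R L2_fourier v) \<xi>"
    by (rule L2_fourier_scale[OF v])
  ultimately show ?thesis by eventually_elim (simp add: scaleR_fun_def)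
qed

lemma L2_norm_fourier_diff:
  fixes u v :: "'a::euclidean_space \<Rightarrow> real"
  assumes u: "u \<in> L2_space lborel" and v: "v \<in> L2_space lborel"
  shows "L2_norm lborel (L2_fourier u - L2_fourier v) = gauss_const TYPE('a) * L2_norm lborel (u - v)"
proof -
  have "L2_norm lborel (L2_fourier u - L2_fourier v) = L2_norm lborel (L2_fourier (u - v))"
    by (rule L2_norm_cong_AE[symmetric, OF L2_fourier_diff[OF u v]]) (intro L2.mem L2_fourier_L2 u v)+
  then show ?thesis by (simp add: plancherel L2.mem u v)
qed

lemma L2_fourier_cong_AE:
  assumes "AE x in lborel. u x = v x" and u: "u \<in> L2_space lborel" and v: "v \<in> L2_space lborel"
  shows "AE \<xi> in lborel. L2_fourier u \<xi> = L2_fourier v \<xi>"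
proof -
  have "L2_norm lborel (u - v) = 0" using assms by (simp add: L2_norm_diff_eq_0_iff)
  then have "L2_norm lborel (L2_fourier u - L2_fourier v) = 0" by (simp add: L2_norm_fourier_diff u v)
  then show ?thesis by (simp add: L2_norm_diff_eq_0_iff L2_fourier_L2 u v)
qed

lemma L2_fourier_tendsto:
  assumes "\<And>n. X n \<in> L2_space lborel" "u \<in> L2_space lborel" "(\<lambda>n. L2_norm lborel (X n - u)) \<longlonglongrightarrow> 0"
  shows "(\<lambda>n. L2_norm lborel (L2_fourier (X n) - L2_fourier u)) \<longlonglongrightarrow> 0"
  using tendsto_mult_left[OF assms(3)] by (simp add: L2_norm_fourier_diff assms)

theorem parseval:
  fixes u v :: "'a::euclidean_space \<Rightarrow> real"
  assumes u: "u \<in> L2_space lborel" and v: "v \<in> L2_space lborel"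
  shows "L2_inner lborel (L2_fourier u) (L2_fourier v) = (gauss_const TYPE('a))\<^sup>2 * L2_inner lborel u v"
proof -
  have pol: "2 * L2_inner M f g = (L2_norm M (f + g))\<^sup>2 - (L2_norm M f)\<^sup>2 - (L2_norm M g)\<^sup>2"
    if "f \<in> L2_space M" "g \<in> L2_space M" for f g :: "'a \<Rightarrow> 'b::euclidean_space" and M
    using that by (simp add: L2.nrm_sq L2.mem L2.ips L2.ip_sym[of g M f])
  have "L2_norm lborel (L2_fourier u + L2_fourier v) = L2_norm lborel (L2_fourier (u + v))"
    by (rule L2_norm_cong_AE[symmetric, OF L2_fourier_add[OF u v]]) (intro L2.mem L2_fourier_L2 u v)+
  then have "2 * L2_inner lborel (L2_fourier u) (L2_fourier v) = (gauss_const TYPE('a))\<^sup>2 * (2 * L2_inner lborel u v)"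
    unfolding pol[OF u v] pol[OF L2_fourier_L2[OF u] L2_fourier_L2[OF v]]
    by (simp add: plancherel u v L2.mem power_mult_distrib algebra_simps)
  then show ?thesis by simp
qed

text \<open>Pointwise identities for Fourier integrals pass to the \<open>L\<^sup>2\<close> transform by truncation.\<close>

lemma L2_fourier_translate:
  assumes u: "u \<in> L2_space lborel"
  shows "AE \<xi> in lborel. L2_fourier (translate h u) \<xi> = cis (h \<bullet> \<xi>) * L2_fourier u \<xi>"
proof (rule L2_fourier_unique[where X="\<lambda>n. translate h (trunc (real n) u)"])
  have [measurable]: "u \<in> borel_measurable borel" using L2_measurable[OF u] by simp
  note FL = L2_fourier_L2[OF u]
  have [measurable]: "L2_fourier u \<in> borel_measurable borel" using L2_measurable[OF FL] by simp
  have mult: "(\<lambda>\<xi>. cis (h \<bullet> \<xi>) * f \<xi>) \<in> L2_space lborel"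
    "L2_norm lborel (\<lambda>\<xi>. cis (h \<bullet> \<xi>) * f \<xi>) = L2_norm lborel f" if f: "f \<in> L2_space lborel" for f
  proof -
    have [measurable]: "f \<in> borel_measurable borel" using L2_measurable[OF f] by simp
    show "(\<lambda>\<xi>. cis (h \<bullet> \<xi>) * f \<xi>) \<in> L2_space lborel"
      by (rule L2_dominated[OF f]) (auto simp: norm_mult)
    show "L2_norm lborel (\<lambda>\<xi>. cis (h \<bullet> \<xi>) * f \<xi>) = L2_norm lborel f"
      by (simp add: L2_norm_def norm_mult)
  qed
  show "translate h u \<in> L2_space lborel" "\<And>n. translate h (trunc (real n) u) \<in> L2_space lborel"
    by (intro translate_L2 trunc_L2 u)+
  show "integrable lborel (translate h (trunc (real n) u))" for n
    unfolding translate_def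
    by (rule integrable_measure_preserving[OF measure_preserving_translate trunc_integrable[OF u]])
  have "translate h (trunc (real n) u) - translate h u = translate h (trunc (real n) u - u)" for n
    by (simp add: translate_def fun_eq_iff)
  then show "(\<lambda>n. L2_norm lborel (translate h (trunc (real n) u) - translate h u)) \<longlonglongrightarrow> 0"
    using trunc_tendsto_seq[OF u] by (simp add: translate_L2 L2.mem trunc_L2 u)
  show "(\<lambda>\<xi>. cis (h \<bullet> \<xi>) * L2_fourier u \<xi>) \<in> L2_space lborel" by (rule mult[OF FL])
  have "fourier_integral (translate h f) \<xi> = cis (h \<bullet> \<xi>) * fourier_integral f \<xi>"
    if [measurable]: "f \<in> borel_measurable borel" for f \<xi>
  proof -
    have "fourier_integral (translate h f) \<xi> = (LINT x|lborel. cis (- ((x + h - h) \<bullet> \<xi>)) * complex_of_real (f (x + h)))"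
      by (simp add: fourier_integral_def translate_def)
    also have "\<dots> = (LINT x|lborel. cis (- ((x - h) \<bullet> \<xi>)) * complex_of_real (f x))"
      by (rule integral_measure_preserving[OF measure_preserving_translate]) measurable
    also have "\<dots> = (LINT x|lborel. cis (h \<bullet> \<xi>) * (cis (- (x \<bullet> \<xi>)) * complex_of_real (f x)))"
      unfolding mult.assoc[symmetric] cis_mult by (simp add: inner_diff_left)
    finally show ?thesis by (simp add: fourier_integral_def)
  qed
  moreover have "trunc R u \<in> borel_measurable borel" for R using L2_measurable[OF trunc_L2[OF u]] by simp
  ultimately have "fourier_integral (translate h (trunc (real n) u)) - (\<lambda>\<xi>. cis (h \<bullet> \<xi>) * L2_fourier u \<xi>)
     = (\<lambda>\<xi>. cis (h \<bullet> \<xi>) * (fourier_integral (trunc (real n) u) - L2_fourier u) \<xi>)" for n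
    by (simp add: fun_eq_iff algebra_simps)
  then show "(\<lambda>n. L2_norm lborel (fourier_integral (translate h (trunc (real n) u)) - (\<lambda>\<xi>. cis (h \<bullet> \<xi>) * L2_fourier u \<xi>))) \<longlonglongrightarrow> 0"
    using L2_fourier_trunc_approx[OF u]
    by (simp only: mult(2)[OF L2.diff_mem[OF plancherel_L1_L2(1)[OF trunc_integrable[OF u] trunc_L2[OF u]] FL]])
qed

lemma L2_fourier_reflect:
  assumes u: "u \<in> L2_space lborel"
  shows "AE \<xi> in lborel. L2_fourier (\<lambda>x. u (- x)) \<xi> = L2_fourier u (- \<xi>)"
proof (rule L2_fourier_unique[where X="\<lambda>n x. trunc (real n) u (- x)"])
  have [measurable]: "u \<in> borel_measurable borel" using L2_measurable[OF u] by simp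
  note FL = L2_fourier_L2[OF u]
  note R = measure_preserving_reflect
  show "(\<lambda>x. u (- x)) \<in> L2_space lborel" "\<And>n. (\<lambda>x. trunc (real n) u (- x)) \<in> L2_space lborel"
    "(\<lambda>\<xi>. L2_fourier u (- \<xi>)) \<in> L2_space lborel"
    by (intro L2_measure_preserving[OF R] trunc_L2 u FL)+
  show "integrable lborel (\<lambda>x. trunc (real n) u (- x))" for n
    by (rule integrable_measure_preserving[OF R trunc_integrable[OF u]])
  have "(\<lambda>x. trunc (real n) u (- x)) - (\<lambda>x. u (- x)) = (\<lambda>x. (trunc (real n) u - u) (- x))" for n
    by (simp add: fun_eq_iff)
  then show "(\<lambda>n. L2_norm lborel ((\<lambda>x. trunc (real n) u (- x)) - (\<lambda>x. u (- x)))) \<longlonglongrightarrow> 0"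
    using trunc_tendsto_seq[OF u] by (simp only: L2_measure_preserving(2)[OF R L2.diff_mem[OF trunc_L2[OF u] u]])
  have refl: "fourier_integral (\<lambda>x. f (- x)) \<xi> = fourier_integral f (- \<xi>)"
    if [measurable]: "f \<in> borel_measurable borel" for f \<xi>
    using integral_measure_preserving[OF R, of "\<lambda>x. cis (x \<bullet> \<xi>) * complex_of_real (f x)"]
    by (simp add: fourier_integral_def)
  have "trunc R u \<in> borel_measurable borel" for R using L2_measurable[OF trunc_L2[OF u]] by simp
  from refl[OF this] have "fourier_integral (\<lambda>x. trunc (real n) u (- x)) - (\<lambda>\<xi>. L2_fourier u (- \<xi>))
     = (\<lambda>\<xi>. (fourier_integral (trunc (real n) u) - L2_fourier u) (- \<xi>))" for n
    by (simp add: fun_eq_iff)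
  then show "(\<lambda>n. L2_norm lborel (fourier_integral (\<lambda>x. trunc (real n) u (- x)) - (\<lambda>\<xi>. L2_fourier u (- \<xi>)))) \<longlonglongrightarrow> 0"
    using L2_fourier_trunc_approx[OF u]
    by (simp only: L2_measure_preserving(2)[OF R L2.diff_mem[OF plancherel_L1_L2(1)[OF trunc_integrable[OF u] trunc_L2[OF u]] FL]])
qed

lemma L2_fourier_hermitian:
  assumes u: "u \<in> L2_space lborel"
  shows "AE \<xi> in lborel. L2_fourier u (- \<xi>) = cnj (L2_fourier u \<xi>)"
proof (rule L2_limit_unique[where X="\<lambda>n \<xi>. fourier_integral (trunc (real n) u) (- \<xi>)"])
  note FL = L2_fourier_L2[OF u]
  note R = measure_preserving_reflect
  have fL: "fourier_integral (trunc (real n) u) \<in> L2_space lborel" for n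
    by (intro plancherel_L1_L2 trunc_integrable trunc_L2 u)
  have [measurable]: "L2_fourier u \<in> borel_measurable borel" using L2_measurable[OF FL] by simp
  show "(\<lambda>\<xi>. fourier_integral (trunc (real n) u) (- \<xi>)) \<in> L2_space lborel" for n
    by (rule L2_measure_preserving(1)[OF R fL])
  show "(\<lambda>\<xi>. L2_fourier u (- \<xi>)) \<in> L2_space lborel" by (rule L2_measure_preserving(1)[OF R FL])
  show "(\<lambda>\<xi>. cnj (L2_fourier u \<xi>)) \<in> L2_space lborel"
    by (rule L2_dominated[OF FL]) auto
  have "(\<lambda>\<xi>. fourier_integral (trunc (real n) u) (- \<xi>)) - (\<lambda>\<xi>. L2_fourier u (- \<xi>))
    = (\<lambda>\<xi>. (fourier_integral (trunc (real n) u) - L2_fourier u) (- \<xi>))" for n by (simp add: fun_eq_iff)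
  then show "(\<lambda>n. L2_norm lborel ((\<lambda>\<xi>. fourier_integral (trunc (real n) u) (- \<xi>)) - (\<lambda>\<xi>. L2_fourier u (- \<xi>)))) \<longlonglongrightarrow> 0"
    using L2_fourier_trunc_approx[OF u]
    by (simp only: L2_measure_preserving(2)[OF R L2.diff_mem[OF fL FL]])
  have cnj: "fourier_integral f (- \<xi>) = cnj (fourier_integral f \<xi>)" for f and \<xi> :: 'a
  proof -
    have "fourier_integral f (- \<xi>) = (LINT x|lborel. cnj (cis (- (x \<bullet> \<xi>)) * complex_of_real (f x)))"
      by (simp add: fourier_integral_def cis_cnj)
    then show ?thesis by (simp add: fourier_integral_def del: complex_cnj_mult)
  qed
  have "L2_norm lborel ((\<lambda>\<xi>. fourier_integral (trunc (real n) u) (- \<xi>)) - (\<lambda>\<xi>. cnj (L2_fourier u \<xi>)))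
    = L2_norm lborel (fourier_integral (trunc (real n) u) - L2_fourier u)" for n
    by (simp add: L2_norm_def cnj flip: complex_cnj_diff)
  then show "(\<lambda>n. L2_norm lborel ((\<lambda>\<xi>. fourier_integral (trunc (real n) u) (- \<xi>)) - (\<lambda>\<xi>. cnj (L2_fourier u \<xi>)))) \<longlonglongrightarrow> 0"
    using L2_fourier_trunc_approx[OF u] by simp
qed

lemma L2_Re_Im:
  assumes f: "f \<in> L2_space M"
  shows "(\<lambda>x. Re (f x)) \<in> L2_space M" "L2_norm M (\<lambda>x. Re (f x)) \<le> L2_norm M f"
    "(\<lambda>x. Im (f x)) \<in> L2_space M" "L2_norm M (\<lambda>x. Im (f x)) \<le> L2_norm M f"
proof -
  have [measurable]: "f \<in> borel_measurable M" by (rule L2_measurable[OF f])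
  have "AE x in M. norm (Re (f x)) \<le> norm (f x)" "AE x in M. norm (Im (f x)) \<le> norm (f x)"
    by (auto simp: abs_Re_le_cmod abs_Im_le_cmod)
  then show "(\<lambda>x. Re (f x)) \<in> L2_space M" "L2_norm M (\<lambda>x. Re (f x)) \<le> L2_norm M f"
    "(\<lambda>x. Im (f x)) \<in> L2_space M" "L2_norm M (\<lambda>x. Im (f x)) \<le> L2_norm M f"
    by (auto intro!: L2_norm_mono[OF _ f] L2_dominated[OF f])
qed

lemma L2_fourier_multiplication_formula:
  assumes u: "u \<in> L2_space lborel" and v: "v \<in> L2_space lborel"
  shows "L2_inner lborel (\<lambda>\<xi>. Re (L2_fourier u \<xi>)) v = L2_inner lborel u (\<lambda>\<xi>. Re (L2_fourier v \<xi>))"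
    and "L2_inner lborel (\<lambda>\<xi>. Im (L2_fourier u \<xi>)) v = L2_inner lborel u (\<lambda>\<xi>. Im (L2_fourier v \<xi>))"
proof -
  let ?u = "\<lambda>n. trunc (real n) u" and ?v = "\<lambda>n. trunc (real n) v"
  let ?F = "\<lambda>u n. fourier_integral (trunc (real n) u)"
  have FL: "?F w n \<in> L2_space lborel" if "w \<in> L2_space lborel" for w :: "'a \<Rightarrow> real" and n
    by (intro plancherel_L1_L2 trunc_integrable trunc_L2 that)
  have lim: "(\<lambda>n. L2_norm lborel ((\<lambda>\<xi>. Re (?F w n \<xi>)) - (\<lambda>\<xi>. Re (L2_fourier w \<xi>)))) \<longlonglongrightarrow> 0"
    "(\<lambda>n. L2_norm lborel ((\<lambda>\<xi>. Im (?F w n \<xi>)) - (\<lambda>\<xi>. Im (L2_fourier w \<xi>)))) \<longlonglongrightarrow> 0"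
    if w: "w \<in> L2_space lborel" for w :: "'a \<Rightarrow> real"
  proof -
    have d: "?F w n - L2_fourier w \<in> L2_space lborel" for n by (intro L2.diff_mem FL L2_fourier_L2 w)
    have eq: "(\<lambda>\<xi>. Re (?F w n \<xi>)) - (\<lambda>\<xi>. Re (L2_fourier w \<xi>)) = (\<lambda>\<xi>. Re ((?F w n - L2_fourier w) \<xi>))"
      "(\<lambda>\<xi>. Im (?F w n \<xi>)) - (\<lambda>\<xi>. Im (L2_fourier w \<xi>)) = (\<lambda>\<xi>. Im ((?F w n - L2_fourier w) \<xi>))" for n
      by (simp_all add: fun_eq_iff)
    show "(\<lambda>n. L2_norm lborel ((\<lambda>\<xi>. Re (?F w n \<xi>)) - (\<lambda>\<xi>. Re (L2_fourier w \<xi>)))) \<longlonglongrightarrow> 0"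
      by (rule Lim_null_comparison[OF _ L2_fourier_trunc_approx[OF w]], unfold eq)
        (use L2_Re_Im(2)[OF d] in auto)
    show "(\<lambda>n. L2_norm lborel ((\<lambda>\<xi>. Im (?F w n \<xi>)) - (\<lambda>\<xi>. Im (L2_fourier w \<xi>)))) \<longlonglongrightarrow> 0"
      by (rule Lim_null_comparison[OF _ L2_fourier_trunc_approx[OF w]], unfold eq)
        (use L2_Re_Im(4)[OF d] in auto)
  qed
  have c: "L2_inner lborel (\<lambda>\<xi>. Re (?F u n \<xi>)) (?v n) = L2_inner lborel (?u n) (\<lambda>\<xi>. Re (?F v n \<xi>))"
     "L2_inner lborel (\<lambda>\<xi>. Im (?F u n \<xi>)) (?v n) = L2_inner lborel (?u n) (\<lambda>\<xi>. Im (?F v n \<xi>))" for n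
  proof -
    have ic: "integrable lborel (\<lambda>x. complex_of_real (?u n x))" "integrable lborel (\<lambda>x. complex_of_real (?v n x))"
      using trunc_integrable u v by (auto intro: integrable_of_real)
    have int: "integrable lborel (\<lambda>\<xi>. ?F w n \<xi> * complex_of_real (trunc (real n) w' \<xi>))"
      if w: "w \<in> L2_space lborel" and w': "w' \<in> L2_space lborel" for w w' :: "'a \<Rightarrow> real"
    proof -
      have [measurable]: "?F w n \<in> borel_measurable borel" "trunc (real n) w' \<in> borel_measurable borel"
        using L2_measurable[OF FL[OF w]] L2_measurable[OF trunc_L2[OF w']] by auto
      show ?thesis
      proof (rule Bochner_Integration.integrable_bound)
        have "(\<lambda>\<xi>. cmod (?F w n \<xi>)) \<in> L2_space lborel" by (rule L2_dominated[OF FL[OF w, of n]]) auto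
        moreover have "(\<lambda>\<xi>. \<bar>trunc (real n) w' \<xi>\<bar>) \<in> L2_space lborel"
          by (rule L2_dominated[OF trunc_L2[OF w', of "real n"]]) auto
        ultimately show "integrable lborel (\<lambda>\<xi>. cmod (?F w n \<xi>) * \<bar>trunc (real n) w' \<xi>\<bar>)"
          by (rule integrable_L2_mult)
      qed (auto simp: norm_mult)
    qed
    have eq: "(LINT \<xi>|lborel. ?F u n \<xi> * complex_of_real (?v n \<xi>)) = (LINT x|lborel. ?F v n x * complex_of_real (?u n x))"
      using ft_multiplication_formula[OF ic] by (simp add: fourier_integral_ft mult.commute)
    have "(LINT \<xi>|lborel. Re (?F u n \<xi> * complex_of_real (?v n \<xi>))) = (LINT x|lborel. Re (?F v n x * complex_of_real (?u n x)))"
      unfolding integral_Re[OF int[OF u v]] integral_Re[OF int[OF v u]] eq ..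
    then show "L2_inner lborel (\<lambda>\<xi>. Re (?F u n \<xi>)) (?v n) = L2_inner lborel (?u n) (\<lambda>\<xi>. Re (?F v n \<xi>))"
      by (simp add: L2_inner_def mult.commute)
    have "(LINT \<xi>|lborel. Im (?F u n \<xi> * complex_of_real (?v n \<xi>))) = (LINT x|lborel. Im (?F v n x * complex_of_real (?u n x)))"
      unfolding integral_Im[OF int[OF u v]] integral_Im[OF int[OF v u]] eq ..
    then show "L2_inner lborel (\<lambda>\<xi>. Im (?F u n \<xi>)) (?v n) = L2_inner lborel (?u n) (\<lambda>\<xi>. Im (?F v n \<xi>))"
      by (simp add: L2_inner_def mult.commute)
  qed
  show "L2_inner lborel (\<lambda>\<xi>. Re (L2_fourier u \<xi>)) v = L2_inner lborel u (\<lambda>\<xi>. Re (L2_fourier v \<xi>))"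
  proof (rule LIMSEQ_unique)
    show "(\<lambda>n. L2_inner lborel (\<lambda>\<xi>. Re (?F u n \<xi>)) (?v n)) \<longlonglongrightarrow> L2_inner lborel (\<lambda>\<xi>. Re (L2_fourier u \<xi>)) v"
      by (intro L2_inner_tendsto L2_Re_Im FL L2_fourier_L2 u v trunc_L2 lim trunc_tendsto_seq)
    show "(\<lambda>n. L2_inner lborel (\<lambda>\<xi>. Re (?F u n \<xi>)) (?v n)) \<longlonglongrightarrow> L2_inner lborel u (\<lambda>\<xi>. Re (L2_fourier v \<xi>))"
      unfolding c by (intro L2_inner_tendsto L2_Re_Im FL L2_fourier_L2 u v trunc_L2 lim trunc_tendsto_seq)
  qed
  show "L2_inner lborel (\<lambda>\<xi>. Im (L2_fourier u \<xi>)) v = L2_inner lborel u (\<lambda>\<xi>. Im (L2_fourier v \<xi>))"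
  proof (rule LIMSEQ_unique)
    show "(\<lambda>n. L2_inner lborel (\<lambda>\<xi>. Im (?F u n \<xi>)) (?v n)) \<longlonglongrightarrow> L2_inner lborel (\<lambda>\<xi>. Im (L2_fourier u \<xi>)) v"
      by (intro L2_inner_tendsto L2_Re_Im FL L2_fourier_L2 u v trunc_L2 lim trunc_tendsto_seq)
    show "(\<lambda>n. L2_inner lborel (\<lambda>\<xi>. Im (?F u n \<xi>)) (?v n)) \<longlonglongrightarrow> L2_inner lborel u (\<lambda>\<xi>. Im (L2_fourier v \<xi>))"
      unfolding c by (intro L2_inner_tendsto L2_Re_Im FL L2_fourier_L2 u v trunc_L2 lim trunc_tendsto_seq)
  qed
qed

text \<open>
  The orthogonal complement of the range of the Fourier transform among Hermitian functions is
  trivial: if \<open>D = P + i Q\<close> is orthogonal to every \<open>\<F> u\<close>, the multiplication formula gives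
  \<open>Re \<F> P + Im \<F> Q = 0\<close>. As \<open>P\<close> is even and \<open>Q\<close> is odd, both terms vanish, and so do \<open>P\<close> and \<open>Q\<close>.
\<close>

lemma hermitian_orthogonal_to_range:
  fixes D :: "'a::euclidean_space \<Rightarrow> complex"
  assumes D: "D \<in> L2_space lborel" and herm: "AE \<xi> in lborel. D (- \<xi>) = cnj (D \<xi>)"
    and orth: "\<And>u. u \<in> L2_space lborel \<Longrightarrow> L2_inner lborel D (L2_fourier u) = 0"
  shows "AE \<xi> in lborel. D \<xi> = 0"
proof -
  define P where "P \<xi> = Re (D \<xi>)" for \<xi>
  define Q where "Q \<xi> = Im (D \<xi>)" for \<xi>
  have P: "P \<in> L2_space lborel" and Q: "Q \<in> L2_space lborel"
    unfolding P_def[abs_def] Q_def[abs_def] by (intro L2_Re_Im D)+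
  note FP = L2_fourier_L2[OF P] and FQ = L2_fourier_L2[OF Q]
  let ?G = "(\<lambda>\<xi>. Re (L2_fourier P \<xi>)) + (\<lambda>\<xi>. Im (L2_fourier Q \<xi>))"
  have G: "?G \<in> L2_space lborel" by (intro L2.add_mem L2_Re_Im FP FQ)
  have "L2_inner lborel ?G u = 0" if u: "u \<in> L2_space lborel" for u
  proof -
    note FU = L2_fourier_L2[OF u]
    have "L2_inner lborel ?G u = L2_inner lborel (\<lambda>\<xi>. Re (L2_fourier P \<xi>)) u + L2_inner lborel (\<lambda>\<xi>. Im (L2_fourier Q \<xi>)) u"
      by (intro L2.ip_add L2_Re_Im FP FQ u)
    also have "\<dots> = L2_inner lborel P (\<lambda>\<xi>. Re (L2_fourier u \<xi>)) + L2_inner lborel Q (\<lambda>\<xi>. Im (L2_fourier u \<xi>))"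
      by (simp add: L2_fourier_multiplication_formula P Q u)
    also have "\<dots> = L2_inner lborel D (L2_fourier u)"
      using integrable_L2_inner[OF P L2_Re_Im(1)[OF FU]] integrable_L2_inner[OF Q L2_Re_Im(3)[OF FU]]
      by (simp add: L2_inner_def inner_complex_def P_def Q_def)
    finally show ?thesis using orth[OF u] by simp
  qed
  from this[OF G] have "L2_norm lborel ?G = 0" using L2.nrm_sq[OF G] by simp
  then have zero: "AE \<xi> in lborel. Re (L2_fourier P \<xi>) + Im (L2_fourier Q \<xi>) = 0"
    by (simp add: L2_norm_eq_0_iff[OF G])
  note R = measure_preserving_reflect
  have "AE \<xi> in lborel. P (- \<xi>) = P \<xi>" using herm by eventually_elim (simp add: P_def)
  then have "AE \<xi> in lborel. L2_fourier (\<lambda>x. P (- x)) \<xi> = L2_fourier P \<xi>"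
    by (intro L2_fourier_cong_AE L2_measure_preserving[OF R] P)
  then have P_even: "AE \<xi> in lborel. L2_fourier P (- \<xi>) = L2_fourier P \<xi> \<and> Im (L2_fourier P \<xi>) = 0"
    using L2_fourier_reflect[OF P] L2_fourier_hermitian[OF P]
  proof eventually_elim
    case (elim \<xi>)
    then have eq: "L2_fourier P \<xi> = cnj (L2_fourier P \<xi>)" by simp
    have "Im (L2_fourier P \<xi>) = - Im (L2_fourier P \<xi>)" using arg_cong[OF eq, of Im] by simp
    then show ?case using elim by simp
  qed
  have "AE \<xi> in lborel. Q (- \<xi>) = ((-1) *\<^sub>R Q) \<xi>" using herm by eventually_elim (simp add: Q_def scaleR_fun_def)
  then have "AE \<xi> in lborel. L2_fourier (\<lambda>x. Q (- x)) \<xi> = L2_fourier ((-1) *\<^sub>R Q) \<xi>"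
    by (intro L2_fourier_cong_AE L2_measure_preserving[OF R] L2.scale_mem Q)
  then have Q_odd: "AE \<xi> in lborel. L2_fourier Q (- \<xi>) = - L2_fourier Q \<xi> \<and> Re (L2_fourier Q \<xi>) = 0"
    using L2_fourier_reflect[OF Q] L2_fourier_hermitian[OF Q] L2_fourier_scale[OF Q, of "-1"]
  proof eventually_elim
    case (elim \<xi>)
    then have eq: "- L2_fourier Q \<xi> = cnj (L2_fourier Q \<xi>)" by (simp add: scaleR_fun_def)
    have "- Re (L2_fourier Q \<xi>) = Re (L2_fourier Q \<xi>)" using arg_cong[OF eq, of Re] by simp
    then show ?case using elim eq by simp
  qed
  have both: "AE \<xi> in lborel. L2_fourier P \<xi> = 0 \<and> L2_fourier Q \<xi> = 0"
    using zero AE_measure_preserving[OF R zero] P_even Q_odd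
    by eventually_elim (auto simp: complex_eq_iff)
  have "L2_norm lborel (L2_fourier P) = 0" "L2_norm lborel (L2_fourier Q) = 0"
    using both by (auto simp: L2_norm_eq_0_iff FP FQ)
  then have "AE \<xi> in lborel. P \<xi> = 0" "AE \<xi> in lborel. Q \<xi> = 0"
    by (simp_all add: plancherel P Q L2_norm_eq_0_iff)
  then show ?thesis by eventually_elim (simp add: complex_eq_iff P_def Q_def)
qed

text \<open>
  The functional \<open>u \<mapsto> \<langle>\<F> u, W\<rangle>\<close> is represented by some \<open>w\<close>. By Parseval's identity \<open>W\<close> minus a multiple of
  \<open>\<F> w\<close> is orthogonal to the range, hence zero.
\<close>

theorem L2_fourier_range:
  fixes W :: "'a::euclidean_space \<Rightarrow> complex"
  assumes W: "W \<in> L2_space lborel" and herm: "AE \<xi> in lborel. W (- \<xi>) = cnj (W \<xi>)"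
  shows "\<exists>w\<in>L2_space lborel. AE \<xi> in lborel. L2_fourier w \<xi> = W \<xi>"
proof -
  define \<kappa> where "\<kappa> = gauss_const TYPE('a)"
  have \<kappa>: "\<kappa> > 0" by (simp add: \<kappa>_def)
  have "\<exists>w\<in>L2_space lborel. \<forall>u\<in>L2_space lborel. L2_inner lborel w u = L2_inner lborel (L2_fourier u) W"
  proof (rule L2.riesz[where K="\<kappa> * L2_norm lborel W"])
    fix u v :: "'a \<Rightarrow> real" assume u: "u \<in> L2_space lborel" and v: "v \<in> L2_space lborel"
    have "L2_inner lborel (L2_fourier (u + v)) W = L2_inner lborel (L2_fourier u + L2_fourier v) W"
      by (intro L2_inner_cong_AE L2_fourier_add L2.mem L2_fourier_L2 u v W)
    then show "L2_inner lborel (L2_fourier (u + v)) W = L2_inner lborel (L2_fourier u) W + L2_inner lborel (L2_fourier v) W"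
      by (simp add: L2.ip_add L2_fourier_L2 u v W)
  next
    fix c and u :: "'a \<Rightarrow> real" assume u: "u \<in> L2_space lborel"
    have "L2_inner lborel (L2_fourier (c *\<^sub>R u)) W = L2_inner lborel (c *\<^sub>R L2_fourier u) W"
      by (intro L2_inner_cong_AE L2_fourier_scale L2.mem L2_fourier_L2 u W)
    then show "L2_inner lborel (L2_fourier (c *\<^sub>R u)) W = c * L2_inner lborel (L2_fourier u) W"
      by (simp add: L2.ip_scale L2_fourier_L2 u W)
    show "\<bar>L2_inner lborel (L2_fourier u) W\<bar> \<le> \<kappa> * L2_norm lborel W * L2_norm lborel u"
      using L2.cauchy_schwarz[OF L2_fourier_L2[OF u] W] by (simp add: plancherel u \<kappa>_def mult_ac)
  qed
  then obtain w where w: "w \<in> L2_space lborel"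
    "\<And>u. u \<in> L2_space lborel \<Longrightarrow> L2_inner lborel w u = L2_inner lborel (L2_fourier u) W" by blast
  define w' where "w' = (1 / \<kappa>\<^sup>2) *\<^sub>R w"
  have w': "w' \<in> L2_space lborel" unfolding w'_def by (intro L2.scale_mem w)
  let ?D = "W - L2_fourier w'"
  have D: "?D \<in> L2_space lborel" by (intro L2.diff_mem W L2_fourier_L2 w')
  have "AE \<xi> in lborel. ?D \<xi> = 0"
  proof (rule hermitian_orthogonal_to_range[OF D])
    show "AE \<xi> in lborel. ?D (- \<xi>) = cnj (?D \<xi>)"
      using herm L2_fourier_hermitian[OF w'] by eventually_elim simp
    fix u :: "'a \<Rightarrow> real" assume u: "u \<in> L2_space lborel"
    have "L2_inner lborel (L2_fourier w') (L2_fourier u) = \<kappa>\<^sup>2 * L2_inner lborel w' u"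
      unfolding \<kappa>_def by (rule parseval[OF w' u])
    also have "\<dots> = L2_inner lborel w u" using \<kappa> by (simp add: w'_def L2.ip_scale w u)
    finally show "L2_inner lborel ?D (L2_fourier u) = 0"
      by (simp add: L2.ip_diff W L2_fourier_L2 w' u w(2) L2.ip_sym)
  qed
  then show ?thesis using w' by (intro bexI[of _ w']) (auto elim: eventually_mono)
qed

section \<open>Sobolev spaces\<close>

text \<open>
  The transform of \<open>(1 - \<Delta>)\<^bsup>r/2\<^esup> u\<close>. It embeds \<open>H\<^sup>r\<close> isometrically into \<open>L\<^sup>2\<close>.
\<close>

definition bessel :: "real \<Rightarrow> ('a::euclidean_space \<Rightarrow> real) \<Rightarrow> 'a \<Rightarrow> complex" where
  "bessel r u = (\<lambda>\<xi>. complex_of_real ((1 + (norm \<xi>)\<^sup>2) powr (r / 2)) * L2_fourier u \<xi>)"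

definition sobolev_inner :: "real \<Rightarrow> ('a::euclidean_space \<Rightarrow> real) \<Rightarrow> ('a \<Rightarrow> real) \<Rightarrow> real" where
  "sobolev_inner r u v = L2_inner lborel (bessel r u) (bessel r v)"

lemma cmod_bessel_sq: "(cmod (bessel r u \<xi>))\<^sup>2 = (1 + (norm \<xi>)\<^sup>2) powr r * (cmod (L2_fourier u \<xi>))\<^sup>2"
proof -
  have "1 + (norm \<xi>)\<^sup>2 > 0" by (simp add: add_pos_nonneg)
  then have "((1 + (norm \<xi>)\<^sup>2) powr (r / 2))\<^sup>2 = (1 + (norm \<xi>)\<^sup>2) powr r"
    by (simp add: power2_eq_square flip: powr_add)
  then show ?thesis by (simp add: bessel_def norm_mult power_mult_distrib)
qed

lemma bessel_measurable:
  assumes "u \<in> L2_space lborel"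
  shows "bessel r u \<in> borel_measurable lborel"
proof -
  have [measurable]: "L2_fourier u \<in> borel_measurable borel"
    using L2_measurable[OF L2_fourier_L2[OF assms]] by simp
  show ?thesis unfolding bessel_def by measurable
qed

lemma sobolev_iff: "u \<in> sobolev r \<longleftrightarrow> u \<in> L2_space lborel \<and> bessel r u \<in> L2_space lborel"
proof -
  have "bessel r u \<in> L2_space lborel \<longleftrightarrow> integrable lborel (\<lambda>\<xi>. (1 + (norm \<xi>)\<^sup>2) powr r * (cmod (L2_fourier u \<xi>))\<^sup>2)"
    if "u \<in> L2_space lborel"
    using bessel_measurable[OF that, of r] by (simp add: L2_space_def[of lborel] cmod_bessel_sq)
  then show ?thesis by (auto simp: sobolev_def L2_on_UNIV)
qed

lemma sobolev_L2: "u \<in> sobolev r \<Longrightarrow> u \<in> L2_space lborel"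
  by (simp add: sobolev_iff)

lemma bessel_L2: "u \<in> sobolev r \<Longrightarrow> bessel r u \<in> L2_space lborel"
  by (simp add: sobolev_iff)

lemma sobolev_norm_bessel: "sobolev_norm r u = L2_norm lborel (bessel r u)"
  by (simp add: sobolev_norm_def L2_norm_def cmod_bessel_sq)

lemma bessel_add:
  assumes "u \<in> L2_space lborel" "v \<in> L2_space lborel"
  shows "AE \<xi> in lborel. bessel r (u + v) \<xi> = (bessel r u + bessel r v) \<xi>"
  using L2_fourier_add[OF assms] by eventually_elim (simp add: bessel_def ring_distribs)

lemma bessel_scale:
  assumes "u \<in> L2_space lborel"
  shows "AE \<xi> in lborel. bessel r (c *\<^sub>R u) \<xi> = (c *\<^sub>R bessel r u) \<xi>"
  using L2_fourier_scale[OF assms, of c] by eventually_elim (simp add: bessel_def scaleR_fun_def)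

lemma sobolev_cong_AE:
  assumes "AE x in lborel. u x = v x" "u \<in> sobolev r" "v \<in> L2_space lborel"
  shows "v \<in> sobolev r" "AE \<xi> in lborel. bessel r u \<xi> = bessel r v \<xi>"
proof -
  show *: "AE \<xi> in lborel. bessel r u \<xi> = bessel r v \<xi>"
    using L2_fourier_cong_AE[OF assms(1) sobolev_L2[OF assms(2)] assms(3)]
    by eventually_elim (simp add: bessel_def)
  show "v \<in> sobolev r"
    using L2_cong_AE[OF * bessel_L2[OF assms(2)] bessel_measurable[OF assms(3)]] assms(3)
    by (simp add: sobolev_iff)
qed

lemma semi_inner_space_sobolev:
  "semi_inner_space (sobolev r :: ('a::euclidean_space \<Rightarrow> real) set) (sobolev_inner r)"
proof
  fix u v w :: "'a \<Rightarrow> real" and c :: real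
  have z: "L2_norm lborel (L2_fourier (0 :: 'a \<Rightarrow> real)) = 0"
    by (simp add: plancherel L2.zero_mem L2.nrm_zero)
  then have "AE \<xi> in lborel. 0 = bessel r (0 :: 'a \<Rightarrow> real) \<xi>"
    unfolding L2_norm_eq_0_iff[OF L2_fourier_L2[OF L2.zero_mem]]
    by eventually_elim (simp add: bessel_def)
  moreover have "(\<lambda>_. 0) \<in> (L2_space lborel :: ('a \<Rightarrow> complex) set)" by (simp add: L2_space_def)
  ultimately have "bessel r (0 :: 'a \<Rightarrow> real) \<in> L2_space lborel"
    by (rule L2_cong_AE) (rule bessel_measurable[OF L2.zero_mem])
  then show "0 \<in> (sobolev r :: ('a \<Rightarrow> real) set)"
    by (simp add: sobolev_iff L2.zero_mem)
  assume u: "u \<in> sobolev r"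
  note uL = sobolev_L2[OF u] bessel_L2[OF u]
  have sc: "bessel r (c *\<^sub>R u) \<in> L2_space lborel"
  proof (rule L2_cong_AE)
    show "AE x in lborel. (c *\<^sub>R bessel r u) x = bessel r (c *\<^sub>R u) x"
      using bessel_scale[OF uL(1), of r c] by eventually_elim simp
  qed (intro L2.scale_mem uL bessel_measurable)+
  then show "c *\<^sub>R u \<in> sobolev r" by (simp add: sobolev_iff L2.scale_mem uL)
  show "0 \<le> sobolev_inner r u u" by (simp add: sobolev_inner_def L2.ip_nonneg uL)
  assume v: "v \<in> sobolev r"
  note vL = sobolev_L2[OF v] bessel_L2[OF v]
  show "sobolev_inner r u v = sobolev_inner r v u" by (simp add: sobolev_inner_def L2.ip_sym uL vL)
  show "sobolev_inner r (c *\<^sub>R u) v = c * sobolev_inner r u v"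
    using L2_inner_cong_AE[OF bessel_scale[OF uL(1), of r c] sc L2.scale_mem[OF uL(2)] vL(2)]
    by (simp add: sobolev_inner_def L2.ip_scale uL vL)
  have ad: "bessel r (u + v) \<in> L2_space lborel"
  proof (rule L2_cong_AE)
    show "AE x in lborel. (bessel r u + bessel r v) x = bessel r (u + v) x"
      using bessel_add[OF uL(1) vL(1), of r] by eventually_elim simp
  qed (intro L2.add_mem uL vL bessel_measurable)+
  then show "u + v \<in> sobolev r" by (simp add: sobolev_iff L2.add_mem uL vL)
  assume w: "w \<in> sobolev r"
  show "sobolev_inner r (u + v) w = sobolev_inner r u w + sobolev_inner r v w"
    using L2_inner_cong_AE[OF bessel_add[OF uL(1) vL(1), of r] ad L2.add_mem[OF uL(2) vL(2)] bessel_L2[OF w]]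
    by (simp add: sobolev_inner_def L2.ip_add uL vL bessel_L2[OF w])
qed

lemma sobolev_nrm_eq: "semi_inner_space.nrm (sobolev_inner r) = sobolev_norm r"
proof
  fix u
  show "semi_inner_space.nrm (sobolev_inner r) u = sobolev_norm r u"
    unfolding semi_inner_space.nrm_def[OF semi_inner_space_sobolev] sobolev_norm_bessel
      fun_cong[OF L2_nrm_eq, symmetric] semi_inner_space.nrm_def[OF semi_inner_space_L2] sobolev_inner_def ..
qed

interpretation Sob: semi_inner_space "sobolev r" "sobolev_inner r"
    rewrites "semi_inner_space.nrm (sobolev_inner r) = sobolev_norm r" for r
  by (rule semi_inner_space_sobolev sobolev_nrm_eq)+

lemma powr_weight_ge_1: "r \<ge> 0 \<Longrightarrow> 1 \<le> (1 + (norm x)\<^sup>2) powr r"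
  by (rule ge_one_powr_ge_zero) auto

lemma L2_norm_le_sobolev:
  fixes u :: "'a::euclidean_space \<Rightarrow> real"
  assumes u: "u \<in> sobolev r" and r: "r \<ge> 0"
  shows "gauss_const TYPE('a) * L2_norm lborel u \<le> sobolev_norm r u"
proof -
  have "L2_norm lborel (L2_fourier u) \<le> L2_norm lborel (bessel r u)"
  proof (rule L2_norm_mono[OF L2_measurable[OF L2_fourier_L2[OF sobolev_L2[OF u]]] bessel_L2[OF u]], rule AE_I2)
    fix \<xi> :: 'a
    show "norm (L2_fourier u \<xi>) \<le> norm (bessel r u \<xi>)"
      using mult_right_mono[OF powr_weight_ge_1[of "r/2" \<xi>], of "norm (L2_fourier u \<xi>)"] r
      by (simp add: bessel_def norm_mult)
  qed
  then show ?thesis by (simp add: plancherel sobolev_L2[OF u] sobolev_norm_bessel)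
qed

text \<open>
  The transforms of a Cauchy sequence converge in the weighted and in the unweighted \<open>L\<^sup>2\<close>; as the
  weight is at least \<open>1\<close>, the two limits agree.
\<close>

lemma sobolev_complete:
  fixes X :: "nat \<Rightarrow> 'a::euclidean_space \<Rightarrow> real"
  assumes r: "r \<ge> 0" and X: "\<And>n. X n \<in> sobolev r" and cauchy: "Sob.cauchy_seq r X"
  shows "\<exists>u\<in>sobolev r. (\<lambda>n. sobolev_norm r (X n - u)) \<longlonglongrightarrow> 0"
proof -
  define \<kappa> where "\<kappa> = gauss_const TYPE('a)"
  have \<kappa>: "\<kappa> > 0" by (simp add: \<kappa>_def)
  have XL: "X n \<in> L2_space lborel" "bessel r (X n) \<in> L2_space lborel" for n
    using X[of n] by (auto simp: sobolev_iff)
  have bessel_diff: "AE \<xi> in lborel. bessel r (u - v) \<xi> = (bessel r u - bessel r v) \<xi>"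
    if "u \<in> L2_space lborel" "v \<in> L2_space lborel" for u v :: "'a \<Rightarrow> real"
    using L2_fourier_diff[OF that] by eventually_elim (simp add: bessel_def ring_distribs)
  have nd: "L2_norm lborel (bessel r u - bessel r v) = sobolev_norm r (u - v)"
    if u: "u \<in> sobolev r" and v: "v \<in> sobolev r" for u v :: "'a \<Rightarrow> real"
    unfolding sobolev_norm_bessel
    by (rule L2_norm_cong_AE[symmetric, OF bessel_diff[OF sobolev_L2[OF u] sobolev_L2[OF v]]])
      (intro bessel_L2 Sob.diff_mem L2.diff_mem u v)+
  have c1: "\<exists>N. \<forall>m\<ge>N. \<forall>n\<ge>N. L2_norm lborel (bessel r (X m) - bessel r (X n)) < e" if "e > 0" for e
    using cauchy that by (simp add: nd X Sob.cauchy_seq_def)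
  obtain G where G: "G \<in> L2_space lborel" "(\<lambda>n. L2_norm lborel (bessel r (X n) - G)) \<longlonglongrightarrow> 0"
    using L2_complete[OF XL(2) c1] by blast
  have c2: "\<exists>N. \<forall>m\<ge>N. \<forall>n\<ge>N. L2_norm lborel (X m - X n) < e" if e: "e > 0" for e
  proof -
    have "\<kappa> * e > 0" using e \<kappa> by simp
    then obtain N where "\<forall>m\<ge>N. \<forall>n\<ge>N. sobolev_norm r (X m - X n) < \<kappa> * e"
      using cauchy unfolding Sob.cauchy_seq_def by blast
    moreover have "\<kappa> * L2_norm lborel (X m - X n) \<le> sobolev_norm r (X m - X n)" for m n
      unfolding \<kappa>_def by (intro L2_norm_le_sobolev Sob.diff_mem X r)
    ultimately have "\<forall>m\<ge>N. \<forall>n\<ge>N. \<kappa> * L2_norm lborel (X m - X n) < \<kappa> * e"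
      by (meson le_less_trans)
    then show ?thesis using \<kappa> by auto
  qed
  obtain u where u: "u \<in> L2_space lborel" "(\<lambda>n. L2_norm lborel (X n - u)) \<longlonglongrightarrow> 0"
    using L2_complete[OF XL(1) c2] by blast
  have [measurable]: "G \<in> borel_measurable borel" using L2_measurable[OF G(1)] by simp
  define H where "H \<xi> = complex_of_real ((1 + (norm \<xi>)\<^sup>2) powr (- (r / 2))) * G \<xi>" for \<xi>
  have w1: "(1 + (norm \<xi>)\<^sup>2) powr (- (r / 2)) \<le> 1" for \<xi> :: 'a
    using powr_weight_ge_1[of "r/2" \<xi>] r by (simp add: powr_minus inverse_le_1_iff)
  have wp: "1 + (norm \<xi>)\<^sup>2 > 0" for \<xi> :: 'a by (simp add: add_pos_nonneg)
  have H: "H \<in> L2_space lborel"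
  proof (rule L2_dominated[OF G(1)])
    show "H \<in> borel_measurable lborel" unfolding H_def[abs_def] by measurable
    show "AE x in lborel. norm (H x) \<le> norm (G x)"
      using w1 by (intro AE_I2) (auto simp: H_def norm_mult intro!: mult_left_le_one_le)
  qed
  have "AE \<xi> in lborel. L2_fourier u \<xi> = H \<xi>"
  proof (rule L2_limit_unique[where X="\<lambda>n. L2_fourier (X n)"])
    show "(\<lambda>n. L2_norm lborel (L2_fourier (X n) - L2_fourier u)) \<longlonglongrightarrow> 0"
      by (intro L2_fourier_tendsto XL u)
    show "(\<lambda>n. L2_norm lborel (L2_fourier (X n) - H)) \<longlonglongrightarrow> 0"
    proof (rule Lim_null_comparison[OF _ G(2)], intro always_eventually allI)
      fix n
      have "cmod ((L2_fourier (X n) - H) \<xi>) \<le> cmod ((bessel r (X n) - G) \<xi>)" for \<xi>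
      proof -
        have e1: "complex_of_real ((1 + (norm \<xi>)\<^sup>2) powr (- (r / 2))) * bessel r (X n) \<xi> = L2_fourier (X n) \<xi>"
          using wp[of \<xi>] unfolding bessel_def mult.assoc[symmetric] of_real_mult[symmetric]
          by (simp flip: powr_add)
        have "(L2_fourier (X n) - H) \<xi> = complex_of_real ((1 + (norm \<xi>)\<^sup>2) powr (- (r / 2))) * (bessel r (X n) - G) \<xi>"
          by (simp add: H_def right_diff_distrib e1)
        then show ?thesis using w1[of \<xi>] by (simp add: norm_mult mult_left_le_one_le)
      qed
      then show "norm (L2_norm lborel (L2_fourier (X n) - H)) \<le> L2_norm lborel (bessel r (X n) - G)"
        by (simp, intro L2_norm_mono L2.diff_mem XL G L2_measurable L2_fourier_L2 H) auto
    qed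
  qed (intro L2_fourier_L2 XL u H)+
  then have uG: "AE \<xi> in lborel. G \<xi> = bessel r u \<xi>"
  proof eventually_elim
    case (elim \<xi>)
    show ?case using wp[of \<xi>] unfolding bessel_def elim H_def mult.assoc[symmetric] of_real_mult[symmetric]
      by (simp flip: powr_add)
  qed
  then have uS: "u \<in> sobolev r"
    using L2_cong_AE[OF uG G(1) bessel_measurable[OF u(1)]] u(1) by (simp add: sobolev_iff)
  have "sobolev_norm r (X n - u) = L2_norm lborel (bessel r (X n) - G)" for n
  proof -
    have "AE \<xi> in lborel. (bessel r (X n) - bessel r u) \<xi> = (bessel r (X n) - G) \<xi>"
      using uG by eventually_elim simp
    then have "L2_norm lborel (bessel r (X n) - bessel r u) = L2_norm lborel (bessel r (X n) - G)"
      by (rule L2_norm_cong_AE) (intro L2.diff_mem XL G bessel_L2[OF uS])+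
    then show ?thesis by (simp add: nd X uS)
  qed
  then show ?thesis using uS G(2) by (intro bexI[of _ u]) auto
qed

subsection \<open>The fractional Laplacian\<close>

text \<open>
  The transform of \<open>(-\<Delta>)\<^bsup>t/2\<^esup> u\<close>.
\<close>

definition riesz_multiplier :: "real \<Rightarrow> ('a::euclidean_space \<Rightarrow> real) \<Rightarrow> 'a \<Rightarrow> complex" where
  "riesz_multiplier t u = (\<lambda>\<xi>. complex_of_real (norm \<xi> powr t) * L2_fourier u \<xi>)"

lemma norm_powr_le_weight:
  assumes "t \<ge> 0"
  shows "norm x powr t \<le> (1 + (norm x)\<^sup>2) powr (t / 2)"
proof -
  have "norm x powr t = ((norm x)\<^sup>2) powr (t / 2)"
    by (cases "x = 0") (simp_all add: powr_powr flip: powr_numeral)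
  also have "\<dots> \<le> (1 + (norm x)\<^sup>2) powr (t / 2)" using assms by (intro powr_mono2) auto
  finally show ?thesis .
qed

lemma riesz_multiplier_L2:
  assumes u: "u \<in> sobolev t" and t: "t \<ge> 0"
  shows "riesz_multiplier t u \<in> L2_space lborel"
    and "L2_norm lborel (riesz_multiplier t u) \<le> sobolev_norm t u"
proof -
  have [measurable]: "L2_fourier u \<in> borel_measurable borel"
    using L2_measurable[OF L2_fourier_L2[OF sobolev_L2[OF u]]] by simp
  have m: "riesz_multiplier t u \<in> borel_measurable lborel" unfolding riesz_multiplier_def by measurable
  have le: "AE \<xi> in lborel. norm (riesz_multiplier t u \<xi>) \<le> norm (bessel t u \<xi>)"
    using norm_powr_le_weight[OF t]
    by (intro AE_I2) (auto simp: riesz_multiplier_def bessel_def norm_mult intro!: mult_right_mono)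
  show "riesz_multiplier t u \<in> L2_space lborel" by (rule L2_dominated[OF bessel_L2[OF u] m le])
  show "L2_norm lborel (riesz_multiplier t u) \<le> sobolev_norm t u"
    unfolding sobolev_norm_bessel by (rule L2_norm_mono[OF m bessel_L2[OF u] le])
qed

text \<open>
  The multiplier is even and real, so the product with \<open>\<F> u\<close> is Hermitian and belongs to the range of
  the Fourier transform.
\<close>

lemma frac_laplacian_spec:
  assumes u: "u \<in> sobolev t" and t: "t \<ge> 0"
  shows "frac_laplacian (t / 2) u \<in> L2_space lborel"
    and "AE \<xi> in lborel. L2_fourier (frac_laplacian (t / 2) u) \<xi> = riesz_multiplier t u \<xi>"
proof -
  have "AE \<xi> in lborel. riesz_multiplier t u (- \<xi>) = cnj (riesz_multiplier t u \<xi>)"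
    using L2_fourier_hermitian[OF sobolev_L2[OF u]] by eventually_elim (simp add: riesz_multiplier_def)
  from L2_fourier_range[OF riesz_multiplier_L2(1)[OF u t] this]
  obtain w where w: "w \<in> L2_space lborel" "AE \<xi> in lborel. L2_fourier w \<xi> = riesz_multiplier t u \<xi>" by blast
  have "frac_laplacian (t / 2) u \<in> L2_on UNIV \<and>
     (AE \<xi> in lborel. L2_fourier (frac_laplacian (t / 2) u) \<xi> = complex_of_real (norm \<xi> powr (2 * (t / 2))) * L2_fourier u \<xi>)"
    unfolding frac_laplacian_def
    by (rule someI[of _ w]) (use w in \<open>auto simp: L2_on_UNIV riesz_multiplier_def\<close>)
  then show "frac_laplacian (t / 2) u \<in> L2_space lborel"
    "AE \<xi> in lborel. L2_fourier (frac_laplacian (t / 2) u) \<xi> = riesz_multiplier t u \<xi>"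
    by (auto simp: L2_on_UNIV riesz_multiplier_def)
qed

lemma frac_laplacian_form:
  fixes u v :: "'a::euclidean_space \<Rightarrow> real"
  assumes u: "u \<in> sobolev t" and v: "v \<in> sobolev t" and t: "t \<ge> 0"
  shows "(LINT x|lborel. frac_laplacian (t / 2) u x * frac_laplacian (t / 2) v x)
    = L2_inner lborel (riesz_multiplier t u) (riesz_multiplier t v) / (gauss_const TYPE('a))\<^sup>2"
proof -
  let ?f = "frac_laplacian (t / 2) u" and ?g = "frac_laplacian (t / 2) v"
  note f = frac_laplacian_spec[OF u t] and g = frac_laplacian_spec[OF v t]
  note M = riesz_multiplier_L2(1)[OF u t] riesz_multiplier_L2(1)[OF v t]
  have "L2_inner lborel (riesz_multiplier t u) (riesz_multiplier t v) = L2_inner lborel (L2_fourier ?f) (riesz_multiplier t v)"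
    by (rule L2_inner_cong_AE[symmetric, OF f(2) L2_fourier_L2[OF f(1)] M])
  also have "\<dots> = L2_inner lborel (riesz_multiplier t v) (L2_fourier ?f)" by (intro L2.ip_sym L2_fourier_L2 f M)
  also have "\<dots> = L2_inner lborel (L2_fourier ?g) (L2_fourier ?f)"
    by (rule L2_inner_cong_AE[symmetric, OF g(2) L2_fourier_L2[OF g(1)] M(2) L2_fourier_L2[OF f(1)]])
  also have "\<dots> = (gauss_const TYPE('a))\<^sup>2 * L2_inner lborel ?g ?f" by (rule parseval[OF g(1) f(1)])
  finally show ?thesis by (simp add: L2_inner_def mult.commute)
qed

lemma riesz_multiplier_add:
  "u \<in> L2_space lborel \<Longrightarrow> v \<in> L2_space lborel \<Longrightarrow>
    AE \<xi> in lborel. riesz_multiplier t (u + v) \<xi> = (riesz_multiplier t u + riesz_multiplier t v) \<xi>"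
  using L2_fourier_add[of u v] by (auto elim!: eventually_mono simp: riesz_multiplier_def ring_distribs)

lemma riesz_multiplier_scale:
  "u \<in> L2_space lborel \<Longrightarrow> AE \<xi> in lborel. riesz_multiplier t (c *\<^sub>R u) \<xi> = (c *\<^sub>R riesz_multiplier t u) \<xi>"
  using L2_fourier_scale[of u c] by (auto elim!: eventually_mono simp: riesz_multiplier_def scaleR_fun_def)

subsection \<open>Translations of Sobolev functions\<close>

lemma cmod_cis_minus_1_le: "cmod (cis x - 1) \<le> \<bar>x\<bar>"
  using iexp_approx1[of x 0] by (simp add: cis_conv_exp)

lemma L2_fourier_difference:
  fixes u :: "'a::euclidean_space \<Rightarrow> real"
  assumes u: "u \<in> L2_space lborel"
  shows "AE \<xi> in lborel. L2_fourier (translate h u - u) \<xi> = (cis (h \<bullet> \<xi>) - 1) * L2_fourier u \<xi>"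
  using L2_fourier_diff[OF translate_L2(1)[OF u, of h] u] L2_fourier_translate[OF u, of h]
  by eventually_elim (simp add: left_diff_distrib)

text \<open>
  Follows from \<open>\<bar>e\<^bsup>i x\<^esup> - 1\<bar> \<le> min 2 \<bar>x\<bar> \<le> 2 \<bar>x\<bar>\<^sup>t\<close> with \<open>x = h \<bullet> \<xi>\<close>, by Plancherel.
\<close>

lemma sobolev_translation_estimate:
  fixes u :: "'a::euclidean_space \<Rightarrow> real"
  assumes u: "u \<in> sobolev t" and t: "0 \<le> t" "t \<le> 1"
  shows "gauss_const TYPE('a) * L2_norm lborel (translate h u - u) \<le> 2 * norm h powr t * sobolev_norm t u"
proof -
  note uL = sobolev_L2[OF u]
  have d: "translate h u - u \<in> L2_space lborel" by (intro L2.diff_mem translate_L2 uL)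
  have sc: "(2 * norm h powr t) *\<^sub>R riesz_multiplier t u \<in> L2_space lborel"
    by (intro L2.scale_mem riesz_multiplier_L2 u t)
  have cis_bound: "cmod (cis x - 1) \<le> 2 * \<bar>x\<bar> powr t" for x
  proof (cases "\<bar>x\<bar> \<le> 1")
    case True
    have "cmod (cis x - 1) \<le> \<bar>x\<bar> powr 1" using cmod_cis_minus_1_le[of x] by simp
    also have "\<dots> \<le> \<bar>x\<bar> powr t" using True t by (intro powr_mono') auto
    also have "\<dots> \<le> 2 * \<bar>x\<bar> powr t" by simp
    finally show ?thesis .
  next
    case False
    have "cmod (cis x - 1) \<le> 2" using norm_triangle_ineq4[of "cis x" 1] by simp
    also have "1 \<le> \<bar>x\<bar> powr t" using False t by (intro ge_one_powr_ge_zero) auto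
    then have "2 \<le> 2 * \<bar>x\<bar> powr t" by simp
    finally show ?thesis .
  qed
  have "L2_norm lborel (L2_fourier (translate h u - u)) \<le> L2_norm lborel ((2 * norm h powr t) *\<^sub>R riesz_multiplier t u)"
  proof (rule L2_norm_mono[OF L2_measurable[OF L2_fourier_L2[OF d]] sc])
    show "AE \<xi> in lborel. norm (L2_fourier (translate h u - u) \<xi>) \<le> norm (((2 * norm h powr t) *\<^sub>R riesz_multiplier t u) \<xi>)"
      using L2_fourier_difference[OF uL, of h]
    proof eventually_elim
      case (elim \<xi>)
      have "cmod (cis (h \<bullet> \<xi>) - 1) \<le> 2 * \<bar>h \<bullet> \<xi>\<bar> powr t" by (rule cis_bound)
      also have "\<dots> \<le> 2 * (norm h * norm \<xi>) powr t"
        using t by (intro mult_left_mono powr_mono2 Cauchy_Schwarz_ineq2) auto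
      also have "\<dots> = 2 * (norm h powr t * norm \<xi> powr t)" by (simp add: powr_mult)
      finally have "cmod (cis (h \<bullet> \<xi>) - 1) * cmod (L2_fourier u \<xi>) \<le> 2 * (norm h powr t * norm \<xi> powr t) * cmod (L2_fourier u \<xi>)"
        by (rule mult_right_mono) simp
      then show ?case by (simp add: elim norm_mult scaleR_fun_def riesz_multiplier_def mult_ac)
    qed
  qed
  also have "\<dots> = 2 * norm h powr t * L2_norm lborel (riesz_multiplier t u)"
    by (subst L2.nrm_scale) (auto intro: riesz_multiplier_L2 u t)
  also have "\<dots> \<le> 2 * norm h powr t * sobolev_norm t u"
    by (intro mult_left_mono riesz_multiplier_L2 u t) auto
  finally show ?thesis by (simp add: plancherel d)
qed

section \<open>Test functions and the spaces of functions supported in a set\<close>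

lemma smooth_differentiable: "smooth f \<Longrightarrow> vs \<in> lists Basis \<Longrightarrow> iterated_deriv vs f differentiable (at x)"
  by (simp add: smooth_def)

lemma iterated_deriv_add:
  assumes "smooth f" "smooth g" "vs \<in> lists Basis"
  shows "iterated_deriv vs (f + g) = iterated_deriv vs f + iterated_deriv vs g"
  using assms(3)
proof (induction vs)
  case Nil
  then show ?case by simp
next
  case (Cons v vs)
  then have vs: "vs \<in> lists Basis" by auto
  show ?case
  proof
    fix x
    have "(iterated_deriv vs f has_derivative frechet_derivative (iterated_deriv vs f) (at x)) (at x)"
      "(iterated_deriv vs g has_derivative frechet_derivative (iterated_deriv vs g) (at x)) (at x)"
      using smooth_differentiable[OF _ vs] assms by (auto simp: frechet_derivative_works)
    from has_derivative_add[OF this]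
    have "frechet_derivative (iterated_deriv vs f + iterated_deriv vs g) (at x)
      = (\<lambda>y. frechet_derivative (iterated_deriv vs f) (at x) y + frechet_derivative (iterated_deriv vs g) (at x) y)"
      using frechet_derivative_at[symmetric] by (simp add: plus_fun_def)
    then show "iterated_deriv (v # vs) (f + g) x = (iterated_deriv (v # vs) f + iterated_deriv (v # vs) g) x"
      unfolding iterated_deriv.simps Cons.IH by (simp add: plus_fun_def)
  qed
qed

lemma iterated_deriv_scale:
  assumes "smooth f" "vs \<in> lists Basis"
  shows "iterated_deriv vs (c *\<^sub>R f) = c *\<^sub>R iterated_deriv vs f"
  using assms(2)
proof (induction vs)
  case Nil
  then show ?case by simp
next
  case (Cons v vs)
  then have vs: "vs \<in> lists Basis" by auto
  show ?case
  proof
    fix x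
    have "(iterated_deriv vs f has_derivative frechet_derivative (iterated_deriv vs f) (at x)) (at x)"
      using smooth_differentiable[OF _ vs] assms by (auto simp: frechet_derivative_works)
    from has_derivative_scaleR_right[OF this, of c]
    have "frechet_derivative (c *\<^sub>R iterated_deriv vs f) (at x)
      = (\<lambda>y. c *\<^sub>R frechet_derivative (iterated_deriv vs f) (at x) y)"
      using frechet_derivative_at[symmetric] by (simp add: scaleR_fun_def)
    then show "iterated_deriv (v # vs) (c *\<^sub>R f) x = (c *\<^sub>R iterated_deriv (v # vs) f) x"
      unfolding iterated_deriv.simps Cons.IH by (simp add: scaleR_fun_def)
  qed
qed

lemma smooth_add: "smooth (f :: 'a::euclidean_space \<Rightarrow> real) \<Longrightarrow> smooth g \<Longrightarrow> smooth (f + g)"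
  unfolding smooth_def[of "f + g"]
proof (intro ballI allI)
  fix vs :: "'a list" and x :: 'a
  assume "smooth f" "smooth g" "vs \<in> lists Basis"
  then show "iterated_deriv vs (f + g) differentiable (at x)"
    unfolding iterated_deriv_add[OF \<open>smooth f\<close> \<open>smooth g\<close> \<open>vs \<in> lists Basis\<close>]
    unfolding plus_fun_def
    by (intro differentiable_add smooth_differentiable[where vs=vs])
qed

lemma smooth_scale: "smooth (f :: 'a::euclidean_space \<Rightarrow> real) \<Longrightarrow> smooth (c *\<^sub>R f)"
  unfolding smooth_def[of "c *\<^sub>R f"]
proof (intro ballI allI)
  fix vs :: "'a list" and x :: 'a
  assume "smooth f" "vs \<in> lists Basis"
  then show "iterated_deriv vs (c *\<^sub>R f) differentiable (at x)"
    unfolding iterated_deriv_scale[OF \<open>smooth f\<close> \<open>vs \<in> lists Basis\<close>]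
    unfolding scaleR_fun_def
    by (intro differentiable_scaleR differentiable_const smooth_differentiable[where vs=vs])
qed

lemma smooth_zero: "smooth (0 :: 'a::euclidean_space \<Rightarrow> real)"
proof -
  have "iterated_deriv vs (\<lambda>_::'a. 0) = (\<lambda>_. 0)" for vs
    by (induction vs) auto
  then show ?thesis by (simp add: smooth_def zero_fun_def)
qed

lemma test_functions_add:
  assumes "f \<in> test_functions U" "g \<in> test_functions U"
  shows "f + g \<in> test_functions U"
proof -
  let ?S = "\<lambda>f. closure {x. f x \<noteq> (0::real)}"
  have "?S (f + g) \<subseteq> closure ({x. f x \<noteq> 0} \<union> {x. g x \<noteq> 0})"
    by (rule closure_mono) auto
  then have sub: "?S (f + g) \<subseteq> ?S f \<union> ?S g" by (simp add: closure_Un)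
  have "compact (?S f \<union> ?S g)" using assms by (auto simp: test_functions_def)
  then have "compact (?S (f + g))"
    using sub by (meson bounded_subset closed_closure compact_eq_bounded_closed)
  then show ?thesis using assms sub by (auto simp: test_functions_def smooth_add)
qed

lemma test_functions_scale:
  assumes "f \<in> test_functions U"
  shows "c *\<^sub>R f \<in> test_functions U"
proof -
  let ?S = "\<lambda>f. closure {x. f x \<noteq> (0::real)}"
  have sub: "?S (c *\<^sub>R f) \<subseteq> ?S f" by (rule closure_mono) (auto simp: scaleR_fun_def)
  have "compact (?S f)" using assms by (auto simp: test_functions_def)
  then have "compact (?S (c *\<^sub>R f))"
    using sub by (meson bounded_subset closed_closure compact_eq_bounded_closed)
  then show ?thesis using assms sub by (auto simp: test_functions_def smooth_scale)
qed

lemma test_functions_zero: "0 \<in> test_functions U"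
  by (simp add: test_functions_def smooth_zero)

lemma test_function_lipschitz:
  fixes f :: "'a::euclidean_space \<Rightarrow> real"
  assumes f: "f \<in> test_functions U"
  shows "\<exists>M\<ge>0. \<forall>x y. \<bar>f x - f y\<bar> \<le> M * norm (x - y)"
proof -
  let ?S = "closure {x. f x \<noteq> 0}"
  let ?D = "\<lambda>x. frechet_derivative f (at x)"
  have sm: "smooth f" and cpt: "compact ?S" using f by (auto simp: test_functions_def)
  have der: "(f has_derivative ?D x) (at x)" for x
    using smooth_differentiable[OF sm, of "[]" x] by (simp add: frechet_derivative_works)
  have "\<exists>M\<ge>0. \<forall>x. \<bar>?D x v\<bar> \<le> M" if v: "v \<in> Basis" for v
  proof -
    have "continuous_on UNIV (\<lambda>x. ?D x v)"
    proof (intro continuous_at_imp_continuous_on ballI)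
      fix x
      have "iterated_deriv [v] f differentiable (at x)" using v by (intro smooth_differentiable[OF sm]) auto
      then show "isCont (\<lambda>x. ?D x v) x" using differentiable_imp_continuous_within by force
    qed
    then have "compact ((\<lambda>x. ?D x v) ` ?S)"
      by (intro compact_continuous_image cpt) (auto intro: continuous_on_subset)
    then have "bounded ((\<lambda>x. ?D x v) ` ?S)" by (rule compact_imp_bounded)
    then obtain M where "\<forall>y\<in>(\<lambda>x. ?D x v) ` ?S. norm y \<le> M" unfolding bounded_iff by blast
    then have M: "\<bar>?D x v\<bar> \<le> M" if "x \<in> ?S" for x using that by auto
    have "?D x v = 0" if x: "x \<notin> ?S" for x
    proof -
      have "(f has_derivative (\<lambda>_. 0)) (at x)"
      proof (rule has_derivative_transform_within_open[where f="\<lambda>_. 0" and s="- ?S"])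
        show "f' \<in> - ?S \<Longrightarrow> 0 = f f'" for f' using closure_subset[of "{x. f x \<noteq> 0}"] by auto
      qed (use x in auto)
      then have "?D x = (\<lambda>_. 0)" by (rule frechet_derivative_at[symmetric])
      then show ?thesis by simp
    qed
    then have "\<bar>?D x v\<bar> \<le> max M 0" for x using M[of x] by (cases "x \<in> ?S") auto
    then show ?thesis by (intro exI[of _ "max M 0"]) auto
  qed
  then obtain M where M: "\<And>v. v \<in> Basis \<Longrightarrow> M v \<ge> 0" "\<And>v x. v \<in> Basis \<Longrightarrow> \<bar>?D x v\<bar> \<le> M v" by metis
  define B where "B = (\<Sum>v\<in>Basis. M v)"
  have B0: "B \<ge> 0" unfolding B_def by (intro sum_nonneg M)
  have on: "onorm (?D x) \<le> B" for x
  proof (rule onorm_bound[OF B0])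
    fix h
    interpret linear "?D x" using der[of x] by (rule has_derivative_linear)
    have "?D x h = ?D x (\<Sum>v\<in>Basis. (h \<bullet> v) *\<^sub>R v)" by (simp add: euclidean_representation)
    also have "\<dots> = (\<Sum>v\<in>Basis. (h \<bullet> v) * ?D x v)" by (simp add: sum scale)
    finally have "norm (?D x h) \<le> (\<Sum>v\<in>Basis. norm ((h \<bullet> v) * ?D x v))" by (simp add: sum_abs)
    also have "\<dots> \<le> (\<Sum>v\<in>Basis. norm h * M v)"
      by (intro sum_mono) (auto simp: abs_mult intro!: mult_mono M Basis_le_norm)
    also have "\<dots> = B * norm h" by (simp add: B_def sum_distrib_left[symmetric])
    finally show "norm (?D x h) \<le> B * norm h" .
  qed
  have "norm (f x - f y) \<le> B * norm (x - y)" for x y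
    by (rule differentiable_bound[OF convex_UNIV der on]) auto
  then show ?thesis using B0 by (intro exI[of _ B]) auto
qed

lemma test_function_L2:
  fixes f :: "'a::euclidean_space \<Rightarrow> real"
  assumes f: "f \<in> test_functions U"
  obtains R where "R > 0" "\<And>x. norm x > R \<Longrightarrow> f x = 0" "f \<in> L2_space lborel"
proof -
  let ?S = "closure {x. f x \<noteq> 0}"
  have sm: "smooth f" and cpt: "compact ?S" using f by (auto simp: test_functions_def)
  have "f differentiable (at x)" for x using smooth_differentiable[OF sm, of "[]" x] by simp
  then have cont: "continuous_on UNIV f"
    by (intro continuous_at_imp_continuous_on ballI) (auto intro: differentiable_imp_continuous_within)
  obtain R where R: "R > 0" "\<And>x. x \<in> ?S \<Longrightarrow> norm x \<le> R"
    using compact_imp_bounded[OF cpt] by (auto simp: bounded_pos)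
  have zero: "f x = 0" if "norm x > R" for x
    using R(2)[of x] that closure_subset[of "{x. f x \<noteq> 0}"] by force
  have "compact (f ` ?S)" by (intro compact_continuous_image cpt continuous_on_subset[OF cont]) auto
  then have "bounded (f ` ?S)" by (rule compact_imp_bounded)
  then obtain B where "\<forall>y\<in>f ` ?S. norm y \<le> B" unfolding bounded_iff by blast
  then have B: "\<bar>f x\<bar> \<le> B" if "x \<in> ?S" for x using that by auto
  have ind: "B *\<^sub>R indicator (cball 0 R) \<in> (L2_space lborel :: ('a \<Rightarrow> real) set)"
    by (intro L2.scale_mem indicator_L2) auto
  have "f \<in> L2_space lborel"
  proof (rule L2_dominated[OF ind])
    show "f \<in> borel_measurable lborel" using borel_measurable_continuous_onI[OF cont] by simp
    show "AE x in lborel. norm (f x) \<le> norm ((B *\<^sub>R indicator (cball 0 R) :: 'a \<Rightarrow> real) x)"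
    proof (rule AE_I2)
      fix x
      show "norm (f x) \<le> norm ((B *\<^sub>R indicator (cball 0 R) :: 'a \<Rightarrow> real) x)"
      proof (cases "f x = 0")
        case False
        then have "x \<in> ?S" using closure_subset[of "{x. f x \<noteq> 0}"] by blast
        then show ?thesis using B[of x] R(2)[of x] by (simp add: scaleR_fun_def)
      qed simp
    qed
  qed
  then show thesis using that R(1) zero by blast
qed

text \<open>
  A test function \<open>\<phi>\<close> is Lipschitz with compact support, so \<open>\<parallel>\<phi>(\<cdot> + h) - \<phi>\<parallel> \<le> C \<bar>h\<bar>\<close>. By Plancherel
  this says that the integrals of \<open>\<bar>sin (h \<bullet> \<xi>)\<bar>\<^sup>2 \<bar>\<F> \<phi>\<bar>\<^sup>2\<close> are \<open>O(\<bar>h\<bar>\<^sup>2)\<close>, and Fatou's lemma for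
  \<open>h = b / k\<close>, \<open>k \<rightarrow> \<infinity>\<close>, shows that \<open>(b \<bullet> \<xi>) \<F> \<phi>\<close> is square integrable.
\<close>

lemma test_functions_sobolev:
  fixes f :: "'a::euclidean_space \<Rightarrow> real"
  assumes f: "f \<in> test_functions U" and t: "t \<le> 1"
  shows "f \<in> sobolev t"
proof -
  define \<kappa> where "\<kappa> = gauss_const TYPE('a)"
  obtain R where R: "R > 0" "\<And>x. norm x > R \<Longrightarrow> f x = 0" and fL: "f \<in> L2_space lborel"
    using test_function_L2[OF f] by metis
  note FL = L2_fourier_L2[OF fL]
  obtain M where M: "M \<ge> 0" "\<And>x y. \<bar>f x - f y\<bar> \<le> M * norm (x - y)" using test_function_lipschitz[OF f] by blast
  have [measurable]: "L2_fourier f \<in> borel_measurable borel" using L2_measurable[OF FL] by simp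
  define I where "I = (indicator (cball 0 (R + 1)) :: 'a \<Rightarrow> real)"
  have IL: "I \<in> L2_space lborel" unfolding I_def by (intro indicator_L2) auto
  define C where "C = \<kappa> * M * L2_norm lborel I"
  have diff: "L2_norm lborel (L2_fourier (translate h f - f)) \<le> C * norm h" if h: "norm h \<le> 1" for h
  proof -
    have d: "translate h f - f \<in> L2_space lborel" by (intro L2.diff_mem translate_L2 fL)
    have "L2_norm lborel (translate h f - f) \<le> L2_norm lborel ((M * norm h) *\<^sub>R I)"
    proof (rule L2_norm_mono[OF L2_measurable[OF d] L2.scale_mem[OF IL]], rule AE_I2)
      fix x
      show "norm ((translate h f - f) x) \<le> norm (((M * norm h) *\<^sub>R I) x)"
      proof (cases "norm x \<le> R + 1")
        case True
        then show ?thesis using M(2)[of "x + h" x] M(1) by (simp add: translate_def I_def scaleR_fun_def)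
      next
        case False
        then have "norm (x + h) > R" "norm x > R" using norm_triangle_ineq2[of x "- h"] h by auto
        then show ?thesis by (simp add: translate_def R)
      qed
    qed
    also have "\<dots> = (M * norm h) * L2_norm lborel I" using M by (simp add: L2.nrm_scale IL)
    finally show ?thesis unfolding plancherel[OF d] C_def \<kappa>_def
      using mult_left_mono[of "L2_norm lborel (translate h f - f)" "(M * norm h) * L2_norm lborel I" "gauss_const TYPE('a)"]
      by (simp add: mult_ac)
  qed
  have comp: "integrable lborel (\<lambda>\<xi>. (b \<bullet> \<xi>)\<^sup>2 * (cmod (L2_fourier f \<xi>))\<^sup>2)" if b: "b \<in> Basis" for b
  proof -
    define \<delta> where "\<delta> n = 1 / real (Suc n)" for n
    have \<delta>: "0 < \<delta> n" "\<delta> n \<le> 1" for n by (auto simp: \<delta>_def)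
    have \<delta>0: "\<delta> \<longlonglongrightarrow> 0" unfolding \<delta>_def[abs_def] by (rule LIMSEQ_Suc[OF lim_1_over_n])
    have sinlim: "(\<lambda>n. sin (\<delta> n * y) / \<delta> n) \<longlonglongrightarrow> y" for y
    proof -
      have "((\<lambda>x. sin (x * y)) has_real_derivative y) (at 0)"
        by (auto intro!: derivative_eq_intros)
      then have "((\<lambda>x. sin (x * y) / x) \<longlongrightarrow> y) (at 0)" by (simp add: has_field_derivative_iff)
      moreover have "filterlim \<delta> (at 0) sequentially"
        using \<delta>0 \<delta>(1) by (auto simp: filterlim_at less_imp_neq[symmetric])
      ultimately show ?thesis by (rule filterlim_compose)
    qed
    have le: "(\<integral>\<^sup>+\<xi>. ennreal ((sin (\<delta> n * (b \<bullet> \<xi>)) / \<delta> n)\<^sup>2 * (cmod (L2_fourier f \<xi>))\<^sup>2) \<partial>lborel) \<le> ennreal (C\<^sup>2)" for n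
    proof -
      let ?h = "\<delta> n *\<^sub>R b"
      have h: "norm ?h = \<delta> n" using b \<delta>[of n] by simp
      let ?D = "L2_fourier (translate ?h f - f)"
      have d: "translate ?h f - f \<in> L2_space lborel" by (intro L2.diff_mem translate_L2 fL)
      have "(\<integral>\<^sup>+\<xi>. ennreal ((sin (\<delta> n * (b \<bullet> \<xi>)) / \<delta> n)\<^sup>2 * (cmod (L2_fourier f \<xi>))\<^sup>2) \<partial>lborel)
        \<le> (\<integral>\<^sup>+\<xi>. ennreal ((norm (((1 / \<delta> n) *\<^sub>R ?D) \<xi>))\<^sup>2) \<partial>lborel)"
      proof (rule nn_integral_mono_AE)
        show "AE \<xi> in lborel. ennreal ((sin (\<delta> n * (b \<bullet> \<xi>)) / \<delta> n)\<^sup>2 * (cmod (L2_fourier f \<xi>))\<^sup>2)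
          \<le> ennreal ((norm (((1 / \<delta> n) *\<^sub>R ?D) \<xi>))\<^sup>2)"
          using L2_fourier_difference[OF fL, of ?h]
        proof eventually_elim
          case (elim \<xi>)
          have "\<bar>sin (\<delta> n * (b \<bullet> \<xi>))\<bar> \<le> cmod (cis (?h \<bullet> \<xi>) - 1)"
            using abs_Im_le_cmod[of "cis (?h \<bullet> \<xi>) - 1"] by simp
          then have "\<bar>sin (\<delta> n * (b \<bullet> \<xi>)) / \<delta> n\<bar> * cmod (L2_fourier f \<xi>) \<le> norm (((1 / \<delta> n) *\<^sub>R ?D) \<xi>)"
            using \<delta>(1)[of n] by (simp add: elim scaleR_fun_def norm_mult divide_right_mono mult_right_mono)
          then have "(\<bar>sin (\<delta> n * (b \<bullet> \<xi>)) / \<delta> n\<bar> * cmod (L2_fourier f \<xi>))\<^sup>2 \<le> (norm (((1 / \<delta> n) *\<^sub>R ?D) \<xi>))\<^sup>2"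
            by (rule power_mono) auto
          then show ?case by (intro ennreal_leI) (simp only: power_mult_distrib power2_abs)
        qed
      qed
      also have "\<dots> = ennreal ((L2_norm lborel ((1 / \<delta> n) *\<^sub>R ?D))\<^sup>2)"
        by (rule L2_norm_nn[symmetric]) (intro L2.scale_mem L2_fourier_L2 d)
      also have "\<dots> \<le> ennreal (C\<^sup>2)"
      proof (intro ennreal_leI power_mono)
        have "L2_norm lborel ((1 / \<delta> n) *\<^sub>R ?D) = L2_norm lborel ?D / \<delta> n"
          using \<delta>(1)[of n] by (simp add: L2.nrm_scale L2_fourier_L2 d)
        also have "\<dots> \<le> C" using diff[of ?h] h \<delta>[of n] by (simp add: divide_simps mult.commute)
        finally show "L2_norm lborel ((1 / \<delta> n) *\<^sub>R ?D) \<le> C" .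
      qed simp
      finally show ?thesis .
    qed
    have "(\<integral>\<^sup>+\<xi>. ennreal ((b \<bullet> \<xi>)\<^sup>2 * (cmod (L2_fourier f \<xi>))\<^sup>2) \<partial>lborel)
      = (\<integral>\<^sup>+\<xi>. liminf (\<lambda>n. ennreal ((sin (\<delta> n * (b \<bullet> \<xi>)) / \<delta> n)\<^sup>2 * (cmod (L2_fourier f \<xi>))\<^sup>2)) \<partial>lborel)"
    proof (rule nn_integral_cong)
      fix \<xi>
      have "(\<lambda>n. ennreal ((sin (\<delta> n * (b \<bullet> \<xi>)) / \<delta> n)\<^sup>2 * (cmod (L2_fourier f \<xi>))\<^sup>2)) \<longlonglongrightarrow> ennreal ((b \<bullet> \<xi>)\<^sup>2 * (cmod (L2_fourier f \<xi>))\<^sup>2)"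
        by (intro tendsto_ennrealI tendsto_mult tendsto_power tendsto_const sinlim)
      then show "ennreal ((b \<bullet> \<xi>)\<^sup>2 * (cmod (L2_fourier f \<xi>))\<^sup>2) = liminf (\<lambda>n. ennreal ((sin (\<delta> n * (b \<bullet> \<xi>)) / \<delta> n)\<^sup>2 * (cmod (L2_fourier f \<xi>))\<^sup>2))"
        by (intro lim_imp_Liminf[symmetric]) auto
    qed
    also have "\<dots> \<le> liminf (\<lambda>n. \<integral>\<^sup>+\<xi>. ennreal ((sin (\<delta> n * (b \<bullet> \<xi>)) / \<delta> n)\<^sup>2 * (cmod (L2_fourier f \<xi>))\<^sup>2) \<partial>lborel)"
      by (rule nn_integral_liminf) simp
    also have "\<dots> \<le> ennreal (C\<^sup>2)" by (rule Liminf_le) (use le in auto)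
    finally show ?thesis by (intro integrableI_bounded) (auto simp: le_less_trans)
  qed
  have "integrable lborel (\<lambda>\<xi>. (cmod (L2_fourier f \<xi>))\<^sup>2 + (\<Sum>b\<in>Basis. (b \<bullet> \<xi>)\<^sup>2 * (cmod (L2_fourier f \<xi>))\<^sup>2))"
    by (intro Bochner_Integration.integrable_add Bochner_Integration.integrable_sum comp L2_integrable_square FL)
  moreover have norm_sq: "(norm \<xi>)\<^sup>2 = (\<Sum>b\<in>Basis. (b \<bullet> \<xi>)\<^sup>2)" for \<xi> :: 'a
    unfolding power2_norm_eq_inner euclidean_inner[of \<xi> \<xi>] by (simp add: power2_eq_square inner_commute)
  have "(cmod (L2_fourier f \<xi>))\<^sup>2 + (\<Sum>b\<in>Basis. (b \<bullet> \<xi>)\<^sup>2 * (cmod (L2_fourier f \<xi>))\<^sup>2)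
     = (1 + (norm \<xi>)\<^sup>2) * (cmod (L2_fourier f \<xi>))\<^sup>2" for \<xi>
    by (simp add: norm_sq sum_distrib_right distrib_right)
  ultimately have int: "integrable lborel (\<lambda>\<xi>. (1 + (norm \<xi>)\<^sup>2) * (cmod (L2_fourier f \<xi>))\<^sup>2)" by simp
  have "integrable lborel (\<lambda>\<xi>. (1 + (norm \<xi>)\<^sup>2) powr t * (cmod (L2_fourier f \<xi>))\<^sup>2)"
  proof (rule Bochner_Integration.integrable_bound[OF int])
    have "(1 + (norm \<xi>)\<^sup>2) powr t \<le> (1 + (norm \<xi>)\<^sup>2) powr 1" for \<xi> :: 'a
      by (rule powr_mono[OF t]) auto
    then show "AE \<xi> in lborel. norm ((1 + (norm \<xi>)\<^sup>2) powr t * (cmod (L2_fourier f \<xi>))\<^sup>2) \<le> norm ((1 + (norm \<xi>)\<^sup>2) * (cmod (L2_fourier f \<xi>))\<^sup>2)"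
      by (intro AE_I2) (auto simp: abs_mult add_nonneg_nonneg intro!: mult_right_mono)
  qed measurable
  then show ?thesis by (simp add: sobolev_def L2_on_UNIV fL)
qed

lemma sobolev_tilde_alt:
  "u \<in> sobolev_tilde r U \<longleftrightarrow> u \<in> sobolev r \<and> (\<forall>e>0. \<exists>\<phi>\<in>test_functions U. sobolev_norm r (u - \<phi>) < e)"
  by (simp add: sobolev_tilde_def fun_diff_def)

lemma sobolev_tilde_sobolev: "u \<in> sobolev_tilde r U \<Longrightarrow> u \<in> sobolev r"
  by (simp add: sobolev_tilde_alt)

lemma test_functions_sobolev_tilde:
  assumes "\<phi> \<in> test_functions U" "r \<le> 1"
  shows "\<phi> \<in> sobolev_tilde r U"
  using assms by (auto simp: sobolev_tilde_alt test_functions_sobolev Sob.nrm_zero intro!: bexI[of _ \<phi>])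

lemma semi_hilbert_space_sobolev_tilde:
  assumes r: "0 \<le> r" "r \<le> 1"
  shows "semi_hilbert_space (sobolev_tilde r U :: ('a::euclidean_space \<Rightarrow> real) set) (sobolev_inner r)"
proof -
  let ?V = "sobolev_tilde r U :: ('a \<Rightarrow> real) set"
  have S: "u \<in> sobolev r" if "u \<in> ?V" for u using that by (rule sobolev_tilde_sobolev)
  have T: "\<phi> \<in> sobolev r" if "\<phi> \<in> test_functions U" for \<phi> :: "'a \<Rightarrow> real"
    using that r by (intro test_functions_sobolev)
  have "semi_inner_space ?V (sobolev_inner r)"
  proof
    show "0 \<in> ?V" by (intro test_functions_sobolev_tilde test_functions_zero r)
    fix u v :: "'a \<Rightarrow> real" assume u: "u \<in> ?V"
    show "c *\<^sub>R u \<in> ?V" for c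
      unfolding sobolev_tilde_alt
    proof (intro conjI allI impI)
      show "c *\<^sub>R u \<in> sobolev r" by (intro Sob.scale_mem S u)
      fix e :: real assume e: "e > 0"
      then have "e / (\<bar>c\<bar> + 1) > 0" by simp
      then obtain \<phi> where \<phi>: "\<phi> \<in> test_functions U" "sobolev_norm r (u - \<phi>) < e / (\<bar>c\<bar> + 1)"
        using u unfolding sobolev_tilde_alt by blast
      have n: "0 \<le> sobolev_norm r (u - \<phi>)" by (intro Sob.nrm_nonneg Sob.diff_mem S T u \<phi>)
      have "sobolev_norm r (c *\<^sub>R u - c *\<^sub>R \<phi>) = \<bar>c\<bar> * sobolev_norm r (u - \<phi>)"
        unfolding scaleR_diff_right[symmetric] by (intro Sob.nrm_scale Sob.diff_mem S T u \<phi>)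
      also have "\<dots> \<le> (\<bar>c\<bar> + 1) * sobolev_norm r (u - \<phi>)" using n by (intro mult_right_mono) auto
      also have "\<dots> < e" using \<phi>(2) by (simp add: field_simps)
      finally show "\<exists>\<phi>\<in>test_functions U. sobolev_norm r (c *\<^sub>R u - \<phi>) < e"
        using test_functions_scale[OF \<phi>(1)] by blast
    qed
    assume v: "v \<in> ?V"
    show "u + v \<in> ?V"
      unfolding sobolev_tilde_alt
    proof (intro conjI allI impI)
      show "u + v \<in> sobolev r" by (intro Sob.add_mem S u v)
      fix e :: real assume e: "e > 0"
      then have "e / 2 > 0" by simp
      then obtain \<phi> \<psi> where \<phi>: "\<phi> \<in> test_functions U" "sobolev_norm r (u - \<phi>) < e / 2"
        and \<psi>: "\<psi> \<in> test_functions U" "sobolev_norm r (v - \<psi>) < e / 2"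
        using u v unfolding sobolev_tilde_alt by blast
      have "(u + v) - (\<phi> + \<psi>) = (u - \<phi>) + (v - \<psi>)" by simp
      then have "sobolev_norm r ((u + v) - (\<phi> + \<psi>)) \<le> sobolev_norm r (u - \<phi>) + sobolev_norm r (v - \<psi>)"
        by (simp only:) (intro Sob.nrm_triangle Sob.diff_mem S T u v \<phi> \<psi>)
      then have "sobolev_norm r ((u + v) - (\<phi> + \<psi>)) < e" using \<phi>(2) \<psi>(2) by simp
      then show "\<exists>\<phi>\<in>test_functions U. sobolev_norm r (u + v - \<phi>) < e"
        using test_functions_add[OF \<phi>(1) \<psi>(1)] by blast
    qed
  qed (auto simp: Sob.ips Sob.ip_sym Sob.ip_nonneg S)
  then interpret semi_inner_space ?V "sobolev_inner r" .
  show ?thesis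
  proof
    fix X assume X: "\<And>n. X n \<in> ?V" and c: "cauchy_seq X"
    have XS: "X n \<in> sobolev r" for n using X S by blast
    have cS: "Sob.cauchy_seq r X" using c unfolding cauchy_seq_def Sob.cauchy_seq_def sobolev_nrm_eq .
    obtain u where u: "u \<in> sobolev r" "(\<lambda>n. sobolev_norm r (X n - u)) \<longlonglongrightarrow> 0"
      using sobolev_complete[OF r(1) XS cS] by blast
    have "u \<in> ?V"
      unfolding sobolev_tilde_alt
    proof (intro conjI allI impI u(1))
      fix e :: real assume e: "e > 0"
      obtain n where "\<forall>m\<ge>n. norm (sobolev_norm r (X m - u) - 0) < e / 2"
        using LIMSEQ_D[OF u(2), of "e/2"] e by auto
      then have n: "sobolev_norm r (X n - u) < e / 2" by auto
      have "e / 2 > 0" using e by simp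
      then obtain \<phi> where \<phi>: "\<phi> \<in> test_functions U" "sobolev_norm r (X n - \<phi>) < e / 2"
        using X[of n] unfolding sobolev_tilde_alt by blast
      have "sobolev_norm r (u - \<phi>) \<le> sobolev_norm r (u - X n) + sobolev_norm r (X n - \<phi>)"
        by (intro Sob.nrm_triangle_diff XS T u \<phi>)
      then have "sobolev_norm r (u - \<phi>) < e"
        using n \<phi>(2) Sob.nrm_minus_commute[OF u(1) XS, of n] by simp
      then show "\<exists>\<phi>\<in>test_functions U. sobolev_norm r (u - \<phi>) < e" using \<phi>(1) by blast
    qed
    then show "\<exists>x\<in>?V. (\<lambda>n. nrm (X n - x)) \<longlonglongrightarrow> 0"
      using u(2) unfolding sobolev_nrm_eq by blast
  qed
qed

text \<open>
  Test functions vanish outside \<open>U\<close>, and convergence in \<open>H\<^sup>r\<close> implies convergence in \<open>L\<^sup>2\<close>.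
\<close>

lemma sobolev_tilde_vanishes_outside:
  fixes u :: "'a::euclidean_space \<Rightarrow> real"
  assumes u: "u \<in> sobolev_tilde r U" and r: "0 \<le> r" "r \<le> 1" and U[measurable]: "U \<in> sets borel"
  shows "AE x in lborel. x \<notin> U \<longrightarrow> u x = 0"
proof -
  define \<kappa> where "\<kappa> = gauss_const TYPE('a)"
  have \<kappa>: "\<kappa> > 0" by (simp add: \<kappa>_def)
  have uS: "u \<in> sobolev r" and uL: "u \<in> L2_space lborel"
    using u by (auto intro: sobolev_tilde_sobolev sobolev_L2)
  have [measurable]: "u \<in> borel_measurable borel" using L2_measurable[OF uL] by simp
  define v where "v x = indicator (- U) x * u x" for x
  have vm: "v \<in> borel_measurable lborel" unfolding v_def[abs_def] by measurable
  have vL: "v \<in> L2_space lborel" by (rule L2_dominated[OF uL vm]) (auto simp: v_def indicator_def)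
  have "L2_norm lborel v \<le> e" if e: "e > 0" for e
  proof -
    have "\<kappa> * e > 0" using e \<kappa> by simp
    then obtain \<phi> where \<phi>: "\<phi> \<in> test_functions U" "sobolev_norm r (u - \<phi>) < \<kappa> * e"
      using u unfolding sobolev_tilde_alt by blast
    have d: "u - \<phi> \<in> sobolev r" by (intro Sob.diff_mem uS test_functions_sobolev[OF \<phi>(1)] r)
    have "\<phi> x = 0" if "x \<notin> U" for x
      using \<phi>(1) that closure_subset[of "{x. \<phi> x \<noteq> 0}"] by (auto simp: test_functions_def)
    then have "L2_norm lborel v \<le> L2_norm lborel (u - \<phi>)"
      by (intro L2_norm_mono vm sobolev_L2[OF d] AE_I2) (auto simp: v_def indicator_def)
    moreover have "\<kappa> * L2_norm lborel (u - \<phi>) \<le> sobolev_norm r (u - \<phi>)"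
      unfolding \<kappa>_def by (rule L2_norm_le_sobolev[OF d r(1)])
    ultimately have "\<kappa> * L2_norm lborel v \<le> \<kappa> * e"
      using \<phi>(2) \<kappa> by (smt (verit) mult_left_mono)
    then show ?thesis using \<kappa> by simp
  qed
  then have "L2_norm lborel v \<le> 0" by (rule field_le_epsilon[of _ 0, simplified])
  then have "AE x in lborel. v x = 0" by (simp add: L2_norm_eq_0_iff[OF vL, symmetric] antisym)
  then show ?thesis by eventually_elim (auto simp: v_def indicator_def)
qed

section \<open>The regional fractional Laplacian\<close>

lemma ball_borel [measurable]: "ball (x :: 'a::euclidean_space) r \<in> sets borel"
  by simp

lemma singular_kernel_integral:
  fixes e :: real
  assumes e: "0 < e" "e \<le> real DIM('a::euclidean_space)"
  shows "\<exists>c\<ge>0. \<forall>\<delta>>0. (\<integral>\<^sup>+h. indicator (ball 0 \<delta>) h * ennreal (norm h powr (e - real DIM('a))) \<partial>(lborel :: 'a measure)) \<le> ennreal (c * \<delta> powr e)"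
proof -
  define D where "D = real DIM('a)"
  define \<omega> where "\<omega> = unit_ball_vol (real DIM('a))"
  define q :: real where "q = (1/2) powr e"
  have q: "0 < q" "q < 1" using e powr_less_mono2[of e "1/2" 1] by (auto simp: q_def)
  have \<omega>: "\<omega> \<ge> 0" by (simp add: \<omega>_def)
  define c where "c = 2 ^ DIM('a) * \<omega> * (q / (1 - q))"
  have c: "c \<ge> 0" using q \<omega> by (simp add: c_def)
  have "(\<integral>\<^sup>+h. indicator (ball 0 \<delta>) h * ennreal (norm h powr (e - D)) \<partial>(lborel :: 'a measure)) \<le> ennreal (c * \<delta> powr e)"
    if \<delta>: "\<delta> > 0" for \<delta>
  proof -
    define a where "a k = \<delta> * (1/2)^k" for k
    have a: "a k > 0" for k using \<delta> by (simp add: a_def)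
    \<comment> \<open>the dyadic shell \<open>a (k + 1) \<le> \<bar>h\<bar> < a k\<close> is estimated by the ball of radius \<open>a k\<close>\<close>
    let ?w = "\<lambda>k. ennreal (a (Suc k) powr (e - D))"
    have pt: "indicator (ball 0 \<delta>) h * ennreal (norm h powr (e - D)) \<le> (\<Sum>k. indicator (ball 0 (a k)) h * ?w k)" for h :: 'a
    proof (cases "h = 0 \<or> norm h \<ge> \<delta>")
      case True
      then show ?thesis by (auto simp: indicator_def)
    next
      case False
      then have h: "0 < norm h" "norm h < \<delta>" by auto
      define k where "k = (LEAST k. a (Suc k) \<le> norm h)"
      obtain n where "(1/2)^n < norm h / \<delta>"
        using real_arch_pow_inv[of "norm h / \<delta>" "1/2"] h \<delta> by auto
      then have "a n \<le> norm h" using \<delta> by (simp add: a_def field_simps)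
      moreover have "a (Suc n) \<le> a n" using \<delta> by (simp add: a_def)
      ultimately have "a (Suc n) \<le> norm h" by simp
      then have k1: "a (Suc k) \<le> norm h" unfolding k_def by (rule LeastI)
      have k2: "norm h < a k"
      proof (cases k)
        case 0
        then show ?thesis using h by (simp add: a_def)
      next
        case (Suc j)
        then have "\<not> a (Suc j) \<le> norm h" using not_less_Least[of j "\<lambda>k. a (Suc k) \<le> norm h"] by (simp add: k_def)
        then show ?thesis using Suc by simp
      qed
      have "indicator (ball 0 \<delta>) h * ennreal (norm h powr (e - D)) = ennreal (norm h powr (e - D))" using h by simp
      also have "\<dots> \<le> ?w k"
        using e a[of "Suc k"] k1 by (intro ennreal_leI powr_mono2') (auto simp: D_def)
      also have "\<dots> = (\<Sum>i\<in>{k}. indicator (ball 0 (a i)) h * ?w i)" using k2 by simp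
      also have "\<dots> \<le> (\<Sum>i. indicator (ball 0 (a i)) h * ?w i)" by (rule sum_le_suminf) auto
      finally show ?thesis .
    qed
    have "(\<integral>\<^sup>+h. indicator (ball 0 \<delta>) h * ennreal (norm h powr (e - D)) \<partial>(lborel :: 'a measure))
      \<le> (\<integral>\<^sup>+h. (\<Sum>k. indicator (ball 0 (a k)) h * ?w k) \<partial>(lborel :: 'a measure))"
      by (intro nn_integral_mono pt)
    also have "\<dots> = (\<Sum>k. \<integral>\<^sup>+h. indicator (ball 0 (a k)) h * ?w k \<partial>(lborel :: 'a measure))"
      by (rule nn_integral_suminf) measurable
    also have "\<dots> = (\<Sum>k. ennreal (2 ^ DIM('a) * \<omega> * \<delta> powr e * q * q ^ k))"
    proof (rule suminf_cong)
      fix k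
      have "(\<integral>\<^sup>+h. indicator (ball 0 (a k)) h * ?w k \<partial>(lborel :: 'a measure)) = emeasure lborel (ball (0::'a) (a k)) * ?w k"
        by (simp add: nn_integral_multc)
      also have "\<dots> = ennreal (\<omega> * a k ^ DIM('a) * a (Suc k) powr (e - D))"
        using a[of k] \<omega> by (simp add: emeasure_ball \<omega>_def ennreal_mult)
      also have "a k ^ DIM('a) = 2 ^ DIM('a) * a (Suc k) powr D"
        using a[of "Suc k"] a[of k] by (simp add: D_def powr_realpow power_mult_distrib[symmetric] a_def)
      also have "\<omega> * (2 ^ DIM('a) * a (Suc k) powr D) * a (Suc k) powr (e - D) = 2 ^ DIM('a) * \<omega> * a (Suc k) powr e"
        by (simp add: powr_add[symmetric] mult.assoc)
      also have "a (Suc k) powr e = \<delta> powr e * q ^ Suc k"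
      proof -
        have "((1/2)^Suc k) powr e = ((1/2::real) powr real (Suc k)) powr e" by (subst powr_realpow) auto
        also have "\<dots> = (1/2) powr (real (Suc k) * e)" by (rule powr_powr)
        also have "\<dots> = q powr real (Suc k)" unfolding q_def by (simp add: powr_powr mult.commute)
        also have "\<dots> = q ^ Suc k" using q by (subst powr_realpow) auto
        finally show ?thesis using \<delta> unfolding a_def by (subst powr_mult) auto
      qed
      finally show "(\<integral>\<^sup>+h. indicator (ball 0 (a k)) h * ?w k \<partial>(lborel :: 'a measure)) = ennreal (2 ^ DIM('a) * \<omega> * \<delta> powr e * q * q ^ k)"
        by (simp add: mult_ac)
    qed
    also have "\<dots> = ennreal (\<Sum>k. 2 ^ DIM('a) * \<omega> * \<delta> powr e * q * q ^ k)"
      using q \<omega> by (intro suminf_ennreal2 summable_mult summable_geometric) auto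
    also have "(\<Sum>k. 2 ^ DIM('a) * \<omega> * \<delta> powr e * q * q ^ k) = 2 ^ DIM('a) * \<omega> * \<delta> powr e * q * (1 / (1 - q))"
      using q by (subst suminf_mult) (auto simp: suminf_geometric intro: summable_geometric)
    also have "\<dots> = c * \<delta> powr e" by (simp add: c_def)
    finally show ?thesis .
  qed
  then show ?thesis using c by (auto simp: D_def)
qed

text \<open>
  The singular integral \<open>\<integral> (u (x + h) - u x) / \<bar>h\<bar>\<^bsup>n + s\<^esup> dh\<close> over \<open>\<bar>h\<bar> < \<delta>\<close>, with absolute values inside.
\<close>

definition oscillation :: "real \<Rightarrow> real \<Rightarrow> ('a::euclidean_space \<Rightarrow> real) \<Rightarrow> 'a \<Rightarrow> ennreal" where
  "oscillation s \<delta> u x = (\<integral>\<^sup>+h. indicator (ball 0 \<delta>) h *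
     ennreal (\<bar>u (x + h) - u x\<bar> * norm h powr (- (real DIM('a) + s))) \<partial>lborel)"

lemma oscillation_measurable:
  assumes [measurable]: "u \<in> borel_measurable borel"
  shows "oscillation s \<delta> u \<in> borel_measurable borel"
  unfolding oscillation_def[abs_def] by measurable

text \<open>
  By the Cauchy-Schwarz inequality with the weights \<open>\<bar>h\<bar>\<^bsup>t - s - n\<^esup>\<close> and
  \<open>\<bar>h\<bar>\<^bsup>- n - s - t\<^esup>\<close>, and then \<open>\<parallel>u(\<cdot> + h) - u\<parallel> \<le> C \<bar>h\<bar>\<^sup>t\<close>, the oscillation at scale \<open>\<delta>\<close> has
  \<open>L\<^sup>2\<close> norm \<open>O(\<delta>\<^bsup>t - s\<^esup>)\<close>. The gap between \<open>s\<close> and \<open>t\<close> makes all these integrals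
  converge absolutely and makes the bound small with \<open>\<delta>\<close>.
\<close>

lemma oscillation_estimate:
  assumes st: "0 < s" "s < t" "t < 1"
  shows "\<exists>C\<ge>0. \<forall>\<delta>>0. \<forall>u\<in>sobolev t. (\<integral>\<^sup>+x. (oscillation s \<delta> u x)\<^sup>2 \<partial>(lborel :: 'a::euclidean_space measure))
     \<le> ennreal ((C * \<delta> powr (t - s) * sobolev_norm t u)\<^sup>2)"
proof -
  define D where "D = real DIM('a)"
  define \<kappa> where "\<kappa> = gauss_const TYPE('a)"
  have \<kappa>: "\<kappa> > 0" by (simp add: \<kappa>_def)
  define e where "e = t - s"
  have D1: "D \<ge> 1" by (simp add: D_def Suc_le_eq)
  have e: "0 < e" "e \<le> D" using st D1 by (auto simp: e_def)
  obtain c where c: "c \<ge> 0" "\<And>\<delta>. \<delta> > 0 \<Longrightarrow>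
     (\<integral>\<^sup>+h. indicator (ball 0 \<delta>) h * ennreal (norm h powr (e - D)) \<partial>(lborel :: 'a measure)) \<le> ennreal (c * \<delta> powr e)"
    using singular_kernel_integral[of e, where ?'a='a] e by (auto simp: D_def)
  define C where "C = 2 * c / \<kappa>"
  have "(\<integral>\<^sup>+x. (oscillation s \<delta> u x)\<^sup>2 \<partial>lborel) \<le> ennreal ((C * \<delta> powr e * sobolev_norm t u)\<^sup>2)"
    if \<delta>: "\<delta> > 0" and u: "u \<in> sobolev t" for \<delta> and u :: "'a \<Rightarrow> real"
  proof -
    have uL: "u \<in> L2_space lborel" by (rule sobolev_L2[OF u])
    have [measurable]: "u \<in> borel_measurable borel" using L2_measurable[OF uL] by simp
    define S where "S = sobolev_norm t u"
    let ?B = "indicator (ball 0 \<delta>) :: 'a \<Rightarrow> ennreal"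
    define K where "K = (\<integral>\<^sup>+h. ?B h * ennreal (norm h powr (e - D)) \<partial>(lborel :: 'a measure))"
    have K: "K \<le> ennreal (c * \<delta> powr e)" unfolding K_def by (rule c(2)[OF \<delta>])
    define g where "g h x = ?B h * ennreal ((u (x + h) - u x)\<^sup>2 * norm h powr (- (D + s + t)))" for h x
    have gm: "case_prod g \<in> borel_measurable (lborel \<Otimes>\<^sub>M lborel)"
      unfolding g_def[abs_def] by measurable
    have cs: "(oscillation s \<delta> u x)\<^sup>2 \<le> K * (\<integral>\<^sup>+h. g h x \<partial>lborel)" for x
    proof -
      let ?f1 = "\<lambda>h. ?B h * ennreal (norm h powr ((e - D) / 2))"
      let ?f2 = "\<lambda>h. ?B h * ennreal (\<bar>u (x + h) - u x\<bar> * norm h powr (- (D + s + t) / 2))"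
      have "oscillation s \<delta> u x = (\<integral>\<^sup>+h. ?f1 h * ?f2 h \<partial>lborel)"
        unfolding oscillation_def
      proof (rule nn_integral_cong)
        fix h :: 'a
        have "(e - D) / 2 + - (D + s + t) / 2 = - (D + s)" by (simp add: e_def field_simps)
        then have "norm h powr ((e - D) / 2) * norm h powr (- (D + s + t) / 2) = norm h powr (- (D + s))"
          by (simp only: powr_add[symmetric])
        then have "ennreal (norm h powr ((e - D) / 2)) * ennreal (\<bar>u (x + h) - u x\<bar> * norm h powr (- (D + s + t) / 2))
          = ennreal (\<bar>u (x + h) - u x\<bar> * norm h powr (- (D + s)))"
          by (simp add: ennreal_mult[symmetric] mult_ac)
        then show "?B h * ennreal (\<bar>u (x + h) - u x\<bar> * norm h powr (- (real DIM('a) + s))) = ?f1 h * ?f2 h"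
          by (auto simp: indicator_def D_def)
      qed
      then have "(oscillation s \<delta> u x)\<^sup>2 \<le> (\<integral>\<^sup>+h. (?f1 h)\<^sup>2 \<partial>lborel) * (\<integral>\<^sup>+h. (?f2 h)\<^sup>2 \<partial>lborel)"
        by (simp only:) (rule Cauchy_Schwarz_nn_integral; measurable)
      also have "(\<integral>\<^sup>+h. (?f1 h)\<^sup>2 \<partial>lborel) = K"
        unfolding K_def
      proof (rule nn_integral_cong)
        fix h :: 'a
        have "(norm h powr ((e - D) / 2))\<^sup>2 = norm h powr (e - D)"
          by (simp add: power2_eq_square flip: powr_add)
        then show "(?f1 h)\<^sup>2 = ?B h * ennreal (norm h powr (e - D))"
          by (auto simp: indicator_def ennreal_power)
      qed
      also have "(\<integral>\<^sup>+h. (?f2 h)\<^sup>2 \<partial>lborel) = (\<integral>\<^sup>+h. g h x \<partial>lborel)"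
      proof (rule nn_integral_cong)
        fix h :: 'a
        have "(norm h powr (- (D + s + t) / 2))\<^sup>2 = norm h powr (- (D + s + t))"
          by (simp only: power2_eq_square powr_add[symmetric]) simp
        then show "(?f2 h)\<^sup>2 = g h x"
          by (auto simp: indicator_def ennreal_power g_def power_mult_distrib)
      qed
      finally show ?thesis .
    qed
    have inner: "(\<integral>\<^sup>+x. g h x \<partial>lborel) \<le> ennreal ((2 * S / \<kappa>)\<^sup>2) * (?B h * ennreal (norm h powr (e - D)))" for h
    proof -
      have d: "translate h u - u \<in> L2_space lborel" by (intro L2.diff_mem translate_L2 uL)
      have "\<kappa> * L2_norm lborel (translate h u - u) \<le> 2 * norm h powr t * S"
        unfolding \<kappa>_def S_def using st by (intro sobolev_translation_estimate u) auto
      then have "L2_norm lborel (translate h u - u) \<le> 2 * S / \<kappa> * norm h powr t"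
        using \<kappa> by (simp add: field_simps)
      then have "(L2_norm lborel (translate h u - u))\<^sup>2 \<le> (2 * S / \<kappa> * norm h powr t)\<^sup>2"
        by (rule power_mono) simp
      also have "\<dots> = (2 * S / \<kappa>)\<^sup>2 * norm h powr (t + t)"
        by (simp only: power_mult_distrib power2_eq_square[of "norm h powr t"] powr_add)
      finally have nrm: "(L2_norm lborel (translate h u - u))\<^sup>2 \<le> (2 * S / \<kappa>)\<^sup>2 * norm h powr (t + t)" .
      have "(\<integral>\<^sup>+x. g h x \<partial>lborel) = (\<integral>\<^sup>+x. (?B h * ennreal (norm h powr (- (D + s + t)))) * ennreal ((norm ((translate h u - u) x))\<^sup>2) \<partial>lborel)"
        by (intro nn_integral_cong) (simp add: g_def translate_def ennreal_mult mult_ac)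
      also have "\<dots> = (?B h * ennreal (norm h powr (- (D + s + t)))) * ennreal ((L2_norm lborel (translate h u - u))\<^sup>2)"
        unfolding L2_norm_nn[OF d] by (rule nn_integral_cmult) (use L2_measurable[OF d] in measurable)
      also have "\<dots> \<le> (?B h * ennreal (norm h powr (- (D + s + t)))) * ennreal ((2 * S / \<kappa>)\<^sup>2 * norm h powr (t + t))"
        by (intro mult_left_mono ennreal_leI nrm) auto
      also have "\<dots> = ennreal ((2 * S / \<kappa>)\<^sup>2) * (?B h * ennreal (norm h powr (e - D)))"
      proof -
        have "- (D + s + t) + (t + t) = e - D" by (simp add: e_def)
        then have "norm h powr (- (D + s + t)) * norm h powr (t + t) = norm h powr (e - D)"
          by (simp only: powr_add[symmetric])
        then have "ennreal (norm h powr (- (D + s + t))) * ennreal ((2 * S / \<kappa>)\<^sup>2 * norm h powr (t + t))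
          = ennreal ((2 * S / \<kappa>)\<^sup>2) * ennreal (norm h powr (e - D))"
          by (simp add: ennreal_mult[symmetric] mult_ac)
        then show ?thesis by (simp add: mult_ac)
      qed
      finally show ?thesis .
    qed
    have "(\<integral>\<^sup>+x. (oscillation s \<delta> u x)\<^sup>2 \<partial>lborel) \<le> (\<integral>\<^sup>+x. K * (\<integral>\<^sup>+h. g h x \<partial>lborel) \<partial>lborel)"
      by (intro nn_integral_mono cs)
    also have "\<dots> = K * (\<integral>\<^sup>+x. (\<integral>\<^sup>+h. g h x \<partial>lborel) \<partial>lborel)"
      by (rule nn_integral_cmult) (use gm in measurable)
    also have "(\<integral>\<^sup>+x. (\<integral>\<^sup>+h. g h x \<partial>lborel) \<partial>lborel) = (\<integral>\<^sup>+h. (\<integral>\<^sup>+x. g h x \<partial>lborel) \<partial>lborel)"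
      by (rule lborel_pair.Fubini'[OF gm])
    also have "\<dots> \<le> (\<integral>\<^sup>+h. ennreal ((2 * S / \<kappa>)\<^sup>2) * (?B h * ennreal (norm h powr (e - D))) \<partial>lborel)"
      by (intro nn_integral_mono inner)
    also have "\<dots> = ennreal ((2 * S / \<kappa>)\<^sup>2) * K"
      unfolding K_def by (rule nn_integral_cmult) measurable
    finally have "(\<integral>\<^sup>+x. (oscillation s \<delta> u x)\<^sup>2 \<partial>lborel) \<le> K * (ennreal ((2 * S / \<kappa>)\<^sup>2) * K)"
      by (simp add: mult_left_mono)
    also have "\<dots> \<le> ennreal (c * \<delta> powr e) * (ennreal ((2 * S / \<kappa>)\<^sup>2) * ennreal (c * \<delta> powr e))"
      by (intro mult_mono K) auto
    also have "\<dots> = ennreal ((C * \<delta> powr e * S)\<^sup>2)"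
    proof -
      have "ennreal A * (ennreal B * ennreal A) = ennreal (A * (B * A))" if "A \<ge> 0" "B \<ge> 0" for A B
        using that by (simp add: ennreal_mult)
      from this[of "c * \<delta> powr e" "(2 * S / \<kappa>)\<^sup>2"] show ?thesis
        using c(1) by (simp add: C_def power2_eq_square mult_ac)
    qed
    finally show ?thesis by (simp add: S_def)
  qed
  moreover have "C \<ge> 0" using c(1) \<kappa> by (simp add: C_def)
  ultimately show ?thesis unfolding e_def by blast
qed

locale fractional_setting =
  fixes \<Omega> :: "'a::euclidean_space set" and s t :: real
  assumes st: "0 < s" "s < t" "t < 1"
    and bounded_\<Omega>: "bounded \<Omega>" and \<Omega>_borel: "\<Omega> \<in> sets borel"
begin

lemmas [measurable] = \<Omega>_borel

definition diff_quot :: "('a \<Rightarrow> real) \<Rightarrow> 'a \<Rightarrow> 'a \<Rightarrow> real" where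
  "diff_quot u x y = (u x - u y) / norm (x - y) powr (real DIM('a) + s)"

text \<open>
  Up to the constant factor \<open>frac_const\<close>, this is the regional Laplacian of order \<open>s\<close>, extended by zero.
\<close>

definition regional_op :: "('a \<Rightarrow> real) \<Rightarrow> 'a \<Rightarrow> real" where
  "regional_op u x = indicator \<Omega> x * (LINT y|lborel. indicator \<Omega> y * diff_quot u x y)"

text \<open>
  All differences of points of \<open>\<Omega>\<close> lie in the ball of radius \<open>\<rho>\<close>, so the oscillation at scale \<open>\<rho>\<close>
  dominates the full regional integral.
\<close>

definition \<rho> :: real where "\<rho> = (SOME r. r > 0 \<and> (\<forall>x\<in>\<Omega>. \<forall>y\<in>\<Omega>. norm (y - x) < r))"

lemma \<rho>: "\<rho> > 0" "x \<in> \<Omega> \<Longrightarrow> y \<in> \<Omega> \<Longrightarrow> norm (y - x) < \<rho>"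
proof -
  obtain B where B: "\<And>x. x \<in> \<Omega> \<Longrightarrow> norm x \<le> B" "B > 0" using bounded_\<Omega> by (auto simp: bounded_pos)
  have "norm (y - x) < 2 * B + 1" if "x \<in> \<Omega>" "y \<in> \<Omega>" for x y
    using norm_triangle_ineq4[of y x] B(1)[OF that(1)] B(1)[OF that(2)] by linarith
  then have "\<exists>r. r > 0 \<and> (\<forall>x\<in>\<Omega>. \<forall>y\<in>\<Omega>. norm (y - x) < r)"
    using B(2) by (intro exI[of _ "2 * B + 1"]) auto
  then have "\<rho> > 0 \<and> (\<forall>x\<in>\<Omega>. \<forall>y\<in>\<Omega>. norm (y - x) < \<rho>)" unfolding \<rho>_def by (rule someI_ex)
  then show "\<rho> > 0" "x \<in> \<Omega> \<Longrightarrow> y \<in> \<Omega> \<Longrightarrow> norm (y - x) < \<rho>" by auto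
qed

lemma indicator_\<Omega>_L2: "indicator \<Omega> \<in> (L2_space lborel :: ('a \<Rightarrow> real) set)"
  by (intro indicator_L2 \<Omega>_borel bounded_\<Omega>)

lemma abs_diff_quot:
  "\<bar>diff_quot u x y\<bar> = \<bar>u x - u y\<bar> * norm (x - y) powr (- (real DIM('a) + s))"
  unfolding diff_quot_def powr_minus by (simp add: abs_mult divide_inverse)

lemma oscillation_shift:
  assumes [measurable]: "u \<in> borel_measurable borel"
  shows "oscillation s \<delta> u x = (\<integral>\<^sup>+y. indicator (ball 0 \<delta>) (y - x) * ennreal \<bar>diff_quot u x y\<bar> \<partial>lborel)"
proof -
  have "(\<integral>\<^sup>+y. indicator (ball 0 \<delta>) (y - x) * ennreal \<bar>diff_quot u x y\<bar> \<partial>lborel)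
    = (\<integral>\<^sup>+h. indicator (ball 0 \<delta>) ((h + x) - x) * ennreal \<bar>diff_quot u x (h + x)\<bar> \<partial>lborel)"
    unfolding diff_quot_def
    by (rule nn_integral_measure_preserving[OF measure_preserving_translate, symmetric]) measurable
  also have "\<dots> = oscillation s \<delta> u x"
    unfolding oscillation_def
  proof (rule nn_integral_cong)
    fix h
    have n: "norm (x - (h + x)) = norm h" by simp
    show "indicator (ball 0 \<delta>) ((h + x) - x) * ennreal \<bar>diff_quot u x (h + x)\<bar>
      = indicator (ball 0 \<delta>) h * ennreal (\<bar>u (x + h) - u x\<bar> * norm h powr (- (real DIM('a) + s)))"
      unfolding abs_diff_quot n by (simp add: add.commute abs_minus_commute)
  qed
  finally show ?thesis by simp
qed

lemma regional_nn_le_oscillation: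
  assumes [measurable]: "u \<in> borel_measurable borel" and x: "x \<in> \<Omega>"
  shows "(\<integral>\<^sup>+y. ennreal (norm (indicator \<Omega> y * diff_quot u x y)) \<partial>lborel) \<le> oscillation s \<rho> u x"
  unfolding oscillation_shift[OF assms(1)]
  using \<rho>(2)[OF x] by (intro nn_integral_mono) (auto simp: indicator_def)

lemma oscillation_finite_AE:
  fixes u :: "'a \<Rightarrow> real"
  assumes u: "u \<in> sobolev t" and \<delta>: "\<delta> > 0"
  shows "AE x in lborel. oscillation s \<delta> u x < \<infinity>"
proof -
  have [measurable]: "u \<in> borel_measurable borel" using L2_measurable[OF sobolev_L2[OF u]] by simp
  obtain C where C: "C \<ge> 0 \<and> (\<forall>\<delta>>0. \<forall>u\<in>sobolev t. (\<integral>\<^sup>+x. (oscillation s \<delta> u x)\<^sup>2 \<partial>(lborel :: 'a measure))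
     \<le> ennreal ((C * \<delta> powr (t - s) * sobolev_norm t u)\<^sup>2))"
    using oscillation_estimate[OF st] by (rule exE)
  have "(\<integral>\<^sup>+x. (oscillation s \<delta> u x)\<^sup>2 \<partial>lborel) \<le> ennreal ((C * \<delta> powr (t - s) * sobolev_norm t u)\<^sup>2)"
    by (rule bspec[OF mp[OF spec[OF conjunct2[OF C]] \<delta>] u])
  then have "(\<integral>\<^sup>+x. (oscillation s \<delta> u x)\<^sup>2 \<partial>lborel) \<noteq> \<infinity>" using neq_top_trans ennreal_neq_top infinity_ennreal_def by metis
  then have "AE x in lborel. (oscillation s \<delta> u x)\<^sup>2 \<noteq> \<infinity>"
    using oscillation_measurable[OF \<open>u \<in> borel_measurable borel\<close>, of s \<delta>]
    by (intro nn_integral_PInf_AE) auto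
  then show ?thesis by eventually_elim (auto simp: less_top power_eq_top_ennreal)
qed

lemma regional_integrable_AE:
  assumes u: "u \<in> sobolev t"
  shows "AE x in lborel. x \<in> \<Omega> \<longrightarrow> integrable lborel (\<lambda>y. indicator \<Omega> y * diff_quot u x y)"
  using oscillation_finite_AE[OF u \<rho>(1)]
proof eventually_elim
  case (elim x)
  have [measurable]: "u \<in> borel_measurable borel" using L2_measurable[OF sobolev_L2[OF u]] by simp
  have m: "(\<lambda>y. indicator \<Omega> y * diff_quot u x y) \<in> borel_measurable lborel"
    unfolding diff_quot_def by measurable
  show ?case
  proof
    assume x: "x \<in> \<Omega>"
    show "integrable lborel (\<lambda>y. indicator \<Omega> y * diff_quot u x y)"
      by (rule integrableI_bounded[OF m le_less_trans[OF regional_nn_le_oscillation[OF _ x] elim]]) measurable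
  qed
qed

lemma regional_op_measurable:
  assumes [measurable]: "u \<in> borel_measurable borel"
  shows "regional_op u \<in> borel_measurable borel"
  unfolding regional_op_def[abs_def] diff_quot_def[abs_def] by measurable

text \<open>
  Where \<open>\<bar>x - y\<bar> < \<delta>\<close> the integrand is part of the oscillation; elsewhere the kernel is at most
  \<open>m = \<delta>\<^bsup>- n - s\<^esup>\<close>.
\<close>

lemma regional_op_pointwise:
  assumes u: "u \<in> sobolev t" and \<delta>: "\<delta> > 0"
  defines "m \<equiv> \<delta> powr (- (real DIM('a) + s))"
  shows "AE x in lborel. \<bar>regional_op u x\<bar> \<le> enn2real (oscillation s \<delta> u x)
     + indicator \<Omega> x * (m * (measure lborel \<Omega> * \<bar>u x\<bar> + (LINT y|lborel. indicator \<Omega> y * \<bar>u y\<bar>)))"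
  using oscillation_finite_AE[OF u \<delta>] regional_integrable_AE[OF u]
proof eventually_elim
  case (elim x)
  have uL: "u \<in> L2_space lborel" by (rule sobolev_L2[OF u])
  have [measurable]: "u \<in> borel_measurable borel" using L2_measurable[OF uL] by simp
  have aL: "(\<lambda>y. \<bar>u y\<bar>) \<in> L2_space lborel" by (rule L2_dominated[OF uL]) auto
  have int1: "integrable lborel (\<lambda>y. indicator \<Omega> y * \<bar>u y\<bar>)"
    by (rule integrable_L2_mult[OF indicator_\<Omega>_L2 aL])
  have int0: "integrable lborel (\<lambda>y. indicator \<Omega> y :: real)"
    using emeasure_bounded_finite[OF bounded_\<Omega>] by simp
  show ?case
  proof (cases "x \<in> \<Omega>")
    case True
    define o' where "o' y = indicator (ball 0 \<delta>) (y - x) * \<bar>diff_quot u x y\<bar>" for y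
    have om: "o' \<in> borel_measurable lborel" unfolding o'_def[abs_def] diff_quot_def by measurable
    have o_nn: "oscillation s \<delta> u x = (\<integral>\<^sup>+y. ennreal (o' y) \<partial>lborel)"
      unfolding oscillation_shift[OF \<open>u \<in> borel_measurable borel\<close>]
      by (intro nn_integral_cong) (auto simp: o'_def indicator_def)
    have oi: "integrable lborel o'"
      using elim(1) unfolding o_nn by (intro integrableI_bounded om) (auto simp: o'_def)
    have ov: "(LINT y|lborel. o' y) = enn2real (oscillation s \<delta> u x)"
      unfolding o_nn by (rule integral_eq_nn_integral[OF om]) (auto simp: o'_def)
    define f where "f y = m * (indicator \<Omega> y * \<bar>u x\<bar> + indicator \<Omega> y * \<bar>u y\<bar>)" for y
    have fi: "integrable lborel f"
      unfolding f_def[abs_def] by (intro integrable_mult_right Bochner_Integration.integrable_add integrable_mult_left int0 int1)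
    have le: "\<bar>indicator \<Omega> y * diff_quot u x y\<bar> \<le> o' y + f y" for y
    proof (cases "norm (y - x) < \<delta>")
      case True
      then show ?thesis by (auto simp: o'_def f_def m_def indicator_def)
    next
      case False
      have "norm (x - y) powr (- (real DIM('a) + s)) \<le> m"
        unfolding m_def using False \<delta> st by (intro powr_mono2') (auto simp: norm_minus_commute)
      moreover have "\<bar>u x - u y\<bar> \<le> \<bar>u x\<bar> + \<bar>u y\<bar>" by simp
      ultimately have "\<bar>u x - u y\<bar> * norm (x - y) powr (- (real DIM('a) + s)) \<le> (\<bar>u x\<bar> + \<bar>u y\<bar>) * m"
        by (intro mult_mono) auto
      then have "\<bar>diff_quot u x y\<bar> \<le> m * (\<bar>u x\<bar> + \<bar>u y\<bar>)"
        by (simp only: abs_diff_quot mult.commute)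
      then show ?thesis by (auto simp: o'_def f_def indicator_def)
    qed
    have "\<bar>regional_op u x\<bar> \<le> (LINT y|lborel. \<bar>indicator \<Omega> y * diff_quot u x y\<bar>)"
      using True integral_abs_bound[of lborel "\<lambda>y. indicator \<Omega> y * diff_quot u x y"] by (simp add: regional_op_def)
    also have "\<dots> \<le> (LINT y|lborel. o' y + f y)"
      using elim(2) True by (intro integral_mono le Bochner_Integration.integrable_add oi fi integrable_abs) auto
    also have "\<dots> = enn2real (oscillation s \<delta> u x) + (LINT y|lborel. f y)"
      by (simp add: oi fi ov)
    also have "(LINT y|lborel. f y) = m * (measure lborel \<Omega> * \<bar>u x\<bar> + (LINT y|lborel. indicator \<Omega> y * \<bar>u y\<bar>))"
      unfolding f_def using int0 int1 by simp
    finally show ?thesis using True by simp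
  next
    case False
    then show ?thesis by (simp add: regional_op_def enn2real_nonneg)
  qed
qed

text \<open>
  The constant in front of the \<open>H\<^sup>t\<close> norm tends to zero with \<open>\<delta>\<close>, at the price of a large multiple of
  the \<open>L\<^sup>2\<close> norm: the regional Laplacian is of lower order.
\<close>

lemma regional_op_bound:
  "\<exists>C\<ge>0. \<forall>\<delta>>0. \<exists>M\<ge>0. \<forall>u\<in>sobolev t. regional_op u \<in> L2_space lborel \<and>
     L2_norm lborel (regional_op u) \<le> C * \<delta> powr (t - s) * sobolev_norm t u + M * L2_norm lborel u"
proof -
  obtain C where C': "C \<ge> 0 \<and> (\<forall>\<delta>>0. \<forall>u\<in>sobolev t. (\<integral>\<^sup>+x. (oscillation s \<delta> u x)\<^sup>2 \<partial>(lborel :: 'a measure))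
     \<le> ennreal ((C * \<delta> powr (t - s) * sobolev_norm t u)\<^sup>2))"
    using oscillation_estimate[OF st] by (rule exE)
  note C = conjunct1[OF C'] bspec[OF mp[OF spec[OF conjunct2[OF C']]]]
  define \<mu> where "\<mu> = measure lborel \<Omega>"
  have "regional_op u \<in> L2_space lborel \<and> L2_norm lborel (regional_op u) \<le> C * \<delta> powr (t - s) * sobolev_norm t u
      + \<delta> powr (- (real DIM('a) + s)) * (\<mu> + (L2_norm lborel (indicator \<Omega> :: 'a \<Rightarrow> real))\<^sup>2) * L2_norm lborel u"
    if \<delta>: "\<delta> > 0" and u: "u \<in> sobolev t" for \<delta> u
  proof -
    define m where "m = \<delta> powr (- (real DIM('a) + s))"
    have m: "m \<ge> 0" by (simp add: m_def)
    have uL: "u \<in> L2_space lborel" by (rule sobolev_L2[OF u])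
    have um [measurable]: "u \<in> borel_measurable borel" using L2_measurable[OF uL] by simp
    define I where "I = (indicator \<Omega> :: 'a \<Rightarrow> real)"
    have IL: "I \<in> L2_space lborel" unfolding I_def by (rule indicator_\<Omega>_L2)
    define a where "a x = enn2real (oscillation s \<delta> u x)" for x
    define w where "w x = \<bar>u x\<bar>" for x
    have wL: "w \<in> L2_space lborel" unfolding w_def[abs_def] by (rule L2_dominated[OF uL]) auto
    have wn: "L2_norm lborel w = L2_norm lborel u" by (simp add: L2_norm_def w_def)
    have am: "a \<in> borel_measurable lborel"
      unfolding a_def[abs_def] using oscillation_measurable[OF um] by simp
    have "(\<integral>\<^sup>+x. ennreal ((norm (a x))\<^sup>2) \<partial>lborel) = (\<integral>\<^sup>+x. (oscillation s \<delta> u x)\<^sup>2 \<partial>lborel)"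
    proof (rule nn_integral_cong_AE)
      show "AE x in lborel. ennreal ((norm (a x))\<^sup>2) = (oscillation s \<delta> u x)\<^sup>2"
        using oscillation_finite_AE[OF u \<delta>]
        by eventually_elim (simp add: a_def enn2real_nonneg flip: ennreal_power)
    qed
    then have "(\<integral>\<^sup>+x. ennreal ((norm (a x))\<^sup>2) \<partial>lborel) \<le> ennreal ((C * \<delta> powr (t - s) * sobolev_norm t u)\<^sup>2)"
      using C(2)[OF \<delta> u] by simp
    from L2_I_nn[OF am this] have aL: "a \<in> L2_space lborel"
      and an: "(L2_norm lborel a)\<^sup>2 \<le> (C * \<delta> powr (t - s) * sobolev_norm t u)\<^sup>2" by auto
    have an: "L2_norm lborel a \<le> C * \<delta> powr (t - s) * sobolev_norm t u"
      by (rule power2_le_imp_le[OF an]) (use C(1) Sob.nrm_nonneg[OF u] in simp)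
    define n1 where "n1 = L2_inner lborel I w"
    have n1: "0 \<le> n1" by (simp add: n1_def L2_inner_def I_def w_def)
    have n1_le: "n1 \<le> L2_norm lborel I * L2_norm lborel u"
      using L2.cauchy_schwarz[OF IL wL] by (simp add: n1_def wn)
    define F where "F = a + ((m * \<mu>) *\<^sub>R w + (m * n1) *\<^sub>R I)"
    have FL: "F \<in> L2_space lborel" unfolding F_def by (intro L2.add_mem L2.scale_mem aL wL IL)
    have le: "AE x in lborel. norm (regional_op u x) \<le> norm (F x)"
      using regional_op_pointwise[OF u \<delta>]
    proof eventually_elim
      case (elim x)
      have "norm (regional_op u x) \<le> a x + I x * (m * (\<mu> * w x + n1))"
        using elim by (simp add: a_def I_def m_def \<mu>_def w_def n1_def L2_inner_def)
      also have "\<dots> \<le> F x"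
        using m n1 by (auto simp: F_def scaleR_fun_def I_def indicator_def w_def \<mu>_def algebra_simps)
      finally show ?case by simp
    qed
    have rm: "regional_op u \<in> borel_measurable lborel" using regional_op_measurable[OF um] by simp
    have "L2_norm lborel (regional_op u) \<le> L2_norm lborel F" by (rule L2_norm_mono[OF rm FL le])
    also have "\<dots> \<le> L2_norm lborel a + L2_norm lborel ((m * \<mu>) *\<^sub>R w + (m * n1) *\<^sub>R I)"
      unfolding F_def by (intro L2.nrm_triangle L2.add_mem L2.scale_mem aL wL IL)
    also have "L2_norm lborel ((m * \<mu>) *\<^sub>R w + (m * n1) *\<^sub>R I) \<le> L2_norm lborel ((m * \<mu>) *\<^sub>R w) + L2_norm lborel ((m * n1) *\<^sub>R I)"
      by (intro L2.nrm_triangle L2.scale_mem wL IL)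
    also have "\<dots> = m * \<mu> * L2_norm lborel u + m * n1 * L2_norm lborel I"
      using m n1 by (simp add: L2.nrm_scale wL IL wn \<mu>_def)
    also have "m * n1 * L2_norm lborel I \<le> m * (L2_norm lborel I * L2_norm lborel u) * L2_norm lborel I"
      using m by (intro mult_right_mono mult_left_mono n1_le) auto
    finally have "L2_norm lborel (regional_op u) \<le> L2_norm lborel a + (m * \<mu> * L2_norm lborel u + m * (L2_norm lborel I * L2_norm lborel u) * L2_norm lborel I)"
      by simp
    also have "\<dots> = L2_norm lborel a + m * (\<mu> + (L2_norm lborel I)\<^sup>2) * L2_norm lborel u"
      by (simp add: power2_eq_square algebra_simps)
    finally show ?thesis using an L2_dominated[OF FL rm le] by (simp add: m_def I_def)
  qed
  moreover have "\<delta> powr (- (real DIM('a) + s)) * (\<mu> + (L2_norm lborel (indicator \<Omega> :: 'a \<Rightarrow> real))\<^sup>2) \<ge> 0" for \<delta>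
    by (simp add: \<mu>_def)
  ultimately show ?thesis using C(1) by blast
qed

lemma regional_op_L2: "u \<in> sobolev t \<Longrightarrow> regional_op u \<in> L2_space lborel"
  using regional_op_bound zero_less_one by blast

lemma regional_op_add:
  assumes u: "u \<in> sobolev t" and v: "v \<in> sobolev t"
  shows "AE x in lborel. regional_op (u + v) x = (regional_op u + regional_op v) x"
  using regional_integrable_AE[OF u] regional_integrable_AE[OF v]
proof eventually_elim
  case (elim x)
  have "diff_quot (u + v) x y = diff_quot u x y + diff_quot v x y" for y
    by (simp add: diff_quot_def diff_divide_distrib add_divide_distrib)
  then show ?case using elim by (cases "x \<in> \<Omega>") (auto simp: regional_op_def ring_distribs)
qed

lemma regional_op_scale: "regional_op (c *\<^sub>R u) = c *\<^sub>R regional_op u"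
proof
  fix x
  have "indicator \<Omega> y * diff_quot (c *\<^sub>R u) x y = c * (indicator \<Omega> y * diff_quot u x y)" for y
    by (simp add: diff_quot_def scaleR_fun_def right_diff_distrib[symmetric])
  then have e: "regional_op (c *\<^sub>R u) x = indicator \<Omega> x * (LINT y|lborel. c * (indicator \<Omega> y * diff_quot u x y))"
    by (simp only: regional_op_def)
  show "regional_op (c *\<^sub>R u) x = (c *\<^sub>R regional_op u) x"
    unfolding e by (simp add: scaleR_fun_def regional_op_def)
qed

end

text \<open>Cutting the Fourier transform off at high frequencies gives functions in every \<open>H\<^sup>a\<close>.\<close>

lemma sobolev_dense:
  fixes f :: "'a::euclidean_space \<Rightarrow> real"
  assumes f: "f \<in> L2_space lborel" and a: "a \<ge> 0"
    and orth: "\<And>v. v \<in> sobolev a \<Longrightarrow> L2_inner lborel f v = 0"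
  shows "AE x in lborel. f x = 0"
proof -
  note FL = L2_fourier_L2[OF f]
  have [measurable]: "L2_fourier f \<in> borel_measurable borel" using L2_measurable[OF FL] by simp
  have "AE \<xi> in lborel. norm \<xi> \<le> real n \<longrightarrow> L2_fourier f \<xi> = 0" for n :: nat
  proof -
    define W where "W \<xi> = (if norm \<xi> \<le> real n then L2_fourier f \<xi> else 0)" for \<xi> :: 'a
    have Wm: "W \<in> borel_measurable lborel" unfolding W_def[abs_def] by measurable
    have W: "W \<in> L2_space lborel" by (rule L2_dominated[OF FL Wm]) (auto simp: W_def)
    have "AE \<xi> in lborel. W (- \<xi>) = cnj (W \<xi>)"
      using L2_fourier_hermitian[OF f] by eventually_elim (simp add: W_def)
    from L2_fourier_range[OF W this] obtain v where v: "v \<in> L2_space lborel"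
      "AE \<xi> in lborel. L2_fourier v \<xi> = W \<xi>" by blast
    define c where "c = (1 + (real n)\<^sup>2) powr (a / 2)"
    have "bessel a v \<in> L2_space lborel"
    proof (rule L2_dominated[OF L2.scale_mem[OF FL, of c] bessel_measurable[OF v(1)]])
      show "AE \<xi> in lborel. norm (bessel a v \<xi>) \<le> norm ((c *\<^sub>R L2_fourier f) \<xi>)"
        using v(2)
      proof eventually_elim
        case (elim \<xi>)
        show ?case
        proof (cases "norm \<xi> \<le> real n")
          case True
          then have "(1 + (norm \<xi>)\<^sup>2) powr (a / 2) \<le> c"
            unfolding c_def using a by (intro powr_mono2 add_left_mono power_mono) auto
          then have "(1 + (norm \<xi>)\<^sup>2) powr (a / 2) * cmod (L2_fourier f \<xi>) \<le> c * cmod (L2_fourier f \<xi>)"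
            by (rule mult_right_mono) simp
          moreover have "c \<ge> 0" by (simp add: c_def)
          ultimately show ?thesis using True elim by (simp add: bessel_def scaleR_fun_def norm_mult W_def)
        qed (simp add: bessel_def elim W_def)
      qed
    qed
    then have "L2_inner lborel f v = 0" using v(1) by (intro orth) (simp add: sobolev_iff)
    then have "L2_inner lborel (L2_fourier v) (L2_fourier f) = 0"
      using parseval[OF f v(1)] by (simp add: L2.ip_sym FL L2_fourier_L2 v(1))
    then have "L2_inner lborel W (L2_fourier f) = 0"
      using L2_inner_cong_AE[OF v(2) L2_fourier_L2[OF v(1)] W FL] by simp
    moreover have "L2_inner lborel W (L2_fourier f) = L2_inner lborel W W"
      unfolding L2_inner_def by (intro Bochner_Integration.integral_cong) (auto simp: W_def)
    ultimately have "L2_norm lborel W = 0" using L2.nrm_sq[OF W] by simp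
    then have "AE \<xi> in lborel. W \<xi> = 0" by (simp add: L2_norm_eq_0_iff[OF W])
    then show ?thesis by eventually_elim (auto simp: W_def split: if_splits)
  qed
  then have "AE \<xi> in lborel. \<forall>n::nat. norm \<xi> \<le> real n \<longrightarrow> L2_fourier f \<xi> = 0" unfolding AE_all_countable by blast
  then have "AE \<xi> in lborel. L2_fourier f \<xi> = 0"
    by eventually_elim (use real_arch_simple in blast)
  then have "L2_norm lborel (L2_fourier f) = 0" by (simp add: L2_norm_eq_0_iff[OF FL])
  then show ?thesis by (simp add: plancherel f L2_norm_eq_0_iff)
qed

context fractional_setting
begin

text \<open>
  The double integral converges absolutely, so the two terms of \<open>v x - v y\<close> can be separated;
  by symmetry they contribute equally.
\<close>

lemma regional_form_eq:
  fixes v :: "'a \<Rightarrow> real"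
  assumes u: "u \<in> sobolev t" and v: "(\<lambda>x. indicator \<Omega> x * v x) \<in> L2_space lborel"
  shows "regional_form (s / 2) \<Omega> u v = frac_const TYPE('a) (s / 2) * L2_inner lborel (regional_op u) (\<lambda>x. indicator \<Omega> x * v x)"
proof -
  define w where "w x = indicator \<Omega> x * v x" for x
  have wL: "w \<in> L2_space lborel" using v unfolding w_def[abs_def] .
  have um [measurable]: "u \<in> borel_measurable borel" using L2_measurable[OF sobolev_L2[OF u]] by simp
  have [measurable]: "w \<in> borel_measurable borel" using L2_measurable[OF wL] by simp
  define F where "F = (\<lambda>(x, y). indicator \<Omega> x * (indicator \<Omega> y * diff_quot u x y) * w x)"
  have Fm: "F \<in> borel_measurable (lborel \<Otimes>\<^sub>M lborel)"
    unfolding F_def diff_quot_def by measurable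
  have om: "oscillation s \<rho> u \<in> borel_measurable lborel" using oscillation_measurable[OF um] by simp
  have Fi: "integrable (lborel \<Otimes>\<^sub>M lborel) F"
  proof (rule integrableI_bounded[OF Fm])
    have "(\<integral>\<^sup>+p. ennreal (norm (F p)) \<partial>(lborel \<Otimes>\<^sub>M lborel)) = (\<integral>\<^sup>+x. (\<integral>\<^sup>+y. ennreal (norm (F (x, y))) \<partial>lborel) \<partial>lborel)"
      by (rule lborel.nn_integral_fst[symmetric]) (use Fm in measurable)
    also have "\<dots> \<le> (\<integral>\<^sup>+x. ennreal \<bar>w x\<bar> * oscillation s \<rho> u x \<partial>lborel)"
    proof (rule nn_integral_mono)
      fix x
      show "(\<integral>\<^sup>+y. ennreal (norm (F (x, y))) \<partial>lborel) \<le> ennreal \<bar>w x\<bar> * oscillation s \<rho> u x"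
      proof (cases "x \<in> \<Omega>")
        case True
        have "(\<integral>\<^sup>+y. ennreal (norm (F (x, y))) \<partial>lborel)
          = (\<integral>\<^sup>+y. ennreal \<bar>w x\<bar> * ennreal (norm (indicator \<Omega> y * diff_quot u x y)) \<partial>lborel)"
          using True by (intro nn_integral_cong) (simp add: F_def abs_mult ennreal_mult[symmetric] mult_ac)
        also have "\<dots> = ennreal \<bar>w x\<bar> * (\<integral>\<^sup>+y. ennreal (norm (indicator \<Omega> y * diff_quot u x y)) \<partial>lborel)"
          unfolding diff_quot_def by (rule nn_integral_cmult) measurable
        also have "\<dots> \<le> ennreal \<bar>w x\<bar> * oscillation s \<rho> u x"
          by (intro mult_left_mono regional_nn_le_oscillation um True) auto
        finally show ?thesis .
      qed (simp add: F_def)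
    qed
    also have "\<dots> < \<infinity>"
    proof -
      have "(\<integral>\<^sup>+x. ennreal \<bar>w x\<bar> * oscillation s \<rho> u x \<partial>lborel)\<^sup>2
        \<le> (\<integral>\<^sup>+x. (ennreal \<bar>w x\<bar>)\<^sup>2 \<partial>lborel) * (\<integral>\<^sup>+x. (oscillation s \<rho> u x)\<^sup>2 \<partial>lborel)"
        by (rule Cauchy_Schwarz_nn_integral) (use om in measurable)
      also have "(\<integral>\<^sup>+x. (ennreal \<bar>w x\<bar>)\<^sup>2 \<partial>lborel) = ennreal ((L2_norm lborel w)\<^sup>2)"
        unfolding L2_norm_nn[OF wL] by (simp add: ennreal_power)
      also have "ennreal ((L2_norm lborel w)\<^sup>2) * (\<integral>\<^sup>+x. (oscillation s \<rho> u x)\<^sup>2 \<partial>lborel) < \<infinity>"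
      proof -
        obtain C where C: "C \<ge> 0 \<and> (\<forall>\<delta>>0. \<forall>u\<in>sobolev t. (\<integral>\<^sup>+x. (oscillation s \<delta> u x)\<^sup>2 \<partial>(lborel :: 'a measure))
          \<le> ennreal ((C * \<delta> powr (t - s) * sobolev_norm t u)\<^sup>2))"
          using oscillation_estimate[OF st] by (rule exE)
        have "(\<integral>\<^sup>+x. (oscillation s \<rho> u x)\<^sup>2 \<partial>lborel) \<le> ennreal ((C * \<rho> powr (t - s) * sobolev_norm t u)\<^sup>2)"
          by (rule bspec[OF mp[OF spec[OF conjunct2[OF C]] \<rho>(1)] u])
        then have "(\<integral>\<^sup>+x. (oscillation s \<rho> u x)\<^sup>2 \<partial>lborel) < \<infinity>"
          by (rule le_less_trans) simp
        then show ?thesis by (simp add: ennreal_mult_less_top)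
      qed
      finally show ?thesis by (auto simp: less_top[symmetric] power_eq_top_ennreal)
    qed
    finally show "(\<integral>\<^sup>+p. ennreal (norm (F p)) \<partial>(lborel \<Otimes>\<^sub>M lborel)) < \<infinity>" .
  qed
  define F' where "F' = (\<lambda>(x, y). F (y, x))"
  have Fi': "integrable (lborel \<Otimes>\<^sub>M lborel) F'"
    unfolding F'_def using lborel_pair.integrable_product_swap[OF Fi] by simp
  have swap: "integral\<^sup>L (lborel \<Otimes>\<^sub>M lborel) F' = integral\<^sup>L (lborel \<Otimes>\<^sub>M lborel) F"
    unfolding F'_def using lborel_pair.integral_product_swap[OF Fm] by simp
  have pt: "indicator \<Omega> x * (indicator \<Omega> y * ((u x - u y) * (v x - v y) / norm (x - y) powr (real DIM('a) + 2 * (s / 2))))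
      = F (x, y) + F' (x, y)" for x y
    by (auto simp: F_def F'_def w_def diff_quot_def indicator_def norm_minus_commute[of y x] add_divide_distrib[symmetric] algebra_simps)
  have "(LINT x:\<Omega>|lborel. (LINT y:\<Omega>|lborel. (u x - u y) * (v x - v y) / norm (x - y) powr (real DIM('a) + 2 * (s / 2))))
    = (LINT x|lborel. (LINT y|lborel. (F (x, y) + F' (x, y))))"
    unfolding set_lebesgue_integral_def real_scaleR_def pt[symmetric] integral_mult_right_zero ..
  also have "\<dots> = integral\<^sup>L (lborel \<Otimes>\<^sub>M lborel) (\<lambda>p. F p + F' p)"
    by (rule lborel_pair.integral_fst') (intro Bochner_Integration.integrable_add Fi Fi')
  also have "\<dots> = 2 * integral\<^sup>L (lborel \<Otimes>\<^sub>M lborel) F"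
    by (simp add: Fi Fi' swap)
  also have "integral\<^sup>L (lborel \<Otimes>\<^sub>M lborel) F = (LINT x|lborel. (LINT y|lborel. F (x, y)))"
    by (rule lborel_pair.integral_fst'[OF Fi, symmetric])
  also have "\<dots> = L2_inner lborel (regional_op u) w"
    unfolding L2_inner_def F_def regional_op_def by simp
  finally have "(LINT x:\<Omega>|lborel. (LINT y:\<Omega>|lborel. (u x - u y) * (v x - v y) / norm (x - y) powr (real DIM('a) + 2 * (s / 2))))
    = 2 * L2_inner lborel (regional_op u) w" .
  moreover have "w = (\<lambda>x. indicator \<Omega> x * v x)" by (simp add: w_def fun_eq_iff)
  ultimately show ?thesis by (simp add: regional_form_def)
qed

lemma indicator_mult_L2:
  fixes v w :: "'a \<Rightarrow> real"
  assumes "set_borel_measurable lborel \<Omega> v" "w \<in> L2_space lborel" "AE x\<in>\<Omega> in lborel. v x = w x"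
  shows "(\<lambda>x. indicator \<Omega> x * v x) \<in> L2_space lborel"
proof (rule L2_dominated[OF assms(2)])
  show "(\<lambda>x. indicator \<Omega> x * v x) \<in> borel_measurable lborel"
    using assms(1) by (simp add: set_borel_measurable_def)
  show "AE x in lborel. norm (indicator \<Omega> x * v x) \<le> norm (w x)"
    using assms(3) by eventually_elim (auto simp: indicator_def)
qed

text \<open>
  A multiple of \<open>regional_op u\<close> represents the weak regional Laplacian, and by density of \<open>H\<^bsup>s/2\<^esup>\<close> in
  \<open>L\<^sup>2\<close> the representing function is unique almost everywhere on \<open>\<Omega>\<close>.
\<close>

lemma regional_frac_laplacian_eq:
  assumes u: "u \<in> sobolev t"
  shows "(\<lambda>x. indicator \<Omega> x * regional_frac_laplacian (s / 2) \<Omega> u x) \<in> L2_space lborel"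
    and "AE x in lborel. indicator \<Omega> x * regional_frac_laplacian (s / 2) \<Omega> u x = frac_const TYPE('a) (s / 2) * regional_op u x"
proof -
  let ?P = "\<lambda>g. g \<in> L2_on \<Omega> \<and> (\<forall>v\<in>sobolev_on (s / 2) \<Omega>. (LINT x:\<Omega>|lborel. g x * v x) = regional_form (s / 2) \<Omega> u v)"
  define g where "g = regional_frac_laplacian (s / 2) \<Omega> u"
  define G where "G x = frac_const TYPE('a) (s / 2) * regional_op u x" for x
  have L2_on: "h \<in> L2_on \<Omega> \<longleftrightarrow> (\<lambda>x. indicator \<Omega> x * h x) \<in> L2_space lborel" for h :: "'a \<Rightarrow> real"
  proof -
    have "(indicator \<Omega> x * h x)\<^sup>2 = indicator \<Omega> x * (h x)\<^sup>2" for x by (simp add: indicator_def)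
    then show ?thesis by (simp add: L2_on_def L2_space_def set_borel_measurable_def set_integrable_def)
  qed
  have opL: "regional_op u \<in> L2_space lborel" by (rule regional_op_L2[OF u])
  have GL: "G \<in> L2_space lborel" using L2.scale_mem[OF opL, of "frac_const TYPE('a) (s / 2)"] by (simp add: G_def[abs_def] scaleR_fun_def)
  have iG: "(\<lambda>x. indicator \<Omega> x * G x) = G" by (auto simp: G_def fun_eq_iff regional_op_def indicator_def)
  have "?P G"
  proof (intro conjI ballI)
    show "G \<in> L2_on \<Omega>" using GL by (simp add: L2_on iG)
    fix v :: "'a \<Rightarrow> real" assume "v \<in> sobolev_on (s / 2) \<Omega>"
    then obtain w where "set_borel_measurable lborel \<Omega> v" "w \<in> sobolev (s / 2)" "AE x\<in>\<Omega> in lborel. v x = w x"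
      by (auto simp: sobolev_on_def)
    then have vL: "(\<lambda>x. indicator \<Omega> x * v x) \<in> L2_space lborel" by (intro indicator_mult_L2 sobolev_L2) auto
    have "(LINT x:\<Omega>|lborel. G x * v x) = (LINT x|lborel. frac_const TYPE('a) (s / 2) * (regional_op u x * (indicator \<Omega> x * v x)))"
      unfolding set_lebesgue_integral_def by (intro Bochner_Integration.integral_cong) (auto simp: G_def)
    then show "(LINT x:\<Omega>|lborel. G x * v x) = regional_form (s / 2) \<Omega> u v"
      unfolding regional_form_eq[OF u vL] by (simp add: L2_inner_def)
  qed
  then have g: "?P g" unfolding g_def regional_frac_laplacian_def by (rule someI[of ?P])
  then show gL: "(\<lambda>x. indicator \<Omega> x * regional_frac_laplacian (s / 2) \<Omega> u x) \<in> L2_space lborel"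
    by (simp add: L2_on g_def)
  have gL: "(\<lambda>x. indicator \<Omega> x * g x) \<in> L2_space lborel" using gL by (simp add: g_def)
  have "AE x in lborel. ((\<lambda>x. indicator \<Omega> x * g x) - G) x = 0"
  proof (rule sobolev_dense[where a="s / 2"])
    show "(\<lambda>x. indicator \<Omega> x * g x) - G \<in> L2_space lborel" by (intro L2.diff_mem gL GL)
    show "s / 2 \<ge> 0" using st by simp
    fix v :: "'a \<Rightarrow> real" assume v: "v \<in> sobolev (s / 2)"
    have vL: "v \<in> L2_space lborel" by (rule sobolev_L2[OF v])
    have [measurable]: "v \<in> borel_measurable borel" using L2_measurable[OF vL] by simp
    have "set_borel_measurable lborel \<Omega> v" unfolding set_borel_measurable_def by measurable
    then have von: "v \<in> sobolev_on (s / 2) \<Omega>" and ivL: "(\<lambda>x. indicator \<Omega> x * v x) \<in> L2_space lborel"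
      using v vL by (auto simp: sobolev_on_def intro!: indicator_mult_L2[OF _ vL])
    have "L2_inner lborel (\<lambda>x. indicator \<Omega> x * g x) v = (LINT x:\<Omega>|lborel. g x * v x)"
      by (simp add: L2_inner_def set_lebesgue_integral_def mult.assoc)
    also have "\<dots> = regional_form (s / 2) \<Omega> u v" using g von by blast
    also have "\<dots> = L2_inner lborel G v"
      unfolding regional_form_eq[OF u ivL]
      unfolding L2_inner_def G_def integral_mult_right_zero[symmetric]
      by (intro Bochner_Integration.integral_cong) (auto simp: regional_op_def indicator_def)
    finally show "L2_inner lborel ((\<lambda>x. indicator \<Omega> x * g x) - G) v = 0"
      by (simp add: L2.ip_diff gL GL vL)
  qed
  then show "AE x in lborel. indicator \<Omega> x * regional_frac_laplacian (s / 2) \<Omega> u x = frac_const TYPE('a) (s / 2) * regional_op u x"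
    by eventually_elim (simp add: g_def G_def)
qed

end

section \<open>Compactness\<close>

text \<open>
  Rellich's theorem. The transforms of functions supported in a bounded set are uniformly bounded
  and equicontinuous, so a subsequence converges at every frequency. Low frequencies are then
  handled by dominated convergence, high ones by the factor \<open>R\<^sup>-\<^sup>t\<close> gained from \<open>H\<^sup>t\<close>.
\<close>

theorem rellich:
  fixes X :: "nat \<Rightarrow> 'a::euclidean_space \<Rightarrow> real"
  assumes t: "0 < t" and \<Omega>: "\<Omega> \<in> sets borel" "bounded \<Omega>"
    and X: "\<And>n. X n \<in> sobolev t" and supp: "\<And>n. AE x in lborel. x \<notin> \<Omega> \<longrightarrow> X n x = 0"
    and bound: "\<And>n. sobolev_norm t (X n) \<le> 1"
  shows "\<exists>r. strict_mono (r :: nat \<Rightarrow> nat) \<and> (\<forall>e>0. \<exists>N. \<forall>m\<ge>N. \<forall>n\<ge>N. L2_norm lborel (X (r m) - X (r n)) < e)"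
proof -
  define \<kappa> where "\<kappa> = gauss_const TYPE('a)"
  have \<kappa>: "\<kappa> > 0" by (simp add: \<kappa>_def)
  have XL: "X n \<in> L2_space lborel" for n by (rule sobolev_L2[OF X])
  have Xm [measurable]: "X n \<in> borel_measurable borel" for n using L2_measurable[OF XL] by simp
  note [measurable] = \<Omega>(1)
  obtain \<rho> where \<rho>: "\<rho> > 0" "\<And>x. x \<in> \<Omega> \<Longrightarrow> norm x \<le> \<rho>" using \<Omega>(2) by (auto simp: bounded_pos)
  define I where "I = (indicator \<Omega> :: 'a \<Rightarrow> real)"
  have IL: "I \<in> L2_space lborel" unfolding I_def by (rule indicator_L2[OF \<Omega>])
  define B where "B = L2_norm lborel I / \<kappa>"
  have B: "B \<ge> 0" using \<kappa> by (simp add: B_def)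
  have aL: "(\<lambda>x. \<bar>X n x\<bar>) \<in> L2_space lborel" for n by (rule L2_dominated[OF XL, of _ n]) auto
  have aI: "AE x in lborel. \<bar>X n x\<bar> = I x * \<bar>X n x\<bar>" for n
    using supp[of n] by eventually_elim (auto simp: I_def indicator_def)
  have int_aI: "integrable lborel (\<lambda>x. I x * \<bar>X n x\<bar>)" for n by (rule integrable_L2_mult[OF IL aL])
  have Im: "I \<in> borel_measurable lborel" unfolding I_def by measurable
  have absint: "integrable lborel (\<lambda>x. \<bar>X n x\<bar>)" for n
    using int_aI[of n] aI[of n] Im by (subst integrable_cong_AE[where g="\<lambda>x. I x * \<bar>X n x\<bar>"]) auto
  have Xint: "integrable lborel (X n)" for n
    by (rule Bochner_Integration.integrable_bound[OF absint[of n]]) auto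
  have absval: "(LINT x|lborel. \<bar>X n x\<bar>) \<le> B" for n
  proof -
    have "(LINT x|lborel. \<bar>X n x\<bar>) = L2_inner lborel I (\<lambda>x. \<bar>X n x\<bar>)"
      unfolding L2_inner_def using aI[of n] Im by (intro integral_cong_AE) auto
    also have "\<dots> \<le> L2_norm lborel I * L2_norm lborel (\<lambda>x. \<bar>X n x\<bar>)"
      using L2.cauchy_schwarz[OF IL aL, of n] by simp
    also have "L2_norm lborel (\<lambda>x. \<bar>X n x\<bar>) = L2_norm lborel (X n)" by (simp add: L2_norm_def)
    also have "L2_norm lborel I * L2_norm lborel (X n) \<le> L2_norm lborel I * (1 / \<kappa>)"
    proof (intro mult_left_mono)
      have "\<kappa> * L2_norm lborel (X n) \<le> 1"
        using L2_norm_le_sobolev[OF X, of n] bound[of n] t by (simp add: \<kappa>_def)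
      then show "L2_norm lborel (X n) \<le> 1 / \<kappa>" using \<kappa> by (simp add: field_simps)
    qed simp
    finally show ?thesis by (simp add: B_def)
  qed
  define Y where "Y n = fourier_integral (X n)" for n
  have Yft: "Y n = ft (\<lambda>x. complex_of_real (X n x))" for n by (simp add: Y_def fourier_integral_ft)
  have Ym [measurable]: "Y n \<in> borel_measurable borel" for n unfolding Yft by measurable
  have YB: "cmod (Y n \<xi>) \<le> B" for n \<xi>
    using ft_bound[of "\<lambda>x. complex_of_real (X n x)" \<xi>] absval[of n] by (simp add: Yft)
  have Ylip: "cmod (Y n \<xi> - Y n \<eta>) \<le> \<rho> * B * norm (\<xi> - \<eta>)" for n \<xi> \<eta>
  proof -
    have ci: "integrable lborel (\<lambda>x. complex_of_real (X n x))" using Xint by simp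
    note i1 = ft_integrable[OF ci, of \<xi>] and i2 = ft_integrable[OF ci, of \<eta>]
    have "Y n \<xi> - Y n \<eta> = (LINT x|lborel. cis (- (x \<bullet> \<xi>)) * complex_of_real (X n x) - cis (- (x \<bullet> \<eta>)) * complex_of_real (X n x))"
      unfolding Yft ft_def by (rule Bochner_Integration.integral_diff[OF i1 i2, symmetric])
    then have "cmod (Y n \<xi> - Y n \<eta>) \<le> (LINT x|lborel. cmod (cis (- (x \<bullet> \<xi>)) * complex_of_real (X n x) - cis (- (x \<bullet> \<eta>)) * complex_of_real (X n x)))"
      by (simp only: integral_norm_bound)
    also have "\<dots> \<le> (LINT x|lborel. (\<rho> * norm (\<xi> - \<eta>)) * \<bar>X n x\<bar>)"
    proof (rule integral_mono_AE)
      show "integrable lborel (\<lambda>x. (\<rho> * norm (\<xi> - \<eta>)) * \<bar>X n x\<bar>)" using absint by simp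
      show "integrable lborel (\<lambda>x. cmod (cis (- (x \<bullet> \<xi>)) * complex_of_real (X n x) - cis (- (x \<bullet> \<eta>)) * complex_of_real (X n x)))"
        by (intro integrable_norm Bochner_Integration.integrable_diff i1 i2)
      show "AE x in lborel. cmod (cis (- (x \<bullet> \<xi>)) * complex_of_real (X n x) - cis (- (x \<bullet> \<eta>)) * complex_of_real (X n x)) \<le> (\<rho> * norm (\<xi> - \<eta>)) * \<bar>X n x\<bar>"
        using supp[of n]
      proof eventually_elim
        case (elim x)
        show ?case
        proof (cases "x \<in> \<Omega>")
          case True
          have "cis (- (x \<bullet> \<xi>)) * complex_of_real (X n x) - cis (- (x \<bullet> \<eta>)) * complex_of_real (X n x)
             = cis (- (x \<bullet> \<eta>)) * ((cis (x \<bullet> \<eta> - x \<bullet> \<xi>) - 1) * complex_of_real (X n x))"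
            by (simp add: right_diff_distrib left_diff_distrib cis_mult mult.assoc[symmetric])
          then have "cmod (cis (- (x \<bullet> \<xi>)) * complex_of_real (X n x) - cis (- (x \<bullet> \<eta>)) * complex_of_real (X n x))
            = cmod (cis (x \<bullet> \<eta> - x \<bullet> \<xi>) - 1) * \<bar>X n x\<bar>" by (simp add: norm_mult)
          also have "\<dots> \<le> (\<rho> * norm (\<xi> - \<eta>)) * \<bar>X n x\<bar>"
          proof (rule mult_right_mono)
            have "cmod (cis (x \<bullet> \<eta> - x \<bullet> \<xi>) - 1) \<le> \<bar>x \<bullet> (\<eta> - \<xi>)\<bar>"
              using cmod_cis_minus_1_le[of "x \<bullet> (\<eta> - \<xi>)"] by (simp add: inner_diff_right)
            also have "\<dots> \<le> norm x * norm (\<eta> - \<xi>)" by (rule Cauchy_Schwarz_ineq2)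
            also have "\<dots> \<le> \<rho> * norm (\<xi> - \<eta>)"
              using \<rho>(2)[OF True] by (simp add: norm_minus_commute mult_right_mono)
            finally show "cmod (cis (x \<bullet> \<eta> - x \<bullet> \<xi>) - 1) \<le> \<rho> * norm (\<xi> - \<eta>)" .
          qed simp
          finally show ?thesis .
        qed (use elim in simp)
      qed
    qed
    also have "\<dots> = (\<rho> * norm (\<xi> - \<eta>)) * (LINT x|lborel. \<bar>X n x\<bar>)" by simp
    also have "\<dots> \<le> (\<rho> * norm (\<xi> - \<eta>)) * B" using \<rho>(1) by (intro mult_left_mono absval) auto
    finally show ?thesis by (simp add: mult_ac)
  qed
  obtain S :: "'a set" where S: "countable S" "\<And>U. open U \<Longrightarrow> U \<noteq> {} \<Longrightarrow> \<exists>d\<in>S. d \<in> U"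
    by (erule countable_dense_setE)
  obtain r :: "nat \<Rightarrow> nat" where r: "strict_mono r" "\<And>\<xi>. \<xi> \<in> S \<Longrightarrow> \<exists>l. (\<lambda>n. Y (r n) \<xi>) \<longlonglongrightarrow> l"
    using function_convergent_subsequence[OF S(1), of Y B] YB by metis
  have conv: "convergent (\<lambda>n. Y (r n) \<xi>)" for \<xi>
  proof -
    have "Cauchy (\<lambda>n. Y (r n) \<xi>)"
      unfolding Cauchy_altdef2 dist_norm
    proof (intro allI impI)
      fix e :: real assume e: "e > 0"
      define d where "d = e / (3 * (\<rho> * B + 1))"
      have \<rho>B: "\<rho> * B + 1 > 0" using \<rho>(1) B by (simp add: add_nonneg_pos)
      have d: "d > 0" using e \<rho>B by (simp add: d_def)
      obtain \<eta> where \<eta>: "\<eta> \<in> S" "\<eta> \<in> ball \<xi> d" using S(2)[of "ball \<xi> d"] d by auto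
      have lip: "cmod (Y n \<xi> - Y n \<eta>) < e / 3" for n
      proof -
        have "cmod (Y n \<xi> - Y n \<eta>) \<le> \<rho> * B * norm (\<xi> - \<eta>)" by (rule Ylip)
        also have "\<dots> \<le> (\<rho> * B + 1) * norm (\<xi> - \<eta>)" by (rule mult_right_mono) auto
        also have "\<dots> < (\<rho> * B + 1) * d" using \<eta>(2) \<rho>B by (simp add: dist_norm)
        also have "\<dots> = e / 3"
        proof -
          have "a * (e / (3 * a)) = e / 3" if "a > 0" for a using that by simp
          from this[OF \<rho>B] show ?thesis by (simp only: d_def)
        qed
        finally show ?thesis .
      qed
      have "Cauchy (\<lambda>n. Y (r n) \<eta>)" using r(2)[OF \<eta>(1)] LIMSEQ_imp_Cauchy by blast
      then obtain N where N: "\<And>n. n \<ge> N \<Longrightarrow> cmod (Y (r n) \<eta> - Y (r N) \<eta>) < e / 3"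
        unfolding Cauchy_altdef2 dist_norm using e by (meson divide_pos_pos zero_less_numeral)
      have "cmod (Y (r n) \<xi> - Y (r N) \<xi>) < e" if "n \<ge> N" for n
      proof -
        have tri: "cmod (p + q - w) \<le> cmod p + cmod q + cmod w" for p q w
          using norm_triangle_ineq4[of "p + q" w] norm_triangle_ineq[of p q] by linarith
        have "Y (r n) \<xi> - Y (r N) \<xi> = (Y (r n) \<xi> - Y (r n) \<eta>) + (Y (r n) \<eta> - Y (r N) \<eta>) - (Y (r N) \<xi> - Y (r N) \<eta>)" by simp
        then have "cmod (Y (r n) \<xi> - Y (r N) \<xi>) \<le> cmod (Y (r n) \<xi> - Y (r n) \<eta>) + cmod (Y (r n) \<eta> - Y (r N) \<eta>) + cmod (Y (r N) \<xi> - Y (r N) \<eta>)"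
          by (simp only: tri)
        then show ?thesis using lip[of "r n"] lip[of "r N"] N[OF that] by linarith
      qed
      then show "\<exists>N. \<forall>n\<ge>N. cmod (Y (r n) \<xi> - Y (r N) \<xi>) < e" by blast
    qed
    then show ?thesis by (simp add: Cauchy_convergent_iff)
  qed
  define Z where "Z \<xi> = lim (\<lambda>n. Y (r n) \<xi>)" for \<xi>
  have YZ: "(\<lambda>n. Y (r n) \<xi>) \<longlonglongrightarrow> Z \<xi>" for \<xi> using conv[of \<xi>] by (simp add: Z_def convergent_LIMSEQ_iff)
  have Zm [measurable]: "Z \<in> borel_measurable borel" by (rule borel_measurable_LIMSEQ_metric[OF _ YZ]) simp
  have ZB: "cmod (Z \<xi>) \<le> B" for \<xi> by (rule LIMSEQ_le_const2[OF tendsto_norm[OF YZ]]) (use YB in auto)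
  have "\<exists>N. \<forall>m\<ge>N. \<forall>n\<ge>N. L2_norm lborel (X (r m) - X (r n)) < e" if e: "e > 0" for e
  proof -
    have "(\<lambda>n. real n powr (- t)) \<longlonglongrightarrow> 0"
      by (intro tendsto_neg_powr filterlim_real_sequentially) (use t in simp)
    then have lim: "(\<lambda>n. 2 * real n powr (- t)) \<longlonglongrightarrow> 0" by (rule tendsto_mult_right_zero)
    have "\<kappa> * e / 2 > 0" using e \<kappa> by simp
    then have "\<forall>\<^sub>F n in sequentially. 2 * real n powr (- t) < \<kappa> * e / 2"
      by (rule order_tendstoD(2)[OF lim])
    then obtain R :: nat where R: "2 * real R powr (- t) < \<kappa> * e / 2" "R > 0"
      using eventually_gt_at_top[of 0] by (metis (mono_tags, lifting) eventually_conj eventually_sequentially order_refl)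
    define J where "J = (indicator (cball 0 (real R)) :: 'a \<Rightarrow> real)"
    have JL: "J \<in> L2_space lborel" unfolding J_def by (intro indicator_L2) auto
    have [measurable]: "J \<in> borel_measurable borel" using L2_measurable[OF JL] by simp
    have dom: "B *\<^sub>R J \<in> L2_space lborel" by (intro L2.scale_mem JL)
    \<comment> \<open>low frequencies of the subsequence and of its pointwise limit\<close>
    define W where "W n \<xi> = complex_of_real (J \<xi>) * Y (r n) \<xi>" for n \<xi>
    define V where "V \<xi> = complex_of_real (J \<xi>) * Z \<xi>" for \<xi>
    have J01: "0 \<le> J \<xi>" for \<xi> by (simp add: J_def)
    have "(\<lambda>x. complex_of_real ((B *\<^sub>R J) x)) \<in> L2_space lborel"
      by (rule L2_dominated[OF dom]) (auto simp: scaleR_fun_def norm_mult abs_mult)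
    note dom' = this
    have Wm: "W n \<in> borel_measurable lborel" for n unfolding W_def[abs_def] by measurable
    have Vm: "V \<in> borel_measurable lborel" unfolding V_def[abs_def] by measurable
    have WB: "norm (W n \<xi>) \<le> norm (complex_of_real ((B *\<^sub>R J) \<xi>))" for n \<xi>
      using mult_left_mono[OF YB[of "r n" \<xi>] J01[of \<xi>]] B J01[of \<xi>]
      by (simp add: W_def norm_mult scaleR_fun_def mult.commute)
    have VB: "norm (V \<xi>) \<le> norm (complex_of_real ((B *\<^sub>R J) \<xi>))" for \<xi>
      using mult_left_mono[OF ZB[of \<xi>] J01[of \<xi>]] B J01[of \<xi>]
      by (simp add: V_def norm_mult scaleR_fun_def mult.commute)
    have WL: "W n \<in> L2_space lborel" for n by (rule L2_dominated[OF dom' Wm]) (use WB in auto)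
    have VL: "V \<in> L2_space lborel" by (rule L2_dominated[OF dom' Vm]) (use VB in auto)
    have "(\<lambda>n. L2_norm lborel (W n - V)) \<longlonglongrightarrow> 0"
    proof (rule L2_dominated_convergence[OF WL VL dom'])
      show "AE x in lborel. norm (W n x) \<le> norm (complex_of_real ((B *\<^sub>R J) x))" for n using WB by auto
      show "AE x in lborel. (\<lambda>n. W n x) \<longlonglongrightarrow> V x"
        unfolding W_def V_def by (intro AE_I2 tendsto_mult tendsto_const YZ)
    qed
    from L2.limit_imp_cauchy[OF WL VL this] \<open>\<kappa> * e / 2 > 0\<close>
    obtain N where N: "\<And>m n. m \<ge> N \<Longrightarrow> n \<ge> N \<Longrightarrow> L2_norm lborel (W m - W n) < \<kappa> * e / 2"
      unfolding L2.cauchy_seq_def by blast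
    have "L2_norm lborel (X (r m) - X (r n)) < e" if mn: "m \<ge> N" "n \<ge> N" for m n
    proof -
      let ?d = "X (r m) - X (r n)"
      have dS: "?d \<in> sobolev t" by (intro Sob.diff_mem X)
      have dL: "?d \<in> L2_space lborel" by (rule sobolev_L2[OF dS])
      have d2: "sobolev_norm t ?d \<le> 2"
        using Sob.nrm_triangle_diff[OF X Sob.zero_mem X, of "r m" "r n"] bound[of "r m"] bound[of "r n"]
          Sob.nrm_minus_commute[OF Sob.zero_mem X, of "r n"] by simp
      \<comment> \<open>dominates the frequencies above \<open>R\<close>, where \<open>1 \<le> R\<^sup>-\<^sup>t \<bar>\<xi>\<bar>\<^sup>t\<close>\<close>
      define T where "T = real R powr (- t) *\<^sub>R riesz_multiplier t ?d"
      have rL: "riesz_multiplier t ?d \<in> L2_space lborel" by (rule riesz_multiplier_L2(1)[OF dS]) (use t in simp)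
      have TL: "T \<in> L2_space lborel" unfolding T_def by (intro L2.scale_mem rL)
      have tail: "(\<lambda>\<xi>. complex_of_real (1 - J \<xi>) * L2_fourier ?d \<xi>) \<in> L2_space lborel \<and>
          L2_norm lborel (\<lambda>\<xi>. complex_of_real (1 - J \<xi>) * L2_fourier ?d \<xi>) \<le> L2_norm lborel T"
      proof -
        have [measurable]: "L2_fourier ?d \<in> borel_measurable borel" using L2_measurable[OF L2_fourier_L2[OF dL]] by simp
        have m: "(\<lambda>\<xi>. complex_of_real (1 - J \<xi>) * L2_fourier ?d \<xi>) \<in> borel_measurable lborel" by measurable
        have le: "AE \<xi> in lborel. norm (complex_of_real (1 - J \<xi>) * L2_fourier ?d \<xi>) \<le> norm (T \<xi>)"
        proof (rule AE_I2)
          fix \<xi> :: 'a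
          show "norm (complex_of_real (1 - J \<xi>) * L2_fourier ?d \<xi>) \<le> norm (T \<xi>)"
          proof (cases "norm \<xi> \<le> real R")
            case True
            then show ?thesis by (simp add: J_def)
          next
            case False
            then have "1 = real R powr (- t) * real R powr t" using R(2) by (simp flip: powr_add)
            also have "\<dots> \<le> real R powr (- t) * norm \<xi> powr t"
              using False t by (intro mult_left_mono powr_mono2) auto
            finally have "1 * cmod (L2_fourier ?d \<xi>) \<le> real R powr (- t) * norm \<xi> powr t * cmod (L2_fourier ?d \<xi>)"
              by (rule mult_right_mono) simp
            then show ?thesis using False by (simp add: J_def T_def scaleR_fun_def riesz_multiplier_def norm_mult mult.assoc)
          qed
        qed
        show ?thesis using L2_dominated[OF TL m le] L2_norm_mono[OF m TL le] by simp
      qed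
      have YF: "AE \<xi> in lborel. L2_fourier (X k) \<xi> = Y k \<xi>" for k
        unfolding Y_def by (rule L2_fourier_eq_fourier_integral[OF XL Xint])
      have split: "AE \<xi> in lborel. L2_fourier ?d \<xi> = ((W m - W n) + (\<lambda>\<xi>. complex_of_real (1 - J \<xi>) * L2_fourier ?d \<xi>)) \<xi>"
        using YF[of "r m"] YF[of "r n"] L2_fourier_diff[OF XL XL, of "r m" "r n"]
      proof eventually_elim
        case (elim \<xi>)
        then have F: "L2_fourier ?d \<xi> = Y (r m) \<xi> - Y (r n) \<xi>" by simp
        have "complex_of_real (J \<xi>) * L2_fourier ?d \<xi> = W m \<xi> - W n \<xi>" unfolding F by (simp add: W_def right_diff_distrib)
        then show ?case by (simp add: algebra_simps)
      qed
      have "\<kappa> * L2_norm lborel ?d = L2_norm lborel (L2_fourier ?d)" by (simp add: plancherel dL \<kappa>_def)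
      also have "\<dots> = L2_norm lborel ((W m - W n) + (\<lambda>\<xi>. complex_of_real (1 - J \<xi>) * L2_fourier ?d \<xi>))"
        by (rule L2_norm_cong_AE[OF split L2_fourier_L2[OF dL]]) (intro L2.add_mem L2.diff_mem WL conjunct1[OF tail])
      also have "\<dots> \<le> L2_norm lborel (W m - W n) + L2_norm lborel (\<lambda>\<xi>. complex_of_real (1 - J \<xi>) * L2_fourier ?d \<xi>)"
        by (intro L2.nrm_triangle L2.diff_mem WL conjunct1[OF tail])
      also have "\<dots> < \<kappa> * e / 2 + \<kappa> * e / 2"
      proof (rule add_strict_mono[OF N[OF mn]])
        have "L2_norm lborel (\<lambda>\<xi>. complex_of_real (1 - J \<xi>) * L2_fourier ?d \<xi>) \<le> L2_norm lborel T" using tail by simp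
        also have "\<dots> = real R powr (- t) * L2_norm lborel (riesz_multiplier t ?d)"
          unfolding T_def by (subst L2.nrm_scale[OF rL]) simp
        also have "\<dots> \<le> real R powr (- t) * 2"
          using riesz_multiplier_L2(2)[OF dS] t d2 by (intro mult_left_mono) auto
        also have "\<dots> < \<kappa> * e / 2" using R(1) by simp
        finally show "L2_norm lborel (\<lambda>\<xi>. complex_of_real (1 - J \<xi>) * L2_fourier ?d \<xi>) < \<kappa> * e / 2" .
      qed
      finally have "\<kappa> * L2_norm lborel ?d < \<kappa> * e" by simp
      then show ?thesis using \<kappa> by simp
    qed
    then show ?thesis by blast
  qed
  then show ?thesis using r(1) by blast
qed

section \<open>The Dirichlet problem\<close>

lemma sobolev_norm_cong_AE:
  assumes "AE x in lborel. u x = v x" "u \<in> sobolev r" "v \<in> sobolev r"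
  shows "sobolev_norm r u = sobolev_norm r v"
  unfolding sobolev_norm_bessel
  by (rule L2_norm_cong_AE[OF sobolev_cong_AE(2)[OF assms(1,2) sobolev_L2[OF assms(3)]]])
    (intro bessel_L2 assms)+

lemma weight_le:
  assumes "0 \<le> t" "t \<le> 1"
  shows "(1 + (norm x)\<^sup>2) powr t \<le> 2 * (1 + (norm x powr t)\<^sup>2)"
proof -
  have n: "(norm x powr t)\<^sup>2 = ((norm x)\<^sup>2) powr t"
    by (cases "x = 0") (simp_all add: powr_powr powr_mult power2_eq_square)
  have "(1 + (norm x)\<^sup>2) powr t \<le> (2 * max 1 ((norm x)\<^sup>2)) powr t"
    using assms by (intro powr_mono2) auto
  also have "\<dots> = 2 powr t * max 1 ((norm x)\<^sup>2) powr t" by (simp add: powr_mult)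
  also have "\<dots> \<le> 2 * (1 + ((norm x)\<^sup>2) powr t)"
  proof (rule mult_mono)
    show "2 powr t \<le> (2::real)" using powr_mono[of t 1 "2::real"] assms by simp
    show "max 1 ((norm x)\<^sup>2) powr t \<le> 1 + ((norm x)\<^sup>2) powr t" by (simp add: max_def)
  qed auto
  finally show ?thesis by (simp add: n)
qed

lemma sobolev_norm_split:
  fixes u :: "'a::euclidean_space \<Rightarrow> real"
  assumes u: "u \<in> sobolev t" and t: "0 \<le> t" "t \<le> 1"
  shows "(sobolev_norm t u)\<^sup>2 \<le> 2 * (gauss_const TYPE('a))\<^sup>2 * (L2_norm lborel u)\<^sup>2 + 2 * (L2_norm lborel (riesz_multiplier t u))\<^sup>2"
proof -
  note FL = L2_fourier_L2[OF sobolev_L2[OF u]] and RL = riesz_multiplier_L2(1)[OF u t(1)]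
  have "(sobolev_norm t u)\<^sup>2 = (LINT \<xi>|lborel. (norm (bessel t u \<xi>))\<^sup>2)"
    by (simp add: sobolev_norm_bessel L2_norm_square)
  also have "\<dots> \<le> (LINT \<xi>|lborel. 2 * (norm (L2_fourier u \<xi>))\<^sup>2 + 2 * (norm (riesz_multiplier t u \<xi>))\<^sup>2)"
  proof (rule integral_mono)
    show "integrable lborel (\<lambda>\<xi>. (norm (bessel t u \<xi>))\<^sup>2)" by (rule L2_integrable_square[OF bessel_L2[OF u]])
    show "integrable lborel (\<lambda>\<xi>. 2 * (norm (L2_fourier u \<xi>))\<^sup>2 + 2 * (norm (riesz_multiplier t u \<xi>))\<^sup>2)"
      by (intro Bochner_Integration.integrable_add integrable_mult_right L2_integrable_square FL RL)
    fix \<xi> :: 'a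
    have "(norm (bessel t u \<xi>))\<^sup>2 \<le> (2 * (1 + (norm \<xi> powr t)\<^sup>2)) * (cmod (L2_fourier u \<xi>))\<^sup>2"
      unfolding cmod_bessel_sq by (intro mult_right_mono weight_le t) auto
    also have "\<dots> = 2 * (norm (L2_fourier u \<xi>))\<^sup>2 + 2 * (norm (riesz_multiplier t u \<xi>))\<^sup>2"
      by (simp add: riesz_multiplier_def norm_mult power_mult_distrib algebra_simps)
    finally show "(norm (bessel t u \<xi>))\<^sup>2 \<le> 2 * (norm (L2_fourier u \<xi>))\<^sup>2 + 2 * (norm (riesz_multiplier t u \<xi>))\<^sup>2" .
  qed
  also have "\<dots> = 2 * (L2_norm lborel (L2_fourier u))\<^sup>2 + 2 * (L2_norm lborel (riesz_multiplier t u))\<^sup>2"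
    by (simp add: L2_norm_square L2_integrable_square FL RL)
  finally show ?thesis by (simp add: plancherel sobolev_L2[OF u] power_mult_distrib)
qed

lemma Linf_on_bound:
  fixes b :: "'a::euclidean_space \<Rightarrow> real"
  assumes "b \<in> Linf_on \<Omega>"
  obtains M where "M \<ge> 0" "(\<lambda>x. indicator \<Omega> x * b x) \<in> borel_measurable borel"
    "AE x in lborel. \<bar>indicator \<Omega> x * b x\<bar> \<le> M"
proof -
  obtain M where M: "AE x\<in>\<Omega> in lborel. \<bar>b x\<bar> \<le> M" and m: "set_borel_measurable lborel \<Omega> b"
    using assms by (auto simp: Linf_on_def)
  have "AE x in lborel. \<bar>indicator \<Omega> x * b x\<bar> \<le> max M 0"
    using M by eventually_elim (auto simp: indicator_def)
  moreover have "(\<lambda>x. indicator \<Omega> x * b x) \<in> borel_measurable borel"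
    using m by (simp add: set_borel_measurable_def)
  ultimately show thesis using that[of "max M 0"] by auto
qed

locale dirichlet_setting = fractional_setting \<Omega> s t for \<Omega> :: "'a::euclidean_space set" and s t +
  fixes b q :: "'a \<Rightarrow> real"
  assumes b: "b \<in> Linf_on \<Omega>" and q: "q \<in> Linf_on \<Omega>"
begin

definition weighted :: "('a \<Rightarrow> real) \<Rightarrow> ('a \<Rightarrow> real) \<Rightarrow> ('a \<Rightarrow> real) \<Rightarrow> real" where
  "weighted m f g = (LINT x|lborel. (indicator \<Omega> x * m x) * f x * g x)"

text \<open>
  The bilinear form with explicit functions in place of the chosen values of the operators. It
  inherits bilinearity from the linearity of these functions almost everywhere.
\<close>

definition form :: "('a \<Rightarrow> real) \<Rightarrow> ('a \<Rightarrow> real) \<Rightarrow> real" where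
  "form u v = L2_inner lborel (riesz_multiplier t u) (riesz_multiplier t v) / (gauss_const TYPE('a))\<^sup>2
     + (frac_const TYPE('a) (s / 2))\<^sup>2 * weighted b (regional_op u) (regional_op v) + weighted q u v"

lemma weighted_L2:
  assumes m: "m \<in> Linf_on \<Omega>" and f: "f \<in> L2_space lborel"
  shows "(\<lambda>x. (indicator \<Omega> x * m x) * f x) \<in> L2_space lborel"
proof -
  obtain M where M: "M \<ge> 0" "(\<lambda>x. indicator \<Omega> x * m x) \<in> borel_measurable borel"
    "AE x in lborel. \<bar>indicator \<Omega> x * m x\<bar> \<le> M" using Linf_on_bound[OF m] by metis
  note [measurable] = M(2)
  have [measurable]: "f \<in> borel_measurable borel" using L2_measurable[OF f] by simp
  show ?thesis
  proof (rule L2_dominated[OF L2.scale_mem[OF f, of M]])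
    show "AE x in lborel. norm (indicator \<Omega> x * m x * f x) \<le> norm ((M *\<^sub>R f) x)"
      using M(3)
    proof eventually_elim
      case (elim x)
      show ?case using mult_right_mono[OF elim, of "\<bar>f x\<bar>"] M(1)
        by (simp add: scaleR_fun_def abs_mult)
    qed
  qed measurable
qed

lemma weighted_inner: "weighted m f g = L2_inner lborel (\<lambda>x. (indicator \<Omega> x * m x) * f x) g"
  by (simp add: weighted_def L2_inner_def)

lemma weighted_bound:
  assumes m: "m \<in> Linf_on \<Omega>"
  shows "\<exists>M\<ge>0. \<forall>f\<in>L2_space lborel. \<forall>g\<in>L2_space lborel. \<bar>weighted m f g\<bar> \<le> M * L2_norm lborel f * L2_norm lborel g"
proof -
  obtain M where M: "M \<ge> 0" "(\<lambda>x. indicator \<Omega> x * m x) \<in> borel_measurable borel"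
    "AE x in lborel. \<bar>indicator \<Omega> x * m x\<bar> \<le> M" using Linf_on_bound[OF m] by metis
  have "\<bar>weighted m f g\<bar> \<le> M * L2_norm lborel f * L2_norm lborel g"
    if f: "f \<in> L2_space lborel" and g: "g \<in> L2_space lborel" for f g
  proof -
    have "L2_norm lborel (\<lambda>x. (indicator \<Omega> x * m x) * f x) \<le> L2_norm lborel (M *\<^sub>R f)"
    proof (rule L2_norm_mono[OF L2_measurable[OF weighted_L2[OF m f]] L2.scale_mem[OF f]])
      show "AE x in lborel. norm (indicator \<Omega> x * m x * f x) \<le> norm ((M *\<^sub>R f) x)"
        using M(3)
      proof eventually_elim
        case (elim x)
        show ?case using mult_right_mono[OF elim, of "\<bar>f x\<bar>"] M(1)
          by (simp add: scaleR_fun_def abs_mult)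
      qed
    qed
    also have "\<dots> = M * L2_norm lborel f" using M(1) by (simp add: L2.nrm_scale f)
    finally have "L2_norm lborel (\<lambda>x. (indicator \<Omega> x * m x) * f x) * L2_norm lborel g \<le> M * L2_norm lborel f * L2_norm lborel g"
      by (rule mult_right_mono) simp
    then show ?thesis using L2.cauchy_schwarz[OF weighted_L2[OF m f] g] by (simp add: weighted_inner)
  qed
  then show ?thesis using M(1) by blast
qed

lemma weighted_sym: "weighted m f g = weighted m g f"
  by (simp add: weighted_def mult_ac)

lemma weighted_add:
  assumes "m \<in> Linf_on \<Omega>" "f \<in> L2_space lborel" "f' \<in> L2_space lborel" "g \<in> L2_space lborel"
  shows "weighted m (f + f') g = weighted m f g + weighted m f' g"
proof -
  have "(\<lambda>x. (indicator \<Omega> x * m x) * (f + f') x) = (\<lambda>x. (indicator \<Omega> x * m x) * f x) + (\<lambda>x. (indicator \<Omega> x * m x) * f' x)"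
    by (simp add: fun_eq_iff ring_distribs)
  then show ?thesis unfolding weighted_inner by (simp only: L2.ip_add[OF weighted_L2 weighted_L2] assms)
qed

lemma weighted_scale: "weighted m (c *\<^sub>R f) g = c * weighted m f g"
proof -
  have "weighted m (c *\<^sub>R f) g = (LINT x|lborel. c * ((indicator \<Omega> x * m x) * f x * g x))"
    unfolding weighted_def by (intro Bochner_Integration.integral_cong) (auto simp: scaleR_fun_def)
  then show ?thesis by (simp add: weighted_def)
qed

lemma weighted_cong_AE:
  assumes m: "m \<in> Linf_on \<Omega>" and "AE x in lborel. f x = f' x" and f: "f \<in> L2_space lborel" "f' \<in> L2_space lborel"
    and g: "g \<in> L2_space lborel"
  shows "weighted m f g = weighted m f' g"
  unfolding weighted_inner
  by (rule L2_inner_cong_AE[OF _ weighted_L2[OF m f(1)] weighted_L2[OF m f(2)] g])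
    (use assms(2) in \<open>auto elim: eventually_mono\<close>)

lemma bilinear_form_eq:
  assumes u: "u \<in> sobolev t" and v: "v \<in> sobolev t"
  shows "bilinear_form s t \<Omega> b q u v = form u v"
proof -
  let ?c = "frac_const TYPE('a) (s / 2)"
  define ru where "ru x = indicator \<Omega> x * regional_frac_laplacian (s / 2) \<Omega> u x" for x
  define rv where "rv x = indicator \<Omega> x * regional_frac_laplacian (s / 2) \<Omega> v x" for x
  have r: "ru \<in> L2_space lborel" "rv \<in> L2_space lborel"
    "AE x in lborel. ru x = (?c *\<^sub>R regional_op u) x" "AE x in lborel. rv x = (?c *\<^sub>R regional_op v) x"
    using regional_frac_laplacian_eq[OF u] regional_frac_laplacian_eq[OF v]
    by (simp_all add: ru_def[abs_def] rv_def[abs_def] scaleR_fun_def)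
  note op = regional_op_L2[OF u] regional_op_L2[OF v]
  note cop = L2.scale_mem[OF op(1), of ?c] L2.scale_mem[OF op(2), of ?c]
  have "(LINT x:\<Omega>|lborel. b x * regional_frac_laplacian (s / 2) \<Omega> u x * regional_frac_laplacian (s / 2) \<Omega> v x) = weighted b ru rv"
    unfolding weighted_def set_lebesgue_integral_def
    by (intro Bochner_Integration.integral_cong) (auto simp: ru_def rv_def indicator_def)
  also have "\<dots> = weighted b (?c *\<^sub>R regional_op u) rv" by (rule weighted_cong_AE[OF b r(3) r(1) cop(1) r(2)])
  also have "\<dots> = weighted b rv (?c *\<^sub>R regional_op u)" by (rule weighted_sym)
  also have "\<dots> = weighted b (?c *\<^sub>R regional_op v) (?c *\<^sub>R regional_op u)"
    by (rule weighted_cong_AE[OF b r(4) r(2) cop(2) cop(1)])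
  also have "\<dots> = ?c * (?c * weighted b (regional_op u) (regional_op v))"
    unfolding weighted_scale by (subst weighted_sym) (simp add: weighted_scale)
  finally have B: "(LINT x:\<Omega>|lborel. b x * regional_frac_laplacian (s / 2) \<Omega> u x * regional_frac_laplacian (s / 2) \<Omega> v x)
    = ?c * (?c * weighted b (regional_op u) (regional_op v))" .
  have Q: "(LINT x:\<Omega>|lborel. q x * u x * v x) = weighted q u v"
    unfolding weighted_def set_lebesgue_integral_def by (simp add: mult_ac)
  have t0: "0 \<le> t" using st by simp
  show ?thesis
    unfolding bilinear_form_def form_def B Q frac_laplacian_form[OF u v t0] by (simp add: power2_eq_square)
qed

lemma form_sym:
  assumes "u \<in> sobolev t" "v \<in> sobolev t"
  shows "form u v = form v u"
  using L2.ip_sym[OF riesz_multiplier_L2(1)[OF assms(1)] riesz_multiplier_L2(1)[OF assms(2)]] st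
  by (simp add: form_def weighted_sym[of _ u] weighted_sym[of _ "regional_op u"])

lemma form_add:
  assumes u: "u \<in> sobolev t" and v: "v \<in> sobolev t" and w: "w \<in> sobolev t"
  shows "form (u + v) w = form u w + form v w"
proof -
  have t0: "0 \<le> t" using st by simp
  note uv = Sob.add_mem[OF u v]
  have R: "riesz_multiplier t x \<in> L2_space lborel" if "x \<in> sobolev t" for x :: "'a \<Rightarrow> real"
    by (rule riesz_multiplier_L2(1)[OF that t0])
  have "L2_inner lborel (riesz_multiplier t (u + v)) (riesz_multiplier t w)
    = L2_inner lborel (riesz_multiplier t u + riesz_multiplier t v) (riesz_multiplier t w)"
    by (intro L2_inner_cong_AE riesz_multiplier_add sobolev_L2[OF u] sobolev_L2[OF v] u v w R uv L2.add_mem)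
  also have "\<dots> = L2_inner lborel (riesz_multiplier t u) (riesz_multiplier t w) + L2_inner lborel (riesz_multiplier t v) (riesz_multiplier t w)"
    by (intro L2.ip_add R u v w)
  finally have 1: "L2_inner lborel (riesz_multiplier t (u + v)) (riesz_multiplier t w) = \<dots>" .
  have "weighted b (regional_op (u + v)) (regional_op w) = weighted b (regional_op u + regional_op v) (regional_op w)"
    by (intro weighted_cong_AE b regional_op_add u v w regional_op_L2 uv L2.add_mem)
  also have "\<dots> = weighted b (regional_op u) (regional_op w) + weighted b (regional_op v) (regional_op w)"
    by (intro weighted_add b regional_op_L2 u v w)
  finally have 2: "weighted b (regional_op (u + v)) (regional_op w) = \<dots>" .
  have 3: "weighted q (u + v) w = weighted q u w + weighted q v w"
    by (intro weighted_add q sobolev_L2[OF u] sobolev_L2[OF v] sobolev_L2[OF w])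
  show ?thesis unfolding form_def 1 2 3 by (simp add: add_divide_distrib algebra_simps)
qed

lemma form_scale:
  assumes u: "u \<in> sobolev t" and w: "w \<in> sobolev t"
  shows "form (c *\<^sub>R u) w = c * form u w"
proof -
  have t0: "0 \<le> t" using st by simp
  have R: "riesz_multiplier t x \<in> L2_space lborel" if "x \<in> sobolev t" for x :: "'a \<Rightarrow> real"
    by (rule riesz_multiplier_L2(1)[OF that t0])
  have "L2_inner lborel (riesz_multiplier t (c *\<^sub>R u)) (riesz_multiplier t w)
    = L2_inner lborel (c *\<^sub>R riesz_multiplier t u) (riesz_multiplier t w)"
    by (intro L2_inner_cong_AE riesz_multiplier_scale sobolev_L2[OF u] R Sob.scale_mem u w L2.scale_mem)
  also have "\<dots> = c * L2_inner lborel (riesz_multiplier t u) (riesz_multiplier t w)"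
    by (intro L2.ip_scale R u w)
  finally have 1: "L2_inner lborel (riesz_multiplier t (c *\<^sub>R u)) (riesz_multiplier t w) = \<dots>" .
  show ?thesis unfolding form_def 1 regional_op_scale weighted_scale by (simp add: algebra_simps)
qed

lemma form_diff:
  assumes u: "u \<in> sobolev t" and v: "v \<in> sobolev t" and w: "w \<in> sobolev t"
  shows "form (u - v) w = form u w - form v w"
  using form_add[OF u Sob.scale_mem[OF v, of "-1"] w] form_scale[OF v w, of "-1"] by simp

lemma regional_op_le_sobolev_norm:
  "\<exists>C\<ge>0. \<forall>u\<in>sobolev t. L2_norm lborel (regional_op u) \<le> C * sobolev_norm t u"
proof -
  define \<kappa> where "\<kappa> = gauss_const TYPE('a)"
  have \<kappa>: "\<kappa> > 0" by (simp add: \<kappa>_def)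
  have t0: "0 \<le> t" using st by simp
  obtain C where C: "C \<ge> 0" "\<forall>\<delta>>0. \<exists>M\<ge>0. \<forall>u\<in>sobolev t. regional_op u \<in> L2_space lborel \<and>
     L2_norm lborel (regional_op u) \<le> C * \<delta> powr (t - s) * sobolev_norm t u + M * L2_norm lborel u"
    using regional_op_bound by blast
  obtain M where M: "M \<ge> 0" "\<forall>u\<in>sobolev t. regional_op u \<in> L2_space lborel \<and>
     L2_norm lborel (regional_op u) \<le> C * 1 powr (t - s) * sobolev_norm t u + M * L2_norm lborel u"
    using C(2) zero_less_one by blast
  have "L2_norm lborel (regional_op u) \<le> (C + M / \<kappa>) * sobolev_norm t u" if u: "u \<in> sobolev t" for u
  proof -
    have "L2_norm lborel u \<le> sobolev_norm t u / \<kappa>"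
      using L2_norm_le_sobolev[OF u t0] \<kappa> by (simp add: \<kappa>_def field_simps)
    then have "M * L2_norm lborel u \<le> M * (sobolev_norm t u / \<kappa>)" using M(1) by (rule mult_left_mono)
    moreover have "L2_norm lborel (regional_op u) \<le> C * sobolev_norm t u + M * L2_norm lborel u"
      using M(2) u by simp
    ultimately show ?thesis by (simp add: algebra_simps)
  qed
  moreover have "C + M / \<kappa> \<ge> 0" using C(1) M(1) \<kappa> by simp
  ultimately show ?thesis by blast
qed

lemma form_bound:
  "\<exists>M\<ge>0. \<forall>u\<in>sobolev t. \<forall>v\<in>sobolev t. \<bar>form u v\<bar> \<le> M * sobolev_norm t u * sobolev_norm t v"
proof -
  define \<kappa> where "\<kappa> = gauss_const TYPE('a)"
  define c where "c = frac_const TYPE('a) (s / 2)"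
  have \<kappa>: "\<kappa> > 0" by (simp add: \<kappa>_def)
  have t0: "0 \<le> t" using st by simp
  obtain C where C: "C \<ge> 0" "\<And>u. u \<in> sobolev t \<Longrightarrow> L2_norm lborel (regional_op u) \<le> C * sobolev_norm t u"
    using regional_op_le_sobolev_norm by blast
  obtain Mb where Mb: "Mb \<ge> 0" "\<And>f g. f \<in> L2_space lborel \<Longrightarrow> g \<in> L2_space lborel \<Longrightarrow> \<bar>weighted b f g\<bar> \<le> Mb * L2_norm lborel f * L2_norm lborel g"
    using weighted_bound[OF b] by blast
  obtain Mq where Mq: "Mq \<ge> 0" "\<And>f g. f \<in> L2_space lborel \<Longrightarrow> g \<in> L2_space lborel \<Longrightarrow> \<bar>weighted q f g\<bar> \<le> Mq * L2_norm lborel f * L2_norm lborel g"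
    using weighted_bound[OF q] by blast
  define M where "M = 1 / \<kappa>\<^sup>2 + c\<^sup>2 * (Mb * C * C) + Mq * (1 / \<kappa>) * (1 / \<kappa>)"
  have "\<bar>form u v\<bar> \<le> M * sobolev_norm t u * sobolev_norm t v" if u: "u \<in> sobolev t" and v: "v \<in> sobolev t" for u v
  proof -
    define U where "U = sobolev_norm t u"
    define V where "V = sobolev_norm t v"
    have UV: "U \<ge> 0" "V \<ge> 0" using Sob.nrm_nonneg[OF u] Sob.nrm_nonneg[OF v] by (auto simp: U_def V_def)
    note R = riesz_multiplier_L2[OF u t0] riesz_multiplier_L2[OF v t0]
    have LU: "L2_norm lborel u \<le> (1 / \<kappa>) * U" "L2_norm lborel v \<le> (1 / \<kappa>) * V"
      using L2_norm_le_sobolev[OF u t0] L2_norm_le_sobolev[OF v t0] \<kappa> by (simp_all add: \<kappa>_def U_def V_def field_simps)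
    have "\<bar>L2_inner lborel (riesz_multiplier t u) (riesz_multiplier t v)\<bar> \<le> L2_norm lborel (riesz_multiplier t u) * L2_norm lborel (riesz_multiplier t v)"
      by (rule L2.cauchy_schwarz[OF R(1,3)])
    also have "\<dots> \<le> U * V" unfolding U_def V_def by (rule mult_mono[OF R(2,4)]) (use UV in \<open>auto simp: U_def\<close>)
    finally have "\<bar>L2_inner lborel (riesz_multiplier t u) (riesz_multiplier t v)\<bar> / \<kappa>\<^sup>2 \<le> U * V / \<kappa>\<^sup>2"
      by (rule divide_right_mono) simp
    then have 1: "\<bar>L2_inner lborel (riesz_multiplier t u) (riesz_multiplier t v) / \<kappa>\<^sup>2\<bar> \<le> 1 / \<kappa>\<^sup>2 * (U * V)" by simp
    have "\<bar>weighted b (regional_op u) (regional_op v)\<bar> \<le> Mb * L2_norm lborel (regional_op u) * L2_norm lborel (regional_op v)"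
      by (intro Mb regional_op_L2 u v)
    also have "\<dots> \<le> Mb * (C * U) * (C * V)"
      unfolding U_def V_def by (intro mult_mono mult_left_mono C Mb u v mult_nonneg_nonneg) (use UV in \<open>auto simp: U_def\<close>)
    finally have "c\<^sup>2 * \<bar>weighted b (regional_op u) (regional_op v)\<bar> \<le> c\<^sup>2 * (Mb * (C * U) * (C * V))"
      by (rule mult_left_mono) simp
    then have 2: "\<bar>c\<^sup>2 * weighted b (regional_op u) (regional_op v)\<bar> \<le> c\<^sup>2 * (Mb * C * C) * (U * V)"
      by (simp add: abs_mult mult_ac)
    have "\<bar>weighted q u v\<bar> \<le> Mq * L2_norm lborel u * L2_norm lborel v" by (intro Mq sobolev_L2[OF u] sobolev_L2[OF v])
    also have "\<dots> \<le> Mq * ((1 / \<kappa>) * U) * ((1 / \<kappa>) * V)"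
      by (intro mult_mono mult_left_mono LU Mq mult_nonneg_nonneg) (use UV \<kappa> in auto)
    finally have 3: "\<bar>weighted q u v\<bar> \<le> Mq * (1 / \<kappa>) * (1 / \<kappa>) * (U * V)" by (simp add: mult_ac)
    have "\<bar>form u v\<bar> \<le> 1 / \<kappa>\<^sup>2 * (U * V) + c\<^sup>2 * (Mb * C * C) * (U * V) + Mq * (1 / \<kappa>) * (1 / \<kappa>) * (U * V)"
      unfolding form_def \<kappa>_def[symmetric] c_def[symmetric] using 1 2 3 by linarith
    also have "\<dots> = M * U * V" by (simp add: M_def algebra_simps)
    finally show ?thesis by (simp add: U_def V_def)
  qed
  moreover have "M \<ge> 0" using \<kappa> C(1) Mb(1) Mq(1) by (simp add: M_def)
  ultimately show ?thesis by blast
qed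

text \<open>
  Garding's inequality. As \<open>b\<close> may be negative, the term with \<open>b\<close> counts as an error; it is of lower order than \<open>H\<^sup>t\<close>, because \<open>s < t\<close>.
\<close>

lemma garding:
  "\<exists>A\<ge>0. \<forall>u\<in>sobolev t. 1 / (2 * (gauss_const TYPE('a))\<^sup>2) * (sobolev_norm t u)\<^sup>2
     \<le> form u u + A * ((L2_norm lborel u)\<^sup>2 + (L2_norm lborel (regional_op u))\<^sup>2)"
proof -
  define \<kappa> where "\<kappa> = gauss_const TYPE('a)"
  define c where "c = frac_const TYPE('a) (s / 2)"
  have \<kappa>: "\<kappa> > 0" by (simp add: \<kappa>_def)
  have t01: "0 \<le> t" "t \<le> 1" using st by auto
  obtain Mb where Mb: "Mb \<ge> 0" "\<And>f g. f \<in> L2_space lborel \<Longrightarrow> g \<in> L2_space lborel \<Longrightarrow> \<bar>weighted b f g\<bar> \<le> Mb * L2_norm lborel f * L2_norm lborel g"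
    using weighted_bound[OF b] by blast
  obtain Mq where Mq: "Mq \<ge> 0" "\<And>f g. f \<in> L2_space lborel \<Longrightarrow> g \<in> L2_space lborel \<Longrightarrow> \<bar>weighted q f g\<bar> \<le> Mq * L2_norm lborel f * L2_norm lborel g"
    using weighted_bound[OF q] by blast
  define A where "A = (1 + Mq) + c\<^sup>2 * Mb"
  have "1 / (2 * \<kappa>\<^sup>2) * (sobolev_norm t u)\<^sup>2 \<le> form u u + A * ((L2_norm lborel u)\<^sup>2 + (L2_norm lborel (regional_op u))\<^sup>2)"
    if u: "u \<in> sobolev t" for u
  proof -
    define L where "L = (L2_norm lborel u)\<^sup>2"
    define O' where "O' = (L2_norm lborel (regional_op u))\<^sup>2"
    define R where "R = (L2_norm lborel (riesz_multiplier t u))\<^sup>2"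
    have LO: "L \<ge> 0" "O' \<ge> 0" by (auto simp: L_def O'_def)
    have "(sobolev_norm t u)\<^sup>2 \<le> 2 * \<kappa>\<^sup>2 * L + 2 * R"
      unfolding L_def R_def \<kappa>_def by (rule sobolev_norm_split[OF u t01])
    then have "1 / (2 * \<kappa>\<^sup>2) * (sobolev_norm t u)\<^sup>2 \<le> 1 / (2 * \<kappa>\<^sup>2) * (2 * \<kappa>\<^sup>2 * L + 2 * R)"
      by (rule mult_left_mono) simp
    also have "\<dots> = L + R / \<kappa>\<^sup>2" using \<kappa> by (simp add: field_simps)
    finally have 0: "1 / (2 * \<kappa>\<^sup>2) * (sobolev_norm t u)\<^sup>2 \<le> L + R / \<kappa>\<^sup>2" .
    have "\<bar>weighted b (regional_op u) (regional_op u)\<bar> \<le> Mb * O'"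
      using Mb(2)[OF regional_op_L2[OF u] regional_op_L2[OF u]] by (simp add: O'_def power2_eq_square mult_ac)
    then have "\<bar>c\<^sup>2 * weighted b (regional_op u) (regional_op u)\<bar> \<le> c\<^sup>2 * (Mb * O')"
      unfolding abs_mult by (simp add: mult_left_mono)
    moreover have "\<bar>weighted q u u\<bar> \<le> Mq * L"
      using Mq(2)[OF sobolev_L2[OF u] sobolev_L2[OF u]] by (simp add: L_def power2_eq_square mult_ac)
    moreover have "form u u = R / \<kappa>\<^sup>2 + c\<^sup>2 * weighted b (regional_op u) (regional_op u) + weighted q u u"
      unfolding form_def R_def \<kappa>_def c_def by (simp add: L2.nrm_sq[OF riesz_multiplier_L2(1)[OF u t01(1)]])
    ultimately have "1 / (2 * \<kappa>\<^sup>2) * (sobolev_norm t u)\<^sup>2 \<le> form u u + ((1 + Mq) * L + c\<^sup>2 * Mb * O')"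
      using 0 by (simp add: algebra_simps)
    also have "(1 + Mq) * L + c\<^sup>2 * Mb * O' \<le> A * L + A * O'"
      using LO Mq(1) Mb(1) by (intro add_mono mult_right_mono) (auto simp: A_def)
    finally show ?thesis by (simp add: L_def O'_def algebra_simps)
  qed
  moreover have "A \<ge> 0" using Mb(1) Mq(1) by (simp add: A_def)
  ultimately show ?thesis unfolding \<kappa>_def by blast
qed

text \<open>
  Rellich's theorem makes the \<open>L\<^sup>2\<close> norms of the differences small. The regional Laplacians are then
  small too: choose first \<open>\<delta>\<close> in \<open>regional_op_bound\<close> to control the part with the \<open>H\<^sup>t\<close> norm, then the
  \<open>L\<^sup>2\<close> closeness.
\<close>

lemma compact_perturbation:
  assumes X: "\<And>n. X n \<in> sobolev_tilde t \<Omega>" and bound: "\<And>n. sobolev_norm t (X n) \<le> 1"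
  shows "\<exists>r. strict_mono (r :: nat \<Rightarrow> nat) \<and> (\<forall>e>0. \<exists>N. \<forall>m\<ge>N. \<forall>n\<ge>N.
     1 / (2 * (gauss_const TYPE('a))\<^sup>2) * (sobolev_norm t (X (r m) - X (r n)))\<^sup>2
       \<le> form (X (r m) - X (r n)) (X (r m) - X (r n)) + e)"
proof -
  have t01: "0 < t" "0 \<le> t" "t \<le> 1" using st by auto
  have XS: "X n \<in> sobolev t" for n by (rule sobolev_tilde_sobolev[OF X])
  obtain A where A: "A \<ge> 0" "\<And>u. u \<in> sobolev t \<Longrightarrow> 1 / (2 * (gauss_const TYPE('a))\<^sup>2) * (sobolev_norm t u)\<^sup>2
     \<le> form u u + A * ((L2_norm lborel u)\<^sup>2 + (L2_norm lborel (regional_op u))\<^sup>2)" using garding by blast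
  obtain C where C: "C \<ge> 0" "\<forall>\<delta>>0. \<exists>M\<ge>0. \<forall>u\<in>sobolev t. regional_op u \<in> L2_space lborel \<and>
     L2_norm lborel (regional_op u) \<le> C * \<delta> powr (t - s) * sobolev_norm t u + M * L2_norm lborel u"
    using regional_op_bound by blast
  have "\<exists>r. strict_mono (r :: nat \<Rightarrow> nat) \<and> (\<forall>e>0. \<exists>N. \<forall>m\<ge>N. \<forall>n\<ge>N. L2_norm lborel (X (r m) - X (r n)) < e)"
    by (rule rellich[OF t01(1) \<Omega>_borel bounded_\<Omega> XS sobolev_tilde_vanishes_outside[OF X t01(2,3) \<Omega>_borel] bound])
  then obtain r :: "nat \<Rightarrow> nat" where r: "strict_mono r"
    "\<And>e. e > 0 \<Longrightarrow> \<exists>N. \<forall>m\<ge>N. \<forall>n\<ge>N. L2_norm lborel (X (r m) - X (r n)) < e"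
    by (elim exE conjE) blast
  have "\<exists>N. \<forall>m\<ge>N. \<forall>n\<ge>N. 1 / (2 * (gauss_const TYPE('a))\<^sup>2) * (sobolev_norm t (X (r m) - X (r n)))\<^sup>2
       \<le> form (X (r m) - X (r n)) (X (r m) - X (r n)) + e" if e: "e > 0" for e
  proof -
    \<comment> \<open>\<open>\<parallel>d\<parallel> \<le> \<eta>\<close> and \<open>\<parallel>regional_op d\<parallel> \<le> 2 \<eta>\<close> give an error of at most \<open>A (\<eta>\<^sup>2 + 4 \<eta>\<^sup>2) \<le> 5 A \<eta>\<close>\<close>
    define \<eta> where "\<eta> = min 1 (e / (5 * A + 1))"
    have \<eta>: "0 < \<eta>" "\<eta> \<le> 1" "(5 * A) * \<eta> \<le> e"
    proof -
      show "0 < \<eta>" "\<eta> \<le> 1" using e A(1) by (auto simp: \<eta>_def)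
      have "(5 * A) * \<eta> \<le> (5 * A + 1) * \<eta>" using \<open>0 < \<eta>\<close> by simp
      also have "\<dots> \<le> (5 * A + 1) * (e / (5 * A + 1))" using A(1) by (intro mult_left_mono) (auto simp: \<eta>_def)
      also have "\<dots> = e" using A(1) by simp
      finally show "(5 * A) * \<eta> \<le> e" .
    qed
    define \<delta> where "\<delta> = (\<eta> / (2 * C + 1)) powr (1 / (t - s))"
    have \<delta>: "\<delta> > 0" using \<eta>(1) C(1) by (simp add: \<delta>_def)
    have "\<delta> powr (t - s) = \<eta> / (2 * C + 1)" using \<eta>(1) C(1) st by (simp add: \<delta>_def powr_powr)
    then have "\<delta> powr (t - s) * (2 * C + 1) = \<eta>" using C(1) by (simp add: field_simps)
    moreover have "0 \<le> \<delta> powr (t - s)" by simp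
    ultimately have C\<delta>: "C * \<delta> powr (t - s) * 2 \<le> \<eta>" by (simp only: algebra_simps)
    obtain M where M: "M \<ge> 0" "\<And>u. u \<in> sobolev t \<Longrightarrow> L2_norm lborel (regional_op u) \<le> C * \<delta> powr (t - s) * sobolev_norm t u + M * L2_norm lborel u"
      using C(2) \<delta> by blast
    have "\<eta> / (M + 1) > 0" using \<eta>(1) M(1) by simp
    then obtain N where N: "\<And>m n. m \<ge> N \<Longrightarrow> n \<ge> N \<Longrightarrow> L2_norm lborel (X (r m) - X (r n)) < \<eta> / (M + 1)"
      using r(2) by blast
    have "1 / (2 * (gauss_const TYPE('a))\<^sup>2) * (sobolev_norm t (X (r m) - X (r n)))\<^sup>2
       \<le> form (X (r m) - X (r n)) (X (r m) - X (r n)) + e" if mn: "m \<ge> N" "n \<ge> N" for m n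
    proof -
      define d where "d = X (r m) - X (r n)"
      have d: "d \<in> sobolev t" unfolding d_def by (intro Sob.diff_mem XS)
      have d2: "sobolev_norm t d \<le> 2"
        using Sob.nrm_triangle_diff[OF XS Sob.zero_mem XS, of "r m" "r n"] bound[of "r m"] bound[of "r n"]
          Sob.nrm_minus_commute[OF Sob.zero_mem XS, of "r n"] by (simp add: d_def)
      have l: "L2_norm lborel d * (M + 1) \<le> \<eta>" using N[OF mn] M(1) by (simp add: d_def field_simps)
      have l': "M * L2_norm lborel d + L2_norm lborel d \<le> \<eta>" using l by (simp add: algebra_simps)
      have lM: "M * L2_norm lborel d \<le> \<eta>" using l' L2_norm_nonneg[of lborel d] by linarith
      have l1: "L2_norm lborel d \<le> \<eta>"
        using l' mult_nonneg_nonneg[OF M(1) L2_norm_nonneg[of lborel d]] by linarith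
      have "L2_norm lborel (regional_op d) \<le> C * \<delta> powr (t - s) * sobolev_norm t d + M * L2_norm lborel d" by (rule M(2)[OF d])
      also have "\<dots> \<le> C * \<delta> powr (t - s) * 2 + \<eta>" using C(1) by (intro add_mono mult_left_mono d2 lM) auto
      finally have o: "L2_norm lborel (regional_op d) \<le> 2 * \<eta>" using C\<delta> by simp
      have \<eta>sq: "\<eta>\<^sup>2 \<le> \<eta>" using \<eta> by (simp add: power2_eq_square mult_left_le)
      have "(L2_norm lborel d)\<^sup>2 \<le> \<eta>\<^sup>2" using l1 by (intro power_mono) auto
      moreover have "(L2_norm lborel (regional_op d))\<^sup>2 \<le> (2 * \<eta>)\<^sup>2" using o by (intro power_mono) auto
      ultimately have "(L2_norm lborel d)\<^sup>2 + (L2_norm lborel (regional_op d))\<^sup>2 \<le> 5 * \<eta>"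
        using \<eta>sq by (simp add: power_mult_distrib)
      then have "A * ((L2_norm lborel d)\<^sup>2 + (L2_norm lborel (regional_op d))\<^sup>2) \<le> A * (5 * \<eta>)"
        using A(1) by (rule mult_left_mono)
      then show ?thesis using A(2)[OF d] \<eta>(3) by (simp add: d_def)
    qed
    then show ?thesis by blast
  qed
  then show ?thesis using r(1) by blast
qed

lemma weak_solution_iff:
  "weak_solution s t \<Omega> b q F f u \<longleftrightarrow> u \<in> sobolev t \<and> (AE x\<in>exterior_of \<Omega> in lborel. u x = f x) \<and>
     (\<forall>\<phi>\<in>test_functions \<Omega>. form u \<phi> = F \<phi>)"
  using bilinear_form_eq[of u] test_functions_sobolev[of _ \<Omega> t] st by (auto simp: weak_solution_def)

end

lemma sobolev_dual_bound:
  fixes u :: "'a::euclidean_space \<Rightarrow> real"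
  assumes r: "0 \<le> r" "r \<le> 1" and F: "F \<in> sobolev_dual r U" and u: "u \<in> sobolev_tilde r U"
  shows "\<bar>F u\<bar> \<le> sobolev_dual_norm r U F * sobolev_norm r u"
    and "0 \<le> sobolev_dual_norm r U F"
proof -
  interpret V: semi_hilbert_space "sobolev_tilde r U" "sobolev_inner r"
    by (rule semi_hilbert_space_sobolev_tilde[OF r])
  obtain K where "\<forall>u\<in>sobolev_tilde r U. \<bar>F u\<bar> \<le> K * sobolev_norm r u"
    using F by (auto simp: sobolev_dual_def)
  then have K: "\<bar>F u\<bar> \<le> K * sobolev_norm r u" if "u \<in> sobolev_tilde r U" for u using that by blast
  have scale: "F (c *\<^sub>R u) = c * F u" if "u \<in> sobolev_tilde r U" for c u
    using F that by (auto simp: sobolev_dual_def scaleR_fun_def)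
  have nn: "0 \<le> sobolev_norm r u" if "u \<in> sobolev_tilde r U" for u
    using Sob.nrm_nonneg[OF sobolev_tilde_sobolev[OF that]] .
  let ?S = "{u \<in> sobolev_tilde r U. sobolev_norm r u \<le> 1}"
  have bdd: "bdd_above ((\<lambda>u. \<bar>F u\<bar>) ` ?S)"
  proof (rule bdd_aboveI2)
    fix u assume u: "u \<in> ?S"
    have "\<bar>F u\<bar> \<le> K * sobolev_norm r u" using K u by simp
    also have "\<dots> \<le> \<bar>K\<bar> * sobolev_norm r u" using nn[of u] u by (intro mult_right_mono) auto
    also have "\<dots> \<le> \<bar>K\<bar> * 1" using u by (intro mult_left_mono) auto
    finally show "\<bar>F u\<bar> \<le> \<bar>K\<bar>" by simp
  qed
  have up: "\<bar>F u\<bar> \<le> sobolev_dual_norm r U F" if "u \<in> ?S" for u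
    unfolding sobolev_dual_norm_def by (rule cSUP_upper[OF that bdd])
  have "sobolev_norm r (0 :: 'a \<Rightarrow> real) = 0" by (rule Sob.nrm_zero)
  then have "0 \<in> ?S" using V.zero_mem by simp
  from order_trans[OF abs_ge_zero up[OF this]] show "0 \<le> sobolev_dual_norm r U F" .
  show "\<bar>F u\<bar> \<le> sobolev_dual_norm r U F * sobolev_norm r u"
  proof (cases "sobolev_norm r u = 0")
    case True
    then show ?thesis using K[OF u] by simp
  next
    case False
    define c where "c = 1 / sobolev_norm r u"
    have c: "c > 0" using False nn[OF u] by (simp add: c_def)
    have "c *\<^sub>R u \<in> ?S"
      using V.scale_mem[OF u, of c] Sob.nrm_scale[OF sobolev_tilde_sobolev[OF u], of c] False c by (simp add: c_def)
    from up[OF this] have "c * \<bar>F u\<bar> \<le> sobolev_dual_norm r U F"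
      using c by (simp add: scale[OF u] abs_mult)
    then show ?thesis using False nn[OF u] by (simp add: c_def field_simps)
  qed
qed

context dirichlet_setting
begin

text \<open>
  Any \<open>w \<in> H\<^sup>t\<close> can serve as the exterior datum: a solution is \<open>w + z\<close>, where \<open>z\<close> solves a problem
  with zero exterior values and right-hand side \<open>F - form w\<close>.
\<close>

lemma solution_with_datum:
  assumes ev: "eigenvalue_condition s t \<Omega> b q"
  shows "\<exists>C\<ge>0. \<forall>F\<in>sobolev_dual t \<Omega>. \<forall>w\<in>sobolev t. \<exists>u. weak_solution s t \<Omega> b q F w u \<and>
     sobolev_norm t u \<le> C * (sobolev_dual_norm t \<Omega> F + sobolev_norm t w)"
proof -
  let ?V = "sobolev_tilde t \<Omega>"
  have t01: "0 \<le> t" "t \<le> 1" using st by auto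
  have S: "u \<in> sobolev t" if "u \<in> ?V" for u using that by (rule sobolev_tilde_sobolev)
  have T: "\<phi> \<in> ?V" if "\<phi> \<in> test_functions \<Omega>" for \<phi>
    by (rule test_functions_sobolev_tilde[OF that t01(2)])
  have ext: "AE x\<in>exterior_of \<Omega> in lborel. u x = 0" if "u \<in> ?V" for u
    using sobolev_tilde_vanishes_outside[OF that t01 \<Omega>_borel]
    by eventually_elim (use closure_subset[of \<Omega>] in \<open>auto simp: exterior_of_def\<close>)
  obtain M where M: "M \<ge> 0" "\<And>u v. u \<in> sobolev t \<Longrightarrow> v \<in> sobolev t \<Longrightarrow> \<bar>form u v\<bar> \<le> M * sobolev_norm t u * sobolev_norm t v"
    using form_bound by blast
  interpret V: semi_hilbert_space ?V "sobolev_inner t"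
    by (rule semi_hilbert_space_sobolev_tilde[OF t01])
  interpret V: fredholm_form ?V "sobolev_inner t" form M "1 / (2 * (gauss_const TYPE('a))\<^sup>2)"
  proof (unfold_locales, unfold sobolev_nrm_eq)
    fix u assume u: "u \<in> ?V" and "\<And>v. v \<in> ?V \<Longrightarrow> form u v = 0"
    then have "weak_solution s t \<Omega> b q (\<lambda>_. 0) (\<lambda>_. 0) u"
      using S T ext by (simp add: weak_solution_iff)
    then have "AE x in lborel. u x = 0" using ev by (simp add: eigenvalue_condition_def)
    then have "sobolev_norm t u = sobolev_norm t (0 :: 'a \<Rightarrow> real)"
      by (intro sobolev_norm_cong_AE[OF _ S[OF u] Sob.zero_mem]) simp
    then show "sobolev_norm t u = 0" by (simp add: Sob.nrm_zero)
  next
    fix X :: "nat \<Rightarrow> 'a \<Rightarrow> real" assume "\<And>n. X n \<in> ?V" "\<And>n. sobolev_norm t (X n) \<le> 1"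
    then show "\<exists>r. strict_mono (r :: nat \<Rightarrow> nat) \<and> (\<forall>e>0. \<exists>N. \<forall>m\<ge>N. \<forall>n\<ge>N.
      1 / (2 * (gauss_const TYPE('a))\<^sup>2) * (sobolev_norm t (X (r m) - X (r n)))\<^sup>2
        \<le> form (X (r m) - X (r n)) (X (r m) - X (r n)) + e)"
      by (rule compact_perturbation)
  qed (auto simp: form_add form_scale form_sym[OF S S] M S)
  obtain C where C: "C \<ge> 0" and solv: "\<forall>F. \<forall>K\<ge>0. (\<forall>u\<in>?V. \<forall>v\<in>?V. F (u + v) = F u + F v) \<and>
      (\<forall>a. \<forall>u\<in>?V. F (a *\<^sub>R u) = a * F u) \<and> (\<forall>v\<in>?V. \<bar>F v\<bar> \<le> K * sobolev_norm t v) \<longrightarrow>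
      (\<exists>u\<in>?V. (\<forall>v\<in>?V. form u v = F v) \<and> sobolev_norm t u \<le> C * K)"
    using V.solvable[unfolded sobolev_nrm_eq] by (elim exE conjE)
  have "\<exists>u. weak_solution s t \<Omega> b q F w u \<and>
     sobolev_norm t u \<le> (1 + C + C * M) * (sobolev_dual_norm t \<Omega> F + sobolev_norm t w)"
    if F: "F \<in> sobolev_dual t \<Omega>" and w: "w \<in> sobolev t" for F and w :: "'a \<Rightarrow> real"
  proof -
    define D where "D = sobolev_dual_norm t \<Omega> F"
    define W where "W = sobolev_norm t w"
    have D: "D \<ge> 0" unfolding D_def by (rule sobolev_dual_bound(2)[OF t01 F V.zero_mem])
    have W: "W \<ge> 0" unfolding W_def by (rule Sob.nrm_nonneg[OF w])
    define G where "G v = F v - form w v" for v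
    have "\<exists>z\<in>?V. (\<forall>v\<in>?V. form z v = G v) \<and> sobolev_norm t z \<le> C * (D + M * W)"
    proof (intro mp[OF mp[OF spec[OF spec[OF solv]]]] conjI ballI allI)
      show "0 \<le> D + M * W" using D W M(1) by simp
    next
      fix u v assume u: "u \<in> ?V" and v: "v \<in> ?V"
      have "F (u + v) = F u + F v" using F u v by (simp add: sobolev_dual_def plus_fun_def)
      moreover have "form w (u + v) = form w u + form w v"
        using form_add[OF S[OF u] S[OF v] w] form_sym[OF w Sob.add_mem[OF S[OF u] S[OF v]]]
          form_sym[OF w S[OF u]] form_sym[OF w S[OF v]] by linarith
      ultimately show "G (u + v) = G u + G v" by (simp add: G_def)
    next
      fix a u assume u: "u \<in> ?V"
      have "F (a *\<^sub>R u) = a * F u" using F u by (simp add: sobolev_dual_def scaleR_fun_def)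
      moreover have "form w (a *\<^sub>R u) = a * form w u"
        using form_scale[OF S[OF u] w, of a] form_sym[OF w Sob.scale_mem[OF S[OF u], of a]]
          form_sym[OF w S[OF u]] by simp
      ultimately show "G (a *\<^sub>R u) = a * G u" by (simp add: G_def right_diff_distrib)
    next
      fix v assume v: "v \<in> ?V"
      have "\<bar>G v\<bar> \<le> \<bar>F v\<bar> + \<bar>form w v\<bar>" by (simp add: G_def)
      also have "\<dots> \<le> D * sobolev_norm t v + M * W * sobolev_norm t v"
        unfolding D_def W_def by (intro add_mono sobolev_dual_bound(1)[OF t01 F v] M w S v)
      finally show "\<bar>G v\<bar> \<le> (D + M * W) * sobolev_norm t v" by (simp add: algebra_simps)
    qed
    then obtain z where z: "z \<in> ?V" "\<And>v. v \<in> ?V \<Longrightarrow> form z v = G v" "sobolev_norm t z \<le> C * (D + M * W)" by blast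
    have "weak_solution s t \<Omega> b q F w (w + z)"
      unfolding weak_solution_iff
    proof (intro conjI ballI)
      show "w + z \<in> sobolev t" by (intro Sob.add_mem w S z)
      show "AE x\<in>exterior_of \<Omega> in lborel. (w + z) x = w x" using ext[OF z(1)] by eventually_elim simp
      fix \<phi> assume \<phi>: "\<phi> \<in> test_functions \<Omega>"
      show "form (w + z) \<phi> = F \<phi>"
        using form_add[OF w S[OF z(1)] S[OF T[OF \<phi>]]] z(2)[OF T[OF \<phi>]] by (simp add: G_def)
    qed
    moreover have "sobolev_norm t (w + z) \<le> (1 + C + C * M) * (D + W)"
    proof -
      have "sobolev_norm t (w + z) \<le> W + C * (D + M * W)"
        using Sob.nrm_triangle[OF w S[OF z(1)]] z(3) by (simp add: W_def)
      also have "\<dots> \<le> (1 + C + C * M) * (D + W)"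
      proof -
        have "0 \<le> D + C * W + C * M * D" using D W C M(1) by simp
        then show ?thesis by (simp add: algebra_simps)
      qed
      finally show ?thesis .
    qed
    ultimately show ?thesis unfolding D_def W_def by blast
  qed
  moreover have "1 + C + C * M \<ge> 0" using C M(1) by simp
  ultimately show ?thesis by blast
qed

lemma weak_solution_unique:
  assumes ev: "eigenvalue_condition s t \<Omega> b q"
    and u: "weak_solution s t \<Omega> b q F f u" and v: "weak_solution s t \<Omega> b q F f v"
  shows "AE x in lborel. v x = u x"
proof -
  have S: "u \<in> sobolev t" "v \<in> sobolev t" using u v by (auto simp: weak_solution_def)
  have "weak_solution s t \<Omega> b q (\<lambda>_. 0) (\<lambda>_. 0) (v - u)"
    unfolding weak_solution_iff
  proof (intro conjI ballI)
    show "v - u \<in> sobolev t" by (intro Sob.diff_mem S)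
    have "AE x\<in>exterior_of \<Omega> in lborel. u x = f x" "AE x\<in>exterior_of \<Omega> in lborel. v x = f x"
      using u v by (auto simp: weak_solution_def)
    then show "AE x\<in>exterior_of \<Omega> in lborel. (v - u) x = 0" by eventually_elim auto
    fix \<phi> assume \<phi>: "\<phi> \<in> test_functions \<Omega>"
    have "\<phi> \<in> sobolev t" using st by (intro test_functions_sobolev[OF \<phi>]) simp
    then show "form (v - u) \<phi> = 0"
      using u v \<phi> form_diff[OF S(2,1), of \<phi>] by (simp add: weak_solution_iff)
  qed
  then have "AE x in lborel. (v - u) x = 0" using ev unfolding eigenvalue_condition_def by blast
  then show ?thesis by eventually_elim simp
qed

end

theorem theorem2p16:
  fixes \<Omega> :: "'a::euclidean_space set" and b q :: "'a \<Rightarrow> real" and s t :: real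
  assumes "0 < s" and "s < t" and "t < 1"
    and "bounded_lipschitz_domain \<Omega>"
    and "b \<in> Linf_on \<Omega>" and "q \<in> Linf_on \<Omega>"
    and "eigenvalue_condition s t \<Omega> b q"
  shows "\<exists>C. \<forall>F \<in> sobolev_dual t \<Omega>. \<forall>f \<in> sobolev_tilde t (exterior_of \<Omega>).
     \<exists>u. weak_solution s t \<Omega> b q F f u \<and>
         (\<forall>v. weak_solution s t \<Omega> b q F f v \<longrightarrow> (AE x in lborel. v x = u x)) \<and>
         sobolev_norm t u
           \<le> C * (sobolev_dual_norm t \<Omega> F + sobolev_norm_on t (exterior_of \<Omega>) f)"
proof -
  have "open \<Omega>" "bounded \<Omega>" using assms(4) by (auto simp: bounded_lipschitz_domain_def)
  then interpret dirichlet_setting \<Omega> s t b q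
    by unfold_locales (use assms in auto)
  note ev = assms(7)
  obtain C where C: "C \<ge> 0" "\<And>F w. F \<in> sobolev_dual t \<Omega> \<Longrightarrow> w \<in> sobolev t \<Longrightarrow> \<exists>u. weak_solution s t \<Omega> b q F w u \<and>
     sobolev_norm t u \<le> C * (sobolev_dual_norm t \<Omega> F + sobolev_norm t w)"
    using solution_with_datum[OF ev] by blast
  show ?thesis
  \<comment> \<open>\<open>C + 1\<close> is positive, so the estimate can be divided by it before taking the infimum\<close>
  proof (intro exI[of _ "C + 1"] ballI)
    fix F f assume F: "F \<in> sobolev_dual t \<Omega>" and f: "f \<in> sobolev_tilde t (exterior_of \<Omega>)"
    let ?D = "sobolev_dual_norm t \<Omega> F"
    let ?E = "exterior_of \<Omega>"
    have fS: "f \<in> sobolev t" by (rule sobolev_tilde_sobolev[OF f])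
    obtain u where u: "weak_solution s t \<Omega> b q F f u" using C(2)[OF F fS] by blast
    have uS: "u \<in> sobolev t" using u by (simp add: weak_solution_def)
    have "sobolev_norm t u / (C + 1) - ?D \<le> sobolev_norm_on t ?E f"
      unfolding sobolev_norm_on_def
    proof (rule cInf_greatest)
      show "{sobolev_norm t w |w. w \<in> sobolev t \<and> (AE x\<in>?E in lborel. f x = w x)} \<noteq> {}" using fS by blast
      fix y assume "y \<in> {sobolev_norm t w |w. w \<in> sobolev t \<and> (AE x\<in>?E in lborel. f x = w x)}"
      then obtain w where w: "y = sobolev_norm t w" "w \<in> sobolev t" "AE x\<in>?E in lborel. f x = w x" by blast
      obtain u' where u': "weak_solution s t \<Omega> b q F w u'" "sobolev_norm t u' \<le> C * (?D + sobolev_norm t w)"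
        using C(2)[OF F w(2)] by blast
      have "AE x\<in>?E in lborel. u' x = w x" using u'(1) by (simp add: weak_solution_def)
      then have "AE x\<in>?E in lborel. u' x = f x" using w(3) by eventually_elim simp
      then have u'f: "weak_solution s t \<Omega> b q F f u'" using u'(1) by (simp add: weak_solution_def)
      have u'S: "u' \<in> sobolev t" using u'(1) by (simp add: weak_solution_def)
      have "sobolev_norm t u = sobolev_norm t u'"
        by (rule sobolev_norm_cong_AE[OF weak_solution_unique[OF ev u'f u] uS u'S])
      also have "\<dots> \<le> C * (?D + sobolev_norm t w)" by (rule u'(2))
      also have "\<dots> \<le> (C + 1) * (?D + sobolev_norm t w)"
      proof (rule mult_right_mono)
        have "0 \<in> sobolev_tilde t \<Omega>"
          using st by (intro test_functions_sobolev_tilde test_functions_zero) simp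
        then have "0 \<le> ?D" using st by (intro sobolev_dual_bound(2)[OF _ _ F]) auto
        then show "0 \<le> ?D + sobolev_norm t w" using Sob.nrm_nonneg[OF w(2)] by simp
      qed simp
      finally show "sobolev_norm t u / (C + 1) - ?D \<le> y"
        using C(1) w(1) by (simp add: field_simps)
    qed
    then have "sobolev_norm t u \<le> (C + 1) * (?D + sobolev_norm_on t ?E f)"
      using C(1) by (simp add: field_simps)
    then show "\<exists>u. weak_solution s t \<Omega> b q F f u \<and> (\<forall>v. weak_solution s t \<Omega> b q F f v \<longrightarrow> (AE x in lborel. v x = u x)) \<and>
         sobolev_norm t u \<le> (C + 1) * (?D + sobolev_norm_on t ?E f)"
      using u weak_solution_unique[OF ev u] by blast
  qed
qed

end
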